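(* Let $N\ge2$, $\alpha\in(0,2]$, let $W$ be $\mathrm{Herm}(N)$ or $\mathrm{Herm}_0(N)$, let $H$ be a unitarily invariant Borel probability measure on $\mathbb{S}_W$ whose support spans $W$, and let $H_{\mathrm{eig}}$ be its eigenvalue part. Let $\widetilde X_1,\widetilde X_2,\ldots$ be i.i.d. random vectors in $\mathbb{R}^N$ drawn from the $N$-dimensional stable distribution $S(\alpha,H_{\mathrm{eig}},0)$, $X_j=\mathrm{diag}(\widetilde X_j)$, and let $U_1,U_2,\ldots$ be i.i.d. Haar distributed matrices in $\mathrm{U}(N)$, all $X_j$ and $U_j$ being independent. Denote by $p_m$ the probability density function (on $W$) of $$Y_m:=\frac{1}{m^{1/\alpha}}\sum_{j=1}^mU_jX_jU_j^\dagger-\frac{2t_0\log m}{\pi}I_N\mathbf{1}_{\alpha=1},\qquad t_0:=\frac1N\int_{\mathbb{S}^{N-1}}H_{\mathrm{eig}}(\mathrm{d}t)\sum_{k=1}^Nt_k,$$ where $\mathbf 1_{\alpha=1}$ is $1$ if $\alpha=1$ and $0$ otherwise, and by $p_\infty$ the probability density function (on $W$) of the stable invariant ensemble $S(\alpha,H,0)$. Let $\sigma(W)$ be the Borel $\sigma$-algebra of $W$. Then, as $m\to\infty$, $$\sup_{A\in\sigma(W)}\left|\int_Ap_m(X)\,\mathrm{d}X-\int_Ap_\infty(X)\,\mathrm{d}X\right|=O\big(m^{-\alpha/(N^2+\alpha)}\big).$$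
   Context: $\mathrm{Herm}(N)$ is the real vector space of $N\times N$ Hermitian matrices, $\mathrm{Herm}_0(N)$ its subspace of traceless matrices; $\mathrm{U}(N)$ is the unitary group. The norm is $(\mathrm{Tr}\,X^2)^{1/2}$ and $\mathbb{S}_W=\{R\in W:\mathrm{Tr}\,R^2=1\}$. Lebesgue measure on $\mathrm{Herm}(N)$ is $\mathrm{d}X=\prod_j\mathrm{d}x_{j,j}\prod_{j<k}\mathrm{d}\,\mathrm{Re}\,x_{j,k}\,\mathrm{d}\,\mathrm{Im}\,x_{j,k}$, and on $\mathrm{Herm}_0(N)$ the measure induced by restricting the trace to zero. Set $\nu_\alpha(u)=|u|^\alpha\big(1-i\,\mathrm{sgn}(u)\tan\frac{\pi\alpha}{2}\big)$ for $\alpha\in(0,1)\cup(1,2]$ and $\nu_1(u)=|u|\big(1+\frac{2i}{\pi}\mathrm{sgn}(u)\log|u|\big)$ with $\nu_1(0)=0$. For a Borel probability measure $h$ on $\mathbb{S}^{d-1}\subset\mathbb{R}^d$, $\sigma>0$, $\mu\in\mathbb{R}^d$, the stable distribution $S(\alpha,\sigma h,\mu)$ on $\mathbb{R}^d$ is the one with characteristic function $\exp\big(-\sigma\int_{\mathbb{S}^{d-1}}h(\mathrm{d}r)\nu_\alpha(r^\top\xi)+i\xi^\top\mu\big)$, $\xi\in\mathbb{R}^d$. For a Borel probability measure $H$ on $\mathbb{S}_W$ that is unitarily invariant ($H$ is invariant under $R\mapsto URU^\dagger$ for all $U\in\mathrm{U}(N)$), the stable invariant ensemble $S(\alpha,H,0)$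 is the distribution of a random $Y$ with $\mathbb{E}\exp(i\,\mathrm{Tr}\,SY)=\exp\big(-\int_{\mathbb{S}_W}H(\mathrm{d}R)\nu_\alpha(\mathrm{Tr}\,RS)\big)$. The eigenvalue part $H_{\mathrm{eig}}$ of $H$ is the permutation-invariant Borel probability measure on $\mathbb{S}^{N-1}\subset\mathbb{R}^N$ such that $H$ is the law of $U^\dagger\mathrm{diag}(r)U$ with $r\sim H_{\mathrm{eig}}$ and $U$ Haar distributed on $\mathrm{U}(N)$ independent of $r$. Here $\mathrm{diag}(r)$ is the diagonal matrix with diagonal entries $r_1,\ldots,r_N$. *)

theory Defs
  imports "HOL-Probability.Probability" "HOL-Library.Landau_Symbols"
begin

type_synonym 'n cmat = "complex^'n^'n"

definition ctransp :: "'n::finite cmat \<Rightarrow> 'n::finite cmat"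
  where "ctransp A = (\<chi> i j. cnj (A $ j $ i))"

definition diag_mat :: "real^'n \<Rightarrow> 'n::finite cmat"
  where "diag_mat r = (\<chi> i j. if i = j then complex_of_real (r $ i) else 0)"

definition Herm :: "'n::finite cmat set"
  where "Herm = {X. ctransp X = X}"

definition Herm0 :: "'n::finite cmat set"
  where "Herm0 = {X \<in> Herm. trace X = 0}"

definition unitary_group :: "'n::finite cmat set"
  where "unitary_group = {U. U ** ctransp U = mat 1 \<and> ctransp U ** U = mat 1}"

definition unit_sphere_in :: "'n::finite cmat set \<Rightarrow> 'n::finite cmat set"
  where "unit_sphere_in W = {R \<in> W. trace (R ** R) = 1}"

text \<open>
  The Hermitian matrix with real coordinates \<open>x\<close>: the diagonal entries are \<open>x (j, j)\<close>, and for
  \<open>j < k\<close> the entry at position \<open>(j, k)\<close> has real part \<open>x (j, k)\<close> and imaginary part \<open>x (k, j)\<close>.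
\<close>
definition herm_of_coords :: "('n::{finite,linorder} \<times> 'n \<Rightarrow> real) \<Rightarrow> 'n cmat"
  where "herm_of_coords x = (\<chi> j k.
    if j = k then complex_of_real (x (j, j))
    else if j < k then Complex (x (j, k)) (x (k, j))
    else Complex (x (k, j)) (- x (j, k)))"

text \<open>
  Lebesgue measure on \<open>W\<close> is represented as a measure on the Borel sets of the space of all complex
  matrices that is concentrated on \<open>W\<close>. On traceless matrices it is the measure
  \<open>\<delta>(Tr X) dX\<close>: the last diagonal coordinate is eliminated by the condition \<open>Tr X = 0\<close>.
\<close>
definition lebesgue_Herm :: "'n::{finite,linorder} cmat measure"
  where "lebesgue_Herm = distr (\<Pi>\<^sub>M p\<in>UNIV. lborel) borel herm_of_coords"

definition lebesgue_Herm0 :: "'n::{finite,linorder} cmat measure"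
  where "lebesgue_Herm0 = (let l = Max UNIV in
    distr (\<Pi>\<^sub>M p\<in>UNIV - {(l, l)}. lborel) borel
      (\<lambda>x. herm_of_coords (x((l, l) := - (\<Sum>j\<in>UNIV - {l}. x (j, j))))))"

definition lebesgue_in :: "'n::{finite,linorder} cmat set \<Rightarrow> 'n cmat measure"
  where "lebesgue_in W = (if W = Herm then lebesgue_Herm else lebesgue_Herm0)"

definition borel_prob_on :: "'a::topological_space set \<Rightarrow> 'a measure \<Rightarrow> bool"
  where "borel_prob_on S P \<longleftrightarrow> prob_space P \<and> sets P = sets (restrict_space borel S)"

definition topological_support :: "'a::topological_space measure \<Rightarrow> 'a set"
  where "topological_support P =
    {x \<in> space P. \<forall>V. open V \<longrightarrow> x \<in> V \<longrightarrow> emeasure P (V \<inter> space P) > 0}"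

definition unitarily_invariant :: "'n::finite cmat measure \<Rightarrow> bool"
  where "unitarily_invariant H \<longleftrightarrow>
    (\<forall>U\<in>unitary_group. distr H H (\<lambda>R. U ** R ** ctransp U) = H)"

definition permutation_invariant :: "(real^'n) measure \<Rightarrow> bool"
  where "permutation_invariant h \<longleftrightarrow>
    (\<forall>\<pi>. \<pi> permutes UNIV \<longrightarrow> distr h h (\<lambda>r. \<chi> i. r $ \<pi> i) = h)"

text \<open>The normalized Haar measure of the compact group of unitary matrices.\<close>
definition haar_unitary :: "'n::finite cmat measure \<Rightarrow> bool"
  where "haar_unitary \<kappa> \<longleftrightarrow> borel_prob_on unitary_group \<kappa> \<and>
    (\<forall>V\<in>unitary_group. distr \<kappa> \<kappa> (\<lambda>U. V ** U) = \<kappa>)"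

definition stable_nu :: "real \<Rightarrow> real \<Rightarrow> complex"
  where "stable_nu \<alpha> u =
    (if \<alpha> = 1 then of_real \<bar>u\<bar> * (1 + (2 * \<i> / of_real pi) * of_real (sgn u * ln \<bar>u\<bar>))
     else of_real (\<bar>u\<bar> powr \<alpha>) * (1 - \<i> * of_real (sgn u * tan (pi * \<alpha> / 2))))"

text \<open>\<open>P\<close> is the stable distribution \<open>S(\<alpha>, \<sigma>h, \<mu>)\<close>.\<close>
definition is_stable_dist ::
  "real \<Rightarrow> real \<Rightarrow> (real^'n) measure \<Rightarrow> real^'n \<Rightarrow> (real^'n) measure \<Rightarrow> bool"
  where "is_stable_dist \<alpha> \<sigma> h \<mu> P \<longleftrightarrow> borel_prob_on UNIV P \<and>
    (\<forall>\<xi>. (\<integral>x. exp (\<i> * of_real (\<xi> \<bullet> x)) \<partial>P) =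
      exp (- of_real \<sigma> * (\<integral>r. stable_nu \<alpha> (r \<bullet> \<xi>) \<partial>h) + \<i> * of_real (\<xi> \<bullet> \<mu>)))"

text \<open>
  \<open>P\<close> is the stable invariant ensemble \<open>S(\<alpha>, H, 0)\<close> on \<open>W\<close>. The traces of products of
  two Hermitian matrices are real.
\<close>
definition is_stable_ensemble ::
  "'n::finite cmat set \<Rightarrow> real \<Rightarrow> 'n::finite cmat measure \<Rightarrow> 'n::finite cmat measure \<Rightarrow> bool"
  where "is_stable_ensemble W \<alpha> H P \<longleftrightarrow> borel_prob_on W P \<and>
    (\<forall>S\<in>W. (\<integral>Y. exp (\<i> * trace (S ** Y)) \<partial>P) =
      exp (- (\<integral>R. stable_nu \<alpha> (Re (trace (R ** S))) \<partial>H)))"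

text \<open>
  The laws are compared on the ambient matrix space, because \<open>U\<^sup>\<dagger> diag(r) U\<close> need only lie in the
  space of \<open>H\<close> for almost all \<open>r\<close> (if \<open>H\<close> lives on traceless matrices).
\<close>
definition is_eigenvalue_part :: "'n::finite cmat measure \<Rightarrow> (real^'n) measure \<Rightarrow> bool"
  where "is_eigenvalue_part H h \<longleftrightarrow> borel_prob_on (sphere 0 1) h \<and> permutation_invariant h \<and>
    (\<exists>\<kappa>. haar_unitary \<kappa> \<and>
      distr H borel (\<lambda>R. R) =
      distr (h \<Otimes>\<^sub>M \<kappa>) borel (\<lambda>(r, U). ctransp U ** diag_mat r ** U))"

definition mean_coordinate :: "(real^'n) measure \<Rightarrow> real"
  where "mean_coordinate h = (1 / real CARD('n)) * (\<integral>t. (\<Sum>k\<in>UNIV. t $ k) \<partial>h)"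

definition normalized_sum ::
  "real \<Rightarrow> (real^'n) measure \<Rightarrow> (nat \<Rightarrow> 'n::finite cmat) \<Rightarrow> (nat \<Rightarrow> 'n::finite cmat) \<Rightarrow> nat \<Rightarrow>
   'n::finite cmat"
  where "normalized_sum \<alpha> h X U m =
    (1 / real m powr (1 / \<alpha>)) *\<^sub>R (\<Sum>j = 1..m. U j ** X j ** ctransp (U j))
    - (if \<alpha> = 1 then (2 * mean_coordinate h * ln (real m) / pi) *\<^sub>R mat 1 else 0)"

end

theory Submission
  imports Defs
begin

text \<open>
  In the \<open>N\<^sup>2\<close> real coordinates of Hermitian matrices, the characteristic function of \<open>Y\<^sub>m\<close> is
  \<open>(\<integral> exp (- g(U, \<xi>) / m) dU)^m\<close> and that of the limit is \<open>exp (- \<integral> g(U, \<xi>) dU)\<close>, where \<open>g(U, \<xi>)\<close> is the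
  exponent of the stable law of the eigenvalues at the diagonal of \<open>U\<^sup>\<dagger> S U\<close>, \<open>S\<close> the matrix dual to
  \<open>\<xi>\<close>. The centring at \<open>\<alpha> = 1\<close> cancels the logarithm that rescaling \<open>g\<close> produces. Since
  the support of \<open>H\<close> spans the space, \<open>Re \<integral> g\<close> dominates a multiple of \<open>|\<xi>|^\<alpha>\<close>, and the \<open>L\<^sup>1\<close>
  distance of the two characteristic functions is \<open>O(1/m)\<close>, up to an exponentially small part of the
  law of \<open>Y\<^sub>m\<close> that is split off because the characteristic function of a summand need not be
  integrable. By Fourier inversion the two laws differ by \<open>O(R^(N\<^sup>2) / m)\<close> on a ball of radius \<open>R\<close>, and
  both have mass \<open>O(R^(- \<alpha>))\<close> outside of it; \<open>R = m^(1 / (N\<^sup>2 + \<alpha>))\<close> balances the two errors.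

  The splitting and the existence of densities rest on the absolute continuity of the law of a
  single summand \<open>U X U\<^sup>\<dagger>\<close>: the map \<open>(X, U) \<mapsto> U X U\<^sup>\<dagger>\<close>, with \<open>U\<close> near a given unitary matrix
  parametrized by the Cayley transform, is locally expanding where the eigenvalues are distinct, so
  preimages of null sets are null sets.
\<close>

text \<open>The characteristic function of a summand becomes square integrable once its law has been
  cut down to a set where the density is bounded; two such pieces convolved have the integrable
  characteristic function \<open>(cf T)\<^sup>2\<close>. Hence the splitting is performed on pairs
  of summands: there are \<open>m div 2\<close> pairs, and one summand is left over for odd
  \<open>m\<close>. What remains of each pair is a positive measure of mass below 1. Its power is
  exponentially small in \<open>m\<close>, which outweighs the volume
  \<open>m powr (d / \<alpha>)\<close>, in dimension \<open>d\<close>, of the region where it is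
  integrated.

  Since the part split off is a positive measure, it can be added to the limit law and then dropped
  from the comparison. What results is a one-sided inequality between the two laws; the other side
  follows by passing to complements, both being probabilities. This also confines the tail estimate
  to the limit law, whose characteristic function is explicit, so that no tail bound uniform in
  \<open>m\<close> has to be found.\<close>

lemma cis_borel_measurable [measurable]: "cis \<in> borel_measurable borel"
  by (intro borel_measurable_continuous_onI continuous_intros)

section \<open>Gaussian densities and their Fourier transforms\<close>

lemma lborel_prod_Basis:
  fixes f :: "'a::euclidean_space \<Rightarrow> real \<Rightarrow> 'b::{real_normed_field,banach,second_countable_topology}"
  assumes f: "\<And>b. b \<in> Basis \<Longrightarrow> integrable lborel (f b)"
  shows lborel_integrable_prod_Basis: "integrable lborel (\<lambda>x. \<Prod>b\<in>Basis. f b (x \<bullet> b))"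
    and lborel_integral_prod_Basis:
      "(\<integral>x. (\<Prod>b\<in>Basis. f b (x \<bullet> b)) \<partial>lborel) = (\<Prod>b\<in>Basis. \<integral>t. f b t \<partial>lborel)"
proof -
  interpret product_sigma_finite "\<lambda>_::'a. lborel :: real measure" by standard
  have [measurable]: "f b \<in> borel_measurable borel" if "b \<in> Basis" for b
    using borel_measurable_integrable[OF f[OF that]] by simp
  have [measurable]: "(\<lambda>x. \<Prod>b\<in>Basis. f b (x \<bullet> b)) \<in> borel_measurable borel"
    by measurable
  show "integrable lborel (\<lambda>x. \<Prod>b\<in>Basis. f b (x \<bullet> b))"
    by (subst lborel_eq, subst integrable_distr_eq)
      (auto simp: inner_sum_left_Basis intro!: product_integrable_prod f cong: prod.cong)
  show "(\<integral>x. (\<Prod>b\<in>Basis. f b (x \<bullet> b)) \<partial>lborel) = (\<Prod>b\<in>Basis. \<integral>t. f b t \<partial>lborel)"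
    by (subst lborel_eq, subst integral_distr)
      (auto simp: inner_sum_left_Basis product_integral_prod f cong: prod.cong)
qed

lemma sum_Basis_inner_power2: "(\<Sum>b\<in>Basis. (x \<bullet> b)\<^sup>2) = (norm (x::'a::euclidean_space))\<^sup>2"
  unfolding power2_norm_eq_inner by (subst euclidean_inner) (simp add: power2_eq_square)

definition gauss :: "'a::euclidean_space \<Rightarrow> real"
  where "gauss x = (\<Prod>b\<in>Basis. std_normal_density (x \<bullet> b))"

lemma gauss_measurable [measurable]: "gauss \<in> borel_measurable borel"
  unfolding gauss_def by measurable

lemma gauss_nonneg [simp]: "0 \<le> gauss x"
  unfolding gauss_def by (intro prod_nonneg) auto

lemma gauss_eq:
  "gauss (x::'a::euclidean_space) = exp (- (norm x)\<^sup>2 / 2) / sqrt (2 * pi) ^ DIM('a)"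
proof -
  have "gauss x = (\<Prod>b\<in>(Basis::'a set). exp (- (x \<bullet> b)\<^sup>2 / 2)) / sqrt (2 * pi) ^ DIM('a)"
    by (simp add: gauss_def std_normal_density_def prod.distrib prod_dividef power_one_over)
  also have "(\<Prod>b\<in>(Basis::'a set). exp (- (x \<bullet> b)\<^sup>2 / 2)) = exp (\<Sum>b\<in>(Basis::'a set). - (x \<bullet> b)\<^sup>2 / 2)"
    by (simp add: exp_sum)
  also have "(\<Sum>b\<in>(Basis::'a set). - (x \<bullet> b)\<^sup>2 / 2) = - (norm x)\<^sup>2 / 2"
    by (simp add: sum_negf sum_Basis_inner_power2 flip: sum_divide_distrib)
  finally show ?thesis .
qed

lemma integrable_gauss: "integrable lborel (gauss :: 'a::euclidean_space \<Rightarrow> real)"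
  using lborel_integrable_prod_Basis[of "\<lambda>_::'a. std_normal_density"]
  by (simp add: gauss_def[abs_def])

lemma integral_gauss: "(\<integral>x. gauss (x::'a::euclidean_space) \<partial>lborel) = 1"
  using lborel_integral_prod_Basis[of "\<lambda>_::'a. std_normal_density"]
  by (simp add: gauss_def[abs_def])

lemma std_normal_fourier:
  "integrable lborel (\<lambda>x. of_real (std_normal_density x) * cis (t * x))"
  "(\<integral>x. of_real (std_normal_density x) * cis (t * x) \<partial>lborel) = exp (- of_real (t\<^sup>2 / 2))"
proof -
  show "integrable lborel (\<lambda>x. of_real (std_normal_density x) * cis (t * x))"
    by (rule Bochner_Integration.integrable_bound[OF integrable_normal_density[of 1 0]])
      (auto simp: norm_mult)
  have "char std_normal_distribution t = (\<integral>x. of_real (std_normal_density x) * cis (t * x) \<partial>lborel)"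
    unfolding char_def
    by (subst integral_density) (auto simp: cis_conv_exp scaleR_conv_of_real mult_ac)
  then show "(\<integral>x. of_real (std_normal_density x) * cis (t * x) \<partial>lborel) = exp (- of_real (t\<^sup>2 / 2))"
    by (simp add: char_std_normal_distribution flip: exp_of_real)
qed

lemma gauss_fourier:
  fixes \<xi> :: "'a::euclidean_space"
  shows "integrable lborel (\<lambda>x. of_real (gauss x) * cis (\<xi> \<bullet> x))"
    and "(\<integral>x. of_real (gauss x) * cis (\<xi> \<bullet> x) \<partial>lborel) = of_real (exp (- (norm \<xi>)\<^sup>2 / 2))"
proof -
  have cis_prod: "cis (\<xi> \<bullet> x) = (\<Prod>b\<in>Basis. cis ((\<xi> \<bullet> b) * (x \<bullet> b)))" for x
    by (subst euclidean_inner) (simp add: cis_conv_exp sum_distrib_left exp_sum)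
  have eq: "of_real (gauss x) * cis (\<xi> \<bullet> x)
      = (\<Prod>b\<in>Basis. of_real (std_normal_density (x \<bullet> b)) * cis ((\<xi> \<bullet> b) * (x \<bullet> b)))" for x
    by (simp add: gauss_def cis_prod prod.distrib)
  show "integrable lborel (\<lambda>x. of_real (gauss x) * cis (\<xi> \<bullet> x))"
    unfolding eq
    by (rule lborel_integrable_prod_Basis[where f="\<lambda>b t. of_real (std_normal_density t) * cis ((\<xi> \<bullet> b) * t)"])
      (rule std_normal_fourier)
  have "(\<integral>x. of_real (gauss x) * cis (\<xi> \<bullet> x) \<partial>lborel) = (\<Prod>b\<in>Basis. exp (- of_real ((\<xi> \<bullet> b)\<^sup>2 / 2)))"
    unfolding eq by (subst lborel_integral_prod_Basis[where f="\<lambda>b t. of_real (std_normal_density t) * cis ((\<xi> \<bullet> b) * t)"])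
      (simp_all add: std_normal_fourier)
  also have "\<dots> = of_real (exp (- (norm \<xi>)\<^sup>2 / 2))"
    by (simp add: sum_negf flip: exp_of_real exp_sum sum_Basis_inner_power2 sum_divide_distrib)
  finally show "(\<integral>x. of_real (gauss x) * cis (\<xi> \<bullet> x) \<partial>lborel) = of_real (exp (- (norm \<xi>)\<^sup>2 / 2))" .
qed

lemma lborel_integral_scaleR:
  fixes f :: "'a::euclidean_space \<Rightarrow> 'b::{banach, second_countable_topology}"
  assumes c: "c \<noteq> 0" and [measurable]: "f \<in> borel_measurable borel"
  shows "(\<integral>x. f x \<partial>lborel) = \<bar>c\<bar> ^ DIM('a) *\<^sub>R (\<integral>x. f (t + c *\<^sub>R x) \<partial>lborel)"
  by (subst lborel_affine[OF c, of t]) (simp add: integral_density integral_distr)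

lemma lborel_integrable_scaleR:
  fixes f :: "'a::euclidean_space \<Rightarrow> 'b::{banach, second_countable_topology}"
  assumes c: "c \<noteq> 0" and f: "integrable lborel f"
  shows "integrable lborel (\<lambda>x. f (t + c *\<^sub>R x))"
proof -
  have [measurable]: "f \<in> borel_measurable borel"
    using f by auto
  have "integrable (density (distr lborel borel (\<lambda>x. t + c *\<^sub>R x)) (\<lambda>_. \<bar>c\<bar>^DIM('a))) f"
    using f lborel_affine[OF c, of t] by simp
  then have "integrable lborel (\<lambda>x. \<bar>c\<bar>^DIM('a) *\<^sub>R f (t + c *\<^sub>R x))"
    by (simp add: integrable_density integrable_distr_eq)
  then have "integrable lborel (\<lambda>x. (1 / \<bar>c\<bar>^DIM('a)) *\<^sub>R (\<bar>c\<bar>^DIM('a) *\<^sub>R f (t + c *\<^sub>R x)))"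
    by (rule integrable_scaleR_right)
  then show ?thesis
    using c by simp
qed

text \<open>The constant (2 pi)^(d/2). Since the Fourier transform of \<open>gauss\<close> is
  \<open>gauss_norm\<close> times \<open>gauss\<close>, its square (2 pi)^d is the constant of
  Fourier inversion, and in this form it enters the comparison theorem. The type argument carries
  the dimension.\<close>

definition gauss_norm :: "'a::euclidean_space itself \<Rightarrow> real"
  where "gauss_norm _ = sqrt (2 * pi) ^ DIM('a)"

lemma gauss_norm_pos [simp]: "0 < gauss_norm TYPE('a::euclidean_space)"
  by (simp add: gauss_norm_def)

lemma gauss_norm_nonzero [simp]: "gauss_norm TYPE('a::euclidean_space) \<noteq> 0"
  by (simp add: gauss_norm_def)

lemma gauss_eq_norm: "gauss (x::'a::euclidean_space) = exp (- (norm x)\<^sup>2 / 2) / gauss_norm TYPE('a)"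
  by (simp add: gauss_eq gauss_norm_def)

text \<open>Rescaling \<open>gauss_fourier\<close> by \<open>e\<close>. As \<open>e\<close> tends to
  0 the right-hand side concentrates at \<open>z = 0\<close>, which makes this the regularized form
  of Fourier inversion.\<close>

lemma gauss_damping:
  fixes z :: "'a::euclidean_space"
  assumes e: "0 < e"
  shows "integrable lborel (\<lambda>\<xi>::'a. of_real (gauss (e *\<^sub>R \<xi>)) * cis (\<xi> \<bullet> z))"
    and "(\<integral>\<xi>. of_real (gauss (e *\<^sub>R \<xi>)) * cis (\<xi> \<bullet> z) \<partial>lborel)
      = of_real (gauss_norm TYPE('a) / e ^ DIM('a) * gauss (z /\<^sub>R e))"
proof -
  define f where "f \<xi> = of_real (gauss (e *\<^sub>R \<xi>)) * cis (\<xi> \<bullet> z)" for \<xi> :: 'a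
  have [measurable]: "f \<in> borel_measurable borel"
    unfolding f_def by measurable
  have "integrable lborel (\<lambda>\<xi>. of_real (gauss (0 + e *\<^sub>R \<xi>)) * cis ((z /\<^sub>R e) \<bullet> (0 + e *\<^sub>R \<xi>)))"
    using e by (intro lborel_integrable_scaleR[of e "\<lambda>x. of_real (gauss x) * cis ((z /\<^sub>R e) \<bullet> x)"] gauss_fourier) auto
  moreover have "(z /\<^sub>R e) \<bullet> (0 + e *\<^sub>R \<xi>) = \<xi> \<bullet> z" for \<xi>
    using e by (simp add: inner_commute)
  ultimately
  show "integrable lborel (\<lambda>\<xi>::'a. of_real (gauss (e *\<^sub>R \<xi>)) * cis (\<xi> \<bullet> z))"
    by simp
  have "(\<integral>\<xi>. f \<xi> \<partial>lborel) = \<bar>1/e\<bar> ^ DIM('a) *\<^sub>R (\<integral>\<xi>. f (0 + (1/e) *\<^sub>R \<xi>) \<partial>lborel)"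
    using e by (intro lborel_integral_scaleR) auto
  also have "(\<integral>\<xi>. f (0 + (1/e) *\<^sub>R \<xi>) \<partial>lborel) = (\<integral>x. of_real (gauss x) * cis ((z /\<^sub>R e) \<bullet> x) \<partial>lborel)"
    using e by (intro Bochner_Integration.integral_cong) (auto simp: f_def inner_commute divide_inverse)
  also have "\<dots> = of_real (exp (- (norm (z /\<^sub>R e))\<^sup>2 / 2))"
    by (rule gauss_fourier)
  finally show "(\<integral>\<xi>. of_real (gauss (e *\<^sub>R \<xi>)) * cis (\<xi> \<bullet> z) \<partial>lborel)
      = of_real (gauss_norm TYPE('a) / e ^ DIM('a) * gauss (z /\<^sub>R e))"
    using e by (simp add: f_def gauss_eq gauss_norm_def scaleR_conv_of_real power_one_over divide_simps)
qed

section \<open>Characteristic functions and Gaussian smoothing\<close>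

definition cf :: "'a::euclidean_space measure \<Rightarrow> 'a \<Rightarrow> complex"
  where "cf M \<xi> = (\<integral>x. cis (\<xi> \<bullet> x) \<partial>M)"

text \<open>Most exchanges of integrals below have this shape: the first measure is only finite, and
  the bound depends on the second variable alone, usually through a Gaussian weight.\<close>

lemma integrable_pair_bound:
  fixes F :: "'x \<times> 'y \<Rightarrow> 'b::{banach,second_countable_topology}" and b :: "'y \<Rightarrow> real"
  assumes "finite_measure T" "sigma_finite_measure M"
    and b: "integrable M b" and F: "F \<in> borel_measurable (T \<Otimes>\<^sub>M M)"
    and bound: "\<And>x y. norm (F (x, y)) \<le> b y"
  shows "integrable (T \<Otimes>\<^sub>M M) F"
proof (rule Bochner_Integration.integrable_bound)
  interpret T: finite_measure T by fact
  interpret M: sigma_finite_measure M by fact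
  interpret pair_sigma_finite T M ..
  have [measurable]: "b \<in> borel_measurable M"
    using b by auto
  show "integrable (T \<Otimes>\<^sub>M M) (\<lambda>(x, y). b y)"
    by (rule Fubini_integrable) (use b in \<open>auto\<close>)
  show "AE x in T \<Otimes>\<^sub>M M. norm (F x) \<le> norm (case x of (x, y) \<Rightarrow> b y)"
    using bound by (auto intro!: AE_I2 simp: order.trans[OF _ abs_ge_self])
qed fact

text \<open>Finite rather than probability measures, because laws are cut into pieces of smaller
  mass and the pieces are compared as well.\<close>

locale borel_finite_measure = finite_measure T for T :: "'a::euclidean_space measure" +
  assumes sets_borel [simp, measurable_cong]: "sets T = sets borel"
begin

lemma space_UNIV [simp]: "space T = UNIV"
  using sets_eq_imp_space_eq[OF sets_borel] by simp

lemma borel_measurable_eq [simp]: "f \<in> measurable T M \<longleftrightarrow> f \<in> measurable borel M"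
  by (simp cong: measurable_cong_sets)

lemma norm_cf_le: "norm (cf T \<xi>) \<le> measure T UNIV"
proof -
  have "norm (cf T \<xi>) \<le> (\<integral>x. norm (cis (\<xi> \<bullet> x)) \<partial>T)"
    unfolding cf_def by (rule integral_norm_bound)
  then show ?thesis
    by simp
qed

lemma cf_measurable [measurable]: "cf T \<in> borel_measurable borel"
  unfolding cf_def[abs_def] by measurable

text \<open>The density at \<open>y\<close> of the convolution of \<open>T\<close> with a centred
  Gaussian of standard deviation \<open>e\<close> in each coordinate.\<close>

definition smooth_density :: "real \<Rightarrow> 'a \<Rightarrow> real"
  where "smooth_density e y = (\<integral>x. gauss ((x - y) /\<^sub>R e) / e ^ DIM('a) \<partial>T)"

text \<open>Inserting \<open>gauss_damping\<close> for the kernel and exchanging integrals gives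
  Fourier inversion for any finite measure; the damping factor stands in for integrability of
  \<open>cf T\<close>.\<close>

lemma smooth_density_fourier:
  assumes e: "0 < e"
  shows "integrable lborel (\<lambda>\<xi>. of_real (gauss (e *\<^sub>R \<xi>)) * (cis (- (\<xi> \<bullet> y)) * cf T \<xi>))"
    and "of_real (smooth_density e y)
      = (\<integral>\<xi>. of_real (gauss (e *\<^sub>R \<xi>)) * (cis (- (\<xi> \<bullet> y)) * cf T \<xi>) \<partial>lborel) / of_real (gauss_norm TYPE('a))"
proof -
  interpret pair_sigma_finite T "lborel :: 'a measure" ..
  have gi: "integrable lborel (\<lambda>\<xi>::'a. gauss (e *\<^sub>R \<xi>))"
    using lborel_integrable_scaleR[of e "gauss :: 'a \<Rightarrow> real" 0] integrable_gauss e by simp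
  have int: "integrable (T \<Otimes>\<^sub>M lborel) (\<lambda>(x, \<xi>). of_real (gauss (e *\<^sub>R \<xi>)) * cis (\<xi> \<bullet> (x - y)) :: complex)"
    by (rule integrable_pair_bound[OF finite_measure_axioms _ gi])
      (auto simp: norm_mult intro: lborel.sigma_finite_measure_axioms)
  have cfeq: "(\<integral>x. of_real (gauss (e *\<^sub>R \<xi>)) * cis (\<xi> \<bullet> (x - y)) \<partial>T)
      = of_real (gauss (e *\<^sub>R \<xi>)) * (cis (- (\<xi> \<bullet> y)) * cf T \<xi>)" for \<xi>
  proof -
    have "cis (\<xi> \<bullet> (x - y)) = cis (- (\<xi> \<bullet> y)) * cis (\<xi> \<bullet> x)" for x
      by (simp add: inner_diff_right cis_mult)
    then show ?thesis
      by (simp add: cf_def)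
  qed
  show "integrable lborel (\<lambda>\<xi>. of_real (gauss (e *\<^sub>R \<xi>)) * (cis (- (\<xi> \<bullet> y)) * cf T \<xi>))"
    using integrable_snd[OF int] by (simp only: cfeq prod.case)
  have "complex_of_real (smooth_density e y)
      = (\<integral>x. of_real (gauss_norm TYPE('a) / e ^ DIM('a) * gauss ((x - y) /\<^sub>R e)) \<partial>T) / of_real (gauss_norm TYPE('a))"
    using gauss_norm_pos[where 'a='a] unfolding smooth_density_def integral_complex_of_real
    by (simp add: field_simps less_imp_neq[OF gauss_norm_pos, symmetric])
  also have "(\<integral>x. of_real (gauss_norm TYPE('a) / e ^ DIM('a) * gauss ((x - y) /\<^sub>R e)) \<partial>T)
      = (\<integral>x. (\<integral>\<xi>. of_real (gauss (e *\<^sub>R \<xi>)) * cis (\<xi> \<bullet> (x - y)) \<partial>lborel) \<partial>T)"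
    by (simp only: gauss_damping(2)[OF e])
  also have "\<dots> = (\<integral>\<xi>. (\<integral>x. of_real (gauss (e *\<^sub>R \<xi>)) * cis (\<xi> \<bullet> (x - y)) \<partial>T) \<partial>lborel)"
    using Fubini_integral[OF int] by simp
  finally show "of_real (smooth_density e y)
      = (\<integral>\<xi>. of_real (gauss (e *\<^sub>R \<xi>)) * (cis (- (\<xi> \<bullet> y)) * cf T \<xi>) \<partial>lborel) / of_real (gauss_norm TYPE('a))"
    by (simp only: cfeq)
qed

text \<open>Both sides integrate \<open>f\<close> against the smoothed measure, taken as the law of
  \<open>x + e *\<^sub>R z\<close> on the left and through its density on the right.\<close>

lemma smooth_density_integral:
  assumes e: "0 < e" and f: "integrable lborel f"
  shows "integrable lborel (\<lambda>y. f y * smooth_density e y)"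
    and "(\<integral>x. (\<integral>z. f (x + e *\<^sub>R z) * gauss z \<partial>lborel) \<partial>T) = (\<integral>y. f y * smooth_density e y \<partial>lborel)"
proof -
  interpret pair_sigma_finite T "lborel :: 'a measure" ..
  have [measurable]: "f \<in> borel_measurable borel"
    using f by auto
  have gb: "gauss z \<le> 1 / gauss_norm TYPE('a)" for z :: 'a
    by (simp add: gauss_eq gauss_norm_def divide_simps)
  have int: "integrable (T \<Otimes>\<^sub>M lborel) (\<lambda>(x, y). f y * (gauss ((x - y) /\<^sub>R e) / e ^ DIM('a)))"
  proof (rule integrable_pair_bound[OF finite_measure_axioms])
    show "integrable lborel (\<lambda>y. \<bar>f y\<bar> * (1 / gauss_norm TYPE('a) / e ^ DIM('a)))"
      using f by (intro integrable_mult_left integrable_abs)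
    show "norm (case (x, y) of (x, y) \<Rightarrow> f y * (gauss ((x - y) /\<^sub>R e) / e ^ DIM('a)))
        \<le> \<bar>f y\<bar> * (1 / gauss_norm TYPE('a) / e ^ DIM('a))" for x y
    proof -
      have "\<bar>f y\<bar> * (gauss ((x - y) /\<^sub>R e) / e ^ DIM('a)) \<le> \<bar>f y\<bar> * (1 / gauss_norm TYPE('a) / e ^ DIM('a))"
        using e by (intro mult_left_mono divide_right_mono gb) auto
      then show ?thesis
        using e by (simp add: abs_mult)
    qed
  qed (auto intro: lborel.sigma_finite_measure_axioms)
  show "integrable lborel (\<lambda>y. f y * smooth_density e y)"
    using integrable_snd[OF int] by (simp add: smooth_density_def)
  have "(\<integral>z. f (x + e *\<^sub>R z) * gauss z \<partial>lborel) = (\<integral>y. f y * (gauss ((x - y) /\<^sub>R e) / e ^ DIM('a)) \<partial>lborel)" for x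
  proof -
    have ev: "gauss (- z) = gauss z" for z :: 'a
      by (simp add: gauss_eq)
    have "(\<integral>y. f y * (gauss ((x - y) /\<^sub>R e) / e ^ DIM('a)) \<partial>lborel)
        = \<bar>e\<bar> ^ DIM('a) *\<^sub>R (\<integral>z. f (x + e *\<^sub>R z) * (gauss ((x - (x + e *\<^sub>R z)) /\<^sub>R e) / e ^ DIM('a)) \<partial>lborel)"
      using e by (intro lborel_integral_scaleR) auto
    also have "\<dots> = (\<integral>z. f (x + e *\<^sub>R z) * gauss z \<partial>lborel)"
      using e by (simp add: ev)
    finally show ?thesis ..
  qed
  then have "(\<integral>x. (\<integral>z. f (x + e *\<^sub>R z) * gauss z \<partial>lborel) \<partial>T)
      = (\<integral>x. (\<integral>y. f y * (gauss ((x - y) /\<^sub>R e) / e ^ DIM('a)) \<partial>lborel) \<partial>T)"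
    by simp
  also have "\<dots> = (\<integral>y. (\<integral>x. f y * (gauss ((x - y) /\<^sub>R e) / e ^ DIM('a)) \<partial>T) \<partial>lborel)"
    using Fubini_integral[OF int] by (simp only: prod.case)
  finally show "(\<integral>x. (\<integral>z. f (x + e *\<^sub>R z) * gauss z \<partial>lborel) \<partial>T) = (\<integral>y. f y * smooth_density e y \<partial>lborel)"
    by (simp add: smooth_density_def)
qed

lemma smoothing_tendsto:
  fixes f :: "'a \<Rightarrow> real"
  assumes f: "continuous_on UNIV f" and B: "\<And>x. \<bar>f x\<bar> \<le> B"
  shows "(\<lambda>n. \<integral>x. (\<integral>z. f (x + (1 / real (Suc n)) *\<^sub>R z) * gauss z \<partial>lborel) \<partial>T) \<longlonglongrightarrow> (\<integral>x. f x \<partial>T)"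
proof (rule integral_dominated_convergence[where w="\<lambda>_. B"])
  have [measurable]: "f \<in> borel_measurable borel"
    using f by (rule borel_measurable_continuous_onI)
  show "f \<in> borel_measurable T" "integrable T (\<lambda>_. B)"
    "(\<lambda>x. \<integral>z. f (x + (1 / real (Suc n)) *\<^sub>R z) * gauss z \<partial>lborel) \<in> borel_measurable T" for n
    by auto
  have Bg: "integrable lborel (\<lambda>z::'a. B * gauss z)"
    by (intro integrable_mult_right integrable_gauss)
  show "AE x in T. norm (\<integral>z. f (x + (1 / real (Suc n)) *\<^sub>R z) * gauss z \<partial>lborel) \<le> B" for n
  proof (rule AE_I2)
    fix x
    have "norm (\<integral>z. f (x + (1 / real (Suc n)) *\<^sub>R z) * gauss z \<partial>lborel)
        \<le> (\<integral>z. B * gauss (z::'a) \<partial>lborel)"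
    proof (rule Bochner_Integration.integral_norm_bound_integral)
      show le: "norm (f (x + (1 / real (Suc n)) *\<^sub>R z) * gauss z) \<le> B * gauss z" for z
        by (auto simp: abs_mult intro!: mult_right_mono B)
      show "integrable lborel (\<lambda>z. f (x + (1 / real (Suc n)) *\<^sub>R z) * gauss z)"
        by (rule Bochner_Integration.integrable_bound[OF Bg])
          (use order.trans[OF le abs_ge_self] in \<open>auto simp: real_norm_def\<close>)
    qed (rule Bg)
    then show "norm (\<integral>z. f (x + (1 / real (Suc n)) *\<^sub>R z) * gauss z \<partial>lborel) \<le> B"
      by (simp add: integral_gauss)
  qed
  show "AE x in T. (\<lambda>n. \<integral>z. f (x + (1 / real (Suc n)) *\<^sub>R z) * gauss z \<partial>lborel) \<longlonglongrightarrow> f x"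
  proof (rule AE_I2)
    fix x
    have "(\<lambda>n. \<integral>z. f (x + (1 / real (Suc n)) *\<^sub>R z) * gauss z \<partial>lborel) \<longlonglongrightarrow> (\<integral>z. f x * gauss (z::'a) \<partial>lborel)"
    proof (rule integral_dominated_convergence[where w="\<lambda>z. B * gauss z"])
      show "AE z in lborel. (\<lambda>n. f (x + (1 / real (Suc n)) *\<^sub>R z) * gauss z) \<longlonglongrightarrow> f x * gauss z"
      proof (rule AE_I2)
        fix z :: 'a
        have "(\<lambda>n. x + (1 / real (Suc n)) *\<^sub>R z) \<longlonglongrightarrow> x + 0 *\<^sub>R z"
          by (intro tendsto_intros LIMSEQ_Suc[OF lim_1_over_n])
        then have "(\<lambda>n. f (x + (1 / real (Suc n)) *\<^sub>R z)) \<longlonglongrightarrow> f x"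
          using f by (intro continuous_on_tendsto_compose[OF f]) auto
        then show "(\<lambda>n. f (x + (1 / real (Suc n)) *\<^sub>R z) * gauss z) \<longlonglongrightarrow> f x * gauss z"
          by (intro tendsto_intros)
      qed
    qed (use B Bg in \<open>auto simp: abs_mult intro!: mult_right_mono\<close>)
    then show "(\<lambda>n. \<integral>z. f (x + (1 / real (Suc n)) *\<^sub>R z) * gauss z \<partial>lborel) \<longlonglongrightarrow> f x"
      by (simp add: integral_gauss)
  qed
qed

end

section \<open>Comparison of measures through their characteristic functions\<close>

text \<open>After smoothing, all three measures have densities, and inversion bounds the density of
  \<open>T1 + T3 - T2\<close> by the L^1 norm of its characteristic function, uniformly in
  \<open>e\<close>. Only the combination has to be integrable, so that a badly behaved part of
  \<open>T2\<close> can be cancelled by \<open>T3\<close>. The smoothing is undone by letting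
  \<open>e\<close> tend to 0 against a bounded continuous \<open>f\<close>.\<close>

lemma cf_compare_continuous:
  fixes T1 T2 T3 :: "'a::euclidean_space measure"
  assumes "borel_finite_measure T1" "borel_finite_measure T2" "borel_finite_measure T3"
    and int: "integrable lborel (\<lambda>\<xi>. cf T1 \<xi> + cf T3 \<xi> - cf T2 \<xi>)"
    and D: "(\<integral>\<xi>. norm (cf T1 \<xi> + cf T3 \<xi> - cf T2 \<xi>) \<partial>lborel) \<le> D"
    and f: "continuous_on UNIV f" "\<And>x. 0 \<le> f x" "\<And>x. f x \<le> B" "integrable lborel f"
  shows "(\<integral>x. f x \<partial>T1) \<le> (\<integral>x. f x \<partial>T2) + D / (gauss_norm TYPE('a))\<^sup>2 * (\<integral>x. f x \<partial>lborel)"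
proof -
  interpret T1: borel_finite_measure T1 by fact
  interpret T2: borel_finite_measure T2 by fact
  interpret T3: borel_finite_measure T3 by fact
  let ?g = "gauss_norm TYPE('a)"
  let ?cf = "\<lambda>\<xi>. cf T1 \<xi> + cf T3 \<xi> - cf T2 \<xi>"
  define S where "S T n = (\<integral>x. (\<integral>z. f (x + (1 / real (Suc n)) *\<^sub>R z) * gauss z \<partial>lborel) \<partial>T)"
    for T :: "'a measure" and n
  have fB: "\<bar>f x\<bar> \<le> B" for x
    using f(2,3)[of x] by simp
  have lim: "S T1 \<longlonglongrightarrow> (\<integral>x. f x \<partial>T1)" "S T2 \<longlonglongrightarrow> (\<integral>x. f x \<partial>T2)"
    unfolding S_def by (rule T1.smoothing_tendsto[OF f(1) fB] T2.smoothing_tendsto[OF f(1) fB])+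
  have "S T1 n \<le> S T2 n + D / ?g\<^sup>2 * (\<integral>x. f x \<partial>lborel)" for n
  proof -
    define e where "e = 1 / real (Suc n)"
    have e: "0 < e"
      by (simp add: e_def)
    have "T1.smooth_density e y + T3.smooth_density e y - T2.smooth_density e y \<le> D / ?g\<^sup>2" for y
    proof -
      note int' = T1.smooth_density_fourier(1)[OF e, of y] T2.smooth_density_fourier(1)[OF e, of y]
        T3.smooth_density_fourier(1)[OF e, of y]
      have "complex_of_real (T1.smooth_density e y + T3.smooth_density e y - T2.smooth_density e y)
          = (\<integral>\<xi>. of_real (gauss (e *\<^sub>R \<xi>)) * (cis (- (\<xi> \<bullet> y)) * cf T1 \<xi>)
              + of_real (gauss (e *\<^sub>R \<xi>)) * (cis (- (\<xi> \<bullet> y)) * cf T3 \<xi>)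
              - of_real (gauss (e *\<^sub>R \<xi>)) * (cis (- (\<xi> \<bullet> y)) * cf T2 \<xi>) \<partial>lborel) / of_real ?g"
        unfolding of_real_add of_real_diff T1.smooth_density_fourier(2)[OF e] T2.smooth_density_fourier(2)[OF e]
          T3.smooth_density_fourier(2)[OF e]
        using int' by (simp add: add_divide_distrib diff_divide_distrib)
      also have "\<dots> = (\<integral>\<xi>. of_real (gauss (e *\<^sub>R \<xi>)) * cis (- (\<xi> \<bullet> y)) * ?cf \<xi> \<partial>lborel) / of_real ?g"
        by (simp add: algebra_simps)
      finally have eq: "complex_of_real (T1.smooth_density e y + T3.smooth_density e y - T2.smooth_density e y) = \<dots>" .
      have "T1.smooth_density e y + T3.smooth_density e y - T2.smooth_density e y
          \<le> norm (complex_of_real (T1.smooth_density e y + T3.smooth_density e y - T2.smooth_density e y))"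
        by (metis norm_of_real abs_ge_self)
      also have "\<dots> = norm (\<integral>\<xi>. of_real (gauss (e *\<^sub>R \<xi>)) * cis (- (\<xi> \<bullet> y)) * ?cf \<xi> \<partial>lborel) / ?g"
        unfolding eq by (simp add: norm_divide less_imp_le)
      also have "norm (\<integral>\<xi>. of_real (gauss (e *\<^sub>R \<xi>)) * cis (- (\<xi> \<bullet> y)) * ?cf \<xi> \<partial>lborel)
          \<le> (\<integral>\<xi>. norm (of_real (gauss (e *\<^sub>R \<xi>)) * cis (- (\<xi> \<bullet> y)) * ?cf \<xi>) \<partial>lborel)"
        by (rule integral_norm_bound)
      also have "\<dots> \<le> (\<integral>\<xi>. norm (?cf \<xi>) / ?g \<partial>lborel)"
      proof (rule integral_mono')
        show "norm (of_real (gauss (e *\<^sub>R \<xi>)) * cis (- (\<xi> \<bullet> y)) * ?cf \<xi>) \<le> norm (?cf \<xi>) / ?g" for \<xi>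
        proof -
          have "gauss (e *\<^sub>R \<xi>) \<le> 1 / ?g"
            by (simp add: gauss_eq gauss_norm_def divide_simps)
          then have "gauss (e *\<^sub>R \<xi>) * norm (?cf \<xi>) \<le> 1 / ?g * norm (?cf \<xi>)"
            by (rule mult_right_mono) simp
          then show ?thesis
            by (simp add: norm_mult)
        qed
        show "integrable lborel (\<lambda>\<xi>. norm (?cf \<xi>) / ?g)"
          by (intro integrable_divide_zero integrable_norm int)
        show "0 \<le> norm (?cf \<xi>) / ?g" for \<xi>
          by (simp add: less_imp_le)
      qed
      also have "\<dots> \<le> D / ?g"
        using D by (simp add: divide_right_mono less_imp_le)
      finally show ?thesis
        by (simp add: power2_eq_square divide_right_mono less_imp_le)
    qed
    then have "f y * T1.smooth_density e y + f y * T3.smooth_density e y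
        \<le> f y * T2.smooth_density e y + D / ?g\<^sup>2 * f y" for y
    proof -
      have "f y * (T1.smooth_density e y + T3.smooth_density e y - T2.smooth_density e y) \<le> f y * (D / ?g\<^sup>2)"
        using \<open>\<And>y. _ y \<le> D / ?g\<^sup>2\<close> f(2) by (intro mult_left_mono) auto
      then show ?thesis
        by (simp add: algebra_simps)
    qed
    \<comment> \<open>Here \<open>T3\<close> is dropped from the smaller side by positivity, which
      is why the conclusion is a one-sided inequality.\<close>
    moreover have "0 \<le> f y * T3.smooth_density e y" for y
      unfolding T3.smooth_density_def using f(2) e by (intro mult_nonneg_nonneg integral_nonneg) auto
    ultimately have "f y * T1.smooth_density e y \<le> f y * T2.smooth_density e y + D / ?g\<^sup>2 * f y" for y
      by (smt (verit))
    then have "(\<integral>y. f y * T1.smooth_density e y \<partial>lborel)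
        \<le> (\<integral>y. f y * T2.smooth_density e y + D / ?g\<^sup>2 * f y \<partial>lborel)"
      by (intro integral_mono T1.smooth_density_integral T2.smooth_density_integral e f
          Bochner_Integration.integrable_add integrable_mult_right)
    also have "\<dots> = (\<integral>y. f y * T2.smooth_density e y \<partial>lborel) + D / ?g\<^sup>2 * (\<integral>x. f x \<partial>lborel)"
      by (subst Bochner_Integration.integral_add)
        (auto intro!: T2.smooth_density_integral e f integrable_mult_right)
    finally show ?thesis
      unfolding S_def e_def[symmetric]
      by (simp add: T1.smooth_density_integral[OF e f(4)] T2.smooth_density_integral[OF e f(4)])
  qed
  then show ?thesis
    by (intro LIMSEQ_le[OF lim(1) tendsto_add[OF lim(2) tendsto_const]]) auto
qed

text \<open>Continuous functions decreasing to an indicator give compact sets. Inner regularity then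
  gives Borel sets; only \<open>T1\<close> has to be approximated from inside, since the right-hand
  side is monotone in the set and finite.\<close>

theorem cf_compare:
  fixes T1 T2 T3 :: "'a::euclidean_space measure"
  assumes T: "borel_finite_measure T1" "borel_finite_measure T2" "borel_finite_measure T3"
    and int: "integrable lborel (\<lambda>\<xi>. cf T1 \<xi> + cf T3 \<xi> - cf T2 \<xi>)"
    and D: "(\<integral>\<xi>. norm (cf T1 \<xi> + cf T3 \<xi> - cf T2 \<xi>) \<partial>lborel) \<le> D"
    and A: "A \<in> sets borel" "emeasure lborel A < \<infinity>"
  shows "measure T1 A \<le> measure T2 A + D / (gauss_norm TYPE('a))\<^sup>2 * measure lborel A"
proof -
  interpret T1: borel_finite_measure T1 by fact
  interpret T2: borel_finite_measure T2 by fact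
  let ?d = "D / (gauss_norm TYPE('a))\<^sup>2"
  have "0 \<le> D"
    using D by (rule order.trans[rotated]) simp
  then have d: "0 \<le> ?d"
    by simp
  have le_compact: "measure T1 K \<le> measure T2 K + ?d * measure lborel K" if K: "compact K" "K \<noteq> {}" for K
  proof -
    \<comment> \<open>From index 1 on, \<open>f n\<close> vanishes at distance 1 from
      \<open>K\<close>, so a fixed ball provides the integrable bound. The function
      \<open>f 0\<close> is constantly 1, hence the \<open>Suc n\<close> below.\<close>
    define f where "f n x = max 0 (1 - real n * infdist x K)" for n x
    have cl: "closed K"
      using K compact_imp_closed by blast
    have cont: "continuous_on UNIV (f n)" for n
      unfolding f_def by (intro continuous_intros continuous_on_infdist continuous_on_id)
    then have [measurable]: "f n \<in> borel_measurable borel" for n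
      by (rule borel_measurable_continuous_onI)
    obtain r where r: "\<And>x. x \<in> K \<Longrightarrow> norm x \<le> r"
      using compact_imp_bounded[OF K(1)] unfolding bounded_iff by blast
    have K_sets [measurable]: "K \<in> sets borel"
      by (rule borel_closed[OF cl])
    have supp: "f (Suc n) x \<le> indicator (cball 0 (r + 1)) x" for n x
    proof (cases "x \<in> cball 0 (r + 1)")
      case True
      then show ?thesis
        using infdist_nonneg[of x K] by (auto simp: f_def)
    next
      case False
      obtain a where a: "a \<in> K" "infdist x K = dist x a"
        using infdist_attains_inf[OF cl K(2)] by metis
      have "norm x \<le> dist x a + norm a"
        by (metis dist_norm norm_triangle_sub add.commute)
      then have "1 \<le> infdist x K"
        using False r[OF a(1)] a by simp
      then have "1 * 1 \<le> real (Suc n) * infdist x K"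
        by (intro mult_mono) auto
      then show ?thesis
        using False by (simp add: f_def)
    qed
    have lim: "(\<lambda>n. f (Suc n) x) \<longlonglongrightarrow> indicator K x" for x
    proof (cases "x \<in> K")
      case True
      then show ?thesis
        by (simp add: f_def)
    next
      case False
      then have "0 < infdist x K"
        using infdist_nonneg[of x K] in_closed_iff_infdist_zero[OF cl K(2), of x] by simp
      then obtain N where N: "1 < real N * infdist x K"
        using reals_Archimedean3 by blast
      have "f (Suc n) x = 0" if "N \<le> n" for n
      proof -
        have "real N * infdist x K \<le> real (Suc n) * infdist x K"
          using that by (intro mult_right_mono infdist_nonneg) auto
        then show ?thesis
          using N by (simp add: f_def)
      qed
      then have "eventually (\<lambda>n. f (Suc n) x = 0) sequentially"
        by (auto simp: eventually_sequentially)
      then show ?thesis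
        using False by (simp add: tendsto_eventually)
    qed
    have lborel_ind: "integrable lborel (indicator (cball 0 (r + 1)) :: 'a \<Rightarrow> real)"
      using emeasure_lborel_cball_finite[of 0 "r+1"] by (simp add: integrable_indicator_iff top.not_eq_extremum)
    have f01: "0 \<le> f n x" "f n x \<le> 1" for n x
      using infdist_nonneg[of x K] by (auto simp: f_def)
    have fint: "integrable lborel (f (Suc n))" for n
      by (rule Bochner_Integration.integrable_bound[OF lborel_ind]) (use supp f01 in auto)
    have l1: "(\<lambda>n. \<integral>x. f (Suc n) x \<partial>T1) \<longlonglongrightarrow> (\<integral>x. indicator K x \<partial>T1)"
      by (rule integral_dominated_convergence[where w="\<lambda>_. 1"]) (use lim f01 in auto)
    have l2: "(\<lambda>n. \<integral>x. f (Suc n) x \<partial>T2) \<longlonglongrightarrow> (\<integral>x. indicator K x \<partial>T2)"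
      by (rule integral_dominated_convergence[where w="\<lambda>_. 1"]) (use lim f01 in auto)
    have l3: "(\<lambda>n. \<integral>x. f (Suc n) x \<partial>lborel) \<longlonglongrightarrow> (\<integral>x. indicator K x \<partial>lborel)"
      by (rule integral_dominated_convergence[OF _ _ lborel_ind]) (use lim f01 supp in auto)
    have le: "(\<integral>x. f (Suc n) x \<partial>T1) \<le> (\<integral>x. f (Suc n) x \<partial>T2) + ?d * (\<integral>x. f (Suc n) x \<partial>lborel)" for n
      by (rule cf_compare_continuous[OF T int D cont f01(1) f01(2) fint])
    have "(\<integral>x. indicator K x \<partial>T1) \<le> (\<integral>x. indicator K x \<partial>T2) + ?d * (\<integral>x. indicator K x \<partial>lborel)"
      by (rule LIMSEQ_le[OF l1 tendsto_add[OF l2 tendsto_mult[OF tendsto_const l3]]]) (use le in blast)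
    then show ?thesis
      by simp
  qed
  have "measure T1 A \<le> measure T2 A + ?d * measure lborel A + e" if e: "0 < e" for e
  proof (rule ccontr)
    assume contr: "\<not> ?thesis"
    define c where "c = measure T2 A + ?d * measure lborel A"
    have "c + e < measure T1 A" "0 \<le> c"
      using contr mult_nonneg_nonneg[OF d measure_nonneg[of lborel A]] measure_nonneg[of T2 A] by (auto simp: c_def)
    then have "ennreal (c + e) < emeasure T1 A"
      using e by (simp add: T1.emeasure_eq_measure ennreal_less_iff del: ennreal_plus)
    also have "emeasure T1 A = (SUP K \<in> {K. K \<subseteq> A \<and> compact K}. emeasure T1 K)"
      using A by (intro inner_regular) (auto simp: T1.emeasure_eq_measure)
    finally obtain K where K: "K \<subseteq> A" "compact K" "ennreal (c + e) < emeasure T1 K"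
      by (auto simp: less_SUP_iff)
    have KK: "c + e < measure T1 K"
      using K(3) e \<open>0 \<le> c\<close> by (simp add: T1.emeasure_eq_measure ennreal_less_iff del: ennreal_plus)
    then have "K \<noteq> {}"
      using e \<open>0 \<le> c\<close> by auto
    have "measure T1 K \<le> measure T2 K + ?d * measure lborel K"
      by (rule le_compact) fact+
    also have "\<dots> \<le> c"
      unfolding c_def using A K d
      by (intro add_mono mult_left_mono T2.finite_measure_mono measure_mono_fmeasurable)
        (auto simp: fmeasurable_def compact_imp_closed)
    finally show False
      using KK e by simp
  qed
  then show ?thesis
    by (rule field_le_epsilon)
qed

text \<open>Half of Plancherel, with Fatou for the limit: the integral of \<open>|cf T|^2\<close>
  against the weight \<open>gauss (e *\<^sub>R \<xi>)\<close> is \<open>gauss_norm\<close> times the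
  integral of the smoothed density with respect to \<open>T\<close>, and a density bounded by
  \<open>K\<close> stays bounded by \<open>K\<close> after smoothing.\<close>

lemma cf_L2_bound:
  fixes g :: "'a::euclidean_space \<Rightarrow> real"
  assumes g [measurable]: "g \<in> borel_measurable borel" and g0: "\<And>x. 0 \<le> g x" and gK: "\<And>x. g x \<le> K"
    and T: "T = density lborel g" and fin: "borel_finite_measure T"
  shows "integrable lborel (\<lambda>\<xi>. (norm (cf T \<xi>))\<^sup>2)"
proof -
  interpret T: borel_finite_measure T by fact
  interpret pair_sigma_finite T "lborel :: 'a measure" ..
  let ?g = "gauss_norm TYPE('a)"
  have g_pos: "0 < ?g"
    by simp
  have K0: "0 \<le> K"
    using g0[of 0] gK[of 0] by simp
  have sd: "T.smooth_density e y \<le> K" "0 \<le> T.smooth_density e y" if e: "0 < e" for e y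
  proof -
    have gi: "integrable lborel (\<lambda>x. gauss ((x - y) /\<^sub>R e) / e ^ DIM('a))"
    proof -
      have "integrable lborel (\<lambda>x. gauss ((- y /\<^sub>R e) + inverse e *\<^sub>R x))"
        using e by (intro lborel_integrable_scaleR integrable_gauss) auto
      moreover have "(- y /\<^sub>R e) + inverse e *\<^sub>R x = (x - y) /\<^sub>R e" for x
        by (simp add: scaleR_diff_right)
      ultimately show ?thesis
        by (intro integrable_divide_zero) (auto simp only:)
    qed
    have "(\<integral>x. gauss ((x - y) /\<^sub>R e) / e ^ DIM('a) \<partial>lborel)
        = \<bar>e\<bar> ^ DIM('a) *\<^sub>R (\<integral>x. gauss ((y + e *\<^sub>R x - y) /\<^sub>R e) / e ^ DIM('a) \<partial>lborel)"
      using e by (intro lborel_integral_scaleR[of e "\<lambda>x. gauss ((x - y) /\<^sub>R e) / e ^ DIM('a)" y]) auto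
    then have i1: "(\<integral>x. gauss ((x - y) /\<^sub>R e) / e ^ DIM('a) \<partial>lborel) = 1"
      using e by (simp add: integral_gauss) (metis less_irrefl zero_less_power)
    have "T.smooth_density e y = (\<integral>x. g x *\<^sub>R (gauss ((x - y) /\<^sub>R e) / e ^ DIM('a)) \<partial>lborel)"
      unfolding T.smooth_density_def unfolding T using g0 by (intro integral_density) auto
    also have "\<dots> \<le> (\<integral>x. K * (gauss ((x - y) /\<^sub>R e) / e ^ DIM('a)) \<partial>lborel)"
      using e gK K0 by (intro integral_mono' integrable_mult_right gi) (auto intro!: mult_right_mono divide_right_mono)
    finally show "T.smooth_density e y \<le> K"
      by (simp only: integral_mult_right_zero i1 mult_1_right)
    show "0 \<le> T.smooth_density e y"
      unfolding T.smooth_density_def using e by (intro Bochner_Integration.integral_nonneg) auto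
  qed
  define M where "M = ?g * (K * measure T UNIV)"
  have damped: "integrable lborel (\<lambda>\<xi>. gauss (e *\<^sub>R \<xi>) * (norm (cf T \<xi>))\<^sup>2)"
    "(\<integral>\<xi>. gauss (e *\<^sub>R \<xi>) * (norm (cf T \<xi>))\<^sup>2 \<partial>lborel) \<le> M" if e: "0 < e" for e
  proof -
    have gi: "integrable lborel (\<lambda>\<xi>::'a. gauss (e *\<^sub>R \<xi>))"
      using lborel_integrable_scaleR[of e "gauss :: 'a \<Rightarrow> real" 0] integrable_gauss e by simp
    have int: "integrable (T \<Otimes>\<^sub>M lborel) (\<lambda>(y, \<xi>). of_real (gauss (e *\<^sub>R \<xi>)) * (cis (- (\<xi> \<bullet> y)) * cf T \<xi>))"
    proof (rule integrable_pair_bound[OF T.finite_measure_axioms])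
      show "integrable lborel (\<lambda>\<xi>::'a. gauss (e *\<^sub>R \<xi>) * measure T UNIV)"
        using gi by (rule integrable_mult_left)
    qed (auto simp: norm_mult intro!: mult_left_mono T.norm_cf_le lborel.sigma_finite_measure_axioms)
    have inner: "(\<integral>y. of_real (gauss (e *\<^sub>R \<xi>)) * (cis (- (\<xi> \<bullet> y)) * cf T \<xi>) \<partial>T)
        = complex_of_real (gauss (e *\<^sub>R \<xi>) * (norm (cf T \<xi>))\<^sup>2)" for \<xi>
    proof -
      have "(\<integral>y. cis (- (\<xi> \<bullet> y)) \<partial>T) = cnj (cf T \<xi>)"
        unfolding cf_def by (subst Bochner_Integration.integral_cnj[symmetric]) (simp add: cis_cnj)
      moreover have "(\<integral>y. of_real (gauss (e *\<^sub>R \<xi>)) * (cis (- (\<xi> \<bullet> y)) * cf T \<xi>) \<partial>T)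
          = of_real (gauss (e *\<^sub>R \<xi>)) * ((\<integral>y. cis (- (\<xi> \<bullet> y)) \<partial>T) * cf T \<xi>)"
        by simp
      ultimately show ?thesis
        by (simp only: of_real_mult complex_norm_square mult_ac)
    qed
    have "integrable lborel (\<lambda>\<xi>. complex_of_real (gauss (e *\<^sub>R \<xi>) * (norm (cf T \<xi>))\<^sup>2))"
      using integrable_snd[OF int] by (simp only: inner prod.case)
    then show int2: "integrable lborel (\<lambda>\<xi>. gauss (e *\<^sub>R \<xi>) * (norm (cf T \<xi>))\<^sup>2)"
      by (simp only: complex_of_real_integrable_eq)
    have "complex_of_real (\<integral>y. T.smooth_density e y \<partial>T)
        = (\<integral>y. (\<integral>\<xi>. of_real (gauss (e *\<^sub>R \<xi>)) * (cis (- (\<xi> \<bullet> y)) * cf T \<xi>) \<partial>lborel) \<partial>T) / of_real ?g"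
      unfolding integral_complex_of_real[symmetric] T.smooth_density_fourier(2)[OF e] by simp
    also have "(\<integral>y. (\<integral>\<xi>. of_real (gauss (e *\<^sub>R \<xi>)) * (cis (- (\<xi> \<bullet> y)) * cf T \<xi>) \<partial>lborel) \<partial>T)
        = (\<integral>\<xi>. complex_of_real (gauss (e *\<^sub>R \<xi>) * (norm (cf T \<xi>))\<^sup>2) \<partial>lborel)"
      using Fubini_integral[OF int] by (simp only: inner prod.case)
    finally have "(\<integral>y. T.smooth_density e y \<partial>T) = (\<integral>\<xi>. gauss (e *\<^sub>R \<xi>) * (norm (cf T \<xi>))\<^sup>2 \<partial>lborel) / ?g"
      unfolding integral_complex_of_real of_real_divide[symmetric] of_real_eq_iff .
    moreover have "(\<integral>y. T.smooth_density e y \<partial>T) \<le> (\<integral>y. K \<partial>T)"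
      using sd[OF e] K0 by (intro integral_mono') auto
    ultimately have "(\<integral>\<xi>. gauss (e *\<^sub>R \<xi>) * (norm (cf T \<xi>))\<^sup>2 \<partial>lborel) / ?g \<le> K * measure T UNIV"
      by (simp add: mult.commute)
    then show "(\<integral>\<xi>. gauss (e *\<^sub>R \<xi>) * (norm (cf T \<xi>))\<^sup>2 \<partial>lborel) \<le> M"
      unfolding M_def using g_pos by (simp add: divide_le_eq mult_ac)
  qed
  \<comment> \<open>The weights tend to \<open>gauss 0 = 1 / gauss_norm\<close>, so the limit is
    \<open>|cf T|^2\<close> divided by this constant.\<close>
  define u where "u n \<xi> = ennreal (gauss ((1 / real (Suc n)) *\<^sub>R \<xi>) * (norm (cf T \<xi>))\<^sup>2)" for n \<xi>
  have "(\<integral>\<^sup>+ \<xi>. ennreal ((norm (cf T \<xi>))\<^sup>2 / ?g) \<partial>lborel) = (\<integral>\<^sup>+ \<xi>. liminf (\<lambda>n. u n \<xi>) \<partial>lborel)"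
  proof (rule nn_integral_cong)
    fix \<xi> :: 'a
    have "(\<lambda>n. exp (- (norm ((1 / real (Suc n)) *\<^sub>R \<xi>))\<^sup>2 / 2)) \<longlonglongrightarrow> exp (- (norm (0 *\<^sub>R \<xi>))\<^sup>2 / 2)"
      by (intro tendsto_intros LIMSEQ_Suc[OF lim_1_over_n]) auto
    then have "(\<lambda>n. exp (- (norm ((1 / real (Suc n)) *\<^sub>R \<xi>))\<^sup>2 / 2) / ?g * (norm (cf T \<xi>))\<^sup>2)
        \<longlonglongrightarrow> exp (- (norm (0 *\<^sub>R \<xi>))\<^sup>2 / 2) / ?g * (norm (cf T \<xi>))\<^sup>2"
      using g_pos by (intro tendsto_mult[OF tendsto_divide[OF _ tendsto_const] tendsto_const]) auto
    then have "(\<lambda>n. u n \<xi>) \<longlonglongrightarrow> ennreal ((norm (cf T \<xi>))\<^sup>2 / ?g)"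
      unfolding u_def gauss_eq_norm by (intro tendsto_ennrealI) simp
    then show "ennreal ((norm (cf T \<xi>))\<^sup>2 / ?g) = liminf (\<lambda>n. u n \<xi>)"
      by (rule lim_imp_Liminf[OF sequentially_bot, symmetric])
  qed
  also have "\<dots> \<le> liminf (\<lambda>n. integral\<^sup>N lborel (u n))"
    unfolding u_def by (intro nn_integral_liminf) measurable
  also have "\<dots> \<le> liminf (\<lambda>n. ennreal M)"
  proof (intro Liminf_mono always_eventually allI)
    fix n
    have "integral\<^sup>N lborel (u n) = ennreal (\<integral>\<xi>. gauss ((1 / real (Suc n)) *\<^sub>R \<xi>) * (norm (cf T \<xi>))\<^sup>2 \<partial>lborel)"
      unfolding u_def by (intro nn_integral_eq_integral damped) auto
    also have "\<dots> \<le> ennreal M"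
      by (intro ennreal_leI damped) auto
    finally show "integral\<^sup>N lborel (u n) \<le> ennreal M" .
  qed
  also have "\<dots> < \<infinity>"
    by (simp add: Liminf_const)
  finally have "integrable lborel (\<lambda>\<xi>. (norm (cf T \<xi>))\<^sup>2 / ?g)"
    using g_pos by (intro integrableI_bounded) (auto simp: less_imp_le)
  then have "integrable lborel (\<lambda>\<xi>. ?g * ((norm (cf T \<xi>))\<^sup>2 / ?g))"
    by (rule integrable_mult_right)
  then show ?thesis
    using g_pos by simp
qed

subsection \<open>Integrability of rapidly decaying functions\<close>

text \<open>The product of \<open>1 + (x \<bullet> b)\<^sup>2\<close> over the basis is at most the
  \<open>d\<close>-th power of \<open>1 + |x|^2\<close>, and its inverse is integrable one
  coordinate at a time.\<close>

lemma integrable_poly_decay: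
  fixes F :: "'a::euclidean_space \<Rightarrow> 'b::{banach,second_countable_topology}"
  assumes F: "F \<in> borel_measurable borel"
    and B: "\<And>x. norm (F x) * (1 + (norm x)\<^sup>2) ^ DIM('a) \<le> B"
  shows "integrable lborel F"
proof (rule Bochner_Integration.integrable_bound)
  have 1: "integrable lborel (\<lambda>t::real. inverse (1 + t\<^sup>2))"
    using integrable_inverse_1_plus_square by (simp add: set_integrable_def)
  show "integrable lborel (\<lambda>x::'a. B * (\<Prod>b\<in>Basis. inverse (1 + (x \<bullet> b)\<^sup>2)))"
    by (intro integrable_mult_right lborel_integrable_prod_Basis 1)
  show "F \<in> borel_measurable lborel"
    using F by simp
  show "AE x in lborel. norm (F x) \<le> norm (B * (\<Prod>b\<in>Basis. inverse (1 + (x \<bullet> b)\<^sup>2)))"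
  proof (rule AE_I2)
    fix x :: 'a
    have B0: "0 \<le> B"
      using B[of x] by (smt (verit) mult_nonneg_nonneg norm_ge_zero zero_le_power zero_le_power2)
    have P: "0 < (\<Prod>b\<in>Basis. 1 + (x \<bullet> b)\<^sup>2)"
      by (intro prod_pos) (auto intro: add_pos_nonneg)
    have "(\<Prod>b\<in>Basis. 1 + (x \<bullet> b)\<^sup>2) \<le> (\<Prod>b\<in>(Basis::'a set). 1 + (norm x)\<^sup>2)"
      using Basis_le_norm[of _ x] by (intro prod_mono) (auto simp: abs_le_square_iff[of _ "norm x", symmetric])
    also have "\<dots> = (1 + (norm x)\<^sup>2) ^ DIM('a)"
      by simp
    finally have "norm (F x) * (\<Prod>b\<in>Basis. 1 + (x \<bullet> b)\<^sup>2) \<le> B"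
      by (intro order.trans[OF mult_left_mono B]) auto
    then have "norm (F x) \<le> B / (\<Prod>b\<in>Basis. 1 + (x \<bullet> b)\<^sup>2)"
      using P by (simp add: pos_le_divide_eq)
    then show "norm (F x) \<le> norm (B * (\<Prod>b\<in>Basis. inverse (1 + (x \<bullet> b)\<^sup>2)))"
      using B0 P by (simp add: prod_inversef[symmetric] comp_def divide_inverse abs_mult prod_nonneg less_imp_le abs_of_pos)
  qed
qed

lemma poly_exp_bound:
  assumes "0 < c" "0 < \<alpha>"
  obtains B where "\<And>x::real. 0 \<le> x \<Longrightarrow> (1 + x\<^sup>2) ^ n * exp (- c * x powr \<alpha>) \<le> B"
proof -
  \<comment> \<open>The \<open>k\<close>-th term of the exponential series in
    \<open>c * x powr \<alpha>\<close> has degree \<open>k * \<alpha>\<close>, enough to dominate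
    \<open>x ^ (2 * n)\<close> for \<open>x > 1\<close>.\<close>
  obtain k :: nat where k: "2 * real n \<le> real k * \<alpha>"
    using reals_Archimedean3[OF \<open>0 < \<alpha>\<close>] less_imp_le by blast
  define B where "B = 2 ^ n * (1 + fact k / c ^ k)"
  have "(1 + x\<^sup>2) ^ n * exp (- c * x powr \<alpha>) \<le> B" if x: "0 \<le> x" for x
  proof (cases "x \<le> 1")
    case True
    have "(1 + x\<^sup>2) ^ n * exp (- c * x powr \<alpha>) \<le> 2 ^ n * 1"
      using x True assms by (intro mult_mono power_mono) (auto simp: power_le_one)
    also have "\<dots> \<le> B"
      using assms by (simp add: B_def)
    finally show ?thesis .
  next
    case False
    then have x1: "1 < x"
      by simp
    have "(1 + x\<^sup>2) ^ n \<le> (2 * x\<^sup>2) ^ n"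
      using x1 by (intro power_mono) (auto simp: one_le_power)
    also have "\<dots> = 2 ^ n * x powr (2 * real n)"
      using x1 powr_realpow[of x "2 * n"] by (simp add: power_mult_distrib power_mult)
    also have "\<dots> \<le> 2 ^ n * x powr (real k * \<alpha>)"
      using x1 k by (intro mult_left_mono powr_mono) auto
    also have "x powr (real k * \<alpha>) = (x powr \<alpha>) ^ k"
      using x1 powr_realpow[of "x powr \<alpha>" k] by (simp add: powr_powr mult.commute)
    finally have 1: "(1 + x\<^sup>2) ^ n \<le> 2 ^ n * (x powr \<alpha>) ^ k" .
    have "(c * x powr \<alpha>) ^ k / fact k \<le> exp (c * x powr \<alpha>)"
    proof -
      have "(\<Sum>i\<in>{k}. (c * x powr \<alpha>) ^ i /\<^sub>R fact i) \<le> (\<Sum>i. (c * x powr \<alpha>) ^ i /\<^sub>R fact i)"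
        using assms by (intro sum_le_suminf summable_exp_generic) auto
      then show ?thesis
        by (simp add: exp_def divide_inverse mult.commute)
    qed
    then have "(x powr \<alpha>) ^ k \<le> fact k / c ^ k * exp (c * x powr \<alpha>)"
      using assms by (simp add: power_mult_distrib field_simps)
    then have "(1 + x\<^sup>2) ^ n \<le> 2 ^ n * (fact k / c ^ k * exp (c * x powr \<alpha>))"
      using 1 by (meson mult_left_mono order.trans zero_le_numeral zero_le_power)
    then have "(1 + x\<^sup>2) ^ n * exp (- c * x powr \<alpha>) \<le> 2 ^ n * (fact k / c ^ k * exp (c * x powr \<alpha>)) * exp (- c * x powr \<alpha>)"
      by (rule mult_right_mono) simp
    also have "\<dots> = 2 ^ n * (fact k / c ^ k)"
      by (simp add: exp_minus field_simps)
    also have "\<dots> \<le> B"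
      by (simp add: B_def algebra_simps)
    finally show ?thesis .
  qed
  then show ?thesis
    by (rule that)
qed

lemma integrable_poly_exp:
  fixes F :: "'a::euclidean_space \<Rightarrow> 'b::{banach,second_countable_topology}"
  assumes "0 < c" "0 < \<alpha>" and F: "F \<in> borel_measurable borel"
    and b: "\<And>x. norm (F x) \<le> C * (1 + (norm x)\<^sup>2) ^ k * exp (- c * norm x powr \<alpha>)"
  shows "integrable lborel F"
proof -
  obtain B where B: "\<And>x::real. 0 \<le> x \<Longrightarrow> (1 + x\<^sup>2) ^ (k + DIM('a)) * exp (- c * x powr \<alpha>) \<le> B"
    using poly_exp_bound[OF assms(1,2)] by blast
  have "0 \<le> C * (1 + (norm (0::'a))\<^sup>2) ^ k * exp (- c * norm (0::'a) powr \<alpha>)"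
    using b[of 0] norm_ge_zero order.trans by blast
  then have C: "0 \<le> C"
    by (simp add: zero_le_mult_iff)
  show ?thesis
  proof (rule integrable_poly_decay[OF F])
    fix x
    have "norm (F x) * (1 + (norm x)\<^sup>2) ^ DIM('a)
        \<le> C * (1 + (norm x)\<^sup>2) ^ k * exp (- c * norm x powr \<alpha>) * (1 + (norm x)\<^sup>2) ^ DIM('a)"
      by (intro mult_right_mono b) auto
    also have "\<dots> = C * ((1 + (norm x)\<^sup>2) ^ (k + DIM('a)) * exp (- c * norm x powr \<alpha>))"
      by (simp add: power_add mult_ac)
    also have "\<dots> \<le> C * B"
      using C by (intro mult_left_mono B) auto
    finally show "norm (F x) * (1 + (norm x)\<^sup>2) ^ DIM('a) \<le> C * B" .
  qed
qed

lemma integrable_gauss_power2: "integrable lborel (\<lambda>x::'a::euclidean_space. gauss x * (1 + (norm x)\<^sup>2))"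
proof (rule integrable_poly_exp[of "1/2" 2])
  show "norm (gauss x * (1 + (norm x)\<^sup>2))
      \<le> 1 / gauss_norm TYPE('a) * (1 + (norm x)\<^sup>2) ^ 1 * exp (- (1/2) * norm x powr 2)" for x :: 'a
    by (cases "x = 0") (auto simp: gauss_eq gauss_norm_def powr_numeral abs_mult mult.commute)
qed auto

subsection \<open>Tails of a distribution\<close>

text \<open>A Gaussian version of the truncation inequality. Averaging
  \<open>1 - Re (cf T (\<xi> /\<^sub>R R))\<close> over a standard Gaussian \<open>\<xi>\<close>
  gives the integral of \<open>1 - exp (- |x / R|^2 / 2)\<close> with respect to \<open>T\<close>,
  which is bounded below where \<open>|x| > R\<close>; homogeneity of the hypothesis produces the
  power of \<open>R\<close>.\<close>

lemma cf_tail: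
  fixes T :: "'a::euclidean_space measure"
  assumes fin: "borel_finite_measure T" and mass: "measure T UNIV = 1"
    and \<alpha>: "0 < \<alpha>" "\<alpha> \<le> 2"
    and C: "\<And>\<xi>. 1 - Re (cf T \<xi>) \<le> C * norm \<xi> powr \<alpha>"
  obtains C' where "\<And>R. 0 < R \<Longrightarrow> measure T {x. R < norm x} \<le> C' * R powr (- \<alpha>)"
proof -
  interpret borel_finite_measure T by fact
  interpret pair_sigma_finite T "lborel :: 'a measure" ..
  have mC: "1 - Re (cf T \<xi>) \<le> \<bar>C\<bar> * norm \<xi> powr \<alpha>" for \<xi>
    by (rule order.trans[OF C]) (simp add: mult_right_mono)
  \<comment> \<open>With \<alpha> at most 2, the second moment of the Gaussian controls the average
    of |\<xi>|^\<alpha>.\<close>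
  have pw: "norm (\<xi>::'a) powr \<alpha> \<le> 1 + (norm \<xi>)\<^sup>2" for \<xi>
  proof (cases "norm \<xi> \<le> 1")
    case True
    then have "norm \<xi> powr \<alpha> \<le> 1"
      using \<alpha> by (simp add: powr_le1)
    then show ?thesis
      by (rule order.trans) simp
  next
    case False
    then have "norm \<xi> powr \<alpha> \<le> norm \<xi> powr 2"
      using \<alpha> by (intro powr_mono) auto
    also have "norm \<xi> powr 2 = (norm \<xi>)\<^sup>2"
      using False powr_numeral[of "norm \<xi>" "num.Bit0 num.One"] by simp
    finally show ?thesis
      by simp
  qed
  define J where "J = (\<integral>\<xi>. gauss (\<xi>::'a) * (1 + (norm \<xi>)\<^sup>2) \<partial>lborel)"
  \<comment> \<open>The value of \<open>1 - exp (- t^2 / 2)\<close> at \<open>t = 1\<close>, its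
    minimum over \<open>t \<ge> 1\<close>.\<close>
  define c where "c = 1 - exp (- 1 / 2 :: real)"
  have c: "0 < c"
    by (simp add: c_def)
  have "measure T {x. R < norm x} \<le> \<bar>C\<bar> * J / c * R powr (- \<alpha>)" if R: "0 < R" for R
  proof -
    have int: "integrable (T \<Otimes>\<^sub>M lborel) (\<lambda>(x, \<xi>). of_real (gauss \<xi>) * cis ((\<xi> /\<^sub>R R) \<bullet> x) :: complex)"
      by (rule integrable_pair_bound[OF finite_measure_axioms _ integrable_gauss])
        (auto simp: norm_mult intro: lborel.sigma_finite_measure_axioms)
    have "(\<integral>x. complex_of_real (exp (- (norm (x /\<^sub>R R))\<^sup>2 / 2)) \<partial>T)
        = (\<integral>x. (\<integral>\<xi>. of_real (gauss \<xi>) * cis ((x /\<^sub>R R) \<bullet> \<xi>) \<partial>lborel) \<partial>T)"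
      by (simp only: gauss_fourier)
    also have "\<dots> = (\<integral>x. (\<integral>\<xi>. of_real (gauss \<xi>) * cis ((\<xi> /\<^sub>R R) \<bullet> x) \<partial>lborel) \<partial>T)"
      by (simp add: inner_commute)
    also have "\<dots> = (\<integral>\<xi>. (\<integral>x. of_real (gauss \<xi>) * cis ((\<xi> /\<^sub>R R) \<bullet> x) \<partial>T) \<partial>lborel)"
      using Fubini_integral[OF int] by (simp only: prod.case)
    also have "\<dots> = (\<integral>\<xi>. of_real (gauss \<xi>) * cf T (\<xi> /\<^sub>R R) \<partial>lborel)"
      by (simp only: cf_def integral_mult_right_zero)
    finally have eq: "complex_of_real (\<integral>x. exp (- (norm (x /\<^sub>R R))\<^sup>2 / 2) \<partial>T) = \<dots>"
      by (simp only: integral_complex_of_real)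
    have int2: "integrable lborel (\<lambda>\<xi>. of_real (gauss \<xi>) * cf T (\<xi> /\<^sub>R R))"
      by (rule Bochner_Integration.integrable_bound[OF integrable_gauss])
        (use norm_cf_le mass in \<open>auto simp: norm_mult intro!: mult_left_le\<close>)
    have int3: "integrable lborel (\<lambda>\<xi>. gauss \<xi> * Re (cf T (\<xi> /\<^sub>R R)))"
      using integrable_Re[OF int2] by simp
    have "(\<integral>x. exp (- (norm (x /\<^sub>R R))\<^sup>2 / 2) \<partial>T) = Re (\<integral>\<xi>. of_real (gauss \<xi>) * cf T (\<xi> /\<^sub>R R) \<partial>lborel)"
      using arg_cong[OF eq, of Re] by simp
    also have "\<dots> = (\<integral>\<xi>. gauss \<xi> * Re (cf T (\<xi> /\<^sub>R R)) \<partial>lborel)"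
      using integral_Re[OF int2] by simp
    finally have "1 - (\<integral>x. exp (- (norm (x /\<^sub>R R))\<^sup>2 / 2) \<partial>T)
        = (\<integral>\<xi>. gauss \<xi> - gauss \<xi> * Re (cf T (\<xi> /\<^sub>R R)) \<partial>lborel)"
      using int3 by (simp add: integrable_gauss integral_gauss)
    also have "\<dots> \<le> (\<integral>\<xi>. \<bar>C\<bar> * R powr (- \<alpha>) * (gauss \<xi> * (1 + (norm (\<xi>::'a))\<^sup>2)) \<partial>lborel)"
    proof (rule integral_mono)
      fix \<xi> :: 'a
      have "gauss \<xi> * (1 - Re (cf T (\<xi> /\<^sub>R R))) \<le> gauss \<xi> * (\<bar>C\<bar> * (R powr (- \<alpha>) * (1 + (norm \<xi>)\<^sup>2)))"
      proof (intro mult_left_mono order.trans[OF mC])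
        have "norm (\<xi> /\<^sub>R R) powr \<alpha> = R powr (- \<alpha>) * norm \<xi> powr \<alpha>"
          using R by (simp add: powr_mult powr_minus inverse_powr abs_of_pos)
        also have "\<dots> \<le> R powr (- \<alpha>) * (1 + (norm \<xi>)\<^sup>2)"
          by (intro mult_left_mono pw) auto
        finally show "norm (\<xi> /\<^sub>R R) powr \<alpha> \<le> R powr (- \<alpha>) * (1 + (norm \<xi>)\<^sup>2)" .
      qed auto
      then show "gauss \<xi> - gauss \<xi> * Re (cf T (\<xi> /\<^sub>R R)) \<le> \<bar>C\<bar> * R powr (- \<alpha>) * (gauss \<xi> * (1 + (norm \<xi>)\<^sup>2))"
        by (simp add: algebra_simps)
    qed (intro Bochner_Integration.integrable_diff integrable_gauss int3 integrable_mult_right integrable_gauss_power2)+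
    also have "\<dots> = \<bar>C\<bar> * R powr (- \<alpha>) * J"
      by (simp add: J_def)
    finally have up: "1 - (\<integral>x. exp (- (norm (x /\<^sub>R R))\<^sup>2 / 2) \<partial>T) \<le> \<bar>C\<bar> * R powr (- \<alpha>) * J" .
    have inte: "integrable T (\<lambda>x. exp (- (norm (x /\<^sub>R R))\<^sup>2 / 2))"
      by (rule integrable_const_bound[where B=1]) auto
    have "c * measure T {x. R < norm x} = (\<integral>x. c * indicator {x. R < norm x} x \<partial>T)"
      by simp
    also have "\<dots> \<le> (\<integral>x. 1 - exp (- (norm (x /\<^sub>R R))\<^sup>2 / 2) \<partial>T)"
    proof (rule integral_mono)
      fix x
      show "c * indicator {x. R < norm x} x \<le> 1 - exp (- (norm (x /\<^sub>R R))\<^sup>2 / 2)"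
      proof (cases "R < norm x")
        case True
        then have "1 \<le> norm (x /\<^sub>R R)"
          using R by (simp add: divide_simps)
        then have "1 \<le> (norm (x /\<^sub>R R))\<^sup>2"
          by (simp only: one_le_power)
        then show ?thesis
          using True by (simp add: c_def del: norm_scaleR)
      qed simp
    next
      show "integrable T (\<lambda>x. c * indicator {x. R < norm x} x)"
        by (rule integrable_const_bound[where B=c]) (use c in \<open>auto simp: indicator_def\<close>)
      show "integrable T (\<lambda>x. 1 - exp (- (norm (x /\<^sub>R R))\<^sup>2 / 2))"
        by (rule Bochner_Integration.integrable_diff[OF integrable_const inte])
    qed
    also have "\<dots> = 1 - (\<integral>x. exp (- (norm (x /\<^sub>R R))\<^sup>2 / 2) \<partial>T)"
      using inte mass by simp
    finally have "c * measure T {x. R < norm x} \<le> \<bar>C\<bar> * R powr (- \<alpha>) * J"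
      using up by simp
    then show ?thesis
      using c by (simp add: pos_le_divide_eq mult_ac)
  qed
  then show ?thesis
    by (rule that)
qed

subsection \<open>Characteristic functions of finite measures\<close>

text \<open>Closure of this class under products, powers and rescaling lets a measure be specified
  by a formula for its characteristic function. The measure need not be normalized; its mass is
  \<open>\<eta> 0\<close>.\<close>

definition is_cf :: "('a::euclidean_space \<Rightarrow> complex) \<Rightarrow> bool"
  where "is_cf \<eta> \<longleftrightarrow> (\<exists>T. borel_finite_measure T \<and> cf T = \<eta>)"

lemma borel_finite_measure_distr:
  assumes "finite_measure M" "f \<in> measurable M borel"
  shows "borel_finite_measure (distr M borel f)"
  using assms by (auto simp: borel_finite_measure_def borel_finite_measure_axioms_def
      intro!: finite_measure.finite_measure_distr)

lemma cf_distr: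
  assumes "f \<in> measurable M borel"
  shows "cf (distr M borel f) \<xi> = (\<integral>x. cis (\<xi> \<bullet> f x) \<partial>M)"
  unfolding cf_def using assms by (subst integral_distr) auto

lemma cf_convolution:
  fixes S T :: "'a::euclidean_space measure"
  assumes "borel_finite_measure S" "borel_finite_measure T"
  shows "borel_finite_measure (distr (S \<Otimes>\<^sub>M T) borel (\<lambda>(x, y). x + y))"
    and "cf (distr (S \<Otimes>\<^sub>M T) borel (\<lambda>(x, y). x + y)) \<xi> = cf S \<xi> * cf T \<xi>"
proof -
  interpret S: borel_finite_measure S by fact
  interpret T: borel_finite_measure T by fact
  interpret pair_sigma_finite S T ..
  show "borel_finite_measure (distr (S \<Otimes>\<^sub>M T) borel (\<lambda>(x, y). x + y))"
    by (intro borel_finite_measure_distr finite_measure_pair_measure S.finite_measure_axioms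
        T.finite_measure_axioms) auto
  have "integrable (S \<Otimes>\<^sub>M T) (\<lambda>(x, y). cis (\<xi> \<bullet> x) * cis (\<xi> \<bullet> y))"
    by (rule integrable_pair_bound[OF S.finite_measure_axioms _ T.integrable_const[of 1]])
      (auto simp: norm_mult intro: T.sigma_finite_measure_axioms)
  note fst = integral_fst[OF this]
  have "cf (distr (S \<Otimes>\<^sub>M T) borel (\<lambda>(x, y). x + y)) \<xi>
      = (\<integral>z. (case z of (x, y) \<Rightarrow> cis (\<xi> \<bullet> x) * cis (\<xi> \<bullet> y)) \<partial>(S \<Otimes>\<^sub>M T))"
    by (subst cf_distr) (auto simp: inner_add_right cis_mult intro!: Bochner_Integration.integral_cong)
  also have "\<dots> = (\<integral>x. (\<integral>y. cis (\<xi> \<bullet> x) * cis (\<xi> \<bullet> y) \<partial>T) \<partial>S)"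
    using fst by (simp only: prod.case)
  also have "\<dots> = cf S \<xi> * cf T \<xi>"
    by (simp only: integral_mult_right_zero integral_mult_left_zero cf_def)
  finally show "cf (distr (S \<Otimes>\<^sub>M T) borel (\<lambda>(x, y). x + y)) \<xi> = cf S \<xi> * cf T \<xi>" .
qed

lemma is_cf_mult: "is_cf \<eta> \<Longrightarrow> is_cf \<psi> \<Longrightarrow> is_cf (\<lambda>\<xi>. \<eta> \<xi> * \<psi> \<xi>)"
  unfolding is_cf_def by (metis (no_types, lifting) cf_convolution ext)

lemma is_cf_cis: "is_cf (\<lambda>\<xi>. cis (b \<bullet> \<xi>))"
  unfolding is_cf_def
  by (intro exI[of _ "distr (return borel b) borel (\<lambda>x. x)"] conjI borel_finite_measure_distr)
    (auto simp: cf_distr integral_return inner_commute prob_space_return prob_space.finite_measure)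

lemma is_cf_power: "is_cf \<eta> \<Longrightarrow> is_cf (\<lambda>\<xi>. \<eta> \<xi> ^ n)"
  using is_cf_cis[of 0] by (induction n) (auto intro: is_cf_mult)

lemma is_cf_scaleR:
  assumes "is_cf \<eta>"
  shows "is_cf (\<lambda>\<xi>. \<eta> (c *\<^sub>R \<xi>))"
proof -
  obtain T where T: "borel_finite_measure T" "cf T = \<eta>"
    using assms by (auto simp: is_cf_def)
  then interpret borel_finite_measure T by simp
  have "cf (distr T borel (\<lambda>x. c *\<^sub>R x)) = (\<lambda>\<xi>. \<eta> (c *\<^sub>R \<xi>))"
    unfolding T(2)[symmetric] by (intro ext, subst cf_distr) (auto simp: cf_def)
  moreover have "borel_finite_measure (distr T borel (\<lambda>x. c *\<^sub>R x))"
    by (intro borel_finite_measure_distr finite_measure_axioms) auto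
  ultimately show ?thesis
    unfolding is_cf_def by blast
qed

text \<open>\<open>S\<close> is the image under addition of the product measure restricted to the
  complement of \<open>Q \<times> Q\<close>. The difference of the two convolution squares is
  thereby a positive measure and not merely a signed one.\<close>

lemma is_cf_diff_square:
  assumes T: "borel_finite_measure T" and Q: "Q \<in> sets borel"
  obtains S where "borel_finite_measure S"
    "\<And>\<xi>. cf S \<xi> = (cf T \<xi>)\<^sup>2 - (cf (density T (indicator Q)) \<xi>)\<^sup>2"
    "measure S UNIV = (measure T UNIV)\<^sup>2 - (measure T Q)\<^sup>2"
proof -
  interpret borel_finite_measure T by fact
  interpret pair_sigma_finite T T ..
  interpret TT: finite_measure "T \<Otimes>\<^sub>M T"
    by (intro finite_measure_pair_measure finite_measure_axioms)
  have [measurable]: "Q \<in> sets T"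
    using Q by simp
  define w :: "'a \<times> 'a \<Rightarrow> real" where "w = (\<lambda>(x, y). 1 - indicator Q x * indicator Q y)"
  define S where "S = distr (density (T \<Otimes>\<^sub>M T) (\<lambda>z. ennreal (w z))) borel (\<lambda>(x, y). x + y)"
  have w01: "0 \<le> w z" "w z \<le> 1" for z
    by (auto simp: w_def indicator_def split: prod.split)
  have [measurable]: "w \<in> borel_measurable (T \<Otimes>\<^sub>M T)"
    unfolding w_def by measurable
  have "finite_measure (density (T \<Otimes>\<^sub>M T) (\<lambda>z. ennreal (w z)))"
  proof
    have "emeasure (density (T \<Otimes>\<^sub>M T) (\<lambda>z. ennreal (w z))) (space (T \<Otimes>\<^sub>M T)) \<le> (\<integral>\<^sup>+z. 1 \<partial>(T \<Otimes>\<^sub>M T))"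
    proof (subst emeasure_density)
      have "ennreal (w z) \<le> 1" for z
        using ennreal_leI[OF w01(2)] by simp
      then show "(\<integral>\<^sup>+z. ennreal (w z) * indicator (space (T \<Otimes>\<^sub>M T)) z \<partial>(T \<Otimes>\<^sub>M T)) \<le> (\<integral>\<^sup>+z. 1 \<partial>(T \<Otimes>\<^sub>M T))"
        by (intro nn_integral_mono) (auto split: split_indicator)
      show "space (T \<Otimes>\<^sub>M T) \<in> sets (T \<Otimes>\<^sub>M T)"
        by (rule sets.top)
    qed measurable
    also have "\<dots> < \<infinity>"
      by (simp add: top.not_eq_extremum[symmetric])
    finally show "emeasure (density (T \<Otimes>\<^sub>M T) (\<lambda>z. ennreal (w z))) (space (density (T \<Otimes>\<^sub>M T) (\<lambda>z. ennreal (w z)))) \<noteq> \<infinity>"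
      by simp
  qed
  then have S: "borel_finite_measure S"
    unfolding S_def by (intro borel_finite_measure_distr) auto
  have i1: "integrable (T \<Otimes>\<^sub>M T) (\<lambda>(x, y). cis (\<xi> \<bullet> x) * cis (\<xi> \<bullet> y))" for \<xi>
    by (rule TT.integrable_const_bound[where B=1]) (auto simp: norm_mult)
  have i2: "integrable (T \<Otimes>\<^sub>M T) (\<lambda>(x, y). (indicator Q x *\<^sub>R cis (\<xi> \<bullet> x)) * (indicator Q y *\<^sub>R cis (\<xi> \<bullet> y)))" for \<xi>
    by (rule TT.integrable_const_bound[where B=1]) (auto simp: norm_mult indicator_def)
  have cfQ: "cf (density T (indicator Q)) \<xi> = (\<integral>x. indicator Q x *\<^sub>R cis (\<xi> \<bullet> x) \<partial>T)" for \<xi>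
    unfolding cf_def by (subst integral_density[where g="indicator Q", symmetric]) (auto simp: ennreal_indicator)
  have cfS: "cf S \<xi> = (cf T \<xi>)\<^sup>2 - (cf (density T (indicator Q)) \<xi>)\<^sup>2" for \<xi>
  proof -
    have "cf S \<xi> = (\<integral>z. w z *\<^sub>R cis (\<xi> \<bullet> (case z of (x, y) \<Rightarrow> x + y)) \<partial>(T \<Otimes>\<^sub>M T))"
      unfolding S_def using w01 by (subst cf_distr, simp, subst integral_density) auto
    also have "\<dots> = (\<integral>z. (case z of (x, y) \<Rightarrow> cis (\<xi> \<bullet> x) * cis (\<xi> \<bullet> y))
        - (case z of (x, y) \<Rightarrow> (indicator Q x *\<^sub>R cis (\<xi> \<bullet> x)) * (indicator Q y *\<^sub>R cis (\<xi> \<bullet> y))) \<partial>(T \<Otimes>\<^sub>M T))"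
      by (intro Bochner_Integration.integral_cong)
        (auto simp: w_def inner_add_right cis_mult scaleR_diff_left indicator_def split: prod.splits)
    also have "\<dots> = (cf T \<xi>)\<^sup>2 - (\<integral>x. indicator Q x *\<^sub>R cis (\<xi> \<bullet> x) \<partial>T)\<^sup>2"
    proof (subst Bochner_Integration.integral_diff[OF i1 i2])
      have "(\<integral>z. (case z of (x, y) \<Rightarrow> cis (\<xi> \<bullet> x) * cis (\<xi> \<bullet> y)) \<partial>(T \<Otimes>\<^sub>M T)) = (cf T \<xi>)\<^sup>2"
        using integral_fst[OF i1[of \<xi>]]
        by (simp only: prod.case integral_mult_right_zero integral_mult_left_zero cf_def power2_eq_square)
      moreover have "(\<integral>z. (case z of (x, y) \<Rightarrow> (indicator Q x *\<^sub>R cis (\<xi> \<bullet> x)) * (indicator Q y *\<^sub>R cis (\<xi> \<bullet> y))) \<partial>(T \<Otimes>\<^sub>M T))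
          = (\<integral>x. indicator Q x *\<^sub>R cis (\<xi> \<bullet> x) \<partial>T)\<^sup>2"
        using integral_fst[OF i2[of \<xi>]]
        by (simp only: prod.case integral_mult_right_zero integral_mult_left_zero power2_eq_square)
      ultimately show "(\<integral>z. (case z of (x, y) \<Rightarrow> cis (\<xi> \<bullet> x) * cis (\<xi> \<bullet> y)) \<partial>(T \<Otimes>\<^sub>M T))
          - (\<integral>z. (case z of (x, y) \<Rightarrow> (indicator Q x *\<^sub>R cis (\<xi> \<bullet> x)) * (indicator Q y *\<^sub>R cis (\<xi> \<bullet> y))) \<partial>(T \<Otimes>\<^sub>M T))
        = (cf T \<xi>)\<^sup>2 - (\<integral>x. indicator Q x *\<^sub>R cis (\<xi> \<bullet> x) \<partial>T)\<^sup>2"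
        by simp
    qed
    finally show ?thesis
      by (simp add: cfQ)
  qed
  have "complex_of_real (measure S UNIV) = cf S 0"
    using borel_finite_measure.space_UNIV[OF S] by (simp add: cf_def scaleR_conv_of_real)
  also have "\<dots> = complex_of_real ((measure T UNIV)\<^sup>2 - (measure T Q)\<^sup>2)"
  proof -
    have "(\<integral>x. indicator Q x *\<^sub>R cis (0 \<bullet> x) \<partial>T) = (\<integral>x. complex_of_real (indicator Q x) \<partial>T)"
      by (simp add: scaleR_conv_of_real)
    also have "\<dots> = complex_of_real (measure T Q)"
      unfolding integral_complex_of_real using Q by simp
    finally show ?thesis
      unfolding cfS cfQ by (simp add: cf_def scaleR_conv_of_real)
  qed
  finally show ?thesis
    using that[OF S cfS] by (simp only: of_real_eq_iff)
qed

section \<open>Elementary inequalities for exponentials and powers\<close>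

lemma integral_norm_le:
  fixes f :: "'x \<Rightarrow> 'b::{banach,second_countable_topology}"
  assumes "integrable M f" "integrable M g" "\<And>x. x \<in> space M \<Longrightarrow> norm (f x) \<le> g x"
  shows "norm (\<integral>x. f x \<partial>M) \<le> (\<integral>x. g x \<partial>M)"
  by (rule order.trans[OF integral_norm_bound integral_mono]) (use assms in auto)

text \<open>Inside the unit disc this is Taylor's formula with \<open>exp 1 \<le> 3\<close>.
  Outside, \<open>|exp (- z)| \<le> 1\<close> by the sign of the real part, and
  \<open>2 + |z| \<le> 3 |z|^2\<close>.\<close>

lemma norm_exp_minus_linear:
  fixes z :: complex
  assumes "0 \<le> Re z"
  shows "norm (exp (- z) - 1 + z) \<le> 3 * (norm z)\<^sup>2"
proof (cases "norm z \<le> 1")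
  case True
  have "norm (exp (- z) - (\<Sum>i\<le>1. (- z) ^ i / fact i)) \<le> exp (norm (- z)) * (norm (- z) ^ Suc 1) / fact 1"
    by (rule Taylor_exp_field)
  then have "norm (exp (- z) - 1 + z) \<le> exp (norm z) * (norm z)\<^sup>2"
    by (simp add: numeral_2_eq_2 algebra_simps)
  also have "\<dots> \<le> 3 * (norm z)\<^sup>2"
  proof (rule mult_right_mono)
    have "exp (norm z) \<le> exp 1"
      using True by simp
    then show "exp (norm z) \<le> 3"
      using exp_le by (rule order.trans)
  qed simp
  finally show ?thesis .
next
  case False
  then have z: "1 \<le> norm z" "norm z * 1 \<le> norm z * norm z"
    using mult_left_mono[of 1 "norm z" "norm z"] by auto
  have "norm (exp (- z) - 1 + z) \<le> norm (exp (- z)) + norm (1::complex) + norm z"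
    by (rule order.trans[OF norm_triangle_ineq add_right_mono[OF norm_triangle_ineq4]])
  also have "\<dots> \<le> 2 + norm z"
    using assms by simp
  also have "\<dots> \<le> 3 * (norm z)\<^sup>2"
    using z by (simp add: power2_eq_square)
  finally show ?thesis .
qed

lemma exp_minus_le_half: "exp (- x) \<le> 1 - x / 2" if "0 \<le> x" "x \<le> 1" for x :: real
proof -
  have "1 \<le> (1 - x / 2) * (1 + x)"
    using that mult_left_mono[of x 1 x] by (simp add: algebra_simps)
  also have "\<dots> \<le> (1 - x / 2) * exp x"
    using that by (intro mult_left_mono exp_ge_add_one_self) auto
  finally show ?thesis
    by (simp add: exp_minus field_simps)
qed

text \<open>Rescaling by \<open>r\<close> reduces this to the unit ball. The factor
  \<open>r ^ (n - 1)\<close> retains the decay of the bases, which later makes the error integrable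
  in the Fourier variable.\<close>

lemma norm_power_diff_le:
  fixes a b :: "'a::{real_normed_algebra_1, comm_monoid_mult}"
  assumes a: "norm a \<le> r" and b: "norm b \<le> r" and n: "0 < n"
  shows "norm (a ^ n - b ^ n) \<le> real n * r ^ (n - 1) * norm (a - b)"
proof (cases "r = 0")
  case True
  then show ?thesis
    using a b by simp
next
  case False
  have r: "0 < r"
    using False order.trans[OF norm_ge_zero a] by simp
  have "a ^ n - b ^ n = r ^ n *\<^sub>R ((a /\<^sub>R r) ^ n - (b /\<^sub>R r) ^ n)"
    using r by (simp add: scaleR_power scaleR_diff_right power_inverse)
  then have "norm (a ^ n - b ^ n) = r ^ n * norm ((a /\<^sub>R r) ^ n - (b /\<^sub>R r) ^ n)"
    using r by simp
  also have "\<dots> \<le> r ^ n * (real n * norm (a /\<^sub>R r - b /\<^sub>R r))"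
    using r a b by (intro mult_left_mono norm_power_diff) (auto simp: divide_simps)
  also have "a /\<^sub>R r - b /\<^sub>R r = (a - b) /\<^sub>R r"
    by (simp add: scaleR_diff_right)
  also have "r ^ n * (real n * norm ((a - b) /\<^sub>R r)) = real n * r ^ (n - 1) * norm (a - b)"
  proof -
    have "r ^ n = r * r ^ (n - 1)"
      using n by (metis power_minus_mult mult.commute)
    then show ?thesis
      using r by simp
  qed
  finally show ?thesis .
qed

text \<open>The condition relating \<open>m\<close> and \<open>j\<close> admits both
  \<open>j = m div 2\<close> and \<open>j = m div 2 - 1\<close>, the two exponents that occur when
  summands are paired.\<close>

lemma geometric_poly_bound:
  fixes \<rho> s :: real
  assumes \<rho>: "0 < \<rho>" "\<rho> < 1" and s: "0 \<le> s"
  obtains B where "\<And>m j. 1 \<le> m \<Longrightarrow> real m \<le> 2 * real j + 3 \<Longrightarrow> \<rho> ^ j * real m powr s \<le> B"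
proof -
  define l where "l = - ln \<rho> / 2"
  have l: "0 < l"
    using \<rho> by (simp add: l_def)
  obtain n :: nat where n: "s \<le> real n"
    using real_arch_simple by blast
  obtain B where B: "\<And>x::real. 0 \<le> x \<Longrightarrow> (1 + x\<^sup>2) ^ n * exp (- l * x powr 1) \<le> B"
    using poly_exp_bound[OF l zero_less_one, of n] by blast
  have "\<rho> ^ j * real m powr s \<le> exp (3 * l) * B" if m: "1 \<le> m" "real m \<le> 2 * real j + 3" for m j
  proof -
    have "\<rho> ^ j = exp (real j * ln \<rho>)"
      using \<rho> by (simp add: exp_of_nat_mult)
    also have "real j * ln \<rho> = - (2 * real j) * l"
      by (simp add: l_def)
    also have "exp \<dots> \<le> exp (3 * l - l * real m)"
      using l m(2) mult_right_mono[of "real m - 3" "2 * real j" l] by (simp add: algebra_simps)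
    also have "\<dots> = exp (3 * l) * exp (- l * real m)"
      by (simp add: exp_diff exp_minus divide_inverse)
    finally have 1: "\<rho> ^ j \<le> exp (3 * l) * exp (- l * real m)" .
    have "real m powr s \<le> real m powr real n"
      using m n by (intro powr_mono) auto
    also have "\<dots> = real m ^ n"
      using m by (simp add: powr_realpow)
    also have "\<dots> \<le> (1 + (real m)\<^sup>2) ^ n"
    proof (intro power_mono)
      have "real m * 1 \<le> real m * real m"
        using m by (intro mult_left_mono) auto
      then show "real m \<le> 1 + (real m)\<^sup>2"
        by (simp add: power2_eq_square)
    qed auto
    finally have "\<rho> ^ j * real m powr s \<le> (exp (3 * l) * exp (- l * real m)) * (1 + (real m)\<^sup>2) ^ n"
      using 1 by (intro mult_mono) auto
    also have "\<dots> = exp (3 * l) * ((1 + (real m)\<^sup>2) ^ n * exp (- l * real m powr 1))"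
      using m by (simp add: mult_ac)
    also have "\<dots> \<le> exp (3 * l) * B"
      by (intro mult_left_mono B) auto
    finally show ?thesis .
  qed
  then show ?thesis
    by (rule that)
qed

lemma powr_le_one_plus_square:
  fixes x \<alpha> :: real
  assumes "0 \<le> x" "0 < \<alpha>" "\<alpha> \<le> 2"
  shows "x powr \<alpha> \<le> 1 + x\<^sup>2"
proof (cases "x \<le> 1")
  case True
  then have "x powr \<alpha> \<le> 1"
    using assms by (simp add: powr_le1)
  then show ?thesis
    by (rule order.trans) simp
next
  case False
  then have "x powr \<alpha> \<le> x powr 2"
    using assms by (intro powr_mono) auto
  also have "x powr 2 = x\<^sup>2"
    using False by (simp add: powr_numeral)
  finally show ?thesis
    by simp
qed

section \<open>Rate of convergence for mixtures of stable exponents\<close>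

text \<open>
  The exponents \<open>g u\<close> are averaged over \<open>u\<close> only after exponentiating in the law of a summand, but
  before exponentiating in the limit law; this is the source of the error \<open>1/m\<close>.
\<close>
locale stable_mixture = prob_space \<kappa> for \<kappa> :: "'u measure" +
  fixes g :: "'u \<Rightarrow> 'a::euclidean_space \<Rightarrow> complex" and \<alpha> c C :: real
    and \<mu> \<nu> :: "'a measure" and L :: "nat \<Rightarrow> 'a measure" and b :: "nat \<Rightarrow> 'a"
  assumes \<alpha>: "0 < \<alpha>" "\<alpha> \<le> 2"
    and g_measurable [measurable]: "case_prod g \<in> borel_measurable (\<kappa> \<Otimes>\<^sub>M borel)"
    and Re_scaleR: "\<And>u t \<xi>. u \<in> space \<kappa> \<Longrightarrow> 0 < t \<Longrightarrow> Re (g u (t *\<^sub>R \<xi>)) = t powr \<alpha> * Re (g u \<xi>)"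
    and Re_nonneg: "\<And>u \<xi>. u \<in> space \<kappa> \<Longrightarrow> 0 \<le> Re (g u \<xi>)"
    and C: "0 < C" and c: "0 < c"
    and Re_le: "\<And>u \<xi>. u \<in> space \<kappa> \<Longrightarrow> Re (g u \<xi>) \<le> C * norm \<xi> powr \<alpha>"
    and norm_le: "\<And>u \<xi>. u \<in> space \<kappa> \<Longrightarrow> norm (g u \<xi>) \<le> C * (1 + (norm \<xi>)\<^sup>2)"
    and Im_le: "\<And>u \<xi>. u \<in> space \<kappa> \<Longrightarrow> norm \<xi> \<le> 1 \<Longrightarrow> \<bar>Im (g u \<xi>)\<bar> \<le> C * norm \<xi> powr (\<alpha> / 2)"
    and lower: "\<And>\<xi>. c * norm \<xi> powr \<alpha> \<le> (\<integral>u. Re (g u \<xi>) \<partial>\<kappa>)"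
    and \<mu>: "borel_finite_measure \<mu>" "measure \<mu> UNIV = 1" "absolutely_continuous lborel \<mu>"
    and cf_\<mu>: "\<And>m \<xi>. 1 \<le> m \<Longrightarrow>
      cf \<mu> (real m powr (- 1 / \<alpha>) *\<^sub>R \<xi>) * cis (b m \<bullet> \<xi>) = (\<integral>u. exp (- g u \<xi> / of_nat m) \<partial>\<kappa>)"
    and L: "\<And>m. 1 \<le> m \<Longrightarrow> borel_finite_measure (L m)" "\<And>m. 1 \<le> m \<Longrightarrow> measure (L m) UNIV = 1"
    and cf_L: "\<And>m \<xi>. 1 \<le> m \<Longrightarrow> cf (L m) \<xi> = (\<integral>u. exp (- g u \<xi> / of_nat m) \<partial>\<kappa>) ^ m"
    and \<nu>: "borel_finite_measure \<nu>" "measure \<nu> UNIV = 1"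
    and cf_\<nu>: "\<And>\<xi>. cf \<nu> \<xi> = exp (- (\<integral>u. g u \<xi> \<partial>\<kappa>))"
begin

definition G :: "'a \<Rightarrow> complex"
  where "G \<xi> = (\<integral>u. g u \<xi> \<partial>\<kappa>)"

text \<open>By \<open>cf_\<mu>\<close>, the characteristic function of one summand after rescaling
  and centring; that of \<open>L m\<close> is its \<open>m\<close>-th power.\<close>

definition a :: "nat \<Rightarrow> 'a \<Rightarrow> complex"
  where "a m \<xi> = (\<integral>u. exp (- g u \<xi> / of_nat m) \<partial>\<kappa>)"

lemma integrable_g [simp]: "integrable \<kappa> (\<lambda>u. g u \<xi>)"
  by (rule integrable_const_bound[where B="C * (1 + (norm \<xi>)\<^sup>2)"]) (auto intro!: AE_I2 norm_le)

lemma integrable_exp_g [simp]: "integrable \<kappa> (\<lambda>u. exp (- g u \<xi> / of_nat m))"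
  by (rule integrable_const_bound[where B=1]) (auto intro!: AE_I2 divide_nonpos_nonneg simp: Re_nonneg Re_divide_of_nat)

lemma integrable_exp_g' [simp]: "integrable \<kappa> (\<lambda>u. exp (- (g u \<xi> / of_nat m)))"
  using integrable_exp_g[of \<xi> m] by simp

lemma Re_G: "Re (G \<xi>) = (\<integral>u. Re (g u \<xi>) \<partial>\<kappa>)"
  unfolding G_def by (rule integral_Re[OF integrable_g, symmetric])

lemma Re_G_ge: "c * norm \<xi> powr \<alpha> \<le> Re (G \<xi>)"
  using lower[of \<xi>] Re_G[of \<xi>] by simp

lemma Re_G_nonneg: "0 \<le> Re (G \<xi>)"
  unfolding Re_G by (intro Bochner_Integration.integral_nonneg Re_nonneg)

lemma Re_G_le: "Re (G \<xi>) \<le> C * norm \<xi> powr \<alpha>"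
proof -
  have "Re (G \<xi>) \<le> (\<integral>u. C * norm \<xi> powr \<alpha> \<partial>\<kappa>)"
    unfolding Re_G by (intro integral_mono Re_le) auto
  then show ?thesis
    by (simp add: prob_space)
qed

lemma norm_G_le: "norm (G \<xi>) \<le> C * (1 + (norm \<xi>)\<^sup>2)"
proof -
  have "norm (G \<xi>) \<le> (\<integral>u. C * (1 + (norm \<xi>)\<^sup>2) \<partial>\<kappa>)"
    unfolding G_def by (rule integral_norm_le) (auto intro: norm_le)
  then show ?thesis
    by (simp add: prob_space)
qed

text \<open>Both bounds hold at a unit vector. The inequality places \<open>1 - c / (2 * C)\<close>
  strictly between 0 and 1, so that it can serve as a contraction factor.\<close>

lemma c_le_C: "c \<le> C"
proof -
  obtain \<xi> :: 'a where "norm \<xi> = 1"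
    using vector_choose_size[of 1] by auto
  then show ?thesis
    using Re_G_ge[of \<xi>] Re_G_le[of \<xi>] by simp
qed

lemma norm_a_le_integral: "norm (a m \<xi>) \<le> (\<integral>u. exp (- Re (g u \<xi>) / real m) \<partial>\<kappa>)"
proof -
  have "norm (a m \<xi>) \<le> (\<integral>u. norm (exp (- g u \<xi> / of_nat m)) \<partial>\<kappa>)"
    unfolding a_def by (rule integral_norm_bound)
  then show ?thesis
    by (simp add: Re_divide_of_nat)
qed

text \<open>The assumption \<open>small\<close> puts \<open>Re (g u \<xi>) / m\<close> into the unit
  interval for every \<open>u\<close>. There \<open>exp (- x) \<le> 1 - x / 2\<close>, and this
  bound is linear, so the lower bound, which holds for the average over \<open>u\<close>, can be
  applied.\<close>

lemma integral_exp_Re_le: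
  assumes m: "1 \<le> m" and small: "C * norm \<xi> powr \<alpha> \<le> real m"
  shows "(\<integral>u. exp (- Re (g u \<xi>) / real m) \<partial>\<kappa>) \<le> 1 - c * norm \<xi> powr \<alpha> / (2 * real m)"
proof -
  have "(\<integral>u. exp (- Re (g u \<xi>) / real m) \<partial>\<kappa>) \<le> (\<integral>u. 1 - (Re (g u \<xi>) / real m) / 2 \<partial>\<kappa>)"
  proof (rule integral_mono)
    show "integrable \<kappa> (\<lambda>u. exp (- Re (g u \<xi>) / real m))"
      by (rule integrable_const_bound[where B=1]) (auto intro!: AE_I2 divide_nonpos_nonneg simp: Re_nonneg)
    show "exp (- Re (g u \<xi>) / real m) \<le> 1 - Re (g u \<xi>) / real m / 2" if "u \<in> space \<kappa>" for u
      using exp_minus_le_half[of "Re (g u \<xi>) / real m"] Re_nonneg[OF that] Re_le[OF that, of \<xi>] small m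
      by (simp add: divide_simps)
  qed simp
  also have "\<dots> = 1 - Re (G \<xi>) / (2 * real m)"
    by (simp add: Re_G prob_space)
  also have "\<dots> \<le> 1 - c * norm \<xi> powr \<alpha> / (2 * real m)"
    using Re_G_ge[of \<xi>] m by (simp add: divide_right_mono)
  finally show ?thesis .
qed

lemma norm_a_small:
  assumes "1 \<le> m" "C * norm \<xi> powr \<alpha> \<le> real m"
  shows "norm (a m \<xi>) \<le> exp (- (c * norm \<xi> powr \<alpha> / (2 * real m)))"
proof -
  have "norm (a m \<xi>) \<le> 1 - c * norm \<xi> powr \<alpha> / (2 * real m)"
    by (rule order.trans[OF norm_a_le_integral integral_exp_Re_le[OF assms]])
  also have "\<dots> \<le> exp (- (c * norm \<xi> powr \<alpha> / (2 * real m)))"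
    using exp_ge_add_one_self[of "- (c * norm \<xi> powr \<alpha> / (2 * real m))"] by simp
  finally show ?thesis .
qed

text \<open>No pointwise lower bound for \<open>g\<close> is at hand. Instead \<open>\<xi>\<close>
  is shrunk onto the surface \<open>C * |\<xi>|^\<alpha> = m\<close>; by homogeneity of the real
  part this can only increase the integrand, and on the surface \<open>integral_exp_Re_le\<close>
  gives a constant below 1.\<close>

lemma norm_a_large:
  assumes m: "1 \<le> m" and large: "real m < C * norm \<xi> powr \<alpha>"
  shows "norm (a m \<xi>) \<le> 1 - c / (2 * C)"
proof -
  have \<xi>: "0 < norm \<xi> powr \<alpha>" "\<xi> \<noteq> 0"
    using m large C \<alpha> by (auto simp: zero_less_mult_iff intro: ccontr)
  define s where "s = real m / (C * norm \<xi> powr \<alpha>)"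
  have s: "0 < s" "s \<le> 1"
    using m large C \<xi> by (auto simp: s_def)
  define t where "t = s powr (1 / \<alpha>)"
  have t: "0 < t" "t powr \<alpha> = s"
    using s \<alpha> by (auto simp: t_def powr_powr)
  have nt: "C * norm (t *\<^sub>R \<xi>) powr \<alpha> = real m"
    using t s \<xi> C by (simp add: powr_mult s_def)
  have "norm (a m \<xi>) \<le> (\<integral>u. exp (- Re (g u \<xi>) / real m) \<partial>\<kappa>)"
    by (rule norm_a_le_integral)
  also have "\<dots> \<le> (\<integral>u. exp (- Re (g u (t *\<^sub>R \<xi>)) / real m) \<partial>\<kappa>)"
  proof (rule integral_mono)
    have int: "integrable \<kappa> (\<lambda>u. exp (- Re (g u \<xi>) / real m))" for \<xi>
      by (rule integrable_const_bound[where B=1]) (auto intro!: AE_I2 divide_nonpos_nonneg simp: Re_nonneg)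
    show "integrable \<kappa> (\<lambda>u. exp (- Re (g u \<xi>) / real m))"
      "integrable \<kappa> (\<lambda>u. exp (- Re (g u (t *\<^sub>R \<xi>)) / real m))"
      by (rule int)+
    show "exp (- Re (g u \<xi>) / real m) \<le> exp (- Re (g u (t *\<^sub>R \<xi>)) / real m)" if "u \<in> space \<kappa>" for u
      using s t Re_nonneg[OF that, of \<xi>] Re_scaleR[OF that t(1), of \<xi>]
      by (auto intro!: divide_right_mono mult_left_le_one_le)
  qed
  also have "\<dots> \<le> 1 - c * norm (t *\<^sub>R \<xi>) powr \<alpha> / (2 * real m)"
    using nt by (intro integral_exp_Re_le m) simp
  also have "norm (t *\<^sub>R \<xi>) powr \<alpha> = real m / C"
    using nt C by (simp add: field_simps)
  finally show ?thesis
    using m C by simp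
qed

text \<open>Both terms agree with \<open>1 - G \<xi> / m\<close> up to a quadratic error, because
  \<open>G\<close> is the average of \<open>g\<close>. Each of the two errors contributes half of
  the constant 6.\<close>

lemma norm_a_diff:
  assumes m: "1 \<le> m"
  shows "norm (a m \<xi> - exp (- G \<xi> / of_nat m)) \<le> 6 * (C * (1 + (norm \<xi>)\<^sup>2))\<^sup>2 / (real m)\<^sup>2"
proof -
  define K where "K = C * (1 + (norm \<xi>)\<^sup>2)"
  have lin: "norm (exp (- z / of_nat m) - 1 + z / of_nat m) \<le> 3 * K\<^sup>2 / (real m)\<^sup>2"
    if "0 \<le> Re z" "norm z \<le> K" for z
  proof -
    have "norm (exp (- (z / of_nat m)) - 1 + z / of_nat m) \<le> 3 * (norm (z / of_nat m))\<^sup>2"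
      using that by (intro norm_exp_minus_linear) (simp add: Re_divide_of_nat)
    also have "\<dots> \<le> 3 * (K / real m)\<^sup>2"
      using that by (intro mult_left_mono power_mono) (auto simp: norm_divide divide_right_mono)
    finally show ?thesis
      by (simp add: power_divide)
  qed
  have "a m \<xi> - exp (- G \<xi> / of_nat m)
      = (\<integral>u. exp (- g u \<xi> / of_nat m) - 1 + g u \<xi> / of_nat m \<partial>\<kappa>) - (exp (- G \<xi> / of_nat m) - 1 + G \<xi> / of_nat m)"
    by (simp add: a_def G_def prob_space)
  also have "norm \<dots> \<le> norm (\<integral>u. exp (- g u \<xi> / of_nat m) - 1 + g u \<xi> / of_nat m \<partial>\<kappa>)
      + norm (exp (- G \<xi> / of_nat m) - 1 + G \<xi> / of_nat m)"
    by (rule norm_triangle_ineq4)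
  also have "norm (\<integral>u. exp (- g u \<xi> / of_nat m) - 1 + g u \<xi> / of_nat m \<partial>\<kappa>) \<le> (\<integral>u. 3 * K\<^sup>2 / (real m)\<^sup>2 \<partial>\<kappa>)"
    by (rule integral_norm_le) (auto simp: K_def intro!: lin[unfolded K_def, simplified] Re_nonneg norm_le)
  also have "norm (exp (- G \<xi> / of_nat m) - 1 + G \<xi> / of_nat m) \<le> 3 * K\<^sup>2 / (real m)\<^sup>2"
    by (intro lin Re_G_nonneg) (auto simp: K_def norm_G_le)
  finally show ?thesis
    by (simp add: K_def prob_space)
qed

text \<open>Telescoping over \<open>m\<close> factors turns an error of order \<open>1 / m^2\<close>
  per factor into \<open>1 / m\<close>; the \<open>m - 1\<close> other factors supply the
  exponential decay.\<close>

lemma norm_cf_diff_small: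
  assumes m: "2 \<le> m" and small: "C * norm \<xi> powr \<alpha> \<le> real m"
  shows "norm (a m \<xi> ^ m - exp (- G \<xi>))
    \<le> 6 * C\<^sup>2 * (1 + (norm \<xi>)\<^sup>2)\<^sup>2 * exp (- (c / 4) * norm \<xi> powr \<alpha>) / real m"
proof -
  define q where "q = c * norm \<xi> powr \<alpha>"
  define r where "r = exp (- (q / (2 * real m)))"
  have q: "0 \<le> q"
    using c by (simp add: q_def)
  have r: "norm (a m \<xi>) \<le> r" "norm (exp (- G \<xi> / of_nat m)) \<le> r"
  proof -
    show "norm (a m \<xi>) \<le> r"
      using norm_a_small[of m \<xi>] m small by (simp add: r_def q_def)
    have "q / (2 * real m) \<le> q / real m"
      using q m by (simp add: divide_simps)
    also have "\<dots> \<le> Re (G \<xi>) / real m"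
      using Re_G_ge[of \<xi>] by (simp add: q_def divide_right_mono)
    finally show "norm (exp (- G \<xi> / of_nat m)) \<le> r"
      by (simp add: r_def Re_divide_of_nat)
  qed
  have "exp (- G \<xi>) = exp (- G \<xi> / of_nat m) ^ m"
    using m by (simp flip: exp_of_nat_mult)
  then have "norm (a m \<xi> ^ m - exp (- G \<xi>)) \<le> real m * r ^ (m - 1) * norm (a m \<xi> - exp (- G \<xi> / of_nat m))"
    using norm_power_diff_le[OF r, of m] m by simp
  also have "\<dots> \<le> real m * exp (- (c / 4) * norm \<xi> powr \<alpha>) * (6 * (C * (1 + (norm \<xi>)\<^sup>2))\<^sup>2 / (real m)\<^sup>2)"
  proof (intro mult_mono norm_a_diff mult_left_mono)
    \<comment> \<open>For \<open>m \<ge> 2\<close> the exponent \<open>(m - 1) / (2 * m)\<close> is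
      at least 1/4, the source of \<open>c / 4\<close>.\<close>
    have "real m \<le> 2 * real (m - 1)"
      using m by linarith
    then have "q * real m \<le> q * (2 * real (m - 1))"
      using q by (rule mult_left_mono)
    then have "q / 4 \<le> real (m - 1) * (q / (2 * real m))"
      using m by (simp add: field_simps)
    moreover have "r ^ (m - 1) = exp (- (real (m - 1) * (q / (2 * real m))))"
      unfolding r_def by (simp only: mult_minus_right[symmetric] exp_of_nat_mult)
    ultimately show "r ^ (m - 1) \<le> exp (- (c / 4) * norm \<xi> powr \<alpha>)"
      by (simp add: q_def)
  qed (use m in \<open>auto simp: r_def\<close>)
  also have "\<dots> = 6 * C\<^sup>2 * (1 + (norm \<xi>)\<^sup>2)\<^sup>2 * exp (- (c / 4) * norm \<xi> powr \<alpha>) / real m"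
    using m by (simp add: power2_eq_square field_simps)
  finally show ?thesis .
qed

text \<open>With \<open>x\<close> and \<open>y\<close> the real and imaginary parts of
  \<open>G \<xi>\<close>, \<open>1 - exp (- x) * cos y\<close> is at most
  \<open>x + y\<^sup>2\<close>. The imaginary part enters squared, so a bound with exponent
  \<open>\<alpha> / 2\<close> suffices, which leaves room for the logarithm at
  \<open>\<alpha> = 1\<close>. Away from 0 the left-hand side is at most 2.\<close>

lemma \<nu>_tail:
  "\<exists>K. \<forall>R>0. measure \<nu> {x. R < norm x} \<le> K * R powr (- \<alpha>)"
proof (rule cf_tail[OF \<nu> \<alpha>])
  fix \<xi>
  show "1 - Re (cf \<nu> \<xi>) \<le> (C + C\<^sup>2 + 2) * norm \<xi> powr \<alpha>"
  proof (cases "norm \<xi> \<le> 1")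
    case False
    have "1 - Re (cf \<nu> \<xi>) \<le> 1 + norm (cf \<nu> \<xi>)"
      using abs_Re_le_cmod[of "cf \<nu> \<xi>"] by linarith
    also have "\<dots> \<le> 2"
      using borel_finite_measure.norm_cf_le[OF \<nu>(1), of \<xi>] \<nu>(2) by simp
    also have "\<dots> \<le> (C + C\<^sup>2 + 2) * 1"
      using C by simp
    also have "\<dots> \<le> (C + C\<^sup>2 + 2) * norm \<xi> powr \<alpha>"
      using False \<alpha> C by (intro mult_left_mono ge_one_powr_ge_zero) auto
    finally show ?thesis .
  next
    case True
    define x y where "x = Re (G \<xi>)" and "y = Im (G \<xi>)"
    have x: "0 \<le> x" "x \<le> C * norm \<xi> powr \<alpha>"
      using Re_G_nonneg Re_G_le by (auto simp: x_def)
    have "y = (\<integral>u. Im (g u \<xi>) \<partial>\<kappa>)"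
      unfolding y_def G_def by (rule integral_Im[OF integrable_g, symmetric])
    also have "\<bar>\<dots>\<bar> \<le> (\<integral>u. C * norm \<xi> powr (\<alpha> / 2) \<partial>\<kappa>)"
      unfolding real_norm_def[symmetric]
      by (rule integral_norm_le) (auto intro!: integrable_Im Im_le True)
    finally have "\<bar>y\<bar> \<le> C * norm \<xi> powr (\<alpha> / 2)"
      by (simp add: prob_space)
    then have "\<bar>y\<bar>\<^sup>2 \<le> (C * norm \<xi> powr (\<alpha> / 2))\<^sup>2"
      by (intro power_mono) auto
    also have "\<dots> = C\<^sup>2 * norm \<xi> powr \<alpha>"
      by (simp add: power_mult_distrib power2_eq_square flip: powr_add)
    finally have y: "y\<^sup>2 \<le> C\<^sup>2 * norm \<xi> powr \<alpha>"
      by simp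
    have "1 - Re (cf \<nu> \<xi>) = 1 - exp (- x) * cos y"
      unfolding cf_\<nu> by (simp add: Re_exp x_def y_def G_def)
    also have "\<dots> = (1 - exp (- x)) + exp (- x) * (1 - cos y)"
      by (simp add: algebra_simps)
    also have "\<dots> \<le> x + 1 * (y\<^sup>2)"
    proof (intro add_mono mult_mono)
      show "1 - exp (- x) \<le> x"
        using exp_ge_add_one_self[of "- x"] by simp
      show "1 - cos y \<le> y\<^sup>2"
      proof -
        have "1 - cos y = 2 * (sin (y / 2))\<^sup>2"
          using cos_double_sin[of "y / 2"] by simp
        also have "\<dots> \<le> 2 * (y / 2)\<^sup>2"
          using abs_sin_x_le_abs_x[of "y / 2"] unfolding abs_le_square_iff by simp
        also have "\<dots> \<le> y\<^sup>2"
          by (simp add: power2_eq_square)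
        finally show ?thesis .
      qed
    qed (use x in auto)
    also have "\<dots> \<le> C * norm \<xi> powr \<alpha> + C\<^sup>2 * norm \<xi> powr \<alpha>"
      using x y by simp
    also have "\<dots> \<le> (C + C\<^sup>2 + 2) * norm \<xi> powr \<alpha>"
      by (simp add: algebra_simps)
    finally show ?thesis .
  qed
qed blast

text \<open>The law \<open>\<mu>\<close> is restricted to a set \<open>Q n\<close> of positive mass
  where its density is at most \<open>n\<close>. That piece \<open>T\<close> gives the square
  integrable \<open>\<phi> = cf T\<close>, and \<open>w\<close> is the characteristic function of
  the rest of the convolution square, whose mass \<open>1 - (measure \<mu> (Q n))\<^sup>2\<close> is
  the bound \<open>\<rho>\<close>.\<close>

lemma component:
  "\<exists>w \<phi> \<rho>. is_cf w \<and> (\<forall>\<xi>. norm (w \<xi>) \<le> \<rho>) \<and> 0 \<le> \<rho> \<and> \<rho> < 1 \<and>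
    (\<forall>\<xi>. (cf \<mu> \<xi>)\<^sup>2 - w \<xi> = (\<phi> \<xi>)\<^sup>2) \<and>
    \<phi> \<in> borel_measurable borel \<and> integrable lborel (\<lambda>\<xi>. (norm (\<phi> \<xi>))\<^sup>2)"
proof -
  interpret \<mu>: borel_finite_measure \<mu> by (rule \<mu>)
  obtain D where D: "D \<in> borel_measurable borel" "density lborel D = \<mu>"
    using sigma_finite_measure.Radon_Nikodym[OF lborel.sigma_finite_measure_axioms \<mu>(3)] by auto
  note [measurable] = D(1)
  define Q where "Q n = {x. D x \<le> of_nat n}" for n :: nat
  have Q [measurable]: "Q n \<in> sets borel" for n
    unfolding Q_def by measurable
  have fin: "AE x in lborel. D x \<noteq> \<infinity>"
  proof (rule nn_integral_PInf_AE)
    have "(\<integral>\<^sup>+x. D x \<partial>lborel) = emeasure \<mu> UNIV"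
      unfolding D(2)[symmetric] by (simp add: emeasure_density)
    then show "(\<integral>\<^sup>+x. D x \<partial>lborel) \<noteq> \<infinity>"
      using \<mu>.emeasure_finite[of UNIV] by simp
  qed measurable
  have "(\<Union>n. Q n) \<in> sets borel"
    by measurable
  moreover have "AE x in \<mu>. x \<in> (\<Union>n. Q n)"
    unfolding D(2)[symmetric]
  proof (subst AE_density)
    show "AE x in lborel. 0 < D x \<longrightarrow> x \<in> (\<Union>n. Q n)"
    using fin
  proof eventually_elim
    case (elim x)
    have "D x < top"
      using elim by (simp add: less_top)
    then obtain n where "D x < of_nat n"
      using ennreal_Ex_less_of_nat by blast
    then show ?case
      by (auto simp: Q_def intro!: exI[of _ n] less_imp_le)
  qed
  qed measurable
  ultimately have "measure \<mu> (\<Union>n. Q n) = measure \<mu> UNIV"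
    by (intro measure_eq_AE) auto
  moreover have "(\<lambda>n. measure \<mu> (Q n)) \<longlonglongrightarrow> measure \<mu> (\<Union>n. Q n)"
    by (rule \<mu>.finite_Lim_measure_incseq) (auto simp: incseq_def Q_def intro: order.trans)
  ultimately have "(\<lambda>n. measure \<mu> (Q n)) \<longlonglongrightarrow> 1"
    using \<mu> by simp
  then have "eventually (\<lambda>n. 0 < measure \<mu> (Q n)) sequentially"
    by (rule order_tendstoD) simp
  then obtain n where n: "0 < measure \<mu> (Q n)"
    by (auto simp: eventually_sequentially)
  obtain S where S: "borel_finite_measure S"
    "\<And>\<xi>. cf S \<xi> = (cf \<mu> \<xi>)\<^sup>2 - (cf (density \<mu> (indicator (Q n))) \<xi>)\<^sup>2"
    "measure S UNIV = (measure \<mu> UNIV)\<^sup>2 - (measure \<mu> (Q n))\<^sup>2"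
    using is_cf_diff_square[OF \<mu>(1) Q] by metis
  define T where "T = density \<mu> (indicator (Q n))"
  define f where "f x = enn2real (D x) * indicator (Q n) x" for x
  have T_eq: "T = density lborel (\<lambda>x. ennreal (f x))"
    unfolding T_def D(2)[symmetric]
  proof (subst density_density_eq)
    show "density lborel (\<lambda>x. D x * indicator (Q n) x) = density lborel (\<lambda>x. ennreal (f x))"
    proof (rule density_cong)
      show "AE x in lborel. D x * indicator (Q n) x = ennreal (f x)"
        using fin by eventually_elim (auto simp: f_def less_top indicator_def)
    qed (auto simp: f_def)
  qed auto
  have "borel_finite_measure T"
  proof -
    have "emeasure T UNIV = emeasure \<mu> (Q n)"
      unfolding T_def by (subst emeasure_density) simp_all
    then show ?thesis
      by (auto simp: borel_finite_measure_def borel_finite_measure_axioms_def T_def intro!: finite_measureI)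
  qed
  then have "integrable lborel (\<lambda>\<xi>. (norm (cf T \<xi>))\<^sup>2)"
  proof (intro cf_L2_bound[OF _ _ _ T_eq])
    show "f x \<le> real n" for x
      using enn2real_mono[of "D x" "of_nat n"] by (auto simp: f_def Q_def indicator_def less_top[symmetric])
  qed (auto simp: f_def)
  moreover have "cf T \<in> borel_measurable borel"
    using \<open>borel_finite_measure T\<close> by (rule borel_finite_measure.cf_measurable)
  ultimately show ?thesis
  proof (rule_tac exI[of _ "cf S"], rule_tac exI[of _ "cf T"], rule_tac exI[of _ "measure S UNIV"], intro conjI)
    show "0 \<le> measure S UNIV"
      by simp
    show "measure S UNIV < 1"
      using n S(3) \<mu>(2) by simp
    show "\<forall>\<xi>. (cf \<mu> \<xi>)\<^sup>2 - cf S \<xi> = (cf T \<xi>)\<^sup>2"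
      unfolding S(2) T_def by simp
    show "\<forall>\<xi>. norm (cf S \<xi>) \<le> measure S UNIV"
      using borel_finite_measure.norm_cf_le[OF S(1)] by blast
    show "is_cf (cf S)"
      using S(1) by (auto simp: is_cf_def)
  qed auto
qed

lemma is_cf_a: "1 \<le> m \<Longrightarrow> is_cf (a m)"
proof -
  assume m: "1 \<le> m"
  have "is_cf (cf \<mu>)"
    using \<mu>(1) by (auto simp: is_cf_def)
  then have "is_cf (\<lambda>\<xi>. cf \<mu> (real m powr (- 1 / \<alpha>) *\<^sub>R \<xi>) * cis (b m \<bullet> \<xi>))"
    by (intro is_cf_mult is_cf_scaleR is_cf_cis)
  then show ?thesis
    unfolding a_def[abs_def] cf_\<mu>[OF m] .
qed

text \<open>In every pair of factors of \<open>a m ^ m\<close>, the square of \<open>a m\<close> is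
  replaced by its badly behaved part \<open>v m\<close>; this yields \<open>\<beta> m\<close>, the
  characteristic function of \<open>B m\<close>. Where \<open>C * |\<xi>|^\<alpha> \<le> m\<close>,
  the two laws are close and \<open>B m\<close> is geometrically small on a ball of polynomial
  volume. Elsewhere \<open>exp (- G \<xi>)\<close> is small by itself, and
  \<open>a m ^ m - \<beta> m\<close> has a geometric factor in front of the integrable function
  \<open>|\<phi>|^2\<close>.\<close>

lemma cf_L1_distance:
  "\<exists>K B. 0 \<le> K \<and> (\<forall>m\<ge>2. borel_finite_measure (B m) \<and>
    integrable lborel (\<lambda>\<xi>. cf \<nu> \<xi> + cf (B m) \<xi> - cf (L m) \<xi>) \<and>
    (\<integral>\<xi>. norm (cf \<nu> \<xi> + cf (B m) \<xi> - cf (L m) \<xi>) \<partial>lborel) \<le> K / real m)"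
proof -
  obtain w \<phi> \<rho>1 where w: "is_cf w" "\<forall>\<xi>. norm (w \<xi>) \<le> \<rho>1" "0 \<le> \<rho>1" "\<rho>1 < 1"
    "\<forall>\<xi>. (cf \<mu> \<xi>)\<^sup>2 - w \<xi> = (\<phi> \<xi>)\<^sup>2" "\<phi> \<in> borel_measurable borel"
    "integrable lborel (\<lambda>\<xi>. (norm (\<phi> \<xi>))\<^sup>2)"
    using component by (elim exE conjE) (rule that)
  note [measurable] = w(6)
  \<comment> \<open>A common bound below 1 for \<open>v m\<close> everywhere and for
    \<open>a m\<close> in the outer region.\<close>
  define \<rho> where "\<rho> = max \<rho>1 (1 - c / (2 * C))"
  have "0 < c / C" "c / C \<le> 1"
    using c C c_le_C by auto
  then have \<rho>: "0 < \<rho>" "\<rho> < 1" "\<rho>1 \<le> \<rho>" "1 - c / (2 * C) \<le> \<rho>"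
    using w(4) by (auto simp: \<rho>_def less_max_iff_disj)
  define \<eta> where "\<eta> m = real m powr (- 1 / \<alpha>)" for m
  \<comment> \<open>The shift is doubled because \<open>w\<close> is a part of the square of the law
    of a summand.\<close>
  define v where "v m \<xi> = w (\<eta> m *\<^sub>R \<xi>) * cis ((2 *\<^sub>R b m) \<bullet> \<xi>)" for m \<xi>
  define \<beta> where "\<beta> m \<xi> = v m \<xi> ^ (m div 2) * a m \<xi> ^ (m mod 2)" for m \<xi>
  have "\<exists>B. borel_finite_measure B \<and> cf B = \<beta> m" if "1 \<le> m" for m
  proof -
    have "is_cf (\<beta> m)"
      unfolding \<beta>_def[abs_def] v_def[abs_def]
      by (intro is_cf_mult is_cf_power is_cf_scaleR is_cf_cis is_cf_a w(1) that)
    then show ?thesis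
      by (auto simp: is_cf_def)
  qed
  then obtain B where B: "\<And>m. 1 \<le> m \<Longrightarrow> borel_finite_measure (B m)" "\<And>m. 1 \<le> m \<Longrightarrow> cf (B m) = \<beta> m"
    by metis
  have a_eq: "a m \<xi> = cf \<mu> (\<eta> m *\<^sub>R \<xi>) * cis (b m \<bullet> \<xi>)" if "1 \<le> m" for m \<xi>
    using cf_\<mu>[OF that] by (simp add: a_def \<eta>_def)
  have a_le_1: "norm (a m \<xi>) \<le> 1" if "1 \<le> m" for m \<xi>
    unfolding a_eq[OF that] using borel_finite_measure.norm_cf_le[OF \<mu>(1)] \<mu>(2)
    by (simp add: norm_mult)
  have v_le: "norm (v m \<xi>) \<le> \<rho>" for m \<xi>
    using w(2)[rule_format, of "\<eta> m *\<^sub>R \<xi>"] \<rho> by (simp add: v_def norm_mult)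
  have a_sq: "(a m \<xi>)\<^sup>2 - v m \<xi> = (\<phi> (\<eta> m *\<^sub>R \<xi>))\<^sup>2 * cis ((2 *\<^sub>R b m) \<bullet> \<xi>)" if "1 \<le> m" for m \<xi>
    unfolding a_eq[OF that] v_def w(5)[rule_format, symmetric]
    using cis_mult[of "b m \<bullet> \<xi>" "b m \<bullet> \<xi>"] by (simp add: power_mult_distrib left_diff_distrib power2_eq_square)
  define F1 where "F1 \<xi> = 6 * C\<^sup>2 * (1 + (norm \<xi>)\<^sup>2)\<^sup>2 * exp (- (c / 4) * norm \<xi> powr \<alpha>)" for \<xi> :: 'a
  define F2 where "F2 \<xi> = C * (1 + (norm \<xi>)\<^sup>2) ^ 1 * exp (- c * norm \<xi> powr \<alpha>)" for \<xi> :: 'a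
  \<comment> \<open>The radius of the ball where
    \<open>C * |\<xi>|^\<alpha> \<le> m\<close>.\<close>
  define r where "r m = (real m / C) powr (1 / \<alpha>)" for m
  \<comment> \<open>The first and third terms serve the inner region, the second and fourth the
    outer one; their sum dominates in both.\<close>
  define h where "h m \<xi> = F1 \<xi> / real m + F2 \<xi> / real m + \<rho> ^ (m div 2) * indicator (cball 0 (r m)) \<xi>
    + real (m div 2) * \<rho> ^ (m div 2 - 1) * (norm (\<phi> (\<eta> m *\<^sub>R \<xi>)))\<^sup>2" for m \<xi>
  have bound: "norm (cf \<nu> \<xi> + cf (B m) \<xi> - cf (L m) \<xi>) \<le> h m \<xi>" if m: "2 \<le> m" for m \<xi>
  proof -
    have m1: "1 \<le> m"
      using m by simp
    have L_eq: "cf (L m) \<xi> = a m \<xi> ^ m" and \<nu>_eq: "cf \<nu> \<xi> = exp (- G \<xi>)"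
      using cf_L[OF m1] cf_\<nu> by (simp_all add: a_def G_def)
    have F: "0 \<le> F1 \<xi>" "0 \<le> F2 \<xi>"
      using C by (auto simp: F1_def F2_def)
    have last: "0 \<le> real (m div 2) * \<rho> ^ (m div 2 - 1) * (norm (\<phi> (\<eta> m *\<^sub>R \<xi>)))\<^sup>2"
      using \<rho> by simp
    show ?thesis
    proof (cases "C * norm \<xi> powr \<alpha> \<le> real m")
      case True
      have "norm \<xi> \<le> r m"
      proof -
        have "norm \<xi> = (norm \<xi> powr \<alpha>) powr (1 / \<alpha>)"
          using \<alpha> by (simp add: powr_powr)
        also have "\<dots> \<le> (real m / C) powr (1 / \<alpha>)"
          using True C \<alpha> by (intro powr_mono2) (auto simp: field_simps)
        finally show ?thesis
          by (simp add: r_def)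
      qed
      then have ind: "indicator (cball 0 (r m)) \<xi> = (1::real)"
        by simp
      have "norm (cf (B m) \<xi>) \<le> \<rho> ^ (m div 2) * 1"
        unfolding B(2)[OF m1] \<beta>_def norm_mult norm_power
        using \<rho> v_le a_le_1[OF m1] by (intro mult_mono power_mono power_le_one) auto
      moreover have "norm (exp (- G \<xi>) - a m \<xi> ^ m) \<le> F1 \<xi> / real m"
        using norm_cf_diff_small[OF m True] by (simp add: F1_def norm_minus_commute)
      moreover have "norm (cf \<nu> \<xi> + cf (B m) \<xi> - cf (L m) \<xi>)
          \<le> norm (exp (- G \<xi>) - a m \<xi> ^ m) + norm (cf (B m) \<xi>)"
        unfolding L_eq \<nu>_eq by (rule order.trans[OF _ norm_triangle_ineq]) (simp add: algebra_simps)
      moreover have "0 \<le> F2 \<xi> / real m"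
        using F by simp
      ultimately show ?thesis
        using last unfolding h_def ind by linarith
    next
      case False
      then have large: "real m < C * norm \<xi> powr \<alpha>"
        by simp
      have "norm (exp (- G \<xi>)) \<le> exp (- c * norm \<xi> powr \<alpha>)"
        using Re_G_ge[of \<xi>] by simp
      \<comment> \<open>In the outer region \<open>C * |\<xi>|^\<alpha> / m\<close> exceeds 1;
        inserting this factor buys the \<open>1 / m\<close>.\<close>
      also have "\<dots> \<le> (C * norm \<xi> powr \<alpha> / real m) * exp (- c * norm \<xi> powr \<alpha>)"
        using large m mult_right_mono[of 1 "C * norm \<xi> powr \<alpha> / real m" "exp (- c * norm \<xi> powr \<alpha>)"] by simp
      also have "\<dots> \<le> (C * (1 + (norm \<xi>)\<^sup>2) / real m) * exp (- c * norm \<xi> powr \<alpha>)"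
      proof -
        have "norm \<xi> powr \<alpha> \<le> 1 + (norm \<xi>)\<^sup>2"
          using \<alpha> by (intro powr_le_one_plus_square) auto
        then show ?thesis
          using C by (intro mult_right_mono divide_right_mono mult_left_mono) auto
      qed
      finally have 1: "norm (exp (- G \<xi>)) \<le> F2 \<xi> / real m"
        by (simp add: F2_def)
      have a_le: "norm (a m \<xi>) \<le> \<rho>"
        using norm_a_large[OF m1 large] \<rho>(4) by simp
      have "norm ((a m \<xi>)\<^sup>2) \<le> \<rho> * 1"
        unfolding power2_eq_square norm_mult using a_le a_le_1[OF m1] \<rho> by (intro mult_mono) auto
      then have "norm (((a m \<xi>)\<^sup>2) ^ (m div 2) - v m \<xi> ^ (m div 2))
          \<le> real (m div 2) * \<rho> ^ (m div 2 - 1) * norm ((a m \<xi>)\<^sup>2 - v m \<xi>)"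
        using v_le m by (intro norm_power_diff_le) auto
      also have "norm ((a m \<xi>)\<^sup>2 - v m \<xi>) = (norm (\<phi> (\<eta> m *\<^sub>R \<xi>)))\<^sup>2"
        unfolding a_sq[OF m1] by (simp add: norm_mult norm_power)
      finally have "norm (((a m \<xi>)\<^sup>2) ^ (m div 2) - v m \<xi> ^ (m div 2)) * norm (a m \<xi>) ^ (m mod 2)
          \<le> (real (m div 2) * \<rho> ^ (m div 2 - 1) * (norm (\<phi> (\<eta> m *\<^sub>R \<xi>)))\<^sup>2) * 1"
        using a_le_1[OF m1, of \<xi>] by (intro mult_mono last power_le_one) auto
      moreover have "a m \<xi> ^ m = ((a m \<xi>)\<^sup>2) ^ (m div 2) * a m \<xi> ^ (m mod 2)"
        by (simp add: power_mult[symmetric] power_add[symmetric])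
      ultimately have 2: "norm (a m \<xi> ^ m - \<beta> m \<xi>) \<le> real (m div 2) * \<rho> ^ (m div 2 - 1) * (norm (\<phi> (\<eta> m *\<^sub>R \<xi>)))\<^sup>2"
        unfolding \<beta>_def by (simp add: left_diff_distrib[symmetric] norm_mult norm_power)
      have "norm (cf \<nu> \<xi> + cf (B m) \<xi> - cf (L m) \<xi>) \<le> norm (exp (- G \<xi>)) + norm (a m \<xi> ^ m - \<beta> m \<xi>)"
        unfolding L_eq \<nu>_eq B(2)[OF m1]
        by (rule order.trans[OF _ norm_triangle_ineq4]) (simp add: algebra_simps)
      moreover have "0 \<le> F1 \<xi> / real m" "0 \<le> \<rho> ^ (m div 2) * indicator (cball 0 (r m)) \<xi>"
        using F \<rho> by auto
      ultimately show ?thesis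
        using 1 2 unfolding h_def by linarith
    qed
  qed
  have F1: "integrable lborel F1"
    by (rule integrable_poly_exp[of "c / 4" \<alpha> _ "6 * C\<^sup>2" 2]) (use c \<alpha> in \<open>auto simp: F1_def[abs_def] abs_mult\<close>)
  have F2: "integrable lborel F2"
    by (rule integrable_poly_exp[of c \<alpha> _ C 1]) (use c C \<alpha> in \<open>auto simp: F2_def[abs_def] abs_mult\<close>)
  have ind: "integrable lborel (indicator (cball 0 x) :: 'a \<Rightarrow> real)" for x
    using emeasure_lborel_cball_finite[of 0 x] by (simp add: integrable_indicator_iff top.not_eq_extremum)
  have \<eta>_pos: "0 < \<eta> m" if "2 \<le> m" for m
    using that by (simp add: \<eta>_def)
  have \<phi>_int: "integrable lborel (\<lambda>\<xi>. (norm (\<phi> (\<eta> m *\<^sub>R \<xi>)))\<^sup>2)" if "2 \<le> m" for m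
    using lborel_integrable_scaleR[OF _ w(7), of "\<eta> m" 0] \<eta>_pos[OF that] by simp
  have h_int: "integrable lborel (h m)" if "2 \<le> m" for m
    unfolding h_def[abs_def] using F1 F2 ind \<phi>_int[OF that]
    by (intro Bochner_Integration.integrable_add integrable_divide_zero integrable_mult_right)
  define J1 J2 J3 J4 where "J1 = (\<integral>\<xi>. F1 \<xi> \<partial>lborel)" and "J2 = (\<integral>\<xi>. F2 \<xi> \<partial>lborel)"
    and "J3 = unit_ball_vol (real DIM('a)) * (1 / C) powr (real DIM('a) / \<alpha>)"
    and "J4 = (\<integral>\<xi>. (norm (\<phi> \<xi>))\<^sup>2 \<partial>lborel)"
  let ?s = "real DIM('a) / \<alpha>"
  have h_integral: "(\<integral>\<xi>. h m \<xi> \<partial>lborel) = J1 / real m + J2 / real m + \<rho> ^ (m div 2) * (J3 * real m powr ?s)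
      + real (m div 2) * \<rho> ^ (m div 2 - 1) * (J4 * real m powr ?s)" if m: "2 \<le> m" for m
  proof -
    have "(\<integral>\<xi>. h m \<xi> \<partial>lborel) = J1 / real m + J2 / real m
      + \<rho> ^ (m div 2) * (\<integral>\<xi>. indicator (cball 0 (r m)) (\<xi>::'a) \<partial>lborel)
      + real (m div 2) * \<rho> ^ (m div 2 - 1) * (\<integral>\<xi>. (norm (\<phi> (\<eta> m *\<^sub>R \<xi>)))\<^sup>2 \<partial>lborel)"
      unfolding h_def[abs_def] J1_def J2_def using F1 F2 ind[of "r m"] \<phi>_int[OF m] by simp
    moreover have "(\<integral>\<xi>. indicator (cball 0 (r m)) (\<xi>::'a) \<partial>lborel) = J3 * real m powr ?s"
    proof -
      have "(\<integral>\<xi>. indicator (cball 0 (r m)) (\<xi>::'a) \<partial>lborel) = unit_ball_vol (real DIM('a)) * r m ^ DIM('a)"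
        by (simp add: content_cball r_def)
      also have "r m ^ DIM('a) = (1 / C) powr ?s * real m powr ?s"
        using m C by (simp add: r_def powr_powr powr_divide flip: powr_realpow)
      finally show ?thesis
        by (simp add: J3_def)
    qed
    moreover have "(\<integral>\<xi>. (norm (\<phi> (\<eta> m *\<^sub>R \<xi>)))\<^sup>2 \<partial>lborel) = J4 * real m powr ?s"
    proof -
      have "J4 = \<bar>\<eta> m\<bar> ^ DIM('a) *\<^sub>R (\<integral>\<xi>. (norm (\<phi> (0 + \<eta> m *\<^sub>R \<xi>)))\<^sup>2 \<partial>lborel)"
        unfolding J4_def using \<eta>_pos[OF m]
        by (intro lborel_integral_scaleR[of "\<eta> m" "\<lambda>\<xi>. (norm (\<phi> \<xi>))\<^sup>2" 0]) auto
      also have "\<bar>\<eta> m\<bar> ^ DIM('a) = inverse (real m powr ?s)"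
        using m by (simp add: \<eta>_def powr_powr powr_minus[symmetric] flip: powr_realpow)
      finally show ?thesis
        using m by (simp add: field_simps)
    qed
    ultimately show ?thesis
      by simp
  qed
  \<comment> \<open>The exponent collects \<open>?s\<close> from the rescaled volume, 1 from the
    number of telescoping factors and 1 for the gain \<open>1 / m\<close>.\<close>
  obtain K0 where K0: "\<And>m j. 1 \<le> m \<Longrightarrow> real m \<le> 2 * real j + 3 \<Longrightarrow> \<rho> ^ j * real m powr (?s + 2) \<le> K0"
    using geometric_poly_bound[OF \<rho>(1,2), of "?s + 2"] \<alpha> by auto
  have J: "0 \<le> J3" "0 \<le> J4"
    by (auto simp: J3_def J4_def)
  define K where "K = J1 + J2 + J3 * K0 + J4 * K0"
  have K: "(\<integral>\<xi>. h m \<xi> \<partial>lborel) \<le> K / real m" if m: "2 \<le> m" for m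
  proof -
    have pw: "real m powr (?s + 2) = real m powr ?s * real m * real m"
      using m by (simp add: powr_add powr_numeral power2_eq_square)
    have "\<rho> ^ (m div 2) * real m powr ?s * real m \<le> \<rho> ^ (m div 2) * real m powr (?s + 2)"
      using \<rho> m mult_left_mono[of 1 "real m" "\<rho> ^ (m div 2) * real m powr ?s * real m"] by (simp add: pw mult_ac)
    also have "\<dots> \<le> K0"
      using m by (intro K0) linarith+
    finally have 1: "\<rho> ^ (m div 2) * real m powr ?s \<le> K0 / real m"
      using m by (simp add: pos_le_divide_eq)
    have "real (m div 2) * \<rho> ^ (m div 2 - 1) * real m powr ?s * real m
        \<le> real m * \<rho> ^ (m div 2 - 1) * real m powr ?s * real m"
      using \<rho> by (intro mult_right_mono) auto
    also have "\<dots> = \<rho> ^ (m div 2 - 1) * real m powr (?s + 2)"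
      by (simp add: pw mult_ac)
    also have "\<dots> \<le> K0"
      using m by (intro K0) linarith+
    finally have 2: "real (m div 2) * \<rho> ^ (m div 2 - 1) * real m powr ?s \<le> K0 / real m"
      using m by (simp add: pos_le_divide_eq)
    have "(\<integral>\<xi>. h m \<xi> \<partial>lborel) = J1 / real m + J2 / real m + J3 * (\<rho> ^ (m div 2) * real m powr ?s)
        + J4 * (real (m div 2) * \<rho> ^ (m div 2 - 1) * real m powr ?s)"
      unfolding h_integral[OF m] by (simp add: mult_ac)
    also have "\<dots> \<le> J1 / real m + J2 / real m + J3 * (K0 / real m) + J4 * (K0 / real m)"
      by (intro add_mono mult_left_mono 1 2 J order.refl)
    also have "\<dots> = K / real m"
      by (simp add: K_def add_divide_distrib)
    finally show ?thesis .
  qed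
  have meas: "(\<lambda>\<xi>. cf \<nu> \<xi> + cf (B m) \<xi> - cf (L m) \<xi>) \<in> borel_measurable borel" if "2 \<le> m" for m
    using that borel_finite_measure.cf_measurable[OF \<nu>(1)] borel_finite_measure.cf_measurable[OF B(1)[of m]]
      borel_finite_measure.cf_measurable[OF L(1)[of m]]
    by (intro borel_measurable_diff borel_measurable_add) auto
  have int: "integrable lborel (\<lambda>\<xi>. cf \<nu> \<xi> + cf (B m) \<xi> - cf (L m) \<xi>)" if m: "2 \<le> m" for m
    by (rule Bochner_Integration.integrable_bound[OF h_int[OF m]])
      (use meas[OF m] order.trans[OF bound[OF m] abs_ge_self] in \<open>auto\<close>)
  have le: "(\<integral>\<xi>. norm (cf \<nu> \<xi> + cf (B m) \<xi> - cf (L m) \<xi>) \<partial>lborel) \<le> K / real m" if m: "2 \<le> m" for m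
    by (rule order.trans[OF integral_mono K[OF m]]) (use int[OF m] h_int[OF m] bound[OF m] in auto)
  have "0 \<le> K / real 2"
    by (rule order.trans[OF _ le[of 2]]) auto
  then show ?thesis
    using B(1) int le by (intro exI[of _ K] exI[of _ B]) auto
qed

theorem total_variation_rate:
  "\<exists>K. \<forall>m A. 1 \<le> m \<longrightarrow> A \<in> sets borel \<longrightarrow>
    \<bar>measure (L m) A - measure \<nu> A\<bar> \<le> K * real m powr (- \<alpha> / (real DIM('a) + \<alpha>))"
proof -
  obtain K1 B where K1: "0 \<le> K1" and B: "\<forall>m\<ge>2. borel_finite_measure (B m) \<and>
    integrable lborel (\<lambda>\<xi>. cf \<nu> \<xi> + cf (B m) \<xi> - cf (L m) \<xi>) \<and>
    (\<integral>\<xi>. norm (cf \<nu> \<xi> + cf (B m) \<xi> - cf (L m) \<xi>) \<partial>lborel) \<le> K1 / real m"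
    using cf_L1_distance by (elim exE conjE) (rule that)
  obtain K2 where K2: "\<And>R. 0 < R \<Longrightarrow> measure \<nu> {x. R < norm x} \<le> K2 * R powr (- \<alpha>)"
    using \<nu>_tail by blast
  interpret \<nu>: borel_finite_measure \<nu> by (rule \<nu>)
  let ?d = "real DIM('a)"
  let ?e = "- \<alpha> / (?d + \<alpha>)"
  define K where "K = K1 / (gauss_norm TYPE('a))\<^sup>2 * unit_ball_vol ?d + K2 + 1"
  have d\<alpha>: "0 < ?d + \<alpha>"
    using \<alpha> by simp
  have one_sided: "measure \<nu> A \<le> measure (L m) A + K * real m powr ?e" if m: "2 \<le> m" and A [measurable]: "A \<in> sets borel" for m A
  proof -
    interpret L: borel_finite_measure "L m" using L(1)[of m] m by simp
    define R where "R = real m powr (1 / (?d + \<alpha>))"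
    have R: "0 < R"
      using m by (simp add: R_def)
    have "measure \<nu> A \<le> measure \<nu> (A \<inter> cball 0 R \<union> {x. R < norm x})"
      by (rule \<nu>.finite_measure_mono) auto
    also have "\<dots> \<le> measure \<nu> (A \<inter> cball 0 R) + measure \<nu> {x. R < norm x}"
      by (rule measure_Un_le) auto
    also have "measure \<nu> {x. R < norm x} \<le> K2 * R powr (- \<alpha>)"
      by (rule K2[OF R])
    also have "R powr (- \<alpha>) = real m powr ?e"
      by (simp add: R_def powr_powr)
    also have "measure \<nu> (A \<inter> cball 0 R) \<le> measure (L m) (A \<inter> cball 0 R)
        + (K1 / real m) / (gauss_norm TYPE('a))\<^sup>2 * measure lborel (A \<inter> cball 0 R)"
    proof (rule cf_compare[OF \<nu>(1) L.borel_finite_measure_axioms])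
      have "emeasure lborel (A \<inter> cball 0 R) \<le> emeasure lborel (cball (0::'a) R)"
        by (rule emeasure_mono) auto
      also have "\<dots> < \<infinity>"
        by (rule emeasure_lborel_cball_finite)
      finally show "emeasure lborel (A \<inter> cball 0 R) < \<infinity>" .
    qed (use B m in auto)
    also have "measure (L m) (A \<inter> cball 0 R) \<le> measure (L m) A"
      by (rule L.finite_measure_mono) auto
    also have "measure lborel (A \<inter> cball 0 R) \<le> measure lborel (cball (0::'a) R)"
      using emeasure_lborel_cball_finite[of 0 R] by (intro measure_mono_fmeasurable) (auto simp: fmeasurable_def)
    also have "\<dots> = unit_ball_vol ?d * R ^ DIM('a)"
      using R by (simp add: content_cball)
    also have "R ^ DIM('a) = real m * real m powr ?e"
    proof -
      have "R ^ DIM('a) = real m powr (?d / (?d + \<alpha>))"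
        using m by (simp add: R_def powr_powr flip: powr_realpow)
      also have "?d / (?d + \<alpha>) = 1 + ?e"
        using d\<alpha> by (simp add: field_simps)
      finally show ?thesis
        using m powr_add[of "real m" 1 ?e] by simp
    qed
    finally have "measure \<nu> A \<le> measure (L m) A
        + K1 / real m / (gauss_norm TYPE('a))\<^sup>2 * (unit_ball_vol ?d * (real m * real m powr ?e)) + K2 * real m powr ?e"
      using K1 by (simp add: mult_left_mono divide_right_mono)
    also have "K1 / real m / (gauss_norm TYPE('a))\<^sup>2 * (unit_ball_vol ?d * (real m * real m powr ?e))
        = K1 / (gauss_norm TYPE('a))\<^sup>2 * unit_ball_vol ?d * real m powr ?e"
      using m by simp
    also have "measure (L m) A + K1 / (gauss_norm TYPE('a))\<^sup>2 * unit_ball_vol ?d * real m powr ?e + K2 * real m powr ?e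
        \<le> measure (L m) A + K * real m powr ?e"
      by (simp add: K_def algebra_simps)
    finally show ?thesis .
  qed
  have "\<bar>measure (L m) A - measure \<nu> A\<bar> \<le> max K 1 * real m powr ?e" if m: "1 \<le> m" and A: "A \<in> sets borel" for m A
  proof -
    interpret L: borel_finite_measure "L m" using L(1)[OF m] .
    \<comment> \<open>Equal total masses turn the one-sided bound for \<open>- A\<close> into the
      opposite inequality for \<open>A\<close>.\<close>
    have compl: "measure \<nu> (- A) = 1 - measure \<nu> A" "measure (L m) (- A) = 1 - measure (L m) A"
      using \<nu>.finite_measure_compl[of A] L.finite_measure_compl[of A] A \<nu>(2) L(2)[OF m]
      by (simp_all add: Compl_eq_Diff_UNIV)
    show ?thesis
    proof (cases "m = 1")
      case True
      have "measure \<nu> A \<le> 1" "measure (L m) A \<le> 1"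
        using compl measure_nonneg[of \<nu> "- A"] measure_nonneg[of "L m" "- A"] by linarith+
      then have "\<bar>measure (L m) A - measure \<nu> A\<bar> \<le> 1"
        using measure_nonneg[of \<nu> A] measure_nonneg[of "L m" A] by linarith
      then show ?thesis
        using True by simp
    next
      case False
      then have m2: "2 \<le> m"
        using m by simp
      have "- A \<in> sets borel"
        using A by auto
      then have "\<bar>measure (L m) A - measure \<nu> A\<bar> \<le> K * real m powr ?e"
        using one_sided[OF m2 A] one_sided[OF m2, of "- A"] compl by (simp add: abs_le_iff)
      also have "\<dots> \<le> max K 1 * real m powr ?e"
        by (intro mult_right_mono) auto
      finally show ?thesis .
    qed
  qed
  then show ?thesis
    by blast
qed

end

section \<open>Complex matrices with the Frobenius norm\<close>

lemma ctransp_nth [simp]: "ctransp A $ i $ j = cnj (A $ j $ i)"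
  by (simp add: ctransp_def)

lemma ctransp_ctransp [simp]: "ctransp (ctransp A) = A"
  by (simp add: vec_eq_iff)

lemma ctransp_mult: "ctransp (A ** B) = ctransp B ** ctransp A"
  by (simp add: vec_eq_iff matrix_matrix_mult_def mult.commute)

lemma ctransp_add: "ctransp (A + B) = ctransp A + ctransp B"
  and ctransp_diff: "ctransp (A - B) = ctransp A - ctransp B"
  and ctransp_scaleR: "ctransp (c *\<^sub>R A) = c *\<^sub>R ctransp A"
  and ctransp_mat_1 [simp]: "ctransp (mat 1) = mat 1"
  by (auto simp: vec_eq_iff mat_def)

lemma ctransp_diag_mat [simp]: "ctransp (diag_mat d) = diag_mat d"
  by (auto simp: vec_eq_iff diag_mat_def)

lemma norm_cmat_power2: "(norm (A::complex^'n^'m))\<^sup>2 = (\<Sum>i\<in>UNIV. \<Sum>j\<in>UNIV. (cmod (A $ i $ j))\<^sup>2)"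
  by (simp add: norm_vec_def L2_set_def sum_nonneg)

lemma norm_ctransp [simp]: "norm (ctransp A) = norm A"
proof -
  have "(norm (ctransp A))\<^sup>2 = (norm A)\<^sup>2"
    unfolding norm_cmat_power2 by (subst sum.swap) simp
  then show ?thesis
    by simp
qed

lemma norm_power2_eq_trace: "complex_of_real ((norm A)\<^sup>2) = trace (ctransp A ** A)"
  unfolding norm_cmat_power2
proof (subst sum.swap)
  show "complex_of_real (\<Sum>j\<in>UNIV. \<Sum>i\<in>UNIV. (cmod (A $ i $ j))\<^sup>2) = trace (ctransp A ** A)"
    unfolding of_real_sum trace_def matrix_matrix_mult_def
    by (simp only: complex_norm_square vec_lambda_beta ctransp_nth mult.commute)
qed

lemma norm_entry_le: "cmod (A $ i $ j) \<le> norm (A::complex^'n^'m)"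
  by (rule order.trans[OF Finite_Cartesian_Product.norm_nth_le Finite_Cartesian_Product.norm_nth_le])

lemma norm_matrix_mult_le:
  fixes A :: "complex^'n^'m" and B :: "complex^'k^'n"
  shows "norm (A ** B) \<le> norm A * norm B"
proof -
  define b where "b j = (\<Sum>k\<in>UNIV. (cmod (B $ k $ j))\<^sup>2)" for j
  have "(norm (A ** B))\<^sup>2 = (\<Sum>i\<in>UNIV. \<Sum>j\<in>UNIV. (cmod (\<Sum>k\<in>UNIV. A $ i $ k * B $ k $ j))\<^sup>2)"
    by (simp add: norm_cmat_power2 matrix_matrix_mult_def)
  also have "\<dots> \<le> (\<Sum>i\<in>UNIV. \<Sum>j\<in>UNIV. (\<Sum>k\<in>UNIV. (cmod (A $ i $ k))\<^sup>2) * b j)"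
  proof (intro sum_mono)
    fix i j
    have "cmod (\<Sum>k\<in>UNIV. A $ i $ k * B $ k $ j) \<le> (\<Sum>k\<in>UNIV. cmod (A $ i $ k) * cmod (B $ k $ j))"
      by (rule order.trans[OF norm_sum]) (simp add: norm_mult)
    then have "(cmod (\<Sum>k\<in>UNIV. A $ i $ k * B $ k $ j))\<^sup>2 \<le> (\<Sum>k\<in>UNIV. cmod (A $ i $ k) * cmod (B $ k $ j))\<^sup>2"
      by (intro power_mono) auto
    also have "\<dots> \<le> (\<Sum>k\<in>UNIV. (cmod (A $ i $ k))\<^sup>2) * b j"
      unfolding b_def by (rule Cauchy_Schwarz_ineq_sum)
    finally show "(cmod (\<Sum>k\<in>UNIV. A $ i $ k * B $ k $ j))\<^sup>2 \<le> (\<Sum>k\<in>UNIV. (cmod (A $ i $ k))\<^sup>2) * b j" .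
  qed
  also have "\<dots> = (norm A)\<^sup>2 * (\<Sum>j\<in>UNIV. b j)"
    unfolding norm_cmat_power2 by (simp only: sum_distrib_left[symmetric] sum_distrib_right[symmetric])
  also have "(\<Sum>j\<in>UNIV. b j) = (norm B)\<^sup>2"
    unfolding norm_cmat_power2 b_def by (rule sum.swap)
  finally have "(norm (A ** B))\<^sup>2 \<le> (norm A * norm B)\<^sup>2"
    by (simp add: power_mult_distrib)
  then show ?thesis
    by (rule power2_le_imp_le) simp
qed

lemma bounded_bilinear_matrix_mult:
  "bounded_bilinear ((**) :: complex^'n^'m \<Rightarrow> complex^'k^'n \<Rightarrow> complex^'k^'m)"
proof
  show "\<exists>K. \<forall>(a::complex^'n^'m) (b::complex^'k^'n). norm (a ** b) \<le> norm a * norm b * K"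
    using norm_matrix_mult_le by (intro exI[of _ 1]) (simp only: mult_1_right, blast)
qed (auto simp: vec_eq_iff matrix_matrix_mult_def algebra_simps sum.distrib sum_distrib_left scaleR_sum_right)

lemmas matrix_mult_diff_left = bounded_bilinear.diff_left[OF bounded_bilinear_matrix_mult]
  and matrix_mult_diff_right = bounded_bilinear.diff_right[OF bounded_bilinear_matrix_mult]
  and matrix_mult_add_left = bounded_bilinear.add_left[OF bounded_bilinear_matrix_mult]
  and matrix_mult_add_right = bounded_bilinear.add_right[OF bounded_bilinear_matrix_mult]
  and matrix_mult_scaleR_left = bounded_bilinear.scaleR_left[OF bounded_bilinear_matrix_mult]
  and matrix_mult_scaleR_right = bounded_bilinear.scaleR_right[OF bounded_bilinear_matrix_mult]

lemma continuous_on_matrix_mult [continuous_intros]: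
  fixes f :: "'a::topological_space \<Rightarrow> complex^'n^'m" and g :: "'a \<Rightarrow> complex^'k^'n"
  shows "continuous_on S f \<Longrightarrow> continuous_on S g \<Longrightarrow> continuous_on S (\<lambda>x. f x ** g x)"
  by (rule bounded_bilinear.continuous_on[OF bounded_bilinear_matrix_mult])

lemma measurable_matrix_mult [measurable]:
  fixes f :: "'a \<Rightarrow> complex^'n^'m" and g :: "'a \<Rightarrow> complex^'k^'n"
  assumes "f \<in> borel_measurable M" "g \<in> borel_measurable M"
  shows "(\<lambda>x. f x ** g x) \<in> borel_measurable M"
  by (rule borel_measurable_continuous_Pair[OF assms]) (intro continuous_intros)

lemma bounded_linear_ctransp: "bounded_linear ctransp"
  by (rule bounded_linear_intro[of _ 1]) (auto simp: ctransp_add ctransp_scaleR)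

lemma continuous_on_ctransp [continuous_intros]: "continuous_on S f \<Longrightarrow> continuous_on S (\<lambda>x. ctransp (f x))"
  by (rule bounded_linear.continuous_on[OF bounded_linear_ctransp])

lemma measurable_ctransp [measurable]: "ctransp \<in> borel_measurable borel"
  by (intro borel_measurable_continuous_onI continuous_intros)

lemma linear_diag_mat: "linear diag_mat"
  by (rule linearI) (auto simp: vec_eq_iff diag_mat_def complex_eq_iff)

lemma bounded_linear_diag_mat: "bounded_linear diag_mat"
  using linear_diag_mat by (rule linear_conv_bounded_linear[THEN iffD1])

lemma continuous_on_diag_mat [continuous_intros]: "continuous_on S f \<Longrightarrow> continuous_on S (\<lambda>x. diag_mat (f x))"
  by (rule bounded_linear.continuous_on[OF bounded_linear_diag_mat])

lemma measurable_diag_mat [measurable]: "diag_mat \<in> borel_measurable borel"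
  by (intro borel_measurable_continuous_onI continuous_intros)

lemma bounded_linear_trace: "bounded_linear (trace :: complex^'n^'n \<Rightarrow> complex)"
proof -
  have "linear (trace :: complex^'n^'n \<Rightarrow> complex)"
    by (rule linearI) (auto simp: trace_def sum.distrib scaleR_sum_right)
  then show ?thesis
    by (rule linear_conv_bounded_linear[THEN iffD1])
qed

lemma continuous_on_trace [continuous_intros]:
  fixes f :: "'a::topological_space \<Rightarrow> complex^'n^'n"
  shows "continuous_on S f \<Longrightarrow> continuous_on S (\<lambda>x. trace (f x))"
  by (rule bounded_linear.continuous_on[OF bounded_linear_trace])

lemma measurable_trace [measurable]: "(trace :: complex^'n^'n \<Rightarrow> complex) \<in> borel_measurable borel"
  by (intro borel_measurable_continuous_onI continuous_intros)

subsection \<open>Unitary and Hermitian matrices\<close>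

lemma unitary_groupD: "U \<in> unitary_group \<Longrightarrow> U ** ctransp U = mat 1"
  "U \<in> unitary_group \<Longrightarrow> ctransp U ** U = mat 1"
  by (auto simp: unitary_group_def)

lemma unitary_groupI: "ctransp U ** U = mat 1 \<Longrightarrow> U \<in> unitary_group"
  using matrix_left_right_inverse[of U "ctransp U"] by (auto simp: unitary_group_def)

lemma ctransp_unitary [simp]: "ctransp U \<in> unitary_group \<longleftrightarrow> U \<in> unitary_group"
  by (auto simp: unitary_group_def)

lemma unitary_mult: "U \<in> unitary_group \<Longrightarrow> V \<in> unitary_group \<Longrightarrow> U ** V \<in> unitary_group"
proof (intro unitary_groupI)
  assume "U \<in> unitary_group" "V \<in> unitary_group"
  moreover have "ctransp (U ** V) ** (U ** V) = ctransp V ** ((ctransp U ** U) ** V)"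
    by (simp only: ctransp_mult matrix_mul_assoc)
  ultimately show "ctransp (U ** V) ** (U ** V) = mat 1"
    by (simp add: unitary_groupD)
qed

lemma norm_unitary_mult [simp]: "U \<in> unitary_group \<Longrightarrow> norm (U ** (A::'n::finite cmat)) = norm A"
proof -
  assume U: "U \<in> unitary_group"
  have "ctransp (U ** A) ** (U ** A) = ctransp A ** ((ctransp U ** U) ** A)"
    by (simp add: ctransp_mult matrix_mul_assoc)
  then have "complex_of_real ((norm (U ** A))\<^sup>2) = complex_of_real ((norm A)\<^sup>2)"
    unfolding norm_power2_eq_trace using U by (simp add: unitary_groupD)
  then show ?thesis
    by (simp only: of_real_eq_iff) simp
qed

lemma norm_mult_unitary [simp]: "U \<in> unitary_group \<Longrightarrow> norm ((A::'n::finite cmat) ** U) = norm A"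
  using norm_unitary_mult[of "ctransp U" "ctransp A"]
  by (simp add: ctransp_mult[symmetric])

lemma unitary_conj_cancel:
  "U \<in> unitary_group \<Longrightarrow> ctransp U ** (U ** A ** ctransp U) ** U = A"
  "U \<in> unitary_group \<Longrightarrow> U ** (ctransp U ** A ** U) ** ctransp U = A"
proof -
  assume U: "U \<in> unitary_group"
  have "ctransp U ** (U ** A ** ctransp U) ** U = (ctransp U ** U) ** A ** (ctransp U ** U)"
    "U ** (ctransp U ** A ** U) ** ctransp U = (U ** ctransp U) ** A ** (U ** ctransp U)"
    by (simp_all only: matrix_mul_assoc)
  then show "ctransp U ** (U ** A ** ctransp U) ** U = A" "U ** (ctransp U ** A ** U) ** ctransp U = A"
    using U by (simp_all add: unitary_groupD)
qed

lemma trace_conj: "U \<in> unitary_group \<Longrightarrow> trace (U ** A ** ctransp U) = trace A"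
proof -
  assume U: "U \<in> unitary_group"
  have "trace (U ** A ** ctransp U) = trace (ctransp U ** (U ** A))"
    by (rule trace_mul_sym)
  also have "\<dots> = trace ((ctransp U ** U) ** A)"
    by (simp only: matrix_mul_assoc)
  finally show ?thesis
    using U by (simp add: unitary_groupD)
qed

lemma HermD: "X \<in> Herm \<Longrightarrow> ctransp X = X"
  by (simp add: Herm_def)

lemma Herm_conj: "X \<in> Herm \<Longrightarrow> U ** X ** ctransp U \<in> Herm"
  by (simp add: Herm_def ctransp_mult matrix_mul_assoc)

lemma Herm_conj': "X \<in> Herm \<Longrightarrow> ctransp U ** X ** U \<in> Herm"
  using Herm_conj[of X "ctransp U"] by simp

lemma diag_mat_Herm [simp]: "diag_mat d \<in> Herm"
  by (simp add: Herm_def)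

lemma Herm_diag_real: "X \<in> Herm \<Longrightarrow> Im (X $ i $ i) = 0"
  using arg_cong[OF HermD, of X "\<lambda>A. A $ i $ i"] by (simp add: complex_eq_iff)

lemma trace_Herm_mult_real:
  assumes "A \<in> Herm" "B \<in> Herm"
  shows "trace (A ** B) = complex_of_real (Re (trace (A ** B)))"
proof -
  have "cnj (trace (A ** B)) = trace (ctransp (A ** B))"
    by (simp add: trace_def)
  also have "\<dots> = trace (A ** B)"
    unfolding ctransp_mult HermD[OF assms(1)] HermD[OF assms(2)] by (rule trace_mul_sym)
  finally show ?thesis
    by (simp add: complex_eq_iff)
qed

lemma mat_1_Herm [simp]: "mat 1 \<in> Herm"
  by (simp add: Herm_def)

lemma diag_mat_const: "diag_mat (\<chi> i. t) = t *\<^sub>R mat 1"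
  by (auto simp: vec_eq_iff diag_mat_def mat_def complex_eq_iff)

lemma trace_diag_mat: "trace (diag_mat d) = complex_of_real (\<Sum>i\<in>UNIV. d $ i)"
  by (simp add: trace_def diag_mat_def)

lemma diag_mat_mult_nth: "(diag_mat d ** A) $ i $ j = of_real (d $ i) * A $ i $ j"
  by (simp add: matrix_matrix_mult_def diag_mat_def if_distrib[where f="\<lambda>x. x * _"] cong: if_cong)

lemma mult_diag_mat_nth: "(A ** diag_mat d) $ i $ j = A $ i $ j * of_real (d $ j)"
  by (simp add: matrix_matrix_mult_def diag_mat_def if_distrib[where f="\<lambda>x. _ * x"] cong: if_cong)

lemma trace_diag_mat_mult: "Re (trace (diag_mat d ** A)) = d \<bullet> (\<chi> i. Re (A $ i $ i))"
  by (simp add: trace_def diag_mat_mult_nth inner_vec_def)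

subsection \<open>Real coordinates of Hermitian matrices\<close>

text \<open>The coordinates form a vector indexed by pairs, so that the results on Euclidean spaces
  apply in dimension N^2.\<close>

definition herm :: "real^('n \<times> 'n) \<Rightarrow> 'n::{finite,linorder} cmat"
  where "herm x = herm_of_coords (($) x)"

text \<open>Only the real parts of the diagonal and the entries of the upper triangle are read. This
  makes \<open>coords\<close> linear on all matrices and a left inverse of
  \<open>herm\<close>.\<close>

definition coords :: "'n::{finite,linorder} cmat \<Rightarrow> real^('n \<times> 'n)"
  where "coords Z = (\<chi> p. if fst p \<le> snd p then Re (Z $ fst p $ snd p) else Im (Z $ snd p $ fst p))"

lemma herm_nth: "herm x $ j $ k =
  (if j = k then complex_of_real (x $ (j, j))
   else if j < k then Complex (x $ (j, k)) (x $ (k, j)) else Complex (x $ (k, j)) (- x $ (j, k)))"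
  by (simp add: herm_def herm_of_coords_def)

lemma herm_Herm [simp]: "herm x \<in> Herm"
  by (auto simp: Herm_def vec_eq_iff herm_nth complex_eq_iff not_less)

lemma coords_herm [simp]: "coords (herm x) = x"
  by (auto simp: vec_eq_iff coords_def herm_nth not_le)

lemma herm_coords: "Z \<in> Herm \<Longrightarrow> herm (coords Z) = Z"
proof -
  assume Z: "Z \<in> Herm"
  have "cnj (Z $ k $ j) = Z $ j $ k" for j k
    using arg_cong[OF HermD[OF Z], of "\<lambda>A. A $ j $ k"] by simp
  note sym = this
  have "herm (coords Z) $ j $ k = Z $ j $ k" for j k
  proof (cases j k rule: linorder_cases)
    case equal
    then show ?thesis
      using Herm_diag_real[OF Z, of j] by (simp add: herm_nth coords_def complex_eq_iff)
  next
    case less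
    then show ?thesis
      by (auto simp: herm_nth coords_def complex_eq_iff)
  next
    case greater
    then show ?thesis
      unfolding sym[of k j, symmetric] by (auto simp: herm_nth coords_def complex_eq_iff)
  qed
  then show ?thesis
    by (simp add: vec_eq_iff)
qed

lemma linear_herm: "linear herm"
  by (rule linearI) (auto simp: vec_eq_iff herm_nth complex_eq_iff)

lemma linear_coords: "linear coords"
  by (rule linearI) (auto simp: vec_eq_iff coords_def)

lemma continuous_on_herm [continuous_intros]: "continuous_on S f \<Longrightarrow> continuous_on S (\<lambda>x. herm (f x))"
  by (rule bounded_linear.continuous_on[OF linear_conv_bounded_linear[THEN iffD1, OF linear_herm]])

lemma continuous_on_coords [continuous_intros]: "continuous_on S f \<Longrightarrow> continuous_on S (\<lambda>x. coords (f x))"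
  by (rule bounded_linear.continuous_on[OF linear_conv_bounded_linear[THEN iffD1, OF linear_coords]])

lemma measurable_herm [measurable]: "herm \<in> borel_measurable borel"
  by (intro borel_measurable_continuous_onI continuous_intros)

lemma measurable_coords [measurable]: "coords \<in> borel_measurable borel"
  by (intro borel_measurable_continuous_onI continuous_intros)

text \<open>The linear map \<open>dual\<close> turns the trace form into the inner product of coordinates.\<close>
definition dual :: "real^('n \<times> 'n) \<Rightarrow> 'n::{finite,linorder} cmat"
  where "dual \<xi> = herm (\<chi> p. if fst p = snd p then \<xi> $ p else \<xi> $ p / 2)"

lemma dual_Herm [simp]: "dual \<xi> \<in> Herm"
  by (simp add: dual_def)

lemma linear_dual: "linear dual"
  by (rule linearI) (auto simp: vec_eq_iff dual_def herm_nth complex_eq_iff add_divide_distrib)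

lemma continuous_on_dual [continuous_intros]: "continuous_on S f \<Longrightarrow> continuous_on S (\<lambda>x. dual (f x))"
  by (rule bounded_linear.continuous_on[OF linear_conv_bounded_linear[THEN iffD1, OF linear_dual]])

lemma measurable_dual [measurable]: "dual \<in> borel_measurable borel"
  by (intro borel_measurable_continuous_onI continuous_intros)

lemma dual_eq_0_iff [simp]: "dual \<xi> = 0 \<longleftrightarrow> \<xi> = 0"
proof
  assume "dual \<xi> = 0"
  then have "coords (dual \<xi>) = 0"
    using linear_0[OF linear_coords] by simp
  then show "\<xi> = 0"
    by (auto simp: dual_def vec_eq_iff split: if_splits)
qed (simp add: linear_0[OF linear_dual])

text \<open>Every off-diagonal coordinate occurs in the trace at \<open>(j, k)\<close> and again at
  \<open>(k, j)\<close>; the factor 1/2 in \<open>dual\<close> compensates for this.\<close>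

lemma trace_dual_herm: "trace (dual \<xi> ** herm x) = complex_of_real (\<xi> \<bullet> x)"
proof -
  have "Re (trace (dual \<xi> ** herm x)) = (\<Sum>j\<in>UNIV. \<Sum>k\<in>UNIV. Re (dual \<xi> $ j $ k * herm x $ k $ j))"
    by (simp add: trace_def matrix_matrix_mult_def)
  also have "\<dots> = (\<Sum>j\<in>UNIV. \<Sum>k\<in>UNIV. (\<xi> $ (j, k) * x $ (j, k)) / 2 + (\<xi> $ (k, j) * x $ (k, j)) / 2)"
    by (intro sum.cong refl) (auto simp: dual_def herm_nth not_less)
  also have "\<dots> = (\<Sum>j\<in>UNIV. \<Sum>k\<in>UNIV. (\<xi> $ (j, k) * x $ (j, k)) / 2)
      + (\<Sum>j\<in>UNIV. \<Sum>k\<in>UNIV. (\<xi> $ (k, j) * x $ (k, j)) / 2)"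
    by (simp add: sum.distrib)
  also have "(\<Sum>j\<in>UNIV. \<Sum>k\<in>UNIV. (\<xi> $ (k, j) * x $ (k, j)) / 2)
      = (\<Sum>j\<in>UNIV. \<Sum>k\<in>UNIV. (\<xi> $ (j, k) * x $ (j, k)) / 2)"
    by (rule sum.swap)
  also have "(\<Sum>j\<in>UNIV. \<Sum>k\<in>UNIV. (\<xi> $ (j, k) * x $ (j, k)) / 2)
      + (\<Sum>j\<in>UNIV. \<Sum>k\<in>UNIV. (\<xi> $ (j, k) * x $ (j, k)) / 2) = \<xi> \<bullet> x"
  proof -
    have "\<xi> \<bullet> x = (\<Sum>j\<in>UNIV. \<Sum>k\<in>UNIV. \<xi> $ (j, k) * x $ (j, k))"
      by (simp add: inner_vec_def sum.cartesian_product split_beta')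
    then show ?thesis
      by (simp add: sum_divide_distrib[symmetric])
  qed
  finally show ?thesis
    using trace_Herm_mult_real[of "dual \<xi>" "herm x"] by simp
qed

text \<open>By the trace identity, \<open>|dual \<xi>|^2\<close> is the inner product of
  \<open>\<xi>\<close> with the coordinates of \<open>dual \<xi>\<close>, and these are the
  coordinates of \<open>\<xi>\<close> with the off-diagonal ones halved.\<close>

lemma norm_dual_le: "norm (dual \<xi>) \<le> norm \<xi>"
proof -
  define x where "x = coords (dual \<xi>)"
  have "(norm x)\<^sup>2 \<le> (norm \<xi>)\<^sup>2"
    unfolding x_def norm_vec_def L2_set_def dual_def
    by (auto simp: sum_nonneg real_norm_def power_divide intro!: sum_mono)
  then have x: "norm x \<le> norm \<xi>"
    by simp
  have "complex_of_real ((norm (dual \<xi>))\<^sup>2) = trace (dual \<xi> ** herm x)"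
    unfolding norm_power2_eq_trace by (simp add: HermD x_def herm_coords)
  then have "(norm (dual \<xi>))\<^sup>2 = \<xi> \<bullet> x"
    unfolding trace_dual_herm of_real_eq_iff .
  also have "\<dots> \<le> norm \<xi> * norm x"
    by (rule norm_cauchy_schwarz)
  also have "\<dots> \<le> (norm \<xi>)\<^sup>2"
    using x by (simp add: power2_eq_square mult_left_mono)
  finally show ?thesis
    by simp
qed

lemma dual_surj:
  assumes "S \<in> Herm"
  obtains \<xi> where "dual \<xi> = S"
proof
  show "dual (\<chi> p. if fst p = snd p then coords S $ p else 2 * coords S $ p) = S"
    unfolding dual_def by (subst (3) herm_coords[OF assms, symmetric])
      (intro arg_cong[where f=herm], auto simp: vec_eq_iff)
qed

subsection \<open>Lebesgue measure in coordinates\<close>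

text \<open>Stated for a bijection \<open>e\<close> of index sets, since it is applied both to all
  pairs and to the diagonal pairs alone.\<close>

lemma lborel_vec_reindex:
  fixes e :: "'i::finite \<Rightarrow> 'k"
  assumes e: "bij_betw e UNIV I"
  shows "(\<lambda>f. \<chi> i. f (e i)) \<in> measurable (\<Pi>\<^sub>M k\<in>I. lborel :: real measure) borel"
    and "distr (\<Pi>\<^sub>M k\<in>I. lborel :: real measure) borel (\<lambda>f. \<chi> i. f (e i)) = (lborel :: (real^'i) measure)"
proof -
  interpret product_sigma_finite "\<lambda>_::'k. lborel :: real measure" by standard
  have I: "finite I" "inj e" "I = range e"
    using e by (auto simp: bij_betw_def intro: bij_betw_finite[THEN iffD1, OF e])
  show meas [measurable]: "(\<lambda>f. \<chi> i. f (e i)) \<in> measurable (\<Pi>\<^sub>M k\<in>I. lborel :: real measure) borel"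
  proof (rule borel_measurable_euclidean_space[THEN iffD2], rule ballI)
    fix b :: "real^'i" assume "b \<in> Basis"
    then obtain i where b: "b = axis i 1"
      by (auto simp: Basis_vec_def)
    have "e i \<in> I"
      using I by simp
    then show "(\<lambda>f. (\<chi> i. f (e i)) \<bullet> b) \<in> borel_measurable (\<Pi>\<^sub>M k\<in>I. lborel :: real measure)"
      unfolding b inner_axis by simp measurable
  qed
  show "distr (\<Pi>\<^sub>M k\<in>I. lborel :: real measure) borel (\<lambda>f. \<chi> i. f (e i)) = (lborel :: (real^'i) measure)"
  proof (rule lborel_eqI[symmetric])
    fix l u :: "real^'i" assume le: "\<And>b. b \<in> Basis \<Longrightarrow> l \<bullet> b \<le> u \<bullet> b"
    have le': "l $ i \<le> u $ i" for i
      using le[of "axis i 1"] by (simp add: inner_axis)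
    define e' where "e' = the_inv e"
    have e': "e' (e i) = i" for i
      using I by (simp add: e'_def the_inv_f_f)
    have "(\<lambda>f. \<chi> i. f (e i)) -` box l u \<inter> space (\<Pi>\<^sub>M k\<in>I. lborel :: real measure)
        = (\<Pi>\<^sub>E k\<in>I. {l $ e' k<..<u $ e' k})"
      by (auto simp: mem_box_cart space_PiM PiE_iff I(3) e')
    then have "emeasure (distr (\<Pi>\<^sub>M k\<in>I. lborel :: real measure) borel (\<lambda>f. \<chi> i. f (e i))) (box l u)
        = emeasure (\<Pi>\<^sub>M k\<in>I. lborel :: real measure) (\<Pi>\<^sub>E k\<in>I. {l $ e' k<..<u $ e' k})"
      by (subst emeasure_distr) auto
    also have "\<dots> = (\<Prod>k\<in>I. emeasure lborel {l $ e' k<..<u $ e' k})"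
      using I by (intro emeasure_PiM) auto
    also have "\<dots> = (\<Prod>i\<in>UNIV. ennreal (u $ i - l $ i))"
      unfolding I(3) using I(2) le' by (subst prod.reindex) (auto simp: e')
    also have "\<dots> = ennreal (\<Prod>i\<in>UNIV. u $ i - l $ i)"
      using le' by (intro prod_ennreal) auto
    also have "(\<Prod>i\<in>UNIV. u $ i - l $ i) = (\<Prod>b\<in>Basis. (u - l) \<bullet> b)"
    proof -
      have B: "(Basis :: (real^'i) set) = range (\<lambda>i. axis i 1)"
        by (auto simp: Basis_vec_def)
      have "inj (\<lambda>i. axis i 1 :: real^'i)"
        by (auto simp: inj_def axis_eq_axis)
      then show ?thesis
        unfolding B by (subst prod.reindex) (auto simp: inner_axis)
    qed
    finally show "emeasure (distr (\<Pi>\<^sub>M k\<in>I. lborel :: real measure) borel (\<lambda>f. \<chi> i. f (e i))) (box l u)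
        = ennreal (\<Prod>b\<in>Basis. (u - l) \<bullet> b)" .
  qed simp
qed

lemma herm_of_coords_eq_herm: "herm_of_coords f = herm (\<chi> p. f p)"
  by (simp add: herm_def vec_lambda_beta[abs_def])

lemma lebesgue_Herm_eq: "(lebesgue_Herm :: 'n::{finite,linorder} cmat measure) = distr lborel borel herm"
proof -
  note * = lborel_vec_reindex[OF bij_betw_id[of "UNIV :: ('n \<times> 'n) set"], unfolded id_apply]
  show ?thesis
    unfolding lebesgue_Herm_def herm_of_coords_eq_herm *(2)[symmetric]
    by (subst distr_distr[OF measurable_herm *(1)]) (simp add: comp_def)
qed

subsection \<open>Haar measure\<close>

locale haar =
  fixes \<kappa> :: "'n::finite cmat measure"
  assumes haar: "haar_unitary \<kappa>"
begin

sublocale prob_space \<kappa>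
  using haar by (simp add: haar_unitary_def borel_prob_on_def)

lemma sets_eq [measurable_cong]: "sets \<kappa> = sets (restrict_space borel unitary_group)"
  using haar by (simp add: haar_unitary_def borel_prob_on_def)

lemma space_eq [simp]: "space \<kappa> = unitary_group"
  using sets_eq_imp_space_eq[OF sets_eq] by (simp add: space_restrict_space)

lemma left_invariant: "V \<in> unitary_group \<Longrightarrow> distr \<kappa> \<kappa> (\<lambda>U. V ** U) = \<kappa>"
  using haar by (simp add: haar_unitary_def)

lemma measurable_into:
  assumes "f \<in> borel_measurable M" "\<And>x. x \<in> space M \<Longrightarrow> f x \<in> unitary_group"
  shows "f \<in> measurable M \<kappa>"
  using assms by (subst measurable_cong_sets[OF refl sets_eq]) (auto intro!: measurable_restrict_space2)

lemma measurable_from: "f \<in> borel_measurable borel \<Longrightarrow> f \<in> borel_measurable \<kappa>"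
  by (subst measurable_cong_sets[OF sets_eq refl]) (rule measurable_restrict_space1)

lemma measurable_id_borel [measurable]: "(\<lambda>U. U) \<in> measurable \<kappa> borel"
  by (rule measurable_from) simp

lemma nn_integral_left:
  assumes [measurable]: "f \<in> borel_measurable \<kappa>" and V: "V \<in> unitary_group"
  shows "(\<integral>\<^sup>+U. f (V ** U) \<partial>\<kappa>) = (\<integral>\<^sup>+U. f U \<partial>\<kappa>)"
proof -
  have m: "(\<lambda>U. V ** U) \<in> measurable \<kappa> \<kappa>"
    by (rule measurable_into) (auto intro: unitary_mult V)
  have "(\<integral>\<^sup>+U. f U \<partial>\<kappa>) = (\<integral>\<^sup>+U. f U \<partial>(distr \<kappa> \<kappa> (\<lambda>U. V ** U)))"
    by (simp only: left_invariant[OF V])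
  also have "\<dots> = (\<integral>\<^sup>+U. f (V ** U) \<partial>\<kappa>)"
    by (rule nn_integral_distr[OF m]) simp
  finally show ?thesis ..
qed

end

text \<open>
  Averaging \<open>f (U\<^sup>\<dagger> V)\<close> over two Haar measures in either order shows that the inverse of a Haar
  distributed matrix has the law of any other Haar distributed matrix.
\<close>
lemma haar_nn_integral_ctransp:
  fixes \<kappa> \<kappa>' :: "'n::finite cmat measure"
  assumes "haar_unitary \<kappa>" "haar_unitary \<kappa>'" and f: "f \<in> borel_measurable \<kappa>'"
  shows "(\<integral>\<^sup>+U. f (ctransp U) \<partial>\<kappa>) = (\<integral>\<^sup>+V. f V \<partial>\<kappa>')"
proof -
  interpret k: haar \<kappa> by standard fact
  interpret k': haar \<kappa>' by standard fact
  interpret pair_sigma_finite \<kappa> \<kappa>' ..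
  note [measurable] = f
  have f': "f \<in> borel_measurable \<kappa>"
    using f by (simp only: measurable_cong_sets[OF k.sets_eq refl] measurable_cong_sets[OF k'.sets_eq refl])
  have m: "(\<lambda>(U, V). ctransp U ** V) \<in> measurable (\<kappa> \<Otimes>\<^sub>M \<kappa>') \<kappa>'"
    by (rule k'.measurable_into) (auto simp: space_pair_measure intro: unitary_mult)
  have F: "(\<lambda>(U, V). f (ctransp U ** V)) \<in> borel_measurable (\<kappa> \<Otimes>\<^sub>M \<kappa>')"
    using measurable_compose[OF m f] by (simp add: split_beta')
  have c: "(\<lambda>U. f (ctransp U)) \<in> borel_measurable \<kappa>"
    by (rule measurable_compose[OF k.measurable_into f']) auto
  have "(\<integral>\<^sup>+V. f V \<partial>\<kappa>') = (\<integral>\<^sup>+U. (\<integral>\<^sup>+V. f (ctransp U ** V) \<partial>\<kappa>') \<partial>\<kappa>)"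
    by (subst nn_integral_cong[OF k'.nn_integral_left]) (auto simp: k.emeasure_space_1[unfolded k.space_eq])
  also have "\<dots> = (\<integral>\<^sup>+V. (\<integral>\<^sup>+U. f (ctransp U ** V) \<partial>\<kappa>) \<partial>\<kappa>')"
    using Fubini'[OF F] by simp
  also have "\<dots> = (\<integral>\<^sup>+V. (\<integral>\<^sup>+U. f (ctransp (ctransp V ** U)) \<partial>\<kappa>) \<partial>\<kappa>')"
    by (simp add: ctransp_mult)
  also have "\<dots> = (\<integral>\<^sup>+V. (\<integral>\<^sup>+U. f (ctransp U) \<partial>\<kappa>) \<partial>\<kappa>')"
    by (intro nn_integral_cong k.nn_integral_left[OF c]) auto
  also have "\<dots> = (\<integral>\<^sup>+U. f (ctransp U) \<partial>\<kappa>)"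
    by (simp add: k'.emeasure_space_1[unfolded k'.space_eq])
  finally show ?thesis ..
qed

text \<open>Both integrals equal that of the inverse under \<open>\<kappa>\<close>. This identifies
  the law of each unitary factor of the sum with the Haar measure that occurs in the eigenvalue
  part.\<close>

lemma haar_unique:
  fixes \<kappa> \<kappa>' :: "'n::finite cmat measure"
  assumes "haar_unitary \<kappa>" "haar_unitary \<kappa>'"
  shows "\<kappa> = \<kappa>'"
proof (rule measure_eqI)
  interpret k: haar \<kappa> by standard fact
  interpret k': haar \<kappa>' by standard fact
  show sets: "sets \<kappa> = sets \<kappa>'"
    by (simp only: k.sets_eq k'.sets_eq)
  fix A assume A: "A \<in> sets \<kappa>"
  then have i: "indicator A \<in> borel_measurable \<kappa>" "(indicator A :: _ \<Rightarrow> ennreal) \<in> borel_measurable \<kappa>'"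
    using sets by auto
  have "(\<integral>\<^sup>+U. indicator A U \<partial>\<kappa>) = (\<integral>\<^sup>+U. indicator A U \<partial>\<kappa>')"
    using haar_nn_integral_ctransp[OF assms(1,1) i(1)] haar_nn_integral_ctransp[OF assms i(2)] by simp
  then show "emeasure \<kappa> A = emeasure \<kappa>' A"
    using A sets by simp
qed

context haar
begin

lemma nn_integral_ctransp:
  "f \<in> borel_measurable \<kappa> \<Longrightarrow> (\<integral>\<^sup>+U. f (ctransp U) \<partial>\<kappa>) = (\<integral>\<^sup>+U. f U \<partial>\<kappa>)"
  by (rule haar_nn_integral_ctransp[OF haar haar])

text \<open>Inversion turns right multiplication into left multiplication.\<close>

lemma nn_integral_right:
  assumes f: "f \<in> borel_measurable \<kappa>" and V: "V \<in> unitary_group"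
  shows "(\<integral>\<^sup>+U. f (U ** V) \<partial>\<kappa>) = (\<integral>\<^sup>+U. f U \<partial>\<kappa>)"
proof -
  have c: "(\<lambda>U. f (ctransp U)) \<in> borel_measurable \<kappa>" "(\<lambda>U. f (U ** V)) \<in> borel_measurable \<kappa>"
    using V by (auto intro!: measurable_compose[OF measurable_into f] unitary_mult)
  have "(\<integral>\<^sup>+U. f (U ** V) \<partial>\<kappa>) = (\<integral>\<^sup>+U. f (ctransp U ** V) \<partial>\<kappa>)"
    by (rule nn_integral_ctransp[OF c(2), symmetric])
  also have "\<dots> = (\<integral>\<^sup>+U. f (ctransp (ctransp V ** U)) \<partial>\<kappa>)"
    by (simp add: ctransp_mult)
  also have "\<dots> = (\<integral>\<^sup>+U. f (ctransp U) \<partial>\<kappa>)"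
    using V by (intro nn_integral_left c) auto
  also have "\<dots> = (\<integral>\<^sup>+U. f U \<partial>\<kappa>)"
    by (rule nn_integral_ctransp[OF f])
  finally show ?thesis .
qed

lemma distr_ctransp: "distr \<kappa> \<kappa> ctransp = \<kappa>"
proof (rule measure_eqI)
  have m: "ctransp \<in> measurable \<kappa> \<kappa>"
    by (rule measurable_into) auto
  fix A assume "A \<in> sets (distr \<kappa> \<kappa> ctransp)"
  then have A: "A \<in> sets \<kappa>"
    by simp
  then have i: "(indicator A :: _ \<Rightarrow> ennreal) \<in> borel_measurable \<kappa>"
    by simp
  have "emeasure (distr \<kappa> \<kappa> ctransp) A = (\<integral>\<^sup>+U. indicator A U \<partial>(distr \<kappa> \<kappa> ctransp))"
    using A by simp
  also have "\<dots> = (\<integral>\<^sup>+U. indicator A (ctransp U) \<partial>\<kappa>)"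
    using m i by (intro nn_integral_distr) auto
  also have "\<dots> = (\<integral>\<^sup>+U. indicator A U \<partial>\<kappa>)"
    by (rule nn_integral_ctransp[OF i])
  finally show "emeasure (distr \<kappa> \<kappa> ctransp) A = emeasure \<kappa> A"
    using A by simp
qed simp

end

subsection \<open>The conjugation orbit map in Cayley coordinates\<close>

text \<open>
  The unitary matrix is \<open>2 (1 - K)\<^sup>-\<^sup>1 - 1\<close>, the Cayley transform of \<open>K\<close>.
\<close>
lemma cayley:
  fixes K :: "'n::finite cmat"
  assumes K: "ctransp K = - K"
  obtains R where "R ** (mat 1 - K) = mat 1" "(mat 1 - K) ** R = mat 1"
    "2 *\<^sub>R R - mat 1 \<in> unitary_group"
proof -
  have "x = 0" if "(mat 1 - K) *v x = 0" for x :: "complex^'n"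
  proof -
    have x: "K *v x = x"
      using that by (simp add: matrix_vector_mult_diff_rdistrib)
    \<comment> \<open>The Hermitian form of the skew-Hermitian \<open>K\<close> at \<open>x\<close>
      is purely imaginary, yet at a fixed vector of \<open>K\<close> it is the real number
      \<open>|x|^2\<close>. Written out, \<open>s = - s\<close>.\<close>
    define s where "s = (\<Sum>i\<in>UNIV. cnj (x $ i) * x $ i)"
    have "s = (\<Sum>i\<in>UNIV. cnj (x $ i) * (K *v x) $ i)"
      by (simp add: s_def x)
    also have "\<dots> = (\<Sum>i\<in>UNIV. \<Sum>j\<in>UNIV. cnj (x $ i) * (K $ i $ j * x $ j))"
      by (simp add: matrix_vector_mult_def sum_distrib_left)
    also have "\<dots> = (\<Sum>j\<in>UNIV. \<Sum>i\<in>UNIV. cnj (x $ i) * (K $ i $ j * x $ j))"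
      by (rule sum.swap)
    also have "\<dots> = (\<Sum>j\<in>UNIV. \<Sum>i\<in>UNIV. - (cnj (K $ j $ i * x $ i) * x $ j))"
    proof (intro sum.cong refl)
      fix i j
      have "cnj (K $ j $ i) = - K $ i $ j"
        using arg_cong[OF K, of "\<lambda>A. A $ i $ j"] by simp
      then show "cnj (x $ i) * (K $ i $ j * x $ j) = - (cnj (K $ j $ i * x $ i) * x $ j)"
        by simp
    qed
    also have "\<dots> = - (\<Sum>j\<in>UNIV. cnj ((K *v x) $ j) * x $ j)"
      by (simp add: matrix_vector_mult_def sum_distrib_right sum_negf)
    also have "\<dots> = - s"
      by (simp add: s_def x)
    finally have "s = 0"
      by simp
    moreover have "s = complex_of_real (\<Sum>i\<in>UNIV. (cmod (x $ i))\<^sup>2)"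
      unfolding s_def of_real_sum by (simp only: complex_norm_square mult.commute)
    ultimately have "(\<Sum>i\<in>UNIV. (cmod (x $ i))\<^sup>2) = 0"
      by (simp only: of_real_eq_0_iff)
    then show "x = 0"
      by (simp add: sum_nonneg_eq_0_iff vec_eq_iff)
  qed
  then obtain R where R: "R ** (mat 1 - K) = mat 1"
    using matrix_left_invertible_ker[of "mat 1 - K"] by blast
  then have R': "(mat 1 - K) ** R = mat 1"
    by (simp add: matrix_left_right_inverse)
  have Rc: "ctransp R ** (mat 1 + K) = mat 1"
    using arg_cong[OF R', of ctransp] K by (simp add: ctransp_mult ctransp_diff)
  have "ctransp R = ctransp R ** ((mat 1 - K) ** R)" "R = (ctransp R ** (mat 1 + K)) ** R"
    by (simp_all add: R' Rc)
  then have "ctransp R + R = ctransp R ** ((mat 1 - K) ** R) + ctransp R ** ((mat 1 + K) ** R)"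
    by (metis matrix_mul_assoc)
  also have "\<dots> = ctransp R ** ((2 *\<^sub>R mat 1) ** R)"
    unfolding matrix_mult_add_right[symmetric] matrix_mult_add_left[symmetric] by (simp add: scaleR_2)
  also have "\<dots> = 2 *\<^sub>R (ctransp R ** R)"
    by (simp add: matrix_mult_scaleR_left matrix_mult_scaleR_right)
  finally have sum: "ctransp R + R = 2 *\<^sub>R (ctransp R ** R)" .
  have "ctransp (2 *\<^sub>R R - mat 1) ** (2 *\<^sub>R R - mat 1)
      = 2 *\<^sub>R (2 *\<^sub>R (ctransp R ** R)) - 2 *\<^sub>R (ctransp R + R) + mat 1"
    by (simp add: ctransp_diff ctransp_scaleR matrix_mult_diff_left matrix_mult_diff_right
        matrix_mult_scaleR_left matrix_mult_scaleR_right algebra_simps)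
  then have "2 *\<^sub>R R - mat 1 \<in> unitary_group"
    by (intro unitary_groupI) (simp add: sum)
  then show ?thesis
    using that R R' by blast
qed

lemma norm_cmat_mono:
  fixes A B :: "complex^'n^'m"
  assumes "\<And>i j. cmod (A $ i $ j) \<le> cmod (B $ i $ j)"
  shows "norm A \<le> norm B"
proof -
  have "(norm A)\<^sup>2 \<le> (norm B)\<^sup>2"
    unfolding norm_cmat_power2 by (intro sum_mono power_mono assms) auto
  then show ?thesis
    by simp
qed

text \<open>The diagonal is left out because diagonal unitary matrices commute with diagonal
  matrices and move nothing. The diagonal coordinates of \<open>p\<close> are thereby free to hold
  the eigenvalues, and the total dimension is exactly N^2.\<close>

definition skew :: "real^('n \<times> 'n) \<Rightarrow> 'n::{finite,linorder} cmat"
  where "skew p = (\<chi> j k. if j = k then 0 else \<i> * herm p $ j $ k)"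

definition diag_part :: "real^('n \<times> 'n) \<Rightarrow> real^'n"
  where "diag_part p = (\<chi> j. p $ (j, j))"

lemma skew_diag [simp]: "skew p $ j $ j = 0"
  by (simp add: skew_def)

lemma ctransp_skew: "ctransp (skew p) = - skew p"
proof -
  have "cnj (herm p $ k $ j) = herm p $ j $ k" for j k
    using arg_cong[OF HermD[OF herm_Herm[of p]], of "\<lambda>A. A $ j $ k"] by simp
  then show ?thesis
    by (simp add: vec_eq_iff skew_def)
qed

lemma abs_coord_le_skew: "j \<noteq> k \<Longrightarrow> \<bar>p $ (j, k) - q $ (j, k)\<bar> \<le> norm (skew p - skew q)"
proof -
  assume "j \<noteq> k"
  then consider "j < k" | "k < j"
    by fastforce
  then show ?thesis
  proof cases
    case 1
    have "\<bar>p $ (j, k) - q $ (j, k)\<bar> = \<bar>Im ((skew p - skew q) $ j $ k)\<bar>"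
      using 1 by (auto simp: skew_def herm_nth)
    also have "\<dots> \<le> norm (skew p - skew q)"
      by (rule order.trans[OF abs_Im_le_cmod norm_entry_le])
    finally show ?thesis .
  next
    case 2
    have "\<bar>p $ (j, k) - q $ (j, k)\<bar> = \<bar>Re ((skew p - skew q) $ k $ j)\<bar>"
      using 2 by (auto simp: skew_def herm_nth)
    also have "\<dots> \<le> norm (skew p - skew q)"
      by (rule order.trans[OF abs_Re_le_cmod norm_entry_le])
    finally show ?thesis .
  qed
qed

lemma norm_vec_le_sum: "norm (x :: 'a::real_normed_vector^'n) \<le> (\<Sum>i\<in>UNIV. norm (x $ i))"
  unfolding norm_vec_def by (rule L2_set_le_sum) simp

lemma norm_skew_le:
  assumes "\<And>j k. j \<noteq> k \<Longrightarrow> \<bar>p $ (j, k)\<bar> \<le> e" "0 \<le> e"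
  shows "norm (skew (p :: real^('n::{finite,linorder} \<times> 'n))) \<le> 2 * e * real (CARD('n) * CARD('n))"
proof -
  have "norm (skew p) \<le> (\<Sum>i\<in>UNIV. norm (skew p $ i))"
    by (rule norm_vec_le_sum)
  also have "\<dots> \<le> (\<Sum>i\<in>(UNIV::'n set). \<Sum>j\<in>(UNIV::'n set). cmod (skew p $ i $ j))"
    by (intro sum_mono norm_vec_le_sum)
  also have "\<dots> \<le> (\<Sum>i\<in>(UNIV::'n set). \<Sum>j\<in>(UNIV::'n set). 2 * e)"
  proof (intro sum_mono)
    fix j k :: 'n
    show "cmod (skew p $ j $ k) \<le> 2 * e"
    proof (cases "j = k")
      case False
      then have "cmod (skew p $ j $ k) \<le> \<bar>p $ (j, k)\<bar> + \<bar>p $ (k, j)\<bar>"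
        using cmod_le[of "herm p $ j $ k"] by (auto simp: skew_def norm_mult herm_nth)
      then show ?thesis
        using assms(1)[of j k] assms(1)[of k j] False by simp
    qed (use assms in simp)
  qed
  finally show ?thesis
    by (simp add: mult_ac)
qed

text \<open>The inverse of \<open>1 - K\<close>; the Cayley transform itself is
  \<open>2 *\<^sub>R cay K - mat 1\<close>. Existence is provided for skew-Hermitian
  \<open>K\<close>, hence the choice operator.\<close>

definition cay :: "'n::finite cmat \<Rightarrow> 'n cmat"
  where "cay K = (SOME R. R ** (mat 1 - K) = mat 1 \<and> (mat 1 - K) ** R = mat 1 \<and>
    2 *\<^sub>R R - mat 1 \<in> unitary_group)"

lemma cay_skew:
  "cay (skew p) ** (mat 1 - skew p) = mat 1" "(mat 1 - skew p) ** cay (skew p) = mat 1"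
  "2 *\<^sub>R cay (skew p) - mat 1 \<in> unitary_group"
proof -
  have "\<exists>R. R ** (mat 1 - skew p) = mat 1 \<and> (mat 1 - skew p) ** R = mat 1 \<and> 2 *\<^sub>R R - mat 1 \<in> unitary_group"
    using cayley[OF ctransp_skew] by metis
  from someI_ex[OF this] show "cay (skew p) ** (mat 1 - skew p) = mat 1"
    "(mat 1 - skew p) ** cay (skew p) = mat 1" "2 *\<^sub>R cay (skew p) - mat 1 \<in> unitary_group"
    by (auto simp: cay_def)
qed

lemma norm_mat_1_ge: "1 \<le> norm (mat 1 :: 'n::finite cmat)"
  using norm_entry_le[of "mat 1 :: 'n cmat" undefined undefined] by (simp add: mat_def)

text \<open>From \<open>R - 1 = K R\<close> the norm of \<open>R - 1\<close> is at most
  \<open>e * (|R - 1| + |1|)\<close>, and \<open>e \<le> 1 / 2\<close> absorbs the first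
  term.\<close>

lemma cay_near_1:
  fixes p :: "real^('n::{finite,linorder} \<times> 'n)"
  assumes e: "norm (skew p) \<le> e" "e \<le> 1 / 2"
  shows "norm (cay (skew p) - mat 1) \<le> 2 * e * norm (mat 1 :: 'n cmat)"
proof -
  let ?R = "cay (skew p)" and ?s = "norm (mat 1 :: 'n cmat)"
  have "?R - mat 1 = skew p ** ?R"
    using cay_skew(2)[of p] by (simp add: matrix_mult_diff_left algebra_simps)
  then have "norm (?R - mat 1) \<le> norm (skew p) * norm ?R"
    by (simp add: norm_matrix_mult_le)
  also have "\<dots> \<le> e * (norm (?R - mat 1) + ?s)"
    using e norm_triangle_ineq[of "?R - mat 1" "mat 1"] by (intro mult_mono order.trans[OF norm_ge_zero e(1)]) auto
  finally have 1: "norm (?R - mat 1) \<le> e * norm (?R - mat 1) + e * ?s"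
    by (simp add: algebra_simps)
  have "e * norm (?R - mat 1) \<le> 1 / 2 * norm (?R - mat 1)"
    using e by (intro mult_right_mono) auto
  then show ?thesis
    using 1 by simp
qed

text \<open>The derivative of the Cayley transform at 0 is multiplication by 2; the resolvent
  identity \<open>R' - R = R' \<Delta> R\<close> makes this quantitative. With
  \<open>s = |1|\<close>, the errors add up to \<open>16 * e * s * (s + 1)\<close> times the norm of
  \<open>\<Delta>\<close>, and the constant 32 brings this down to one half.\<close>

lemma cayley_relative:
  fixes p q :: "real^('n::{finite,linorder} \<times> 'n)"
  assumes pq: "norm (skew p) \<le> e" "norm (skew q) \<le> e"
    and small: "32 * e * norm (mat 1 :: 'n cmat) * (norm (mat 1 :: 'n cmat) + 1) \<le> 1"
  shows "norm (ctransp (2 *\<^sub>R cay (skew p) - mat 1) ** (2 *\<^sub>R cay (skew q) - mat 1) - mat 1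
      - 2 *\<^sub>R (skew q - skew p)) \<le> norm (skew q - skew p) / 2"
proof -
  let ?s = "norm (mat 1 :: 'n cmat)"
  define R R' C \<Delta> where "R = cay (skew p)" and "R' = cay (skew q)" and "C = 2 *\<^sub>R R - mat 1"
    and "\<Delta> = skew q - skew p"
  have s: "1 \<le> ?s"
    by (rule norm_mat_1_ge)
  have e0: "0 \<le> e"
    using pq(1) norm_ge_zero order.trans by blast
  have "32 * e * 1 * 2 \<le> 32 * e * ?s * (?s + 1)"
    using s e0 by (intro mult_mono) auto
  then have e: "e \<le> 1 / 2"
    using small by simp
  have es: "2 * e * ?s * 1 \<le> 2 * e * ?s * (?s + 1)"
    using s e0 by (intro mult_left_mono) auto
  have R: "norm (R - mat 1) \<le> 2 * e * ?s" "norm (R' - mat 1) \<le> 2 * e * ?s"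
    unfolding R_def R'_def using pq e by (auto intro: cay_near_1)
  have nR: "norm R \<le> ?s + 1"
    using norm_triangle_ineq[of "R - mat 1" "mat 1"] R(1) es small by simp
  have C: "C \<in> unitary_group"
    unfolding C_def R_def by (rule cay_skew)
  have R'R: "R' - R = R' ** \<Delta> ** R"
  proof -
    have "R' ** \<Delta> ** R = R' ** (mat 1 - skew p) ** R - R' ** (mat 1 - skew q) ** R"
      unfolding \<Delta>_def by (simp add: matrix_mult_diff_left matrix_mult_diff_right)
    also have "R' ** (mat 1 - skew p) ** R = R'"
      using cay_skew(2)[of p] by (simp add: R_def matrix_mul_assoc[symmetric])
    also have "R' ** (mat 1 - skew q) ** R = R"
      using cay_skew(1)[of q] by (simp add: R'_def)
    finally show ?thesis ..
  qed
  have "ctransp C ** (2 *\<^sub>R R' - mat 1) - mat 1 = ctransp C ** (2 *\<^sub>R R' - mat 1) - ctransp C ** C"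
    using C by (simp add: unitary_groupD)
  also have "\<dots> = ctransp C ** (2 *\<^sub>R (R' - R))"
    by (simp add: matrix_mult_diff_right[symmetric] C_def scaleR_diff_right)
  also have "\<dots> = 2 *\<^sub>R ((ctransp C ** R') ** \<Delta> ** R)"
    by (simp add: R'R matrix_mult_scaleR_right matrix_mul_assoc)
  finally have V: "ctransp C ** (2 *\<^sub>R R' - mat 1) - mat 1 - 2 *\<^sub>R \<Delta>
      = 2 *\<^sub>R ((ctransp C ** R' - mat 1) ** \<Delta> ** R + \<Delta> ** (R - mat 1))"
    by (simp add: matrix_mult_diff_left matrix_mult_diff_right algebra_simps scaleR_diff_right)
  have P: "norm (ctransp C ** R' - mat 1) \<le> 6 * e * ?s"
  proof -
    have "ctransp C ** R' - mat 1 = ctransp C ** (R' - mat 1) + ctransp (C - mat 1)"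
      by (simp add: matrix_mult_diff_right ctransp_diff)
    also have "norm \<dots> \<le> norm (R' - mat 1) + norm (C - mat 1)"
      using C by (intro order.trans[OF norm_triangle_ineq]) (simp add: del: ctransp_diff)
    also have "C - mat 1 = 2 *\<^sub>R (R - mat 1)"
      by (simp add: C_def scaleR_diff_right scaleR_2)
    also have "norm \<dots> = 2 * norm (R - mat 1)"
      by simp
    finally show ?thesis
      using R by simp
  qed
  have "norm ((ctransp C ** R' - mat 1) ** \<Delta> ** R) \<le> norm ((ctransp C ** R' - mat 1) ** \<Delta>) * norm R"
    by (rule norm_matrix_mult_le)
  also have "\<dots> \<le> (norm (ctransp C ** R' - mat 1) * norm \<Delta>) * norm R"
    by (intro mult_right_mono norm_matrix_mult_le) auto
  also have "\<dots> \<le> (6 * e * ?s * norm \<Delta>) * (?s + 1)"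
    using P nR e0 by (intro mult_mono) auto
  finally have 1: "norm ((ctransp C ** R' - mat 1) ** \<Delta> ** R) \<le> norm \<Delta> * (6 * e * ?s * (?s + 1))"
    by (simp add: mult_ac)
  have "norm (\<Delta> ** (R - mat 1)) \<le> norm \<Delta> * norm (R - mat 1)"
    by (rule norm_matrix_mult_le)
  also have "\<dots> \<le> norm \<Delta> * (2 * e * ?s * (?s + 1))"
    using R(1) es by (intro mult_left_mono) auto
  finally have 2: "norm (\<Delta> ** (R - mat 1)) \<le> norm \<Delta> * (2 * e * ?s * (?s + 1))" .
  have "norm (ctransp C ** (2 *\<^sub>R R' - mat 1) - mat 1 - 2 *\<^sub>R \<Delta>)
      \<le> 2 * (norm ((ctransp C ** R' - mat 1) ** \<Delta> ** R) + norm (\<Delta> ** (R - mat 1)))"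
    unfolding V norm_scaleR by (intro mult_mono norm_triangle_ineq) auto
  also have "\<dots> \<le> 2 * (norm \<Delta> * (8 * e * ?s * (?s + 1)))"
    using add_mono[OF 1 2] by (simp add: algebra_simps)
  also have "\<dots> \<le> 2 * (norm \<Delta> * (1 / 4))"
    using small by (intro mult_left_mono) auto
  finally show ?thesis
    by (simp add: C_def R_def R'_def \<Delta>_def)
qed

text \<open>The diagonal of \<open>p\<close> holds the eigenvalues; the off-diagonal coordinates
  hold the unitary matrix, with 0 for the identity.\<close>

definition orbit :: "real^('n \<times> 'n) \<Rightarrow> 'n::{finite,linorder} cmat"
  where "orbit p = (2 *\<^sub>R cay (skew p) - mat 1) ** diag_mat (diag_part p) **
    ctransp (2 *\<^sub>R cay (skew p) - mat 1)"

lemma orbit_Herm [simp]: "orbit p \<in> Herm"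
  unfolding orbit_def by (intro Herm_conj) simp

text \<open>
  With \<open>V\<close> the relative unitary, \<open>orbit p - orbit q\<close> is unitarily equivalent to \<open>D V - V D'\<close>,
  whose entries are \<open>(d i - d' j) V i j\<close>.
\<close>
lemma orbit_expanding:
  fixes p q :: "real^('n::{finite,linorder} \<times> 'n)"
  assumes pq: "norm (skew p) \<le> e" "norm (skew q) \<le> e"
    and small: "32 * e * norm (mat 1 :: 'n cmat) * (norm (mat 1 :: 'n cmat) + 1) \<le> 1"
    and gap: "\<And>i j. i \<noteq> j \<Longrightarrow> g \<le> \<bar>diag_part p $ i - diag_part q $ j\<bar>" and g: "0 < g"
  shows "norm (p - q) \<le> real (CARD('n \<times> 'n)) * (2 + 1 / g) * norm (orbit p - orbit q)"
proof -
  define C C' \<Delta> V d d' where "C = 2 *\<^sub>R cay (skew p) - mat 1" and "C' = 2 *\<^sub>R cay (skew q) - mat 1"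
    and "\<Delta> = skew q - skew p" and "V = ctransp C ** C'" and "d = diag_part p" and "d' = diag_part q"
  define E where "E = V - mat 1 - 2 *\<^sub>R \<Delta>"
  define M where "M = orbit p - orbit q"
  define M' where "M' = diag_mat d ** V - V ** diag_mat d'"
  have E: "norm E \<le> norm \<Delta> / 2"
    unfolding E_def V_def C_def C'_def \<Delta>_def by (rule cayley_relative[OF pq small])
  have U: "C \<in> unitary_group" "C' \<in> unitary_group"
    unfolding C_def C'_def by (rule cay_skew)+
  have "ctransp C ** M ** C' = (ctransp C ** C) ** diag_mat d ** (ctransp C ** C') - (ctransp C ** C') ** diag_mat d' ** (ctransp C' ** C')"
    unfolding M_def orbit_def C_def[symmetric] C'_def[symmetric] d_def[symmetric] d'_def[symmetric]
    by (simp add: matrix_mult_diff_left matrix_mult_diff_right matrix_mul_assoc)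
  then have "ctransp C ** M ** C' = M'"
    using U by (simp add: M'_def V_def unitary_groupD)
  then have nM: "norm M' = norm M"
    using U norm_mult_unitary[of C' "ctransp C ** M"] by simp
  have entry: "M' $ i $ j = of_real (d $ i - d' $ j) * V $ i $ j" for i j
    by (simp add: M'_def diag_mat_mult_nth mult_diag_mat_nth algebra_simps)
  \<comment> \<open>\<open>\<Delta>\<close> has zero diagonal, so the off-diagonal part of
    \<open>V\<close> is \<open>2 \<Delta>\<close> up to \<open>O2\<close>, an error of at most half
    the norm of \<open>\<Delta>\<close>.\<close>
  define O1 O2 :: "'n cmat" where "O1 = (\<chi> i j. if i = j then 0 else V $ i $ j)"
    and "O2 = (\<chi> i j. if i = j then 0 else E $ i $ j)"
  have \<Delta>_le: "norm \<Delta> \<le> norm M / g"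
  proof -
    have "O1 = 2 *\<^sub>R \<Delta> + O2"
      by (auto simp: O1_def O2_def E_def \<Delta>_def vec_eq_iff mat_def)
    then have "2 * norm \<Delta> \<le> norm O1 + norm O2"
      using norm_triangle_ineq4[of O1 O2] by simp
    moreover have "norm O2 \<le> norm E"
      by (rule norm_cmat_mono) (simp add: O2_def)
    ultimately have "norm \<Delta> \<le> norm O1"
      using E norm_ge_zero[of \<Delta>] by linarith
    moreover have "norm (g *\<^sub>R O1) \<le> norm M'"
    proof (rule norm_cmat_mono)
      fix i j
      show "cmod ((g *\<^sub>R O1) $ i $ j) \<le> cmod (M' $ i $ j)"
        unfolding entry using gap[of i j] g by (auto simp: O1_def norm_mult d_def d'_def simp del: of_real_diff intro!: mult_right_mono)
    qed
    ultimately show ?thesis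
      using g nM by (simp add: field_simps mult_left_mono order.trans[OF mult_left_mono[of "norm \<Delta>" "norm O1" g]])
  qed
  have \<Delta>1: "norm \<Delta> \<le> 1"
  proof -
    have s: "1 \<le> norm (mat 1 :: 'n cmat)"
      by (rule norm_mat_1_ge)
    have e0: "0 \<le> e"
      using pq(1) norm_ge_zero order.trans by blast
    have "32 * e * 1 * 2 \<le> 32 * e * norm (mat 1 :: 'n cmat) * (norm (mat 1 :: 'n cmat) + 1)"
      using s e0 by (intro mult_mono) auto
    then have "e \<le> 1 / 2"
      using small by simp
    then show ?thesis
      using norm_triangle_ineq4[of "skew q" "skew p"] pq by (simp add: \<Delta>_def)
  qed
  \<comment> \<open>The diagonal entries of \<open>V\<close> differ from 1 by at most 1/2, so
    \<open>M'\<close> also controls the differences of eigenvalues in equal positions.\<close>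
  have diag_le: "\<bar>d $ i - d' $ i\<bar> \<le> 2 * norm M" for i
  proof -
    have "V $ i $ i = 1 + E $ i $ i"
      by (simp add: E_def \<Delta>_def mat_def)
    moreover have "cmod (E $ i $ i) \<le> 1 / 2"
      using norm_entry_le[of E i i] E \<Delta>1 by simp
    ultimately have "1 / 2 \<le> cmod (V $ i $ i)"
      using norm_triangle_ineq4[of "1 + E $ i $ i" "E $ i $ i"] by simp
    then have "\<bar>d $ i - d' $ i\<bar> * (1 / 2) \<le> \<bar>d $ i - d' $ i\<bar> * cmod (V $ i $ i)"
      by (rule mult_left_mono) simp
    also have "\<dots> = cmod (M' $ i $ i)"
      unfolding entry norm_mult norm_of_real ..
    also have "\<dots> \<le> norm M"
      unfolding nM[symmetric] by (rule norm_entry_le)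
    finally show ?thesis
      by simp
  qed
  have coord: "\<bar>(p - q) $ x\<bar> \<le> (2 + 1 / g) * norm M" for x
  proof (cases x)
    case (Pair j k)
    show ?thesis
    proof (cases "j = k")
      case True
      then have "\<bar>(p - q) $ x\<bar> \<le> 2 * norm M"
        using diag_le[of j] Pair by (simp add: d_def d'_def diag_part_def)
      also have "\<dots> \<le> (2 + 1 / g) * norm M"
        using g by (intro mult_right_mono) auto
      finally show ?thesis .
    next
      case False
      then have "\<bar>(p - q) $ x\<bar> \<le> norm \<Delta>"
        using abs_coord_le_skew[of j k q p] Pair by (simp add: \<Delta>_def abs_minus_commute)
      also have "\<dots> \<le> (1 / g) * norm M"
        using \<Delta>_le by simp
      also have "\<dots> \<le> (2 + 1 / g) * norm M"
        by (intro mult_right_mono) auto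
      finally show ?thesis .
    qed
  qed
  have "norm (p - q) \<le> (\<Sum>x\<in>UNIV. \<bar>(p - q) $ x\<bar>)"
    by (rule norm_le_l1_cart)
  also have "\<dots> \<le> (\<Sum>x\<in>(UNIV :: ('n \<times> 'n) set). (2 + 1 / g) * norm M)"
    by (intro sum_mono coord)
  finally show ?thesis
    by (simp add: M_def mult_ac)
qed

section \<open>Absolute continuity under random conjugation\<close>

lemma negligible_borel_iff: "S \<in> sets borel \<Longrightarrow> negligible S \<longleftrightarrow> emeasure lborel S = 0"
  unfolding negligible_iff_null_sets by (subst null_sets_completion_iff) (auto simp: null_sets_def)

lemma measurable_diag_part [measurable]: "diag_part \<in> borel_measurable borel"
proof (rule borel_measurable_continuous_onI)
  show "continuous_on UNIV diag_part"
    unfolding diag_part_def by (intro continuous_intros)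
qed

lemma negligible_linear_image:
  fixes f :: "'a::euclidean_space \<Rightarrow> 'a"
  assumes "linear f" "negligible N"
  shows "negligible (f ` N)"
proof (rule negligible_locally_Lipschitz_image[OF order.refl assms(2)])
  fix x
  obtain B where "\<And>y. norm (f y) \<le> B * norm y"
    using linear_bounded[OF assms(1)] by blast
  then have "\<forall>y\<in>N \<inter> UNIV. norm (f y - f x) \<le> B * norm (y - x)"
    by (simp add: linear_diff[OF assms(1), symmetric])
  then show "\<exists>T B. open T \<and> x \<in> T \<and> (\<forall>y\<in>N \<inter> T. norm (f y - f x) \<le> B * norm (y - x))"
    by blast
qed

text \<open>With the coordinates split into diagonal and off-diagonal ones, the null set is the
  product of \<open>Q\<close> with a cube of positive volume.\<close>

lemma emeasure_lborel_diag_part: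
  fixes Q :: "(real^'n::{finite,linorder}) set"
  assumes Q: "Q \<in> sets borel" and \<delta>: "0 < \<delta>"
    and null: "emeasure lborel {p :: real^('n \<times> 'n). diag_part p \<in> Q \<and> (\<forall>j k. j \<noteq> k \<longrightarrow> \<bar>p $ (j, k)\<bar> < \<delta>)} = 0"
  shows "emeasure lborel Q = 0"
proof -
  interpret product_sigma_finite "\<lambda>_::'n \<times> 'n. lborel :: real measure" by standard
  define I J :: "('n \<times> 'n) set" where "I = range (\<lambda>j. (j, j))" and "J = - I"
  have IJ: "I \<inter> J = {}" "I \<union> J = UNIV" "finite I" "finite J"
    by (auto simp: J_def)
  have bij: "bij_betw (\<lambda>j. (j, j)) UNIV I"
    by (auto simp: bij_betw_def I_def inj_def)
  let ?P = "\<lambda>K. \<Pi>\<^sub>M p\<in>K. lborel :: real measure"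
  interpret J: sigma_finite_measure "?P J"
    by (rule sigma_finite) (rule IJ)
  note vec = lborel_vec_reindex[OF bij_betw_id[of "UNIV :: ('n \<times> 'n) set"], unfolded id_apply]
  note dia = lborel_vec_reindex[OF bij]
  define S where "S = {p :: real^('n \<times> 'n). diag_part p \<in> Q \<and> (\<forall>j k. j \<noteq> k \<longrightarrow> \<bar>p $ (j, k)\<bar> < \<delta>)}"
  have S: "S \<in> sets borel"
    unfolding S_def using Q by measurable
  define Q' where "Q' = (\<lambda>f. \<chi> j. f (j, j)) -` Q \<inter> space (?P I)"
  have Q': "Q' \<in> sets (?P I)" "emeasure (?P I) Q' = emeasure lborel Q"
    using dia(1) Q unfolding Q'_def dia(2)[symmetric] by (auto simp: emeasure_distr)
  define box where "box = (\<Pi>\<^sub>E p\<in>J. {- \<delta><..<\<delta>})"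
  have box: "box \<in> sets (?P J)" "emeasure (?P J) box = (\<Prod>p\<in>J. ennreal (2 * \<delta>))"
    unfolding box_def using IJ \<delta> by (auto simp: emeasure_PiM)
  have "0 = emeasure (?P UNIV) ((\<lambda>f. \<chi> p. f p) -` S \<inter> space (?P UNIV))"
    using null S unfolding S_def[symmetric] vec(2)[symmetric] by (simp add: emeasure_distr[OF vec(1)])
  also have "\<dots> = emeasure (?P I \<Otimes>\<^sub>M ?P J) (merge I J -` ((\<lambda>f. \<chi> p. f p) -` S \<inter> space (?P UNIV)) \<inter> space (?P I \<Otimes>\<^sub>M ?P J))"
    using measurable_sets[OF vec(1) S]
    by (subst distr_merge[OF IJ(1,3,4), unfolded IJ(2), symmetric])
      (rule emeasure_distr, auto simp: IJ(2)[symmetric])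
  also have "merge I J -` ((\<lambda>f. \<chi> p. f p) -` S \<inter> space (?P UNIV)) \<inter> space (?P I \<Otimes>\<^sub>M ?P J) = Q' \<times> box"
  proof -
    have d: "merge I J (f, g) (j, j) = f (j, j)" for f g :: "'n \<times> 'n \<Rightarrow> real" and j
      by (simp add: merge_def I_def)
    have o: "merge I J (f, g) (j, k) = g (j, k)" if "j \<noteq> k" for f g :: "'n \<times> 'n \<Rightarrow> real" and j k
      using that by (auto simp: merge_def I_def J_def)
    have J: "(j, k) \<in> J \<longleftrightarrow> j \<noteq> k" for j k
      by (auto simp: I_def J_def)
    have "(f, g) \<in> merge I J -` ((\<lambda>f. \<chi> p. f p) -` S \<inter> space (?P UNIV)) \<inter> space (?P I \<Otimes>\<^sub>M ?P J)
        \<longleftrightarrow> (f, g) \<in> Q' \<times> box" for f g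
      by (auto simp: S_def diag_part_def d o Q'_def box_def space_pair_measure space_PiM PiE_iff J
          abs_less_iff minus_less_iff)
    then show ?thesis
      by auto
  qed
  also have "emeasure (?P I \<Otimes>\<^sub>M ?P J) (Q' \<times> box) = emeasure (?P I) Q' * emeasure (?P J) box"
    by (rule J.emeasure_pair_measure_Times) (use Q' box in auto)
  finally have "emeasure lborel Q * (\<Prod>p\<in>J. ennreal (2 * \<delta>)) = 0"
    by (simp add: Q' box)
  moreover have "(\<Prod>p\<in>J. ennreal (2 * \<delta>)) \<noteq> 0"
    using \<delta> by simp
  ultimately show ?thesis
    by (simp only: mult_eq_0_iff) auto
qed

text \<open>\<open>F Z\<close>, the probability that a random conjugate of \<open>Z\<close> lies in
  \<open>A\<close>, depends on the conjugacy class only and, by Fubini, vanishes for almost every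
  Hermitian \<open>Z\<close>. Diagonal matrices form a null set among these, so this alone says
  nothing about them; but a non-null set of bad diagonals with distinct entries would be spread by
  \<open>orbit\<close> over a non-null set of bad Hermitian matrices.\<close>

theorem haar_conj_absolutely_continuous:
  fixes \<kappa> :: "'n::{finite,linorder} cmat measure"
  assumes "haar_unitary \<kappa>" and A: "A \<in> sets borel" and null: "emeasure lebesgue_Herm A = 0"
  shows "AE x in lborel. (\<integral>\<^sup>+U. indicator A (U ** diag_mat (x::(real, 'n) vec) ** ctransp U) \<partial>\<kappa>) = 0"
proof -
  interpret haar \<kappa> by standard fact
  interpret P: pair_sigma_finite "lborel :: (real^('n \<times> 'n)) measure" \<kappa> ..
  note [measurable] = A
  define F where "F Z = (\<integral>\<^sup>+U. indicator A (U ** Z ** ctransp U) \<partial>\<kappa>)" for Z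
  have [measurable]: "ctransp \<in> measurable \<kappa> borel"
    by (rule measurable_from) simp
  have F_meas [measurable]: "F \<in> borel_measurable borel"
    unfolding F_def by measurable
  have F_conj: "F (V ** Z ** ctransp V) = F Z" if V: "V \<in> unitary_group" for V Z
  proof -
    have f: "(\<lambda>U. indicator A (U ** Z ** ctransp U) :: ennreal) \<in> borel_measurable \<kappa>"
      by measurable
    have "F (V ** Z ** ctransp V) = (\<integral>\<^sup>+U. indicator A ((U ** V) ** Z ** ctransp (U ** V)) \<partial>\<kappa>)"
      by (simp add: F_def ctransp_mult matrix_mul_assoc)
    then show ?thesis
      unfolding F_def using nn_integral_right[OF f V] by simp
  qed
  define N where "N = {y :: real^('n \<times> 'n). herm y \<in> A}"
  have N_sets: "N \<in> sets borel"
    unfolding N_def by measurable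
  have N: "negligible N"
    using null N_sets unfolding lebesgue_Herm_eq negligible_borel_iff[OF N_sets]
    by (subst (asm) emeasure_distr) (auto simp: N_def vimage_def)
  have conj_null: "(\<integral>\<^sup>+y. indicator A (U ** herm y ** ctransp U) \<partial>lborel) = 0" if U: "U \<in> unitary_group" for U
  proof -
    \<comment> \<open>In coordinates, conjugation by the inverse of \<open>U\<close> is the linear
      map \<open>T'\<close>, and linear images of null sets are null.\<close>
    define T T' where "T y = coords (U ** herm y ** ctransp U)" and "T' y = coords (ctransp U ** herm y ** U)"
      for y :: "real^('n \<times> 'n)"
    have herm_T: "herm (T y) = U ** herm y ** ctransp U" "herm (T' y) = ctransp U ** herm y ** U" for y
      unfolding T_def T'_def by (intro herm_coords Herm_conj Herm_conj' herm_Herm)+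
    have TT': "T (T' y) = y" "T' (T y) = y" for y
      unfolding T_def[of "T' y"] T'_def[of "T y"] herm_T using unitary_conj_cancel[OF U] by simp_all
    have "linear T'"
      unfolding T'_def
      by (intro linear_compose[OF _ linear_coords, unfolded comp_def] linear_compose[OF linear_herm, unfolded comp_def])
        (rule linearI, auto simp: matrix_mult_add_left matrix_mult_add_right matrix_mult_scaleR_left matrix_mult_scaleR_right)
    then have "negligible (T' ` N)"
      using N by (rule negligible_linear_image)
    moreover have "T' ` N = {y. U ** herm y ** ctransp U \<in> A}"
      unfolding N_def herm_T(1)[symmetric] using TT' by (auto simp: image_iff) metis
    moreover have "{y. U ** herm y ** ctransp U \<in> A} \<in> sets borel"
      by measurable
    ultimately have "emeasure lborel {y. U ** herm y ** ctransp U \<in> A} = 0"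
      by (metis negligible_borel_iff)
    moreover have "(\<lambda>y. indicator A (U ** herm y ** ctransp U) :: ennreal) = indicator {y. U ** herm y ** ctransp U \<in> A}"
      by (auto simp: indicator_def)
    ultimately show ?thesis
      by simp
  qed
  have "(\<integral>\<^sup>+y. F (herm y) \<partial>lborel) = (\<integral>\<^sup>+U. (\<integral>\<^sup>+y. indicator A (U ** herm y ** ctransp U) \<partial>lborel) \<partial>\<kappa>)"
    unfolding F_def by (rule P.Fubini'[symmetric]) measurable
  also have "\<dots> = 0"
    using conj_null by (subst nn_integral_cong[of _ _ "\<lambda>_. 0"]) auto
  finally have zero: "(\<integral>\<^sup>+y. F (herm y) \<partial>lborel) = 0" .
  have FH: "(\<lambda>y. F (herm y)) \<in> borel_measurable lborel"
    by measurable
  have AE_F: "AE y in lborel. F (herm y) = 0"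
    using zero unfolding nn_integral_0_iff_AE[OF FH] .
  define N1 where "N1 = {y. F (herm y) \<noteq> 0}"
  have "N1 \<in> sets borel"
    unfolding N1_def by measurable
  moreover have "emeasure lborel N1 = 0"
    using AE_F \<open>N1 \<in> sets borel\<close> by (subst (asm) AE_iff_measurable[of N1]) (auto simp: N1_def)
  ultimately have N1: "negligible N1"
    by (simp add: negligible_borel_iff)
  define Bad where "Bad = {x :: (real, 'n) vec. F (diag_mat x) \<noteq> 0}"
  have Bad_sets [measurable]: "Bad \<in> sets borel"
    unfolding Bad_def by measurable
  define Dist where "Dist = {x :: (real, 'n) vec. \<forall>i j. i \<noteq> j \<longrightarrow> x $ i \<noteq> x $ j}"
  have "negligible (Bad \<inter> Dist)"
  proof (rule locally_negligible_alt[THEN iffD2], rule ballI)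
    fix x0 assume x0: "x0 \<in> Bad \<inter> Dist"
    \<comment> \<open>The 1 keeps \<open>D\<close> nonempty. A third of the minimum is taken because
      \<open>p\<close> and \<open>q\<close> may each move an entry by up to \<open>g\<close>, and a
      gap \<open>g\<close> has to remain.\<close>
    define D where "D = insert 1 ((\<lambda>(i, j). \<bar>x0 $ i - x0 $ j\<bar>) ` {(i, j). i \<noteq> j})"
    define g where "g = Min D / 3"
    have "finite D"
      unfolding D_def by simp
    moreover have "0 < y" if "y \<in> D" for y
      using that x0 by (auto simp: D_def Dist_def)
    ultimately have g: "0 < g" and gap: "i \<noteq> j \<Longrightarrow> 3 * g \<le> \<bar>x0 $ i - x0 $ j\<bar>" for i j
      by (auto simp: g_def D_def intro!: Min_le)
    define B where "B = {x. \<forall>j. \<bar>x $ j - x0 $ j\<bar> < g}"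
    have B_open: "open B"
    proof -
      have "B = (\<Inter>j. {x. \<bar>x $ j - x0 $ j\<bar> < g})"
        by (auto simp: B_def)
      then show ?thesis
        by (auto intro!: open_INT open_Collect_less continuous_intros)
    qed
    let ?s = "norm (mat 1 :: 'n cmat)"
    \<comment> \<open>The largest \<open>e\<close> that \<open>orbit_expanding\<close> admits;
      \<open>\<delta>\<close> below is the matching bound on single coordinates through
      \<open>norm_skew_le\<close>.\<close>
    define e where "e = 1 / (32 * ?s * (?s + 1))"
    have s: "1 \<le> ?s"
      by (rule norm_mat_1_ge)
    have e: "0 < e" "32 * e * ?s * (?s + 1) \<le> 1"
      using s by (auto simp: e_def intro!: mult_pos_pos)
    define \<delta> where "\<delta> = e / (2 * real (CARD('n) * CARD('n)))"
    have \<delta>: "0 < \<delta>"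
      using e by (simp add: \<delta>_def)
    define S where "S = {p :: real^('n \<times> 'n). diag_part p \<in> Bad \<inter> B \<and> (\<forall>j k. j \<noteq> k \<longrightarrow> \<bar>p $ (j, k)\<bar> < \<delta>)}"
    have skew_le: "norm (skew p) \<le> e" if "p \<in> S" for p
    proof -
      have "norm (skew p) \<le> 2 * \<delta> * real (CARD('n) * CARD('n))"
        using that \<delta> by (intro norm_skew_le) (auto simp: S_def less_imp_le)
      then show ?thesis
        by (simp add: \<delta>_def)
    qed
    obtain l where l: "\<And>y :: real^('n \<times> 'n). norm (herm y) \<le> l * norm y"
      using linear_bounded[OF linear_herm] by blast
    define c where "c = real (CARD('n \<times> 'n)) * (2 + 1 / g)"
    have c: "0 \<le> c"
      using g by (simp add: c_def)
    define y where "y p = coords (orbit p)" for p :: "real^('n \<times> 'n)"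
    have expand: "norm (p - q) \<le> (c * l) * norm (y p - y q)" if pq: "p \<in> S" "q \<in> S" for p q
    proof -
      have "norm (p - q) \<le> c * norm (orbit p - orbit q)"
        unfolding c_def
      proof (rule orbit_expanding[OF skew_le[OF pq(1)] skew_le[OF pq(2)] e(2) _ g])
        fix i j :: 'n assume "i \<noteq> j"
        then have "3 * g \<le> \<bar>x0 $ i - x0 $ j\<bar>"
          by (rule gap)
        moreover have "\<bar>diag_part p $ i - x0 $ i\<bar> < g" "\<bar>diag_part q $ j - x0 $ j\<bar> < g"
          using pq by (auto simp: S_def B_def)
        ultimately show "g \<le> \<bar>diag_part p $ i - diag_part q $ j\<bar>"
          by linarith
      qed
      also have "orbit p - orbit q = herm (y p - y q)"
        by (simp add: linear_diff[OF linear_herm] y_def herm_coords)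
      also have "c * norm (herm (y p - y q)) \<le> c * (l * norm (y p - y q))"
        using c l by (rule mult_left_mono[rotated])
      finally show ?thesis
        by (simp add: mult.assoc)
    qed
    have inj: "inj_on y S"
      using expand by (intro inj_onI) fastforce
    \<comment> \<open>By \<open>expand\<close> this inverse is Lipschitz on the image of
      \<open>S\<close>, so it carries that null set back to a null set.\<close>
    define f where "f = inv_into S y"
    have f: "f (y p) = p" if "p \<in> S" for p
      unfolding f_def using inj that by simp
    have "y ` S \<subseteq> N1"
    proof (rule image_subsetI)
      fix p assume "p \<in> S"
      then have "F (diag_mat (diag_part p)) \<noteq> 0"
        by (simp add: S_def Bad_def)
      moreover have "F (orbit p) = F (diag_mat (diag_part p))"
        unfolding orbit_def by (intro F_conj cay_skew)
      ultimately show "y p \<in> N1"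
        by (simp add: N1_def y_def herm_coords)
    qed
    then have "negligible (y ` S)"
      using N1 negligible_subset by blast
    then have "negligible (f ` (y ` S))"
    proof (rule negligible_locally_Lipschitz_image[rotated])
      fix x assume "x \<in> y ` S"
      then show "\<exists>T B. open T \<and> x \<in> T \<and> (\<forall>z\<in>y ` S \<inter> T. norm (f z - f x) \<le> B * norm (z - x))"
        using expand f by (intro exI[of _ UNIV] exI[of _ "c * l"]) auto
    qed simp
    moreover have "f ` (y ` S) = S"
      using f by (force simp: image_image)
    ultimately have "negligible S"
      by simp
    moreover have "S \<in> sets borel"
    proof -
      have [measurable]: "B \<in> sets borel"
        using B_open by simp
      show ?thesis
        unfolding S_def by measurable
    qed
    ultimately have "emeasure lborel S = 0"
      by (simp add: negligible_borel_iff)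
    then have "emeasure lborel (Bad \<inter> B) = 0"
      unfolding S_def using \<delta> B_open by (intro emeasure_lborel_diag_part[of _ \<delta>]) auto
    then have "negligible (Bad \<inter> B)"
      using B_open by (subst negligible_borel_iff) auto
    then have "negligible (Bad \<inter> Dist \<inter> B)"
      by (rule negligible_subset) auto
    moreover have "openin (top_of_set (Bad \<inter> Dist)) (Bad \<inter> Dist \<inter> B)"
      using B_open by (rule openin_open_Int)
    moreover have "x0 \<in> Bad \<inter> Dist \<inter> B"
      using x0 g by (simp add: B_def)
    ultimately show "\<exists>U. openin (top_of_set (Bad \<inter> Dist)) U \<and> x0 \<in> U \<and> negligible U"
      by blast
  qed
  moreover have "negligible (\<Union>(i, j)\<in>{(i, j). i \<noteq> j}. {x :: (real, 'n) vec. x $ i = x $ j})"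
  proof (rule negligible_Union)
    show "negligible T" if T: "T \<in> (\<lambda>(i, j). {x :: (real, 'n) vec. x $ i = x $ j}) ` {(i, j). i \<noteq> j}" for T
    proof -
      obtain i j :: 'n where ij: "i \<noteq> j" "T = {x. x $ i = x $ j}"
        using T by auto
      have "T = {x. (axis i 1 - axis j 1) \<bullet> x = 0}"
        by (auto simp: ij inner_diff_left inner_axis')
      moreover have "axis i 1 - axis j (1::real) \<noteq> 0"
        using ij by (simp add: axis_eq_axis)
      ultimately show ?thesis
        by (simp add: negligible_hyperplane)
    qed
  qed simp
  ultimately have "negligible (Bad \<inter> Dist \<union> (\<Union>(i, j)\<in>{(i, j). i \<noteq> j}. {x :: (real, 'n) vec. x $ i = x $ j}))"
    by (rule negligible_Un)
  then have "negligible Bad"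
    by (rule negligible_subset) (auto simp: Dist_def)
  then have "emeasure lborel Bad = 0"
    by (simp add: negligible_borel_iff)
  then show ?thesis
    unfolding F_def[symmetric]
    by (subst AE_iff_measurable[of Bad]) (auto simp: Bad_def)
qed

subsection \<open>The exponents of stable laws\<close>

lemma stable_nu_measurable [measurable]: "stable_nu \<alpha> \<in> borel_measurable borel"
  unfolding stable_nu_def by measurable

lemma Re_stable_nu: "Re (stable_nu \<alpha> u) = \<bar>u\<bar> powr \<alpha>"
  by (simp add: stable_nu_def Re_divide_of_real)

text \<open>For \<open>\<alpha> = 1\<close>, \<open>ln (t * |u|) = ln t + ln |u|\<close> leaves a
  term that is linear in \<open>u\<close>. Its linearity is what lets it average to a deterministic
  shift.\<close>

lemma stable_nu_scale:
  assumes "0 < t"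
  shows "stable_nu \<alpha> (t * u) = of_real (t powr \<alpha>) * stable_nu \<alpha> u
    + (if \<alpha> = 1 then \<i> * of_real (2 / pi * t * ln t * u) else 0)"
proof (cases "u = 0")
  case True
  then show ?thesis
    by (simp add: stable_nu_def)
next
  case False
  have [simp]: "sgn (t * u) = sgn u" "\<bar>t * u\<bar> = t * \<bar>u\<bar>"
    using assms by (simp_all add: sgn_mult abs_mult)
  show ?thesis
  proof (cases "\<alpha> = 1")
    case True
    have u: "u = \<bar>u\<bar> * sgn u"
      by (simp add: abs_mult_sgn)
    have "ln (t * \<bar>u\<bar>) = ln t + ln \<bar>u\<bar>"
      using assms False by (simp add: ln_mult)
    then have "stable_nu \<alpha> (t * u) = of_real t * stable_nu \<alpha> u + \<i> * of_real (2 / pi * t * ln t * (\<bar>u\<bar> * sgn u))"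
      using True by (simp add: stable_nu_def algebra_simps)
    then show ?thesis
      using True assms u[symmetric] by simp
  next
    case False
    then show ?thesis
      using assms by (simp add: stable_nu_def powr_mult algebra_simps)
  qed
qed

lemma abs_ln_le: "0 < u \<Longrightarrow> u \<le> 1 \<Longrightarrow> u * \<bar>ln u\<bar> \<le> 2 * sqrt u" for u :: real
proof -
  assume u: "0 < u" "u \<le> 1"
  have "ln (1 / sqrt u) \<le> 1 / sqrt u - 1"
    using u by (intro ln_le_minus_one) simp
  then have "- ln u \<le> 2 * (1 / sqrt u)"
    using u by (simp add: ln_div ln_sqrt)
  then have "u * (- ln u) \<le> u * (2 * (1 / sqrt u))"
    using u by (intro mult_left_mono) auto
  also have "\<dots> = 2 * (u / sqrt u)"
    by simp
  also have "\<dots> = 2 * sqrt u"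
    using u by (simp only: real_div_sqrt less_imp_le)
  finally show ?thesis
    using u by simp
qed

text \<open>The exponent \<open>\<alpha> / 2\<close> for the imaginary part is dictated by
  \<open>\<alpha> = 1\<close>, where \<open>|u|\<close> times its logarithm is not of order
  \<open>|u|\<close> near 0; half the exponent absorbs the logarithm and is taken for all
  \<open>\<alpha>\<close> alike.\<close>

lemma stable_nu_bounds:
  assumes \<alpha>: "0 < \<alpha>" "\<alpha> \<le> 2"
  obtains C where "0 < C" "\<And>u. cmod (stable_nu \<alpha> u) \<le> C * (1 + u\<^sup>2)"
    "\<And>u. \<bar>u\<bar> \<le> 1 \<Longrightarrow> \<bar>Im (stable_nu \<alpha> u)\<bar> \<le> C * \<bar>u\<bar> powr (\<alpha> / 2)"
proof -
  define T where "T = \<bar>tan (pi * \<alpha> / 2)\<bar>"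
  define C where "C = 4 + T"
  have T: "0 \<le> T"
    by (simp add: T_def)
  have pw: "\<bar>u\<bar> powr \<alpha> \<le> 1 + u\<^sup>2" for u
    using powr_le_one_plus_square[of "\<bar>u\<bar>" \<alpha>] \<alpha> by simp
  have Im_le: "\<bar>Im (stable_nu \<alpha> u)\<bar> \<le> (3 + T) * (1 + u\<^sup>2) \<and>
      (\<bar>u\<bar> \<le> 1 \<longrightarrow> \<bar>Im (stable_nu \<alpha> u)\<bar> \<le> C * \<bar>u\<bar> powr (\<alpha> / 2))" for u
  proof (cases "u = 0")
    case True
    then show ?thesis
      using T by (simp add: stable_nu_def)
  next
    case False
    have sgn1: "\<bar>sgn u\<bar> = 1"
      using False by (simp add: abs_sgn_eq)
    show ?thesis
    proof (cases "\<alpha> = 1")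
      case True
      have "Im (stable_nu \<alpha> u) = \<bar>u\<bar> * (2 / pi * (sgn u * ln \<bar>u\<bar>))"
        using True by (simp add: stable_nu_def Im_divide_of_real)
      then have "\<bar>Im (stable_nu \<alpha> u)\<bar> = 2 / pi * (\<bar>u\<bar> * \<bar>ln \<bar>u\<bar>\<bar>)"
        using sgn1 by (simp add: abs_mult)
      also have "\<dots> \<le> 1 * (\<bar>u\<bar> * \<bar>ln \<bar>u\<bar>\<bar>)"
        using pi_ge_two by (intro mult_right_mono) auto
      finally have Im: "\<bar>Im (stable_nu \<alpha> u)\<bar> \<le> \<bar>u\<bar> * \<bar>ln \<bar>u\<bar>\<bar>"
        by simp
      show ?thesis
      proof (cases "\<bar>u\<bar> \<le> 1")
        case u1: True
        have 1: "\<bar>u\<bar> * \<bar>ln \<bar>u\<bar>\<bar> \<le> 2 * sqrt \<bar>u\<bar>"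
          using False u1 by (intro abs_ln_le) auto
        have "2 * sqrt \<bar>u\<bar> \<le> C * \<bar>u\<bar> powr (\<alpha> / 2)"
          using True T False by (simp add: C_def powr_half_sqrt mult_right_mono)
        moreover have "2 * sqrt \<bar>u\<bar> \<le> 2 * 1"
          using u1 by (intro mult_left_mono) auto
        moreover have "2 * 1 \<le> (3 + T) * (1 + u\<^sup>2)"
          using T by (intro mult_mono) auto
        ultimately show ?thesis
          using Im 1 by linarith
      next
        case u2: False
        have "\<bar>ln \<bar>u\<bar>\<bar> \<le> \<bar>u\<bar>"
          using u2 False ln_le_minus_one[of "\<bar>u\<bar>"] by simp
        then have "\<bar>u\<bar> * \<bar>ln \<bar>u\<bar>\<bar> \<le> \<bar>u\<bar> * \<bar>u\<bar>"
          by (intro mult_left_mono) auto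
        also have "\<dots> \<le> 1 * (1 + u\<^sup>2)"
          by (simp add: power2_eq_square)
        also have "\<dots> \<le> (3 + T) * (1 + u\<^sup>2)"
          using T by (intro mult_right_mono) auto
        finally show ?thesis
          using Im u2 by simp
      qed
    next
      case a: False
      have "\<bar>Im (stable_nu \<alpha> u)\<bar> = T * \<bar>u\<bar> powr \<alpha>"
        using a sgn1 by (simp add: stable_nu_def T_def abs_mult)
      moreover have "T * \<bar>u\<bar> powr \<alpha> \<le> (3 + T) * (1 + u\<^sup>2)"
        using T pw by (intro mult_mono) auto
      moreover have "T * \<bar>u\<bar> powr \<alpha> \<le> C * \<bar>u\<bar> powr (\<alpha> / 2)" if "\<bar>u\<bar> \<le> 1"
        using T that \<alpha> False by (intro mult_mono powr_mono') (auto simp: C_def)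
      ultimately show ?thesis
        by simp
    qed
  qed
  have "cmod (stable_nu \<alpha> u) \<le> C * (1 + u\<^sup>2)" for u
  proof -
    have "cmod (stable_nu \<alpha> u) \<le> \<bar>u\<bar> powr \<alpha> + \<bar>Im (stable_nu \<alpha> u)\<bar>"
      using cmod_le[of "stable_nu \<alpha> u"] by (simp add: Re_stable_nu)
    also have "\<dots> \<le> (1 + u\<^sup>2) + (3 + T) * (1 + u\<^sup>2)"
      using pw Im_le by (intro add_mono) auto
    finally show ?thesis
      by (simp add: C_def algebra_simps)
  qed
  then show ?thesis
    using that[of C] Im_le T by (auto simp: C_def)
qed

lemma homogeneous_lower_bound:
  fixes f :: "'a::euclidean_space \<Rightarrow> real"
  assumes cont: "continuous_on (sphere 0 1) f"
    and hom: "\<And>t \<xi>. 0 < t \<Longrightarrow> f (t *\<^sub>R \<xi>) = t powr \<alpha> * f \<xi>"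
    and pos: "\<And>\<xi>. \<xi> \<noteq> 0 \<Longrightarrow> 0 < f \<xi>" and zero: "0 \<le> f 0"
  obtains c where "0 < c" "\<And>\<xi>. c * norm \<xi> powr \<alpha> \<le> f \<xi>"
proof -
  obtain e :: 'a where "norm e = 1"
    using vector_choose_size[of 1] by auto
  then have "sphere 0 1 \<noteq> ({} :: 'a set)"
    by auto
  then obtain x where x: "x \<in> sphere 0 1" "\<And>y. y \<in> sphere 0 1 \<Longrightarrow> f x \<le> f y"
    using continuous_attains_inf[OF compact_sphere _ cont] by blast
  have "f x * norm \<xi> powr \<alpha> \<le> f \<xi>" for \<xi>
  proof (cases "\<xi> = 0")
    case False
    then have "f \<xi> = norm \<xi> powr \<alpha> * f (\<xi> /\<^sub>R norm \<xi>)"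
      using hom[of "norm \<xi>" "\<xi> /\<^sub>R norm \<xi>"] by simp
    moreover have "f x \<le> f (\<xi> /\<^sub>R norm \<xi>)"
      using False by (intro x) simp
    ultimately show ?thesis
      using mult_left_mono[of "f x" "f (\<xi> /\<^sub>R norm \<xi>)" "norm \<xi> powr \<alpha>"] by (simp add: mult.commute)
  qed (use zero in simp)
  moreover have "0 < f x"
    using x by (intro pos) auto
  ultimately show ?thesis
    using that by blast
qed

text \<open>Serves twice: with \<open>M = h\<close> for eigenvalue vectors, and with the product of
  \<open>h\<close> and Haar measure for matrices. The form is homogeneous and, by dominated
  convergence, continuous, so it suffices that it does not vanish on the sphere; a zero integral
  forces \<open>l r \<xi> = 0\<close> almost everywhere, which \<open>pos\<close> excludes.\<close>

lemma stable_form_lower_bound: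
  fixes l :: "'b \<Rightarrow> 'a::euclidean_space \<Rightarrow> real" and \<tau> :: "'a \<Rightarrow> real"
  assumes "finite_measure M" and \<alpha>: "0 < \<alpha>"
    and l_meas: "\<And>\<xi>. (\<lambda>r. l r \<xi>) \<in> borel_measurable M"
    and l_lin: "\<And>r. r \<in> space M \<Longrightarrow> linear (l r)"
    and l_le: "\<And>r \<xi>. r \<in> space M \<Longrightarrow> \<bar>l r \<xi>\<bar> \<le> norm \<xi>"
    and \<tau>: "linear \<tau>" and c0: "0 \<le> c0"
    and pos: "\<And>\<xi>. (AE r in M. l r \<xi> = 0) \<Longrightarrow> c0 = 0 \<or> \<tau> \<xi> = 0 \<Longrightarrow> \<xi> = 0"
  obtains c where "0 < c"
    "\<And>\<xi>. c * norm \<xi> powr \<alpha> \<le> (\<integral>r. \<bar>l r \<xi>\<bar> powr \<alpha> \<partial>M) + c0 * \<bar>\<tau> \<xi>\<bar> powr \<alpha>"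
proof -
  interpret finite_measure M by fact
  note [measurable] = l_meas
  define f where "f \<xi> = (\<integral>r. \<bar>l r \<xi>\<bar> powr \<alpha> \<partial>M) + c0 * \<bar>\<tau> \<xi>\<bar> powr \<alpha>" for \<xi>
  have le: "\<bar>l r \<xi>\<bar> powr \<alpha> \<le> norm \<xi> powr \<alpha>" if "r \<in> space M" for r \<xi>
    using l_le[OF that] \<alpha> by (intro powr_mono2) auto
  have int: "integrable M (\<lambda>r. \<bar>l r \<xi>\<bar> powr \<alpha>)" for \<xi>
    by (rule integrable_const_bound[where B="norm \<xi> powr \<alpha>"]) (auto intro!: AE_I2 le)
  have "continuous_on (sphere 0 1) f"
    unfolding f_def
  proof (intro continuous_on_add continuous_on_mult continuous_on_const)
    show "continuous_on (sphere 0 1) (\<lambda>\<xi>. \<integral>r. \<bar>l r \<xi>\<bar> powr \<alpha> \<partial>M)"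
      unfolding continuous_on_sequentially comp_def
    proof (intro ballI allI impI, elim conjE)
      fix \<xi> and x :: "nat \<Rightarrow> 'a" assume x: "\<forall>n. x n \<in> sphere 0 1" "x \<longlonglongrightarrow> \<xi>"
      show "(\<lambda>n. \<integral>r. \<bar>l r (x n)\<bar> powr \<alpha> \<partial>M) \<longlonglongrightarrow> (\<integral>r. \<bar>l r \<xi>\<bar> powr \<alpha> \<partial>M)"
      proof (rule integral_dominated_convergence[where w="\<lambda>_. 1"])
        show "AE r in M. (\<lambda>n. \<bar>l r (x n)\<bar> powr \<alpha>) \<longlonglongrightarrow> \<bar>l r \<xi>\<bar> powr \<alpha>"
        proof (rule AE_I2)
          fix r assume "r \<in> space M"
          then have "(\<lambda>n. l r (x n)) \<longlonglongrightarrow> l r \<xi>"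
            by (intro bounded_linear.tendsto[OF _ x(2)] linear_conv_bounded_linear[THEN iffD1] l_lin)
          then show "(\<lambda>n. \<bar>l r (x n)\<bar> powr \<alpha>) \<longlonglongrightarrow> \<bar>l r \<xi>\<bar> powr \<alpha>"
            using \<alpha> by (intro tendsto_powr2 tendsto_intros) auto
        qed
        show "AE r in M. norm (\<bar>l r (x n)\<bar> powr \<alpha>) \<le> 1" for n
          using le[of _ "x n"] x(1) by (intro AE_I2) simp
      qed auto
    qed
    show "continuous_on (sphere 0 1) (\<lambda>\<xi>. \<bar>\<tau> \<xi>\<bar> powr \<alpha>)"
      using \<alpha> by (intro continuous_on_powr' continuous_intros linear_continuous_on linear_conv_bounded_linear[THEN iffD1] \<tau>) auto
  qed
  moreover have "f (t *\<^sub>R \<xi>) = t powr \<alpha> * f \<xi>" if t: "0 < t" for t \<xi>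
  proof -
    have "(\<integral>r. \<bar>l r (t *\<^sub>R \<xi>)\<bar> powr \<alpha> \<partial>M) = (\<integral>r. t powr \<alpha> * \<bar>l r \<xi>\<bar> powr \<alpha> \<partial>M)"
      using t by (intro Bochner_Integration.integral_cong refl)
        (simp add: linear_cmul[OF l_lin] abs_mult powr_mult)
    then show ?thesis
      using t by (simp add: f_def linear_cmul[OF \<tau>] abs_mult powr_mult algebra_simps)
  qed
  moreover have "0 \<le> f \<xi>" for \<xi>
    unfolding f_def using c0 by (intro add_nonneg_nonneg Bochner_Integration.integral_nonneg) auto
  moreover have "0 < f \<xi>" if "\<xi> \<noteq> 0" for \<xi>
  proof (rule ccontr)
    assume "\<not> 0 < f \<xi>"
    moreover have "0 \<le> (\<integral>r. \<bar>l r \<xi>\<bar> powr \<alpha> \<partial>M)" "0 \<le> c0 * \<bar>\<tau> \<xi>\<bar> powr \<alpha>"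
      using c0 by (auto intro!: Bochner_Integration.integral_nonneg)
    ultimately have z: "(\<integral>r. \<bar>l r \<xi>\<bar> powr \<alpha> \<partial>M) = 0" "c0 * \<bar>\<tau> \<xi>\<bar> powr \<alpha> = 0"
      unfolding f_def by linarith+
    have "AE r in M. \<bar>l r \<xi>\<bar> powr \<alpha> = 0"
      using z(1) by (subst (asm) integral_nonneg_eq_0_iff_AE[OF int]) auto
    then have "AE r in M. l r \<xi> = 0"
      by eventually_elim simp
    then have "\<xi> = 0"
      by (rule pos) (use z(2) in auto)
    then show False
      using that by simp
  qed
  ultimately obtain c where "0 < c" "\<And>\<xi>. c * norm \<xi> powr \<alpha> \<le> f \<xi>"
    using homogeneous_lower_bound[of f \<alpha>] by metis
  then show ?thesis
    using that by (auto simp: f_def)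
qed

subsection \<open>Absolute continuity\<close>

lemma borel_finite_null_measure: "borel_finite_measure (null_measure borel)"
  by (auto simp: borel_finite_measure_def borel_finite_measure_axioms_def intro!: finite_measureI)

lemma cf_null_measure [simp]: "cf (null_measure borel) \<xi> = 0"
  by (simp add: cf_def)

text \<open>\<open>cf_compare\<close> with two null measures bounds \<open>T\<close> by a multiple
  of Lebesgue measure.\<close>

lemma absolutely_continuousI_cf:
  fixes T :: "'a::euclidean_space measure"
  assumes T: "borel_finite_measure T" and int: "integrable lborel (cf T)"
  shows "absolutely_continuous lborel T"
proof -
  interpret borel_finite_measure T by fact
  have "measure T A = 0" if "A \<in> sets borel" "emeasure lborel A = 0" for A
  proof -
    have "measure T A \<le> measure (null_measure borel) A
        + (\<integral>\<xi>. norm (cf T \<xi>) \<partial>lborel) / (gauss_norm TYPE('a))\<^sup>2 * measure lborel A"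
      using that int by (intro cf_compare[OF T borel_finite_null_measure borel_finite_null_measure]) auto
    moreover have "measure lborel A = 0"
      using that by (simp add: measure_def)
    ultimately show ?thesis
      using measure_nonneg[of T A] by simp
  qed
  then show ?thesis
    by (auto simp: absolutely_continuous_def null_sets_def emeasure_eq_measure)
qed

text \<open>\<open>T\<close> has the characteristic function of a convolution of \<open>S\<close>,
  and convolution preserves absolute continuity. That null sets of the convolution are null for
  \<open>T\<close> is again \<open>cf_compare\<close>, now with distance 0 between the
  characteristic functions.\<close>

lemma absolutely_continuous_cf_mult:
  fixes S T :: "'a::euclidean_space measure"
  assumes S: "borel_finite_measure S" and T: "borel_finite_measure T"
    and ac: "absolutely_continuous lborel S" and \<eta>: "is_cf \<eta>"
    and cf: "\<And>\<xi>. cf T \<xi> = cf S \<xi> * \<eta> \<xi>"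
  shows "absolutely_continuous lborel T"
proof -
  obtain R where R: "borel_finite_measure R" "cf R = \<eta>"
    using \<eta> by (auto simp: is_cf_def)
  interpret S: borel_finite_measure S by fact
  interpret T: borel_finite_measure T by fact
  interpret R: borel_finite_measure R by fact
  interpret pair_sigma_finite R S ..
  define C where "C = distr (R \<Otimes>\<^sub>M S) borel (\<lambda>(x, y). x + y)"
  have C: "borel_finite_measure C" "cf C \<xi> = cf T \<xi>" for \<xi>
    unfolding C_def using cf_convolution[OF R(1) S] R(2) by (simp_all add: cf mult.commute)
  have "measure T A = 0" if A: "A \<in> sets borel" "emeasure lborel A = 0" for A
  proof -
    note [measurable] = A(1)
    have "emeasure C A = (\<integral>\<^sup>+z. indicator A (case z of (x, y) \<Rightarrow> x + y) \<partial>(R \<Otimes>\<^sub>M S))"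
      unfolding C_def by (subst nn_integral_indicator[symmetric], simp, subst nn_integral_distr) auto
    also have "\<dots> = (\<integral>\<^sup>+x. (\<integral>\<^sup>+y. indicator A (x + y) \<partial>S) \<partial>R)"
      by (subst S.nn_integral_fst[symmetric]) auto
    also have "\<dots> = (\<integral>\<^sup>+x. 0 \<partial>R)"
    proof (rule nn_integral_cong)
      fix x
      have "emeasure lborel {y. x + y \<in> A} = 0"
      proof -
        have "emeasure lborel A = emeasure (distr lborel borel ((+) x)) A"
          by (simp add: lborel_distr_plus)
        also have "\<dots> = emeasure lborel {y. x + y \<in> A}"
          by (subst emeasure_distr) (auto simp: vimage_def)
        finally show ?thesis
          using A by simp
      qed
      moreover have "{y. x + y \<in> A} \<in> sets borel"
        by measurable
      ultimately have "{y. x + y \<in> A} \<in> null_sets lborel"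
        by (simp add: null_sets_def)
      then have "{y. x + y \<in> A} \<in> null_sets S"
        using ac unfolding absolutely_continuous_def by blast
      then have "emeasure S {y. x + y \<in> A} = 0"
        by (rule null_setsD1)
      moreover have "(\<lambda>y. indicator A (x + y) :: ennreal) = indicator {y. x + y \<in> A}"
        by (auto simp: indicator_def)
      ultimately show "(\<integral>\<^sup>+y. indicator A (x + y) \<partial>S) = 0"
        by simp
    qed
    finally have "measure C A = 0"
      by (simp add: measure_def)
    moreover have "measure T A \<le> measure C A + 0 / (gauss_norm TYPE('a))\<^sup>2 * measure lborel A"
      using A C by (intro cf_compare[OF T C(1) borel_finite_null_measure]) auto
    ultimately show ?thesis
      using measure_nonneg[of T A] by simp
  qed
  then show ?thesis
    by (auto simp: absolutely_continuous_def null_sets_def T.emeasure_eq_measure)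
qed

subsection \<open>Randomly rotated stable vectors\<close>

lemma borel_measurable_vec_lambda [measurable (raw)]:
  fixes f :: "'a \<Rightarrow> 'i::finite \<Rightarrow> real"
  assumes "\<And>i. (\<lambda>x. f x i) \<in> borel_measurable M"
  shows "(\<lambda>x. \<chi> i. f x i) \<in> borel_measurable M"
proof (rule borel_measurable_euclidean_space[THEN iffD2], rule ballI)
  fix b :: "real^'i" assume "b \<in> Basis"
  then obtain i where "b = axis i 1"
    by (auto simp: Basis_vec_def)
  then show "(\<lambda>x. (\<chi> i. f x i) \<bullet> b) \<in> borel_measurable M"
    using assms[of i] by (simp add: inner_axis)
qed

lemma borel_measurable_matrix_nth [measurable (raw)]:
  fixes f :: "'a \<Rightarrow> complex^'n^'m"
  assumes "f \<in> borel_measurable M"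
  shows "(\<lambda>x. f x $ i $ j) \<in> borel_measurable M"
proof (rule measurable_compose[OF assms])
  show "(\<lambda>A :: complex^'n^'m. A $ i $ j) \<in> borel_measurable borel"
    by (intro borel_measurable_continuous_onI continuous_intros)
qed

text \<open>The diagonal of \<open>dual \<xi>\<close> in the basis rotated by \<open>U\<close>.
  Pairing it with a vector of eigenvalues gives the trace form of \<open>dual \<xi>\<close> with the
  conjugated diagonal matrix, which reduces matrix characteristic functions to those of
  vectors.\<close>

definition rot_diag :: "'n::{finite,linorder} cmat \<Rightarrow> real^('n \<times> 'n) \<Rightarrow> (real, 'n) vec"
  where "rot_diag U \<xi> = (\<chi> i. Re ((ctransp U ** dual \<xi> ** U) $ i $ i))"

lemma inner_coords_conj:
  "\<xi> \<bullet> coords (U ** diag_mat r ** ctransp U) = r \<bullet> rot_diag U \<xi>"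
proof -
  have "\<xi> \<bullet> coords (U ** diag_mat r ** ctransp U) = Re (trace (dual \<xi> ** (U ** diag_mat r ** ctransp U)))"
    using trace_dual_herm[of \<xi> "coords (U ** diag_mat r ** ctransp U)"]
    by (simp add: herm_coords Herm_conj)
  also have "trace (dual \<xi> ** (U ** diag_mat r ** ctransp U)) = trace ((U ** diag_mat r ** ctransp U) ** dual \<xi>)"
    by (rule trace_mul_sym)
  also have "(U ** diag_mat r ** ctransp U) ** dual \<xi> = U ** (diag_mat r ** ctransp U ** dual \<xi>)"
    by (simp only: matrix_mul_assoc)
  also have "trace \<dots> = trace (diag_mat r ** ctransp U ** dual \<xi> ** U)"
    by (rule trace_mul_sym)
  also have "\<dots> = trace (diag_mat r ** (ctransp U ** dual \<xi> ** U))"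
    by (simp only: matrix_mul_assoc)
  finally show ?thesis
    by (simp add: trace_diag_mat_mult rot_diag_def)
qed

lemma norm_rot_diag_le: "U \<in> unitary_group \<Longrightarrow> norm (rot_diag U \<xi>) \<le> norm \<xi>"
proof -
  assume U: "U \<in> unitary_group"
  let ?A = "ctransp U ** dual \<xi> ** U"
  have "(norm (rot_diag U \<xi>))\<^sup>2 = (\<Sum>i\<in>UNIV. (Re (?A $ i $ i))\<^sup>2)"
    by (simp add: norm_vec_def L2_set_def sum_nonneg rot_diag_def)
  also have "\<dots> \<le> (\<Sum>i\<in>UNIV. \<Sum>j\<in>UNIV. (cmod (?A $ i $ j))\<^sup>2)"
  proof (rule sum_mono)
    fix i
    have "(Re (?A $ i $ i))\<^sup>2 \<le> (cmod (?A $ i $ i))\<^sup>2"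
      using abs_Re_le_cmod[of "?A $ i $ i"] by (simp add: abs_le_square_iff[symmetric])
    also have "\<dots> \<le> (\<Sum>j\<in>UNIV. (cmod (?A $ i $ j))\<^sup>2)"
      by (rule member_le_sum) auto
    finally show "(Re (?A $ i $ i))\<^sup>2 \<le> (\<Sum>j\<in>UNIV. (cmod (?A $ i $ j))\<^sup>2)" .
  qed
  also have "\<dots> = (norm (dual \<xi>))\<^sup>2"
    using U unfolding norm_cmat_power2[symmetric] by simp
  finally show ?thesis
    using norm_dual_le[of \<xi>] by simp
qed

lemma linear_rot_diag: "linear (rot_diag (U :: 'n::{finite,linorder} cmat))"
proof (rule linearI)
  fix x y :: "real^('n \<times> 'n)" and c :: real
  show "rot_diag U (x + y) = rot_diag U x + rot_diag U y"
    by (simp add: rot_diag_def vec_eq_iff linear_add[OF linear_dual] matrix_mult_add_left matrix_mult_add_right)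
  show "rot_diag U (c *\<^sub>R x) = c *\<^sub>R rot_diag U x"
    by (simp add: rot_diag_def vec_eq_iff linear_cmul[OF linear_dual] matrix_mult_scaleR_left matrix_mult_scaleR_right)
qed

lemma measurable_rot_diag [measurable (raw)]:
  assumes [measurable]: "f \<in> borel_measurable M" "k \<in> borel_measurable M"
  shows "(\<lambda>x. rot_diag (f x) (k x)) \<in> borel_measurable M"
  unfolding rot_diag_def by measurable

lemma measurable_permute:
  assumes h: "borel_prob_on (sphere 0 1) h"
  shows "(\<lambda>r :: (real, 'n::finite) vec. \<chi> k. r $ Transposition.transpose i j k) \<in> measurable h h"
proof -
  let ?\<pi> = "Transposition.transpose i j"
  have sets: "sets h = sets (restrict_space borel (sphere 0 1))"
    using h by (simp add: borel_prob_on_def)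
  have "norm (\<chi> k. r $ ?\<pi> k) = norm (r :: (real, 'n) vec)" for r
  proof -
    have "(\<Sum>k\<in>UNIV. (r $ ?\<pi> k)\<^sup>2) = (\<Sum>k\<in>UNIV. (r $ k)\<^sup>2)"
      using sum.permute[OF permutes_swap_id[of i UNIV j], of "\<lambda>k. (r $ k)\<^sup>2"] by (simp add: comp_def)
    then show ?thesis
      by (simp add: norm_vec_def L2_set_def)
  qed
  then have "(\<lambda>r :: (real, 'n) vec. \<chi> k. r $ ?\<pi> k) \<in> measurable (restrict_space borel (sphere 0 1)) (restrict_space borel (sphere 0 1))"
    by (intro measurable_restrict_space2 measurable_restrict_space1 borel_measurable_continuous_onI continuous_intros)
      (auto simp: space_restrict_space)
  then show ?thesis
    by (simp only: measurable_cong_sets[OF sets sets])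
qed

text \<open>\<open>\<psi>\<close> is the law of the eigenvalue vectors, \<open>\<rho>\<close> that
  of a random multiple of the identity, with intensity \<open>c0\<close>. The case
  \<open>c0 = 0\<close> is that of all Hermitian matrices; for traceless ones a positive
  \<open>c0\<close> supplies the missing direction, so both spanning conditions then concern only
  vectors orthogonal to the identity.\<close>

locale rotated_stable = haar \<kappa> for \<kappa> :: "'n::{finite,linorder} cmat measure" +
  fixes \<alpha> c0 :: real and h \<psi> :: "(real, 'n) vec measure" and \<rho> :: "real measure"
  assumes \<alpha>: "0 < \<alpha>" "\<alpha> \<le> 2"
    and h: "borel_prob_on (sphere 0 1) h" and h_perm: "permutation_invariant h"
    and \<psi>: "is_stable_dist \<alpha> 1 h 0 \<psi>"
    and c0: "0 \<le> c0"
    and \<rho>: "borel_finite_measure \<rho>" and cf_\<rho>: "\<And>t. cf \<rho> t = of_real (exp (- c0 * \<bar>t\<bar> powr \<alpha>))"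
    and h_spans: "\<And>x. (AE r in h. r \<bullet> x = 0) \<Longrightarrow> c0 = 0 \<or> (\<chi> i. 1) \<bullet> x = 0 \<Longrightarrow> x = 0"
    and conj_spans: "\<And>\<xi>. (AE z in h \<Otimes>\<^sub>M \<kappa>. fst z \<bullet> rot_diag (snd z) \<xi> = 0) \<Longrightarrow>
      c0 = 0 \<or> \<xi> \<bullet> coords (mat 1) = 0 \<Longrightarrow> \<xi> = 0"
begin

sublocale h: prob_space h
  using h by (simp add: borel_prob_on_def)

lemma sets_h [measurable_cong]: "sets h = sets (restrict_space borel (sphere 0 1))"
  using h by (simp add: borel_prob_on_def)

lemma space_h [simp]: "space h = sphere 0 1"
  using sets_eq_imp_space_eq[OF sets_h] by (simp add: space_restrict_space)

lemma measurable_h: "f \<in> borel_measurable borel \<Longrightarrow> f \<in> borel_measurable h"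
  by (subst measurable_cong_sets[OF sets_h refl]) (rule measurable_restrict_space1)

lemma measurable_h_id [measurable]: "(\<lambda>r. r) \<in> borel_measurable h"
  by (rule measurable_h) simp

sublocale \<psi>: prob_space \<psi>
  using \<psi> by (simp add: is_stable_dist_def borel_prob_on_def)

lemma sets_\<psi> [simp, measurable_cong]: "sets \<psi> = sets borel"
  using \<psi> by (simp add: is_stable_dist_def borel_prob_on_def)

sublocale \<psi>: borel_finite_measure \<psi>
  by unfold_locales simp

sublocale \<rho>: borel_finite_measure \<rho>
  by (rule \<rho>)

sublocale h\<kappa>: pair_prob_space h \<kappa> ..

lemma \<rho>_mass [simp]: "measure \<rho> UNIV = 1"
proof -
  have "complex_of_real (measure \<rho> UNIV) = cf \<rho> 0"
    by (simp add: cf_def scaleR_conv_of_real)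
  then show ?thesis
    by (simp add: cf_\<rho>)
qed

lemma cf_\<psi>: "cf \<psi> \<xi> = exp (- (\<integral>r. stable_nu \<alpha> (r \<bullet> \<xi>) \<partial>h))"
  using \<psi> by (simp add: is_stable_dist_def cf_def cis_conv_exp)

lemma inner_le: "r \<in> sphere 0 1 \<Longrightarrow> \<bar>r \<bullet> x\<bar> \<le> norm x"
  using Cauchy_Schwarz_ineq2[of r x] by simp

definition C1 :: real
  where "C1 = (SOME C. 0 < C \<and> (\<forall>u. cmod (stable_nu \<alpha> u) \<le> C * (1 + u\<^sup>2)) \<and>
    (\<forall>u. \<bar>u\<bar> \<le> 1 \<longrightarrow> \<bar>Im (stable_nu \<alpha> u)\<bar> \<le> C * \<bar>u\<bar> powr (\<alpha> / 2)))"

lemma C1: "0 < C1" "cmod (stable_nu \<alpha> u) \<le> C1 * (1 + u\<^sup>2)"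
  "\<bar>u\<bar> \<le> 1 \<Longrightarrow> \<bar>Im (stable_nu \<alpha> u)\<bar> \<le> C1 * \<bar>u\<bar> powr (\<alpha> / 2)"
proof -
  have "\<exists>C. 0 < C \<and> (\<forall>u. cmod (stable_nu \<alpha> u) \<le> C * (1 + u\<^sup>2)) \<and>
    (\<forall>u. \<bar>u\<bar> \<le> 1 \<longrightarrow> \<bar>Im (stable_nu \<alpha> u)\<bar> \<le> C * \<bar>u\<bar> powr (\<alpha> / 2))"
    using stable_nu_bounds[OF \<alpha>] by metis
  from someI_ex[OF this] show "0 < C1" "cmod (stable_nu \<alpha> u) \<le> C1 * (1 + u\<^sup>2)"
    "\<bar>u\<bar> \<le> 1 \<Longrightarrow> \<bar>Im (stable_nu \<alpha> u)\<bar> \<le> C1 * \<bar>u\<bar> powr (\<alpha> / 2)"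
    unfolding C1_def[symmetric] by blast+
qed

lemma norm_nu_le: "r \<in> sphere 0 1 \<Longrightarrow> cmod (stable_nu \<alpha> (r \<bullet> x)) \<le> C1 * (1 + (norm x)\<^sup>2)"
proof -
  assume "r \<in> sphere 0 1"
  then have "(r \<bullet> x)\<^sup>2 \<le> (norm x)\<^sup>2"
    using inner_le[of r x] by (simp add: abs_le_square_iff[symmetric])
  then show ?thesis
    using C1(1) by (intro order.trans[OF C1(2)] mult_left_mono) auto
qed

lemma integrable_nu [simp]: "integrable h (\<lambda>r. stable_nu \<alpha> (r \<bullet> x))"
  by (rule h.integrable_const_bound[where B="C1 * (1 + (norm x)\<^sup>2)"]) (auto intro!: AE_I2 norm_nu_le)

definition Nu :: "(real, 'n) vec \<Rightarrow> complex"
  where "Nu x = (\<integral>r. stable_nu \<alpha> (r \<bullet> x) \<partial>h)"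

lemma Nu_measurable [measurable]: "Nu \<in> borel_measurable borel"
  unfolding Nu_def[abs_def] by measurable

lemma norm_Nu_le: "cmod (Nu x) \<le> C1 * (1 + (norm x)\<^sup>2)"
proof -
  have "cmod (Nu x) \<le> (\<integral>r. C1 * (1 + (norm x)\<^sup>2) \<partial>h)"
    unfolding Nu_def by (rule integral_norm_le) (auto intro!: norm_nu_le)
  then show ?thesis
    by (simp add: h.prob_space[unfolded space_h])
qed

lemma Re_Nu: "Re (Nu x) = (\<integral>r. \<bar>r \<bullet> x\<bar> powr \<alpha> \<partial>h)"
  unfolding Nu_def by (subst integral_Re[symmetric]) (simp_all add: Re_stable_nu)

lemma Re_Nu_nonneg: "0 \<le> Re (Nu x)"
  unfolding Re_Nu by (intro Bochner_Integration.integral_nonneg) simp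

lemma integrable_abs_powr [simp]: "integrable h (\<lambda>r. \<bar>r \<bullet> x\<bar> powr \<alpha>)"
  using integrable_Re[OF integrable_nu[of x]] by (simp add: Re_stable_nu)

lemma Re_Nu_le: "Re (Nu x) \<le> norm x powr \<alpha>"
proof -
  have "Re (Nu x) \<le> (\<integral>r. norm x powr \<alpha> \<partial>h)"
    unfolding Re_Nu using \<alpha> inner_le by (intro integral_mono powr_mono2) auto
  then show ?thesis
    by (simp add: h.prob_space[unfolded space_h])
qed

lemma Im_Nu_le:
  assumes "norm x \<le> 1"
  shows "\<bar>Im (Nu x)\<bar> \<le> C1 * norm x powr (\<alpha> / 2)"
proof -
  have "norm (\<integral>r. Im (stable_nu \<alpha> (r \<bullet> x)) \<partial>h) \<le> (\<integral>r. C1 * norm x powr (\<alpha> / 2) \<partial>h)"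
  proof (rule integral_norm_le)
    fix r assume "r \<in> space h"
    then have r: "\<bar>r \<bullet> x\<bar> \<le> norm x"
      by (simp only: space_h inner_le)
    then have "\<bar>Im (stable_nu \<alpha> (r \<bullet> x))\<bar> \<le> C1 * \<bar>r \<bullet> x\<bar> powr (\<alpha> / 2)"
      using assms by (intro C1) simp
    also have "\<dots> \<le> C1 * norm x powr (\<alpha> / 2)"
      using r \<alpha> C1(1) by (intro mult_left_mono powr_mono2) auto
    finally show "norm (Im (stable_nu \<alpha> (r \<bullet> x))) \<le> C1 * norm x powr (\<alpha> / 2)"
      by simp
  qed (auto intro!: integrable_Im)
  then show ?thesis
    unfolding Nu_def by (subst integral_Im[symmetric]) (simp_all add: h.prob_space[unfolded space_h])
qed

text \<open>Permutation invariance makes all coordinate means equal. The linear term at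
  \<open>\<alpha> = 1\<close> therefore sees \<open>x\<close> only through the sum of its
  coordinates, and a multiple of the identity can cancel it.\<close>

lemma mean_h: "(\<integral>r. r \<bullet> x \<partial>h) = mean_coordinate h * ((\<chi> i. 1) \<bullet> x)"
proof -
  have int: "integrable h (\<lambda>r. r $ i)" for i
    by (rule h.integrable_const_bound[where B=1])
      (auto intro!: AE_I2 order.trans[OF component_le_norm_cart] measurable_h borel_measurable_continuous_onI continuous_intros)
  have eq: "(\<integral>r. r $ i \<partial>h) = (\<integral>r. r $ j \<partial>h)" for i j
  proof -
    let ?\<pi> = "Transposition.transpose i j"
    have d: "distr h h (\<lambda>r. \<chi> k. r $ ?\<pi> k) = h"
      using h_perm permutes_swap_id[of i UNIV j] unfolding permutation_invariant_def by blast
    have m: "(\<lambda>r. \<chi> k. r $ ?\<pi> k) \<in> measurable h h"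
      by (rule measurable_permute[OF h])
    have "(\<integral>r. r $ i \<partial>h) = (\<integral>r. r $ i \<partial>(distr h h (\<lambda>r. \<chi> k. r $ ?\<pi> k)))"
      by (simp only: d)
    also have "\<dots> = (\<integral>r. r $ j \<partial>h)"
      using m borel_measurable_integrable[OF int[of i]] by (subst integral_distr) auto
    finally show ?thesis .
  qed
  have mean: "(\<integral>r. r $ i \<partial>h) = mean_coordinate h" for i
  proof -
    have "(\<integral>r. (\<Sum>k\<in>UNIV. r $ k) \<partial>h) = (\<Sum>k\<in>(UNIV::'n set). \<integral>r. r $ k \<partial>h)"
      by (intro Bochner_Integration.integral_sum int)
    also have "\<dots> = (\<Sum>k\<in>(UNIV::'n set). \<integral>r. r $ i \<partial>h)"
      by (intro sum.cong refl eq)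
    finally show ?thesis
      by (simp add: mean_coordinate_def)
  qed
  have "(\<integral>r. r \<bullet> x \<partial>h) = (\<integral>r. (\<Sum>i\<in>UNIV. r $ i * x $ i) \<partial>h)"
    by (simp add: inner_vec_def)
  also have "\<dots> = (\<Sum>i\<in>UNIV. (\<integral>r. r $ i \<partial>h) * x $ i)"
    by (subst Bochner_Integration.integral_sum) (auto intro!: integrable_mult_left int)
  also have "\<dots> = mean_coordinate h * ((\<chi> i. 1) \<bullet> x)"
    by (simp add: mean inner_vec_def sum_distrib_left)
  finally show ?thesis .
qed

lemma integrable_inner [simp]: "integrable h (\<lambda>r. r \<bullet> x)"
  by (rule h.integrable_const_bound[where B="norm x"]) (auto intro!: AE_I2 simp: inner_le)

lemma Nu_scale:
  assumes "0 < t"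
  shows "Nu (t *\<^sub>R x) = of_real (t powr \<alpha>) * Nu x
    + (if \<alpha> = 1 then \<i> * of_real (2 / pi * t * ln t * mean_coordinate h * ((\<chi> i. 1) \<bullet> x)) else 0)"
proof -
  have "Nu (t *\<^sub>R x) = (\<integral>r. of_real (t powr \<alpha>) * stable_nu \<alpha> (r \<bullet> x)
      + (if \<alpha> = 1 then \<i> * of_real (2 / pi * t * ln t) else 0) * of_real (r \<bullet> x) \<partial>h)"
    unfolding Nu_def using stable_nu_scale[OF assms, of \<alpha>]
    by (intro Bochner_Integration.integral_cong refl) auto
  also have "\<dots> = of_real (t powr \<alpha>) * Nu x
      + (if \<alpha> = 1 then \<i> * of_real (2 / pi * t * ln t) else 0) * (\<integral>r. complex_of_real (r \<bullet> x) \<partial>h)"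
    unfolding Nu_def by (subst Bochner_Integration.integral_add) (auto intro!: integrable_mult_right)
  also have "(\<integral>r. complex_of_real (r \<bullet> x) \<partial>h) = of_real (mean_coordinate h * ((\<chi> i. 1) \<bullet> x))"
    by (simp only: integral_complex_of_real mean_h)
  finally show ?thesis
    by simp
qed

text \<open>The trace of \<open>dual \<xi>\<close>, which conjugation does not change.\<close>

definition \<tau> :: "real^('n \<times> 'n) \<Rightarrow> real"
  where "\<tau> \<xi> = \<xi> \<bullet> coords (mat 1)"

lemma sum_rot_diag: "U \<in> unitary_group \<Longrightarrow> (\<chi> i. 1) \<bullet> rot_diag U \<xi> = \<tau> \<xi>"
  using inner_coords_conj[of \<xi> U "\<chi> i. 1"] by (simp add: \<tau>_def diag_mat_const unitary_groupD)

lemma linear_\<tau>: "linear \<tau>"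
  by (rule linearI) (auto simp: \<tau>_def inner_add_left)

lemma \<tau>_le: "\<bar>\<tau> \<xi>\<bar> \<le> norm (coords (mat 1 :: 'n cmat)) * norm \<xi>"
  using Cauchy_Schwarz_ineq2[of \<xi> "coords (mat 1)"] by (simp add: \<tau>_def mult.commute)

definition g :: "'n cmat \<Rightarrow> real^('n \<times> 'n) \<Rightarrow> complex"
  where "g U \<xi> = Nu (rot_diag U \<xi>) + of_real (c0 * \<bar>\<tau> \<xi>\<bar> powr \<alpha>)"

text \<open>One \<open>m\<close>-th of the centring, so that it can be distributed over the
  summands.\<close>

definition shift :: "nat \<Rightarrow> real^('n \<times> 'n)"
  where "shift m = (if \<alpha> = 1 then - (2 * mean_coordinate h * ln (real m) / (pi * real m)) *\<^sub>R coords (mat 1) else 0)"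

text \<open>Adding \<open>s\<close> to every eigenvalue adds \<open>s\<close> times the identity to
  the conjugated matrix, so the noise may be put in before the rotation.\<close>

definition \<psi>' :: "(real, 'n) vec measure"
  where "\<psi>' = distr (\<psi> \<Otimes>\<^sub>M \<rho>) borel (\<lambda>(x, s). x + s *\<^sub>R (\<chi> i. 1))"

definition \<mu> :: "(real^('n \<times> 'n)) measure"
  where "\<mu> = distr (\<psi>' \<Otimes>\<^sub>M \<kappa>) borel (\<lambda>(x, U). coords (U ** diag_mat x ** ctransp U))"

lemma \<psi>': "borel_finite_measure \<psi>'" "measure \<psi>' UNIV = 1"
  "cf \<psi>' x = exp (- (Nu x + of_real (c0 * \<bar>(\<chi> i. 1) \<bullet> x\<bar> powr \<alpha>)))"
proof -
  define \<sigma> where "\<sigma> = distr \<rho> borel (\<lambda>s. s *\<^sub>R (\<chi> i. 1) :: (real, 'n) vec)"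
  have \<sigma>: "borel_finite_measure \<sigma>"
    unfolding \<sigma>_def by (intro borel_finite_measure_distr \<rho>.finite_measure_axioms) auto
  have cf_\<sigma>: "cf \<sigma> x = of_real (exp (- c0 * \<bar>(\<chi> i. 1) \<bullet> x\<bar> powr \<alpha>))" for x
  proof -
    have "cf \<sigma> x = cf \<rho> ((\<chi> i. 1) \<bullet> x)"
      unfolding \<sigma>_def by (subst cf_distr) (auto simp: cf_def inner_commute mult.commute)
    then show ?thesis
      by (simp only: cf_\<rho>)
  qed
  interpret \<sigma>: borel_finite_measure \<sigma> by (rule \<sigma>)
  have *: "\<psi>' = distr (\<psi> \<Otimes>\<^sub>M \<sigma>) borel (\<lambda>(x, y). x + y)"
  proof -
    interpret pair_sigma_finite \<psi> \<rho> ..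
    have "distr (\<psi> \<Otimes>\<^sub>M \<rho>) borel (\<lambda>(x, s). x + s *\<^sub>R (\<chi> i. 1))
        = distr (distr (\<psi> \<Otimes>\<^sub>M \<rho>) (borel \<Otimes>\<^sub>M borel) (\<lambda>(x, s). (x, s *\<^sub>R (\<chi> i. 1)))) borel (\<lambda>(x, y). x + y)"
      by (subst distr_distr) (auto simp: comp_def split_beta')
    also have "distr (\<psi> \<Otimes>\<^sub>M \<rho>) (borel \<Otimes>\<^sub>M borel) (\<lambda>(x, s). (x, s *\<^sub>R (\<chi> i. 1))) = distr \<psi> borel (\<lambda>x. x) \<Otimes>\<^sub>M \<sigma>"
      unfolding \<sigma>_def by (subst pair_measure_distr) (auto intro: \<sigma>.sigma_finite_measure_axioms[unfolded \<sigma>_def])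
    also have "distr \<psi> borel (\<lambda>x. x) = \<psi>"
      by (rule distr_id2) simp
    finally show ?thesis
      by (simp add: \<psi>'_def)
  qed
  show fin: "borel_finite_measure \<psi>'"
    unfolding * by (rule cf_convolution[OF \<psi>.borel_finite_measure_axioms \<sigma>])
  show cf: "cf \<psi>' x = exp (- (Nu x + of_real (c0 * \<bar>(\<chi> i. 1) \<bullet> x\<bar> powr \<alpha>)))" for x
    unfolding * cf_convolution(2)[OF \<psi>.borel_finite_measure_axioms \<sigma>] cf_\<sigma>
    by (simp add: cf_\<psi> Nu_def exp_diff exp_minus divide_inverse flip: exp_of_real)
  have "complex_of_real (measure \<psi>' UNIV) = cf \<psi>' 0"
    using borel_finite_measure.space_UNIV[OF fin] by (simp add: cf_def scaleR_conv_of_real)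
  also have "\<dots> = 1"
    unfolding cf by (simp add: Nu_def stable_nu_def)
  finally show "measure \<psi>' UNIV = 1"
    by simp
qed

sublocale \<psi>': borel_finite_measure \<psi>'
  by (rule \<psi>')

text \<open>The lower bound for the exponent makes the characteristic function integrable; the noise
  makes up for the direction in which \<open>h\<close> may be degenerate.\<close>

lemma \<psi>'_absolutely_continuous: "absolutely_continuous lborel \<psi>'"
proof (rule absolutely_continuousI_cf[OF \<psi>'(1)])
  obtain c where c: "0 < c"
    "\<And>x. c * norm x powr \<alpha> \<le> (\<integral>r. \<bar>r \<bullet> x\<bar> powr \<alpha> \<partial>h) + c0 * \<bar>(\<chi> i. 1) \<bullet> x\<bar> powr \<alpha>"
  proof (rule stable_form_lower_bound[of h \<alpha> "\<lambda>r x. r \<bullet> x" "\<lambda>x. (\<chi> i. 1) \<bullet> x" c0])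
    show "linear (\<lambda>x. r \<bullet> x)" for r :: "(real, 'n) vec"
      by (rule linearI) (auto simp: inner_add_right)
    then show "linear (\<lambda>x :: (real, 'n) vec. (\<chi> i. 1) \<bullet> x)" .
  qed (use \<alpha> c0 h_spans inner_le in \<open>auto simp: h.finite_measure_axioms\<close>)
  show "integrable lborel (cf \<psi>')"
  proof (rule integrable_poly_exp[of c \<alpha> _ 1 0])
    show "norm (cf \<psi>' x) \<le> 1 * (1 + (norm x)\<^sup>2) ^ 0 * exp (- c * norm x powr \<alpha>)" for x
      using c(2)[of x] by (simp add: \<psi>'(3) Re_Nu)
  qed (use c \<alpha> in auto)
qed

lemma measurable_conj [measurable]:
  "(\<lambda>(x, U). coords (U ** diag_mat x ** ctransp U)) \<in> borel_measurable (\<psi>' \<Otimes>\<^sub>M \<kappa>)"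
proof -
  have [measurable]: "ctransp \<in> borel_measurable \<kappa>"
    by (rule measurable_from) simp
  show ?thesis
    by measurable
qed

text \<open>For the absolute continuity, \<open>haar_conj_absolutely_continuous\<close> makes the
  conditional probability of a null set vanish for Lebesgue almost every eigenvalue vector, hence
  for \<open>\<psi>'\<close>-almost every one.\<close>

lemma \<mu>: "borel_finite_measure \<mu>" "measure \<mu> UNIV = 1" "cf \<mu> \<xi> = (\<integral>U. exp (- g U \<xi>) \<partial>\<kappa>)"
  "absolutely_continuous lborel \<mu>"
proof -
  interpret pair_sigma_finite \<psi>' \<kappa> ..
  interpret prob: finite_measure "\<psi>' \<Otimes>\<^sub>M \<kappa>"
    by (intro finite_measure_pair_measure \<psi>'.finite_measure_axioms finite_measure_axioms)
  show fin: "borel_finite_measure \<mu>"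
    unfolding \<mu>_def by (intro borel_finite_measure_distr prob.finite_measure_axioms measurable_conj)
  show cf: "cf \<mu> \<xi> = (\<integral>U. exp (- g U \<xi>) \<partial>\<kappa>)" for \<xi>
  proof -
    have "cf \<mu> \<xi> = (\<integral>z. cis (\<xi> \<bullet> (case z of (x, U) \<Rightarrow> coords (U ** diag_mat x ** ctransp U))) \<partial>(\<psi>' \<Otimes>\<^sub>M \<kappa>))"
      unfolding \<mu>_def by (rule cf_distr) (rule measurable_conj)
    also have "\<dots> = (\<integral>(x, U). cis (rot_diag U \<xi> \<bullet> x) \<partial>(\<psi>' \<Otimes>\<^sub>M \<kappa>))"
      by (intro Bochner_Integration.integral_cong refl) (auto simp: inner_coords_conj inner_commute)
    also have "\<dots> = (\<integral>U. (\<integral>x. cis (rot_diag U \<xi> \<bullet> x) \<partial>\<psi>') \<partial>\<kappa>)"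
    proof (rule integral_snd[symmetric])
      show "integrable (\<psi>' \<Otimes>\<^sub>M \<kappa>) (\<lambda>(x, U). cis (rot_diag U \<xi> \<bullet> x))"
        by (rule prob.integrable_const_bound[where B=1]) auto
    qed
    also have "\<dots> = (\<integral>U. exp (- g U \<xi>) \<partial>\<kappa>)"
    proof (rule Bochner_Integration.integral_cong[OF refl])
      fix U assume "U \<in> space \<kappa>"
      then show "(\<integral>x. cis (rot_diag U \<xi> \<bullet> x) \<partial>\<psi>') = exp (- g U \<xi>)"
        using \<psi>'(3)[of "rot_diag U \<xi>"] by (simp add: cf_def g_def sum_rot_diag)
    qed
    finally show ?thesis .
  qed
  have "complex_of_real (measure \<mu> UNIV) = cf \<mu> 0"
    using borel_finite_measure.space_UNIV[OF fin] by (simp add: cf_def scaleR_conv_of_real)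
  also have "\<dots> = 1"
    unfolding cf using prob_space
    by (simp add: g_def Nu_def stable_nu_def linear_0[OF linear_rot_diag] \<tau>_def)
  finally show "measure \<mu> UNIV = 1"
    by simp
  show "absolutely_continuous lborel \<mu>"
    unfolding absolutely_continuous_def
  proof
    fix A :: "(real^('n \<times> 'n)) set" assume "A \<in> null_sets lborel"
    then have A: "A \<in> sets borel" "emeasure lborel A = 0"
      by (auto simp: null_sets_def)
    note [measurable] = A(1)
    define A' where "A' = coords -` A"
    have A' [measurable]: "A' \<in> sets borel"
      using measurable_sets[OF measurable_coords A(1)] by (simp add: A'_def)
    have "emeasure lebesgue_Herm A' = 0"
      unfolding lebesgue_Herm_eq using A by (subst emeasure_distr) (auto simp: A'_def vimage_def)
    then have "AE x in lborel. (\<integral>\<^sup>+U. indicator A' (U ** diag_mat (x :: (real, 'n) vec) ** ctransp U) \<partial>\<kappa>) = 0"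
      by (rule haar_conj_absolutely_continuous[OF haar A'])
    then have "AE x in \<psi>'. (\<integral>\<^sup>+U. indicator A' (U ** diag_mat x ** ctransp U) \<partial>\<kappa>) = 0"
      by (rule absolutely_continuous_AE[rotated 2]) (use \<psi>'_absolutely_continuous in auto)
    then have "(\<integral>\<^sup>+x. (\<integral>\<^sup>+U. indicator A' (U ** diag_mat x ** ctransp U) \<partial>\<kappa>) \<partial>\<psi>') = (\<integral>\<^sup>+x. 0 \<partial>\<psi>')"
      by (rule nn_integral_cong_AE)
    moreover have "emeasure \<mu> A = (\<integral>\<^sup>+x. (\<integral>\<^sup>+U. indicator A' (U ** diag_mat x ** ctransp U) \<partial>\<kappa>) \<partial>\<psi>')"
    proof -
      have sf: "sigma_finite_measure \<kappa>"
        by unfold_locales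
      have [measurable]: "ctransp \<in> borel_measurable \<kappa>"
        by (rule measurable_from) simp
      have "emeasure \<mu> A = (\<integral>\<^sup>+z. indicator A (case z of (x, U) \<Rightarrow> coords (U ** diag_mat x ** ctransp U)) \<partial>(\<psi>' \<Otimes>\<^sub>M \<kappa>))"
        unfolding \<mu>_def by (subst nn_integral_indicator[symmetric], simp, subst nn_integral_distr) auto
      also have "\<dots> = (\<integral>\<^sup>+(x, U). indicator A' (U ** diag_mat x ** ctransp U) \<partial>(\<psi>' \<Otimes>\<^sub>M \<kappa>))"
        by (intro nn_integral_cong) (auto simp: A'_def indicator_def)
      also have "\<dots> = (\<integral>\<^sup>+x. (\<integral>\<^sup>+U. indicator A' (U ** diag_mat x ** ctransp U) \<partial>\<kappa>) \<partial>\<psi>')"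
        using sigma_finite_measure.nn_integral_fst[OF sf, of "\<lambda>(x, U). indicator A' (U ** diag_mat x ** ctransp U)" \<psi>'] by simp
      finally show ?thesis .
    qed
    ultimately show "A \<in> null_sets \<mu>"
      using A by (auto simp: null_sets_def \<mu>_def)
  qed
qed

end

lemma emeasure_lborel_affine_null:
  fixes A :: "'a::euclidean_space set"
  assumes t: "t \<noteq> 0" and A: "A \<in> sets borel" "emeasure lborel A = 0"
  shows "emeasure lborel {x. b + t *\<^sub>R x \<in> A} = 0"
proof -
  note [measurable] = A(1)
  have "emeasure lborel A = (\<integral>\<^sup>+x. indicator A x \<partial>(density (distr lborel borel (\<lambda>x. b + t *\<^sub>R x)) (\<lambda>_. \<bar>t\<bar> ^ DIM('a))))"
    by (subst lborel_affine[OF t, of b, symmetric]) simp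
  also have "\<dots> = (\<integral>\<^sup>+x. ennreal (\<bar>t\<bar> ^ DIM('a)) * indicator A (b + t *\<^sub>R x) \<partial>lborel)"
    by (subst nn_integral_density, simp, simp, subst nn_integral_distr) auto
  also have "\<dots> = ennreal (\<bar>t\<bar> ^ DIM('a)) * (\<integral>\<^sup>+x. indicator {x. b + t *\<^sub>R x \<in> A} x \<partial>lborel)"
    by (subst nn_integral_cmult[symmetric]) (auto intro!: nn_integral_cong simp: indicator_def)
  finally show ?thesis
    using A t by simp
qed

context rotated_stable
begin

lemma g_scale:
  assumes U: "U \<in> unitary_group" and t: "0 < t"
  shows "g U (t *\<^sub>R \<xi>) = of_real (t powr \<alpha>) * g U \<xi>
    + (if \<alpha> = 1 then \<i> * of_real (2 / pi * t * ln t * mean_coordinate h * \<tau> \<xi>) else 0)"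
proof -
  have "\<bar>\<tau> (t *\<^sub>R \<xi>)\<bar> powr \<alpha> = t powr \<alpha> * \<bar>\<tau> \<xi>\<bar> powr \<alpha>"
    using t by (simp add: linear_cmul[OF linear_\<tau>] abs_mult powr_mult)
  then show ?thesis
    using Nu_scale[OF t, of "rot_diag U \<xi>"] sum_rot_diag[OF U, of \<xi>]
    by (simp add: g_def linear_cmul[OF linear_rot_diag] algebra_simps)
qed

text \<open>At \<open>\<alpha> = 1\<close> the rescaling leaves a phase containing
  \<open>ln t = - ln m\<close>, and \<open>shift m\<close> has the opposite one. The cancellation
  can happen under the integral because the phase involves the trace only and hence does not depend
  on \<open>U\<close>.\<close>

lemma cf_\<mu>_scale:
  assumes m: "1 \<le> m"
  shows "cf \<mu> (real m powr (- 1 / \<alpha>) *\<^sub>R \<xi>) * cis (shift m \<bullet> \<xi>) = (\<integral>U. exp (- g U \<xi> / of_nat m) \<partial>\<kappa>)"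
proof -
  define t where "t = real m powr (- 1 / \<alpha>)"
  have "t powr \<alpha> = real m powr (- 1 / \<alpha> * \<alpha>)"
    by (simp only: t_def powr_powr)
  then have t: "0 < t" "t powr \<alpha> = 1 / real m"
    using m \<alpha> by (auto simp: t_def powr_minus_divide)
  have "exp (- g U (t *\<^sub>R \<xi>)) * cis (shift m \<bullet> \<xi>) = exp (- g U \<xi> / of_nat m)" if U: "U \<in> unitary_group" for U
  proof (cases "\<alpha> = 1")
    case True
    then have t1: "t = 1 / real m"
      using m by (simp add: t_def powr_minus_divide)
    then have lnt: "ln t = - ln (real m)"
      using m by (simp add: ln_div)
    have sh: "shift m = - (2 * mean_coordinate h * ln (real m) / (pi * real m)) *\<^sub>R coords (mat 1)"
      unfolding shift_def using True by simp
    have "shift m \<bullet> \<xi> = 2 / pi * t * ln t * mean_coordinate h * \<tau> \<xi>"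
      unfolding sh lnt unfolding t1 \<tau>_def by (simp add: inner_commute)
    then have "cis (shift m \<bullet> \<xi>) = exp (\<i> * of_real (2 / pi * t * ln t * mean_coordinate h * \<tau> \<xi>))"
      by (simp only: cis_conv_exp)
    then show ?thesis
      unfolding g_scale[OF U t(1)] t(2) using True
      by (simp add: exp_add[symmetric] del: of_real_mult)
  next
    case False
    then show ?thesis
      unfolding g_scale[OF U t(1)] t(2) by (simp add: shift_def)
  qed
  then have "(\<integral>U. exp (- g U (t *\<^sub>R \<xi>)) * cis (shift m \<bullet> \<xi>) \<partial>\<kappa>) = (\<integral>U. exp (- g U \<xi> / of_nat m) \<partial>\<kappa>)"
    by (intro Bochner_Integration.integral_cong refl) simp
  then show ?thesis
    unfolding t_def[symmetric] \<mu>(3) by simp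
qed

lemma rot_form_lower_bound:
  "\<exists>c>0. \<forall>\<xi>. c * norm \<xi> powr \<alpha> \<le> (\<integral>U. Re (g U \<xi>) \<partial>\<kappa>)"
proof -
  have fin: "finite_measure (h \<Otimes>\<^sub>M \<kappa>)"
    by (rule finite_measure_pair_measure) unfold_locales
  have meas: "(\<lambda>z. fst z \<bullet> rot_diag (snd z) \<xi>) \<in> borel_measurable (h \<Otimes>\<^sub>M \<kappa>)" for \<xi>
    by measurable
  have le: "\<bar>fst z \<bullet> rot_diag (snd z) \<xi>\<bar> \<le> norm \<xi>" if "z \<in> space (h \<Otimes>\<^sub>M \<kappa>)" for z \<xi>
    using that inner_le[of "fst z" "rot_diag (snd z) \<xi>"] norm_rot_diag_le[of "snd z" \<xi>]
    by (auto simp: space_pair_measure)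
  obtain c where c: "0 < c" "\<And>\<xi>. c * norm \<xi> powr \<alpha>
      \<le> (\<integral>z. \<bar>fst z \<bullet> rot_diag (snd z) \<xi>\<bar> powr \<alpha> \<partial>(h \<Otimes>\<^sub>M \<kappa>)) + c0 * \<bar>\<tau> \<xi>\<bar> powr \<alpha>"
  proof (rule stable_form_lower_bound[of "h \<Otimes>\<^sub>M \<kappa>" \<alpha> "\<lambda>z \<xi>. fst z \<bullet> rot_diag (snd z) \<xi>" \<tau> c0])
    show "linear (\<lambda>\<xi>. fst z \<bullet> rot_diag (snd z) \<xi>)" for z :: "(real, 'n) vec \<times> 'n cmat"
      by (rule linearI) (auto simp: linear_add[OF linear_rot_diag] linear_cmul[OF linear_rot_diag] inner_add_right)
  qed (use \<alpha> c0 conj_spans meas le linear_\<tau> in \<open>auto simp: fin \<tau>_def\<close>)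
  have "(\<integral>z. \<bar>fst z \<bullet> rot_diag (snd z) \<xi>\<bar> powr \<alpha> \<partial>(h \<Otimes>\<^sub>M \<kappa>)) + c0 * \<bar>\<tau> \<xi>\<bar> powr \<alpha> = (\<integral>U. Re (g U \<xi>) \<partial>\<kappa>)" for \<xi>
  proof -
    have int: "integrable (h \<Otimes>\<^sub>M \<kappa>) (\<lambda>(r, U). \<bar>r \<bullet> rot_diag U \<xi>\<bar> powr \<alpha>)"
    proof (rule finite_measure.integrable_const_bound[OF fin, where B="norm \<xi> powr \<alpha>"])
      show "AE z in h \<Otimes>\<^sub>M \<kappa>. norm (case z of (r, U) \<Rightarrow> \<bar>r \<bullet> rot_diag U \<xi>\<bar> powr \<alpha>) \<le> norm \<xi> powr \<alpha>"
        using le \<alpha> by (intro AE_I2) (auto simp: split_beta' intro!: powr_mono2)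
    qed measurable
    have "(\<integral>U. Re (g U \<xi>) \<partial>\<kappa>) = (\<integral>U. (\<integral>r. \<bar>r \<bullet> rot_diag U \<xi>\<bar> powr \<alpha> \<partial>h) + c0 * \<bar>\<tau> \<xi>\<bar> powr \<alpha> \<partial>\<kappa>)"
      by (simp add: g_def Re_Nu)
    also have "\<dots> = (\<integral>U. (\<integral>r. \<bar>r \<bullet> rot_diag U \<xi>\<bar> powr \<alpha> \<partial>h) \<partial>\<kappa>) + c0 * \<bar>\<tau> \<xi>\<bar> powr \<alpha>"
      using h\<kappa>.integrable_snd[OF int] prob_space by simp
    also have "(\<integral>U. (\<integral>r. \<bar>r \<bullet> rot_diag U \<xi>\<bar> powr \<alpha> \<partial>h) \<partial>\<kappa>) = (\<integral>(r, U). \<bar>r \<bullet> rot_diag U \<xi>\<bar> powr \<alpha> \<partial>(h \<Otimes>\<^sub>M \<kappa>))"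
      using h\<kappa>.integral_snd[OF int] by simp
    finally show ?thesis
      by (simp add: split_beta')
  qed
  then show ?thesis
    using c by auto
qed

text \<open>One absolutely continuous summand suffices: the characteristic function is split into
  that of a single summand and the power of the others.\<close>

lemma \<mu>_shift_absolutely_continuous:
  assumes T: "borel_finite_measure T" and m: "1 \<le> m"
    and cf: "\<And>\<xi>. cf T \<xi> = (cf \<mu> (real m powr (- 1 / \<alpha>) *\<^sub>R \<xi>) * cis (shift m \<bullet> \<xi>)) ^ m"
  shows "absolutely_continuous lborel T"
proof -
  interpret \<mu>: borel_finite_measure \<mu> by (rule \<mu>)
  define t where "t = real m powr (- 1 / \<alpha>)"
  have t: "t \<noteq> 0"
    using m by (simp add: t_def)
  define S where "S = distr \<mu> borel (\<lambda>x. shift m + t *\<^sub>R x)"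
  have S: "borel_finite_measure S"
    unfolding S_def by (intro borel_finite_measure_distr \<mu>.finite_measure_axioms) auto
  have cf_S: "cf S \<xi> = cf \<mu> (t *\<^sub>R \<xi>) * cis (shift m \<bullet> \<xi>)" for \<xi>
  proof -
    have "cf S \<xi> = (\<integral>x. cis (\<xi> \<bullet> (shift m + t *\<^sub>R x)) \<partial>\<mu>)"
      unfolding S_def by (rule cf_distr) simp
    also have "\<dots> = (\<integral>x. cis ((t *\<^sub>R \<xi>) \<bullet> x) * cis (shift m \<bullet> \<xi>) \<partial>\<mu>)"
      by (intro Bochner_Integration.integral_cong refl)
        (simp add: cis_mult inner_add_right inner_commute add.commute)
    finally show ?thesis
      by (simp add: cf_def)
  qed
  have "absolutely_continuous lborel S"
    unfolding absolutely_continuous_def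
  proof
    fix A :: "(real^('n \<times> 'n)) set" assume "A \<in> null_sets lborel"
    then have A [measurable]: "A \<in> sets borel" and A0: "emeasure lborel A = 0"
      by (auto simp: null_sets_def)
    have "{x. shift m + t *\<^sub>R x \<in> A} \<in> null_sets lborel"
      using emeasure_lborel_affine_null[OF t A A0] by (auto simp: null_sets_def)
    then have "{x. shift m + t *\<^sub>R x \<in> A} \<in> null_sets \<mu>"
      using \<mu>(4) unfolding absolutely_continuous_def by blast
    then show "A \<in> null_sets S"
      unfolding S_def by (auto simp: null_sets_def emeasure_distr vimage_def)
  qed
  moreover have "is_cf (\<lambda>\<xi>. cf S \<xi> ^ (m - 1))"
    using S by (intro is_cf_power) (auto simp: is_cf_def)
  moreover have "cf T \<xi> = cf S \<xi> * cf S \<xi> ^ (m - 1)" for \<xi>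
    using m unfolding cf cf_S t_def by (metis power_eq_if not_one_le_zero)
  ultimately show ?thesis
    by (rule absolutely_continuous_cf_mult[OF S T])
qed

theorem rotated_sum_rate:
  fixes L :: "nat \<Rightarrow> (real^('n \<times> 'n)) measure" and \<nu> :: "(real^('n \<times> 'n)) measure"
  assumes L: "\<And>m. 1 \<le> m \<Longrightarrow> borel_finite_measure (L m)" "\<And>m. 1 \<le> m \<Longrightarrow> measure (L m) UNIV = 1"
    and cf_L: "\<And>m \<xi>. 1 \<le> m \<Longrightarrow> cf (L m) \<xi> = (cf \<mu> (real m powr (- 1 / \<alpha>) *\<^sub>R \<xi>) * cis (shift m \<bullet> \<xi>)) ^ m"
    and \<nu>: "borel_finite_measure \<nu>" "measure \<nu> UNIV = 1"
    and cf_\<nu>: "\<And>\<xi>. cf \<nu> \<xi> = exp (- (\<integral>U. g U \<xi> \<partial>\<kappa>))"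
  shows "absolutely_continuous lborel \<nu>"
    and "\<exists>K. \<forall>m A. 1 \<le> m \<longrightarrow> A \<in> sets borel \<longrightarrow>
      \<bar>measure (L m) A - measure \<nu> A\<bar> \<le> K * real m powr (- \<alpha> / (real (CARD('n) * CARD('n)) + \<alpha>))"
proof -
  obtain c where c: "0 < c" "\<And>\<xi>. c * norm \<xi> powr \<alpha> \<le> (\<integral>U. Re (g U \<xi>) \<partial>\<kappa>)"
    using rot_form_lower_bound by blast
  define n where "n = norm (coords (mat 1 :: 'n cmat)) powr \<alpha>"
  have n: "0 \<le> n"
    by (simp add: n_def)
  \<comment> \<open>Large enough for three bounds at once: \<open>1 + c0 * n\<close> for the real
    part, \<open>C1 + c0 * n\<close> for the modulus, and \<open>C1\<close> for the imaginary part,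
    to which the real noise term adds nothing.\<close>
  define C where "C = 1 + C1 + c0 * n"
  have C: "0 < C" "C1 \<le> C" "1 + c0 * n \<le> C" "C1 + c0 * n \<le> C"
    using C1(1) c0 n by (auto simp: C_def add_pos_nonneg)
  have \<tau>: "c0 * \<bar>\<tau> \<xi>\<bar> powr \<alpha> \<le> c0 * n * norm \<xi> powr \<alpha>" for \<xi>
  proof -
    have "\<bar>\<tau> \<xi>\<bar> powr \<alpha> \<le> (norm (coords (mat 1 :: 'n cmat)) * norm \<xi>) powr \<alpha>"
      using \<tau>_le[of \<xi>] \<alpha> by (intro powr_mono2) auto
    also have "\<dots> = n * norm \<xi> powr \<alpha>"
      by (simp add: n_def powr_mult)
    finally show ?thesis
      using c0 by (simp add: mult.assoc mult_left_mono)
  qed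
  interpret stable_mixture \<kappa> g \<alpha> c C \<mu> \<nu> L shift
  proof (intro stable_mixture.intro stable_mixture_axioms.intro)
    show "prob_space \<kappa>"
      by unfold_locales
    show "case_prod g \<in> borel_measurable (\<kappa> \<Otimes>\<^sub>M borel)"
    proof -
      have [measurable]: "\<tau> \<in> borel_measurable borel"
        unfolding \<tau>_def[abs_def] by measurable
      show ?thesis
        unfolding g_def[abs_def] by measurable
    qed
    fix U :: "'n cmat" and \<xi> assume "U \<in> space \<kappa>"
    then have U: "U \<in> unitary_group"
      by simp
    note q = norm_rot_diag_le[OF U, of \<xi>]
    have qa: "norm (rot_diag U \<xi>) powr \<alpha> \<le> norm \<xi> powr \<alpha>"
      using q \<alpha> by (intro powr_mono2) auto
    have pw: "norm \<xi> powr \<alpha> \<le> 1 + (norm \<xi>)\<^sup>2"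
      using \<alpha> by (intro powr_le_one_plus_square) auto
    show "Re (g U (t *\<^sub>R \<xi>)) = t powr \<alpha> * Re (g U \<xi>)" if "0 < t" for t
      unfolding g_scale[OF U that] by simp
    show "0 \<le> Re (g U \<xi>)"
      using Re_Nu_nonneg c0 by (simp add: g_def)
    show "Re (g U \<xi>) \<le> C * norm \<xi> powr \<alpha>"
    proof -
      have "Re (g U \<xi>) \<le> norm \<xi> powr \<alpha> + c0 * n * norm \<xi> powr \<alpha>"
        using order.trans[OF Re_Nu_le qa] \<tau>[of \<xi>] by (simp add: g_def add_mono)
      also have "\<dots> = (1 + c0 * n) * norm \<xi> powr \<alpha>"
        by (simp add: algebra_simps)
      also have "\<dots> \<le> C * norm \<xi> powr \<alpha>"
        using C by (intro mult_right_mono) auto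
      finally show ?thesis .
    qed
    show "norm (g U \<xi>) \<le> C * (1 + (norm \<xi>)\<^sup>2)"
    proof -
      have "norm (g U \<xi>) \<le> norm (Nu (rot_diag U \<xi>)) + norm (complex_of_real (c0 * \<bar>\<tau> \<xi>\<bar> powr \<alpha>))"
        unfolding g_def by (rule norm_triangle_ineq)
      also have "norm (complex_of_real (c0 * \<bar>\<tau> \<xi>\<bar> powr \<alpha>)) = c0 * \<bar>\<tau> \<xi>\<bar> powr \<alpha>"
        unfolding norm_of_real using c0 by simp
      also have "\<dots> \<le> c0 * n * (1 + (norm \<xi>)\<^sup>2)"
        using pw c0 n by (intro order.trans[OF \<tau>] mult_left_mono) auto
      also have "norm (Nu (rot_diag U \<xi>)) \<le> C1 * (1 + (norm \<xi>)\<^sup>2)"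
        using q C1(1) by (intro order.trans[OF norm_Nu_le] mult_left_mono add_left_mono power_mono) auto
      also have "C1 * (1 + (norm \<xi>)\<^sup>2) + c0 * n * (1 + (norm \<xi>)\<^sup>2) = (C1 + c0 * n) * (1 + (norm \<xi>)\<^sup>2)"
        by (simp add: algebra_simps)
      also have "\<dots> \<le> C * (1 + (norm \<xi>)\<^sup>2)"
        using C by (intro mult_right_mono) auto
      finally show ?thesis
        by simp
    qed
    show "\<bar>Im (g U \<xi>)\<bar> \<le> C * norm \<xi> powr (\<alpha> / 2)" if "norm \<xi> \<le> 1"
    proof -
      have "\<bar>Im (g U \<xi>)\<bar> \<le> C1 * norm (rot_diag U \<xi>) powr (\<alpha> / 2)"
        using Im_Nu_le[of "rot_diag U \<xi>"] q that by (simp add: g_def)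
      also have "\<dots> \<le> C * norm \<xi> powr (\<alpha> / 2)"
        using q C C1(1) \<alpha> by (intro mult_mono powr_mono2) auto
      finally show ?thesis .
    qed
  next
    show "cf (L m) \<xi> = (\<integral>U. exp (- g U \<xi> / of_nat m) \<partial>\<kappa>) ^ m" if "1 \<le> m" for m \<xi>
      using cf_L[OF that, of \<xi>] cf_\<mu>_scale[OF that, of \<xi>] by simp
    show "cf \<mu> (real m powr (- 1 / \<alpha>) *\<^sub>R \<xi>) * cis (shift m \<bullet> \<xi>) = (\<integral>U. exp (- g U \<xi> / of_nat m) \<partial>\<kappa>)"
      if "1 \<le> m" for m \<xi>
      by (rule cf_\<mu>_scale[OF that])
    show "0 < \<alpha>" "\<alpha> \<le> 2" "0 < C" "0 < c"
      by (fact \<alpha> C c)+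
    show "c * norm \<xi> powr \<alpha> \<le> (\<integral>U. Re (g U \<xi>) \<partial>\<kappa>)" for \<xi>
      by (rule c)
    show "borel_finite_measure \<mu>" "measure \<mu> UNIV = 1" "absolutely_continuous lborel \<mu>"
      by (fact \<mu>)+
    show "borel_finite_measure \<nu>" "measure \<nu> UNIV = 1"
      by (fact \<nu>)+
    show "cf \<nu> \<xi> = exp (- (\<integral>U. g U \<xi> \<partial>\<kappa>))" for \<xi>
      by (rule cf_\<nu>)
    show "borel_finite_measure (L m)" "measure (L m) UNIV = 1" if "1 \<le> m" for m
      using L[OF that] by auto
  qed
  show "absolutely_continuous lborel \<nu>"
  proof (rule absolutely_continuousI_cf[OF \<nu>(1)])
    show "integrable lborel (cf \<nu>)"
    proof (rule integrable_poly_exp[of c \<alpha> _ 1 0])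
      show "norm (cf \<nu> \<xi>) \<le> 1 * (1 + (norm \<xi>)\<^sup>2) ^ 0 * exp (- c * norm \<xi> powr \<alpha>)" for \<xi>
        using Re_G_ge[of \<xi>] unfolding cf_\<nu> G_def by simp
    qed (use c \<alpha> borel_finite_measure.cf_measurable[OF \<nu>(1)] in auto)
  qed
  have "real DIM(real^('n \<times> 'n)) = real (CARD('n) * CARD('n))"
    by simp
  then show "\<exists>K. \<forall>m A. 1 \<le> m \<longrightarrow> A \<in> sets borel \<longrightarrow>
      \<bar>measure (L m) A - measure \<nu> A\<bar> \<le> K * real m powr (- \<alpha> / (real (CARD('n) * CARD('n)) + \<alpha>))"
    using total_variation_rate by (simp only:)
qed

end

subsection \<open>Lebesgue measure on the space of the ensemble\<close>

text \<open>On Hermitian matrices, the orthogonal projection to \<open>W\<close>. In the traceless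
  case it forgets multiples of the identity, and with them the noise.\<close>

definition proj_on :: "'n::{finite,linorder} cmat set \<Rightarrow> 'n cmat \<Rightarrow> 'n cmat"
  where "proj_on W Z = (if W = Herm then Z else Z - (Re (trace Z) / real CARD('n)) *\<^sub>R mat 1)"

lemma measurable_proj_on [measurable]: "proj_on W \<in> borel_measurable borel"
  unfolding proj_on_def[abs_def] by measurable

lemma Herm0_subset: "Herm0 \<subseteq> Herm"
  by (auto simp: Herm0_def)

lemma closed_Herm: "closed (Herm :: 'n::finite cmat set)" and closed_Herm0: "closed (Herm0 :: 'n::finite cmat set)"
proof -
  show *: "closed (Herm :: 'n::finite cmat set)"
    unfolding Herm_def by (intro closed_Collect_eq continuous_intros)
  have eq: "Herm0 = Herm \<inter> {X :: 'n cmat. trace X = 0}"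
    by (auto simp: Herm0_def)
  show "closed (Herm0 :: 'n::finite cmat set)"
    unfolding eq by (intro closed_Int * closed_Collect_eq continuous_intros)
qed

lemma sets_lebesgue_in [simp, measurable_cong]: "sets (lebesgue_in W) = sets borel"
  by (simp add: lebesgue_in_def lebesgue_Herm_def lebesgue_Herm0_def Let_def)

abbreviation last_coord :: "'n::{finite,linorder} \<times> 'n"
  where "last_coord \<equiv> (Max UNIV, Max UNIV)"

definition fill_trace :: "('n::{finite,linorder} \<times> 'n \<Rightarrow> real) \<Rightarrow> 'n \<times> 'n \<Rightarrow> real"
  where "fill_trace x = x(last_coord := - (\<Sum>j\<in>UNIV - {Max UNIV}. x (j, j)))"

lemma measurable_fill_trace:
  fixes I :: "('n::{finite,linorder} \<times> 'n) set"
  assumes "UNIV - {last_coord} \<subseteq> I"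
  shows "(\<lambda>x. herm_of_coords (fill_trace x)) \<in> borel_measurable (\<Pi>\<^sub>M p\<in>I. lborel)"
proof -
  have [measurable]: "(\<lambda>x. x p) \<in> borel_measurable (\<Pi>\<^sub>M p\<in>I. lborel :: real measure)" if "p \<noteq> last_coord" for p
    using assms that measurable_component_singleton[of p I "\<lambda>_. lborel :: real measure"] by auto
  have "(\<lambda>x. fill_trace x p) \<in> borel_measurable (\<Pi>\<^sub>M p\<in>I. lborel :: real measure)" for p
  proof (cases "p = last_coord")
    case True
    have "(\<lambda>x. - (\<Sum>j\<in>UNIV - {Max UNIV}. x (j, j))) \<in> borel_measurable (\<Pi>\<^sub>M p\<in>I. lborel :: real measure)"
      by (intro borel_measurable_uminus borel_measurable_sum) measurable
    then show ?thesis
      using True by (simp add: fill_trace_def)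
  next
    case False
    then show ?thesis
      by (simp add: fill_trace_def)
  qed
  then show ?thesis
    unfolding herm_of_coords_eq_herm
    by (intro measurable_compose[OF _ measurable_herm] borel_measurable_vec_lambda)
qed

lemma lebesgue_Herm0_eq:
  "lebesgue_Herm0 = distr (\<Pi>\<^sub>M p\<in>UNIV - {last_coord}. lborel) borel (\<lambda>x. herm_of_coords (fill_trace x))"
  by (simp add: lebesgue_Herm0_def Let_def fill_trace_def)

text \<open>Lebesgue measure on traceless matrices eliminates the last diagonal coordinate instead
  of projecting orthogonally. For the elimination the preimage is a cylinder in that coordinate and
  null by Fubini; the linear isomorphism \<open>F\<close> then carries one map to the other.\<close>

lemma emeasure_lborel_proj_null:
  fixes A :: "'n::{finite,linorder} cmat set"
  assumes W: "W = Herm \<or> W = Herm0" and A: "A \<in> sets borel" and null: "emeasure (lebesgue_in W) A = 0"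
  shows "emeasure lborel {y. proj_on W (herm y) \<in> A} = 0"
proof (cases "W = Herm")
  case True
  then show ?thesis
    using null A unfolding lebesgue_in_def lebesgue_Herm_eq
    by (simp add: emeasure_distr proj_on_def vimage_def)
next
  case False
  note [measurable] = A
  interpret product_sigma_finite "\<lambda>_::'n \<times> 'n. lborel :: real measure" by standard
  let ?l = "last_coord :: 'n \<times> 'n" and ?P = "\<lambda>K. \<Pi>\<^sub>M p\<in>K. lborel :: real measure"
  note vec = lborel_vec_reindex[OF bij_betw_id[of "UNIV :: ('n \<times> 'n) set"], unfolded id_apply]
  define I where "I = UNIV - {?l}"
  have I: "insert ?l I = UNIV" "?l \<notin> I" "finite I"
    by (auto simp: I_def)
  define Q where "Q = {y :: real^('n \<times> 'n). herm_of_coords (fill_trace (($) y)) \<in> A}"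
  have fill_eq: "fill_trace (x(?l := t)) = fill_trace x" for x :: "'n \<times> 'n \<Rightarrow> real" and t
    unfolding fill_trace_def by (auto intro!: ext sum.cong)
  have mI: "(\<lambda>x. herm_of_coords (fill_trace x)) \<in> borel_measurable (?P I)"
    "(\<lambda>x. herm_of_coords (fill_trace x)) \<in> borel_measurable (?P UNIV)"
    by (rule measurable_fill_trace; simp add: I_def)+
  have nth: "(\<lambda>y :: real^('n \<times> 'n). y $ p) \<in> borel_measurable borel" for p
    by (intro borel_measurable_continuous_onI continuous_intros)
  have "(\<lambda>y :: real^('n \<times> 'n). fill_trace (($) y) p) \<in> borel_measurable borel" for p
    by (cases "p = ?l") (auto simp: fill_trace_def intro!: borel_measurable_uminus borel_measurable_sum nth)
  then have "(\<lambda>y :: real^('n \<times> 'n). herm (\<chi> p. fill_trace (($) y) p)) \<in> borel_measurable borel"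
    by (intro measurable_compose[OF _ measurable_herm] borel_measurable_vec_lambda)
  then have Q: "Q \<in> sets borel"
    unfolding Q_def herm_of_coords_eq_herm by measurable
  have "emeasure lborel Q = emeasure (?P UNIV) {x \<in> space (?P UNIV). herm_of_coords (fill_trace x) \<in> A}"
  proof -
    have "(\<lambda>f. \<chi> p. f p) -` Q \<inter> space (?P UNIV) = {x \<in> space (?P UNIV). herm_of_coords (fill_trace x) \<in> A}"
      by (auto simp: Q_def vec_lambda_beta[abs_def])
    then show ?thesis
      unfolding vec(2)[symmetric] by (subst emeasure_distr[OF vec(1) Q]) simp
  qed
  also have "\<dots> = (\<integral>\<^sup>+x. indicator A (herm_of_coords (fill_trace x)) \<partial>(?P (insert ?l I)))"
  proof -
    have S: "{x \<in> space (?P UNIV). herm_of_coords (fill_trace x) \<in> A} \<in> sets (?P UNIV)"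
      using measurable_sets[OF mI(2) A] by (simp add: vimage_def Int_def conj_commute)
    show ?thesis
      unfolding I(1) nn_integral_indicator[OF S, symmetric]
      by (intro nn_integral_cong) (auto split: split_indicator)
  qed
  also have "\<dots> = (\<integral>\<^sup>+x. (\<integral>\<^sup>+t. indicator A (herm_of_coords (fill_trace (x(?l := t)))) \<partial>lborel) \<partial>(?P I))"
  proof (rule product_nn_integral_insert[OF I(3,2)])
    have "(\<lambda>x. herm_of_coords (fill_trace x)) \<in> borel_measurable (?P (insert ?l I))"
      by (rule measurable_fill_trace) (auto simp: I_def)
    then show "(\<lambda>x. indicator A (herm_of_coords (fill_trace x)) :: ennreal) \<in> borel_measurable (?P (insert ?l I))"
      by measurable
  qed
  also have "\<dots> = (\<integral>\<^sup>+x. (\<integral>\<^sup>+t. indicator A (herm_of_coords (fill_trace x)) \<partial>(lborel :: real measure)) \<partial>(?P I))"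
    by (simp only: fill_eq)
  also have "\<dots> = 0"
  proof -
    have "(\<integral>\<^sup>+x. indicator A (herm_of_coords (fill_trace x)) \<partial>(?P I)) = emeasure (lebesgue_in W) A"
    proof -
      have "(\<integral>\<^sup>+Z. indicator A Z \<partial>(distr (?P I) borel (\<lambda>x. herm_of_coords (fill_trace x))))
          = (\<integral>\<^sup>+x. indicator A (herm_of_coords (fill_trace x)) \<partial>(?P I))"
        by (rule nn_integral_distr[OF mI(1)]) simp
      moreover have "lebesgue_in W = distr (?P I) borel (\<lambda>x. herm_of_coords (fill_trace x))"
        using False by (simp add: lebesgue_in_def lebesgue_Herm0_eq I_def)
      ultimately show ?thesis
        by simp
    qed
    then have "(\<integral>\<^sup>+x. indicator A (herm_of_coords (fill_trace x)) \<partial>(?P I)) = 0"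
      using null by simp
    then have "AE x in ?P I. (indicator A (herm_of_coords (fill_trace x)) :: ennreal) = 0"
      using mI(1) by (subst (asm) nn_integral_0_iff_AE) auto
    then have "AE x in ?P I. (\<integral>\<^sup>+t. indicator A (herm_of_coords (fill_trace x)) \<partial>(lborel :: real measure)) = 0"
      by eventually_elim simp
    then have "(\<integral>\<^sup>+x. (\<integral>\<^sup>+t. indicator A (herm_of_coords (fill_trace x)) \<partial>(lborel :: real measure)) \<partial>(?P I)) = (\<integral>\<^sup>+x. 0 \<partial>(?P I))"
      by (rule nn_integral_cong_AE)
    then show ?thesis
      by simp
  qed
  finally have Q0: "negligible Q"
    using Q by (simp add: negligible_borel_iff)
  let ?N = "real CARD('n)"
  define tr where "tr y = (\<Sum>j\<in>UNIV. y $ (j, j))" for y :: "real^('n \<times> 'n)"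
  \<comment> \<open>The mean of the diagonal is subtracted everywhere on it except in the last
    place, which is kept so that \<open>F\<close> stays injective.\<close>
  define F where "F y = (\<chi> p. if p = ?l \<or> fst p \<noteq> snd p then y $ p else y $ p - tr y / ?N)" for y
  have "linear F"
    by (rule linearI) (auto simp: F_def tr_def vec_eq_iff sum.distrib sum_distrib_left add_divide_distrib algebra_simps)
  moreover have "inj F"
    unfolding linear_injective_0[OF \<open>linear F\<close>]
  proof (intro allI impI)
    fix y assume y: "F y = 0"
    have off: "y $ (j, k) = 0" if "j \<noteq> k" for j k
      using arg_cong[OF y, of "\<lambda>v. v $ (j, k)"] that by (simp add: F_def)
    have l: "y $ ?l = 0"
      using arg_cong[OF y, of "\<lambda>v. v $ ?l"] by (simp add: F_def)
    have d: "y $ (j, j) = tr y / ?N" if "j \<noteq> Max UNIV" for j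
      using arg_cong[OF y, of "\<lambda>v. v $ (j, j)"] that by (simp add: F_def)
    have "tr y = (\<Sum>j\<in>UNIV - {Max UNIV}. y $ (j, j))"
      unfolding tr_def using l by (subst sum.remove[of UNIV "Max UNIV"]) auto
    also have "\<dots> = real (CARD('n) - 1) * (tr y / ?N)"
      using d by simp
    also have "\<dots> = (?N - 1) * (tr y / ?N)"
      by (simp add: of_nat_diff Suc_leI)
    finally have "tr y = 0"
      by (simp add: field_simps)
    then show "y = 0"
      using off l d by (auto simp: vec_eq_iff) (metis div_0)
  qed
  ultimately obtain F' where F': "linear F'" "\<And>x. F' (F x) = x"
    using linear_injective_isomorphism by blast
  have "proj_on W (herm y) = herm_of_coords (fill_trace (($) (F y)))" for y :: "real^('n \<times> 'n)"
  proof -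
    have "Re (trace (herm y)) = tr y"
      by (simp add: trace_def tr_def herm_nth)
    then have p: "proj_on W (herm y) = herm y - (tr y / ?N) *\<^sub>R mat 1"
      using False by (simp add: proj_on_def)
    have "fill_trace (($) (F y)) ?l = y $ ?l - tr y / ?N"
    proof -
      have "(\<Sum>j\<in>UNIV - {Max UNIV}. F y $ (j, j)) = (\<Sum>j\<in>UNIV - {Max UNIV}. y $ (j, j) - tr y / ?N)"
        by (intro sum.cong) (auto simp: F_def)
      also have "\<dots> = (\<Sum>j\<in>UNIV - {Max UNIV}. y $ (j, j)) - (?N - 1) * (tr y / ?N)"
        by (simp add: sum_subtractf of_nat_diff Suc_leI)
      also have "(\<Sum>j\<in>UNIV - {Max UNIV}. y $ (j, j)) = tr y - y $ ?l"
        unfolding tr_def using sum.remove[of UNIV "Max UNIV" "\<lambda>j. y $ (j, j)"] by simp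
      finally show ?thesis
        by (simp add: fill_trace_def field_simps)
    qed
    moreover have "fill_trace (($) (F y)) (j, k) = (if j = k then y $ (j, k) - tr y / ?N else y $ (j, k))"
      if "(j, k) \<noteq> ?l" for j k
      using that by (auto simp: fill_trace_def F_def)
    ultimately have "fill_trace (($) (F y)) (j, k) = (if j = k then y $ (j, k) - tr y / ?N else y $ (j, k))" for j k
      by (cases "(j, k) = ?l") auto
    then show ?thesis
      unfolding p herm_of_coords_eq_herm by (auto simp: vec_eq_iff herm_nth mat_def complex_eq_iff)
  qed
  then have "{y. proj_on W (herm y) \<in> A} \<subseteq> F' ` Q"
    using F'(2) by (force simp: Q_def image_iff)
  then have "negligible {y. proj_on W (herm y) \<in> A}"
    using negligible_linear_image[OF F'(1) Q0] negligible_subset by blast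
  moreover have "{y :: real^('n \<times> 'n). proj_on W (herm y) \<in> A} \<in> sets borel"
    by measurable
  ultimately show ?thesis
    by (simp add: negligible_borel_iff)
qed

text \<open>The preimage of a ball lies in a cube, because the coordinates are bounded by the norm
  of the image.\<close>

lemma sigma_finite_distr_PiM:
  fixes \<phi> :: "('i \<Rightarrow> real) \<Rightarrow> 'b::real_normed_vector"
  assumes I: "finite I" and \<phi>: "\<phi> \<in> measurable (\<Pi>\<^sub>M p\<in>I. lborel) borel"
    and le: "\<And>x p. p \<in> I \<Longrightarrow> \<bar>x p\<bar> \<le> norm (\<phi> x)"
  shows "sigma_finite_measure (distr (\<Pi>\<^sub>M p\<in>I. lborel) borel \<phi>)"
proof
  interpret product_sigma_finite "\<lambda>_::'i. lborel :: real measure" by standard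
  let ?P = "\<Pi>\<^sub>M p\<in>I. lborel :: real measure"
  have "emeasure (distr ?P borel \<phi>) (cball 0 (real n)) \<noteq> \<infinity>" for n
  proof -
    have "emeasure (distr ?P borel \<phi>) (cball 0 (real n)) = emeasure ?P (\<phi> -` cball 0 (real n) \<inter> space ?P)"
      by (rule emeasure_distr[OF \<phi>]) simp
    also have "\<dots> \<le> emeasure ?P (\<Pi>\<^sub>E p\<in>I. {- real n..real n})"
    proof (rule emeasure_mono)
      show "\<phi> -` cball 0 (real n) \<inter> space ?P \<subseteq> (\<Pi>\<^sub>E p\<in>I. {- real n..real n})"
      proof (rule subsetI)
        fix x assume x: "x \<in> \<phi> -` cball 0 (real n) \<inter> space ?P"
        have "x p \<in> {- real n..real n}" if "p \<in> I" for p
          using le[OF that, of x] x by auto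
        then show "x \<in> (\<Pi>\<^sub>E p\<in>I. {- real n..real n})"
          using x by (auto simp: space_PiM PiE_iff)
      qed
      show "(\<Pi>\<^sub>E p\<in>I. {- real n..real n}) \<in> sets ?P"
        using I by (intro sets_PiM_I_finite) auto
    qed
    also have "\<dots> = (\<Prod>p\<in>I. ennreal (2 * real n))"
      using I by (subst emeasure_PiM) auto
    also have "\<dots> < \<infinity>"
      by (simp add: ennreal_power)
    finally show ?thesis
      by simp
  qed
  moreover have "(\<Union>n. cball 0 (real n) :: 'b set) = UNIV"
    using real_arch_simple by auto
  ultimately show "\<exists>A. countable A \<and> A \<subseteq> sets (distr ?P borel \<phi>) \<and> \<Union> A = space (distr ?P borel \<phi>) \<and>
      (\<forall>a\<in>A. emeasure (distr ?P borel \<phi>) a \<noteq> \<infinity>)"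
    by (intro exI[of _ "range (\<lambda>n. cball 0 (real n))"]) auto
qed

lemma abs_le_norm_herm_of_coords: "\<bar>x (j, k)\<bar> \<le> norm (herm_of_coords x)"
proof -
  have "\<bar>coords Z $ (j, k)\<bar> \<le> norm Z" for Z
    by (auto simp: coords_def intro: order.trans[OF abs_Re_le_cmod norm_entry_le] order.trans[OF abs_Im_le_cmod norm_entry_le])
  from this[of "herm_of_coords x"] show ?thesis
    by (simp add: herm_of_coords_eq_herm)
qed

lemma sigma_finite_lebesgue_in: "sigma_finite_measure (lebesgue_in (W :: 'n::{finite,linorder} cmat set))"
proof -
  have "sigma_finite_measure (lebesgue_Herm :: 'n cmat measure)"
    unfolding lebesgue_Herm_def
  proof (rule sigma_finite_distr_PiM)
    show "herm_of_coords \<in> borel_measurable (\<Pi>\<^sub>M p\<in>UNIV. lborel)"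
      unfolding herm_of_coords_eq_herm[abs_def]
      by (intro measurable_compose[OF _ measurable_herm] borel_measurable_vec_lambda)
        (use measurable_component_singleton[of _ UNIV "\<lambda>_. lborel :: real measure"] in auto)
  qed (auto simp: abs_le_norm_herm_of_coords)
  moreover have "sigma_finite_measure (lebesgue_Herm0 :: 'n cmat measure)"
    unfolding lebesgue_Herm0_eq
  proof (rule sigma_finite_distr_PiM)
    fix x :: "'n \<times> 'n \<Rightarrow> real" and p :: "'n \<times> 'n" assume "p \<in> UNIV - {last_coord}"
    then have "x p = fill_trace x p"
      by (simp add: fill_trace_def)
    then show "\<bar>x p\<bar> \<le> norm (herm_of_coords (fill_trace x))"
      using abs_le_norm_herm_of_coords[of "fill_trace x" "fst p" "snd p"] by simp
  qed (auto intro!: measurable_fill_trace)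
  ultimately show ?thesis
    by (simp add: lebesgue_in_def)
qed

subsection \<open>The law of the normalized sum\<close>

lemma (in borel_finite_measure) measure_UNIV_eq_cf: "complex_of_real (measure T UNIV) = cf T 0"
  by (simp add: cf_def scaleR_conv_of_real)

text \<open>Independence is used twice: inside a pair \<open>(X j, U j)\<close>, to integrate over
  the eigenvalues with the unitary matrix held fixed, and between the pairs, to factor the
  expectation.\<close>

lemma (in prob_space) expectation_cis_rotated_sum:
  fixes X U :: "nat \<Rightarrow> 'a \<Rightarrow> 'n::{finite,linorder} cmat" and Xt :: "nat \<Rightarrow> 'a \<Rightarrow> (real, 'n) vec"
  assumes indep: "indep_vars (\<lambda>_. borel) (case_sum X U) ({1..} <+> {1..})"
    and X: "\<And>j \<omega>. X j \<omega> = diag_mat (Xt j \<omega>)"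
    and Xt [measurable]: "\<And>j. 1 \<le> j \<Longrightarrow> Xt j \<in> borel_measurable M"
    and U: "\<And>j. 1 \<le> j \<Longrightarrow> U j \<in> measurable M (restrict_space borel unitary_group)"
    and U_law: "\<And>j. 1 \<le> j \<Longrightarrow> distr M (restrict_space borel unitary_group) (U j) = \<kappa>"
    and cf: "\<And>j x. 1 \<le> j \<Longrightarrow> cf (distr M borel (Xt j)) x = \<phi> x"
    and \<phi> [measurable]: "\<phi> \<in> borel_measurable borel"
  shows "expectation (\<lambda>\<omega>. \<Prod>j = 1..m. cis (\<xi> \<bullet> coords (U j \<omega> ** X j \<omega> ** ctransp (U j \<omega>))))
    = (\<integral>V. \<phi> (rot_diag V \<xi>) \<partial>\<kappa>) ^ m"
proof -
  define f where "f A V = cis (\<xi> \<bullet> coords (V ** A ** ctransp V))" for A V :: "'n cmat"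
  have f_meas [measurable]: "case_prod f \<in> borel_measurable (borel \<Otimes>\<^sub>M borel)"
    unfolding f_def by measurable
  have U_borel [measurable]: "U j \<in> borel_measurable M" if "1 \<le> j" for j
    using measurable_comp[OF U[OF that] measurable_restrict_space1[of "\<lambda>x. x" borel borel]] by (simp add: comp_def)
  have X_borel [measurable]: "X j \<in> borel_measurable M" if "1 \<le> j" for j
    using measurable_compose[OF Xt[OF that] measurable_diag_mat] by (simp add: X[abs_def])
  have single: "expectation (\<lambda>\<omega>. f (X j \<omega>) (U j \<omega>)) = (\<integral>V. \<phi> (rot_diag V \<xi>) \<partial>\<kappa>)" if j: "1 \<le> j" for j
  proof -
    note [measurable] = U_borel[OF j] X_borel[OF j] Xt[OF j]
    have "indep_var (PiM {Inl j} (\<lambda>_. borel)) (\<lambda>\<omega>. restrict (\<lambda>i. case_sum X U i \<omega>) {Inl j})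
        (PiM {Inr j} (\<lambda>_. borel)) (\<lambda>\<omega>. restrict (\<lambda>i. case_sum X U i \<omega>) {Inr j})"
      using j by (intro indep_var_restrict[OF indep]) auto
    then have "indep_var borel ((\<lambda>f. f (Inl j)) \<circ> (\<lambda>\<omega>. restrict (\<lambda>i. case_sum X U i \<omega>) {Inl j}))
        borel ((\<lambda>f. f (Inr j)) \<circ> (\<lambda>\<omega>. restrict (\<lambda>i. case_sum X U i \<omega>) {Inr j}))"
      by (rule indep_var_compose) (auto intro: measurable_component_singleton)
    then have "indep_var borel (X j) borel (U j)"
      by (simp add: comp_def)
    then have joint: "distr M borel (X j) \<Otimes>\<^sub>M distr M borel (U j) = distr M (borel \<Otimes>\<^sub>M borel) (\<lambda>\<omega>. (X j \<omega>, U j \<omega>))"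
      by (simp add: indep_var_distribution_eq)
    interpret DX: prob_space "distr M borel (X j)"
      by (rule prob_space_distr) simp
    interpret DU: prob_space "distr M borel (U j)"
      by (rule prob_space_distr) simp
    interpret D: pair_prob_space "distr M borel (X j)" "distr M borel (U j)" ..
    have "expectation (\<lambda>\<omega>. f (X j \<omega>) (U j \<omega>)) = (\<integral>z. case_prod f z \<partial>(distr M (borel \<Otimes>\<^sub>M borel) (\<lambda>\<omega>. (X j \<omega>, U j \<omega>))))"
      by (subst integral_distr) auto
    also have "\<dots> = (\<integral>z. case_prod f z \<partial>(distr M borel (X j) \<Otimes>\<^sub>M distr M borel (U j)))"
      by (simp only: joint)
    also have "\<dots> = (\<integral>V. (\<integral>A. f A V \<partial>(distr M borel (X j))) \<partial>(distr M borel (U j)))"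
    proof (rule D.integral_snd[symmetric])
      show "integrable (distr M borel (X j) \<Otimes>\<^sub>M distr M borel (U j)) (case_prod f)"
        by (rule D.integrable_const_bound[where B=1]) (auto simp: f_def)
    qed
    also have "\<dots> = (\<integral>V. \<phi> (rot_diag V \<xi>) \<partial>(distr M borel (U j)))"
    proof (rule Bochner_Integration.integral_cong[OF refl])
      fix V
      have [measurable]: "(\<lambda>A. f A V) \<in> borel_measurable borel"
        unfolding f_def by measurable
      have "(\<integral>A. f A V \<partial>(distr M borel (X j))) = expectation (\<lambda>\<omega>. f (X j \<omega>) V)"
        by (rule integral_distr) auto
      also have "\<dots> = expectation (\<lambda>\<omega>. cis (rot_diag V \<xi> \<bullet> Xt j \<omega>))"
        unfolding f_def X inner_coords_conj by (simp add: inner_commute)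
      also have "\<dots> = cf (distr M borel (Xt j)) (rot_diag V \<xi>)"
        by (rule cf_distr[symmetric]) (rule Xt[OF j])
      finally show "(\<integral>A. f A V \<partial>(distr M borel (X j))) = \<phi> (rot_diag V \<xi>)"
        by (simp add: cf[OF j])
    qed
    also have "\<dots> = expectation (\<lambda>\<omega>. \<phi> (rot_diag (U j \<omega>) \<xi>))"
      by (rule integral_distr) auto
    also have "\<dots> = (\<integral>V. \<phi> (rot_diag V \<xi>) \<partial>(distr M (restrict_space borel unitary_group) (U j)))"
      by (rule integral_distr[OF U[OF j], symmetric]) (rule measurable_restrict_space1, measurable)
    finally show ?thesis
      by (simp only: U_law[OF j])
  qed
  \<comment> \<open>Disjoint blocks of the index set, each grouping \<open>X j\<close> with its
    \<open>U j\<close>.\<close>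
  define K :: "nat \<Rightarrow> (nat + nat) set" where "K j = {Inl j, Inr j}" for j
  have "indep_vars (\<lambda>j. PiM (K j) (\<lambda>_. borel)) (\<lambda>j \<omega>. restrict (\<lambda>i. case_sum X U i \<omega>) (K j)) {1..}"
    by (rule indep_vars_restrict[OF indep]) (auto simp: K_def disjoint_family_on_def)
  then have "indep_vars (\<lambda>_. borel) (\<lambda>j \<omega>. f (restrict (\<lambda>i. case_sum X U i \<omega>) (K j) (Inl j))
      (restrict (\<lambda>i. case_sum X U i \<omega>) (K j) (Inr j))) {1..}"
  proof (rule indep_vars_compose2)
    fix j
    have [measurable]: "(\<lambda>x. x (Inl j)) \<in> borel_measurable (PiM (K j) (\<lambda>_. borel :: 'n cmat measure))"
      "(\<lambda>x. x (Inr j)) \<in> borel_measurable (PiM (K j) (\<lambda>_. borel :: 'n cmat measure))"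
      by (auto intro!: measurable_component_singleton simp: K_def)
    show "(\<lambda>x. f (x (Inl j)) (x (Inr j))) \<in> borel_measurable (PiM (K j) (\<lambda>_. borel))"
      unfolding f_def by measurable
  qed
  then have indep_f: "indep_vars (\<lambda>_. borel) (\<lambda>j \<omega>. f (X j \<omega>) (U j \<omega>)) {1..m}"
    by (rule indep_vars_subset[OF indep_vars_cong[THEN iffD1, rotated -1]]) (auto simp: K_def)
  have "expectation (\<lambda>\<omega>. \<Prod>j = 1..m. f (X j \<omega>) (U j \<omega>)) = (\<Prod>j = 1..m. expectation (\<lambda>\<omega>. f (X j \<omega>) (U j \<omega>)))"
  proof (rule indep_vars_lebesgue_integral[OF _ indep_f])
    fix j assume "j \<in> {1..m}"
    then have [measurable]: "X j \<in> borel_measurable M" "U j \<in> borel_measurable M"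
      using X_borel U_borel by auto
    show "integrable M (\<lambda>\<omega>. f (X j \<omega>) (U j \<omega>))"
      by (rule integrable_const_bound[where B=1]) (auto simp: f_def)
  qed simp
  also have "\<dots> = (\<integral>V. \<phi> (rot_diag V \<xi>) \<partial>\<kappa>) ^ m"
    using single by simp
  finally show ?thesis
    by (simp only: f_def)
qed

lemma coords_normalized_sum:
  assumes "1 \<le> m"
  shows "coords (normalized_sum \<alpha> h X U m) = real m powr (- 1 / \<alpha>) *\<^sub>R (\<Sum>j = 1..m. coords (U j ** X j ** ctransp (U j)))
    + real m *\<^sub>R (if \<alpha> = 1 then - (2 * mean_coordinate h * ln (real m) / (pi * real m)) *\<^sub>R coords (mat 1) else 0)"
  using assms
  by (simp add: normalized_sum_def linear_diff[OF linear_coords] linear_cmul[OF linear_coords]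
      linear_sum[OF linear_coords] linear_0[OF linear_coords] powr_minus_divide)

lemma normalized_sum_Herm:
  assumes "\<And>j. X j \<in> Herm"
  shows "normalized_sum \<alpha> h X U m \<in> Herm"
proof -
  have "(\<Sum>j = 1..m. U j ** X j ** ctransp (U j)) \<in> Herm"
  proof (induction m)
    case (Suc m)
    then show ?case
      using Herm_conj[OF assms, of "U (Suc m)" "Suc m"] by (simp add: Herm_def ctransp_add)
  qed (simp add: Herm_def ctransp_def vec_eq_iff)
  then show ?thesis
    by (simp add: normalized_sum_def Herm_def ctransp_diff ctransp_scaleR) (simp add: ctransp_def vec_eq_iff)
qed

subsection \<open>Noise in the direction of the identity\<close>

text \<open>
  For traceless ensembles all characteristic functions are constant in the direction of the identity.
  Adding an independent multiple of the identity makes the laws absolutely continuous on all Hermitian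
  matrices and changes no total variation distance. A symmetric stable multiple keeps the scaling.
\<close>
lemma symmetric_noise:
  fixes h \<psi> :: "(real, 'n::finite) vec measure"
  assumes \<alpha>: "0 < \<alpha>" "\<alpha> \<le> 2" and h: "borel_prob_on (sphere 0 1) h" and \<psi>: "is_stable_dist \<alpha> 1 h 0 \<psi>"
  obtains \<rho> where "borel_finite_measure \<rho>"
    "\<And>t. cf \<rho> t = of_real (exp (- (2 * (\<integral>r. \<bar>r $ i\<bar> powr \<alpha> \<partial>h)) * \<bar>t\<bar> powr \<alpha>))"
proof -
  interpret h: prob_space h
    using h by (simp add: borel_prob_on_def)
  have sets_h [measurable_cong]: "sets h = sets (restrict_space borel (sphere 0 1))"
    using h by (simp add: borel_prob_on_def)
  have space_h: "space h = sphere 0 1"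
    using sets_eq_imp_space_eq[OF sets_h] by (simp add: space_restrict_space)
  have [measurable]: "(\<lambda>r. r) \<in> borel_measurable h"
    by (subst measurable_cong_sets[OF sets_h refl]) (rule measurable_restrict_space1, simp)
  interpret \<psi>: prob_space \<psi>
    using \<psi> by (simp add: is_stable_dist_def borel_prob_on_def)
  have sets_\<psi> [simp, measurable_cong]: "sets \<psi> = sets borel"
    using \<psi> by (simp add: is_stable_dist_def borel_prob_on_def)
  have cf_\<psi>: "cf \<psi> \<xi> = exp (- (\<integral>r. stable_nu \<alpha> (r \<bullet> \<xi>) \<partial>h))" for \<xi>
    using \<psi> by (simp add: is_stable_dist_def cf_def cis_conv_exp)
  obtain C where C: "0 < C" "\<And>u. cmod (stable_nu \<alpha> u) \<le> C * (1 + u\<^sup>2)"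
    using stable_nu_bounds[OF \<alpha>] by metis
  have int: "integrable h (\<lambda>r. stable_nu \<alpha> (r \<bullet> \<xi>))" for \<xi>
  proof (rule h.integrable_const_bound[where B="C * (1 + (norm \<xi>)\<^sup>2)"])
    show "AE r in h. norm (stable_nu \<alpha> (r \<bullet> \<xi>)) \<le> C * (1 + (norm \<xi>)\<^sup>2)"
    proof (rule AE_I2)
      fix r assume "r \<in> space h"
      then have "\<bar>r \<bullet> \<xi>\<bar> \<le> norm \<xi>"
        using Cauchy_Schwarz_ineq2[of r \<xi>] by (simp add: space_h)
      then have "(r \<bullet> \<xi>)\<^sup>2 \<le> (norm \<xi>)\<^sup>2"
        by (simp add: abs_le_square_iff[symmetric])
      then show "norm (stable_nu \<alpha> (r \<bullet> \<xi>)) \<le> C * (1 + (norm \<xi>)\<^sup>2)"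
        using C(1) by (intro order.trans[OF C(2)] mult_left_mono) auto
    qed
  qed measurable
  \<comment> \<open>The noise is the difference of two independent copies of one coordinate of
    \<open>\<psi>\<close>, that is, the convolution of \<open>S 1\<close> and
    \<open>S (- 1)\<close>. The existence of a symmetric stable law is thus inherited from
    \<open>\<psi>\<close>.\<close>
  define S where "S c = distr \<psi> borel (\<lambda>x. c * x $ i)" for c :: real
  have nth [measurable]: "(\<lambda>x. c * x $ i) \<in> borel_measurable \<psi>" for c
  proof -
    have "(\<lambda>x :: (real, 'n) vec. c * x $ i) \<in> borel_measurable borel"
      by (intro borel_measurable_continuous_onI continuous_intros)
    then show ?thesis
      by (simp cong: measurable_cong_sets)
  qed
  have S: "borel_finite_measure (S c)" for c
    unfolding S_def by (intro borel_finite_measure_distr \<psi>.finite_measure_axioms nth)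
  have cf_S: "cf (S c) t = cf \<psi> ((t * c) *\<^sub>R axis i 1)" for c t
    unfolding S_def by (subst cf_distr[OF nth]) (simp add: cf_def inner_axis' mult.assoc)
  have nu_minus: "stable_nu \<alpha> (- u) = cnj (stable_nu \<alpha> u)" for u
    by (simp add: stable_nu_def)
  have "cf (S 1) t * cf (S (- 1)) t = of_real (exp (- (2 * (\<integral>r. \<bar>r $ i\<bar> powr \<alpha> \<partial>h)) * \<bar>t\<bar> powr \<alpha>))" for t
  proof -
    define N where "N = (\<integral>r. stable_nu \<alpha> (r \<bullet> (t *\<^sub>R axis i 1)) \<partial>h)"
    have "(\<integral>r. stable_nu \<alpha> (r \<bullet> ((t * - 1) *\<^sub>R axis i 1)) \<partial>h) = cnj N"
      unfolding N_def Bochner_Integration.integral_cnj[symmetric] by (simp add: nu_minus)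
    then have "cf (S 1) t * cf (S (- 1)) t = exp (- N) * exp (- cnj N)"
      unfolding cf_S cf_\<psi> by (simp add: N_def)
    also have "\<dots> = exp (- (N + cnj N))"
      by (simp add: exp_add[symmetric])
    also have "N + cnj N = of_real (2 * Re N)"
      by (simp add: complex_eq_iff)
    also have "Re N = (\<integral>r. \<bar>r $ i\<bar> powr \<alpha> \<partial>h) * \<bar>t\<bar> powr \<alpha>"
    proof -
      have "Re N = (\<integral>r. Re (stable_nu \<alpha> (r \<bullet> (t *\<^sub>R axis i 1))) \<partial>h)"
        unfolding N_def by (rule integral_Re[OF int, symmetric])
      also have "\<dots> = (\<integral>r. \<bar>r $ i\<bar> powr \<alpha> * \<bar>t\<bar> powr \<alpha> \<partial>h)"
        by (simp add: Re_stable_nu inner_axis abs_mult powr_mult mult.commute)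
      finally show ?thesis
        by simp
    qed
    finally show ?thesis
      by (simp add: mult.assoc flip: exp_of_real)
  qed
  then show ?thesis
    using cf_convolution[OF S S] by (intro that) auto
qed

lemma permuted_AE:
  fixes h :: "(real, 'n::finite) vec measure"
  assumes h: "borel_prob_on (sphere 0 1) h" and perm: "permutation_invariant h"
    and P: "Measurable.pred borel P" and ae: "AE r in h. P r"
  shows "AE r in h. P (\<chi> k. r $ Transposition.transpose i j k)"
proof -
  have "distr h h (\<lambda>r. \<chi> k. r $ Transposition.transpose i j k) = h"
    using perm permutes_swap_id[of i UNIV j] unfolding permutation_invariant_def by blast
  then have "AE r in distr h h (\<lambda>r. \<chi> k. r $ Transposition.transpose i j k). P r"
    using ae by (simp only:)
  moreover have "{r \<in> space h. P r} \<in> sets h"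
  proof -
    have "sets h = sets (restrict_space borel (sphere 0 1))"
      using h by (simp add: borel_prob_on_def)
    moreover have "space h = sphere 0 1"
      using sets_eq_imp_space_eq[OF calculation] by (simp add: space_restrict_space)
    moreover have "{r. P r} \<in> sets borel"
      using P by (simp add: pred_def)
    ultimately show ?thesis
      by (auto simp: sets_restrict_space Collect_conj_eq)
  qed
  ultimately show ?thesis
    by (subst (asm) AE_distr_iff[OF measurable_permute[OF h]])
qed

text \<open>In the traceless case, sets pulled back along \<open>proj_on\<close> are invariant under
  translation by multiples of the identity; for \<open>W = Herm\<close> the noise is concentrated at
  0.\<close>

lemma emeasure_add_noise:
  fixes D :: "(real^('n::{finite,linorder} \<times> 'n)) measure" and \<rho> :: "real measure"
  assumes D: "borel_finite_measure D" and \<rho>: "borel_finite_measure \<rho>" "measure \<rho> UNIV = 1"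
    and \<rho>_Herm: "W = Herm \<Longrightarrow> \<rho> = return borel 0" and A: "A \<in> sets borel"
  shows "emeasure (distr (D \<Otimes>\<^sub>M distr \<rho> borel (\<lambda>s. s *\<^sub>R coords (mat 1))) borel (\<lambda>(x, y). x + y))
      {y. proj_on W (herm y) \<in> A} = emeasure D {y. proj_on W (herm y) \<in> A}"
proof -
  interpret D: borel_finite_measure D by fact
  interpret \<rho>: borel_finite_measure \<rho> by fact
  define \<sigma> where "\<sigma> = distr \<rho> borel (\<lambda>s. s *\<^sub>R coords (mat 1 :: 'n cmat))"
  have \<sigma>: "borel_finite_measure \<sigma>"
    unfolding \<sigma>_def by (intro borel_finite_measure_distr \<rho>.finite_measure_axioms) auto
  interpret \<sigma>: borel_finite_measure \<sigma> by fact
  note [measurable] = A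
  define A' where "A' = {y :: real^('n \<times> 'n). proj_on W (herm y) \<in> A}"
  have A' [measurable]: "A' \<in> sets borel"
    unfolding A'_def by measurable
  have \<rho>1: "emeasure \<rho> UNIV = 1"
    using \<rho>(2) by (simp add: \<rho>.emeasure_eq_measure)
  have inner: "(\<integral>\<^sup>+y. indicator A' (x + y) \<partial>\<sigma>) = indicator A' x" for x
  proof -
    have "(\<integral>\<^sup>+y. indicator A' (x + y) \<partial>\<sigma>) = (\<integral>\<^sup>+s. indicator A' (x + s *\<^sub>R coords (mat 1)) \<partial>\<rho>)"
      unfolding \<sigma>_def by (subst nn_integral_distr) auto
    also have "\<dots> = indicator A' x"
    proof (cases "W = Herm")
      case True
      then show ?thesis
        by (simp add: \<rho>_Herm nn_integral_return)
    next
      case False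
      have "proj_on W (herm (x + s *\<^sub>R coords (mat 1))) = proj_on W (herm x)" for s
      proof -
        have "herm (x + s *\<^sub>R coords (mat 1)) = herm x + s *\<^sub>R mat 1"
          by (simp add: linear_add[OF linear_herm] linear_cmul[OF linear_herm] herm_coords)
        moreover have "Re (trace (herm x + s *\<^sub>R mat 1)) = Re (trace (herm x)) + s * real CARD('n)"
          by (simp add: trace_def sum.distrib mat_def)
        ultimately show ?thesis
          using False by (simp add: proj_on_def add_divide_distrib scaleR_add_left)
      qed
      then have "(\<lambda>s. indicator A' (x + s *\<^sub>R coords (mat 1)) :: ennreal) = (\<lambda>s. indicator A' x)"
        by (auto simp: A'_def indicator_def)
      then show ?thesis
        by (simp add: \<rho>1)
    qed
    finally show ?thesis .
  qed
  have "emeasure (distr (D \<Otimes>\<^sub>M \<sigma>) borel (\<lambda>(x, y). x + y)) A' = (\<integral>\<^sup>+z. indicator A' (case z of (x, y) \<Rightarrow> x + y) \<partial>(D \<Otimes>\<^sub>M \<sigma>))"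
    by (subst nn_integral_indicator[symmetric], simp, subst nn_integral_distr) auto
  also have "\<dots> = (\<integral>\<^sup>+x. (\<integral>\<^sup>+y. indicator A' (x + y) \<partial>\<sigma>) \<partial>D)"
    by (subst \<sigma>.nn_integral_fst[symmetric]) auto
  also have "\<dots> = emeasure D A'"
    unfolding inner by simp
  finally show ?thesis
    by (simp only: A'_def \<sigma>_def)
qed

lemma proj_on_in:
  fixes Z :: "'n::{finite,linorder} cmat"
  assumes W: "W = Herm \<or> W = Herm0" and Z: "Z \<in> Herm"
  shows "proj_on W Z \<in> W"
proof (cases "W = Herm")
  case False
  have "trace Z = of_real (Re (trace Z))"
    using trace_Herm_mult_real[OF Z mat_1_Herm] by simp
  moreover have "trace (Z - c *\<^sub>R mat 1) = trace Z - of_real (c * real CARD('n))" for c and Z :: "'n cmat"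
    by (simp add: trace_def sum_subtractf mat_def scaleR_conv_of_real[of c "of_nat CARD('n)"])
  ultimately have "trace (Z - (Re (trace Z) / real CARD('n)) *\<^sub>R mat 1) = 0"
    by simp
  then show ?thesis
    using False W Z by (auto simp: proj_on_def Herm0_def Herm_def ctransp_diff ctransp_scaleR)
qed (use Z in \<open>simp add: proj_on_def\<close>)

lemma proj_on_id: "Z \<in> W \<Longrightarrow> W = Herm \<or> W = Herm0 \<Longrightarrow> proj_on W Z = Z"
  by (auto simp: proj_on_def Herm0_def)

lemma trace_proj_on_mult:
  fixes Z Y :: "'n::{finite,linorder} cmat"
  assumes W: "W = Herm \<or> W = Herm0" and Y: "Y \<in> W"
  shows "trace (proj_on W Z ** Y) = trace (Z ** Y)"
proof (cases "W = Herm")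
  case False
  then have "trace Y = 0"
    using W Y by (auto simp: Herm0_def)
  then have "trace ((c *\<^sub>R mat 1) ** Y) = 0" for c
    by (simp add: matrix_mult_scaleR_left) (simp add: trace_def scaleR_sum_right[symmetric])
  moreover have "trace (A - B) = trace A - trace B" for A B :: "'n cmat"
    by (simp add: trace_def sum_subtractf)
  ultimately show ?thesis
    using False by (simp add: proj_on_def matrix_mult_diff_left)
qed (simp add: proj_on_def)

lemma trace_dual_mult: "Y \<in> Herm \<Longrightarrow> trace (dual \<xi> ** Y) = of_real (\<xi> \<bullet> coords Y)"
  using trace_dual_herm[of \<xi> "coords Y"] by (simp add: herm_coords)

subsection \<open>Eigenvalue parts\<close>

locale eigenvalue_part = haar \<kappa> for \<kappa> :: "'n::{finite,linorder} cmat measure" +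
  fixes W :: "'n cmat set" and H :: "'n cmat measure" and h :: "(real, 'n) vec measure"
  assumes card: "2 \<le> CARD('n)" and W: "W = Herm \<or> W = Herm0"
    and H: "borel_prob_on (unit_sphere_in W) H" and H_spans: "span (topological_support H) = W"
    and h: "borel_prob_on (sphere 0 1) h" and h_perm: "permutation_invariant h"
    and H_law: "distr H borel (\<lambda>R. R) = distr (h \<Otimes>\<^sub>M \<kappa>) borel (\<lambda>(r, U). ctransp U ** diag_mat r ** U)"
begin

sublocale h: prob_space h
  using h by (simp add: borel_prob_on_def)

sublocale H: prob_space H
  using H by (simp add: borel_prob_on_def)

sublocale h\<kappa>: pair_prob_space h \<kappa> ..

lemma sets_h [measurable_cong]: "sets h = sets (restrict_space borel (sphere 0 1))"
  using h by (simp add: borel_prob_on_def)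

lemma space_h [simp]: "space h = sphere 0 1"
  using sets_eq_imp_space_eq[OF sets_h] by (simp add: space_restrict_space)

lemma measurable_h_id [measurable]: "(\<lambda>r. r) \<in> borel_measurable h"
  by (subst measurable_cong_sets[OF sets_h refl]) (rule measurable_restrict_space1, simp)

lemma sets_H [measurable_cong]: "sets H = sets (restrict_space borel (unit_sphere_in W))"
  using H by (simp add: borel_prob_on_def)

lemma space_H: "space H = unit_sphere_in W"
  using sets_eq_imp_space_eq[OF sets_H] by (simp add: space_restrict_space)

lemma measurable_H_id [measurable]: "(\<lambda>R. R) \<in> borel_measurable H"
  by (subst measurable_cong_sets[OF sets_H refl]) (rule measurable_restrict_space1, simp)

lemma W_Herm: "W \<subseteq> Herm"
  using W Herm0_subset by blast

text \<open>Haar measure is invariant under inversion, so the order of \<open>U\<close> and its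
  adjoint in the eigenvalue part can be made that of the summands.\<close>

lemma H_law':
  "distr H borel (\<lambda>R. R) = distr (h \<Otimes>\<^sub>M \<kappa>) borel (\<lambda>z. snd z ** diag_mat (fst z) ** ctransp (snd z))"
proof -
  have c [measurable]: "ctransp \<in> measurable \<kappa> \<kappa>"
    by (rule measurable_into) (auto intro: measurable_from)
  have "h \<Otimes>\<^sub>M \<kappa> = distr h h (\<lambda>r. r) \<Otimes>\<^sub>M distr \<kappa> \<kappa> ctransp"
    by (simp add: distr_ctransp distr_id2)
  also have "\<dots> = distr (h \<Otimes>\<^sub>M \<kappa>) (h \<Otimes>\<^sub>M \<kappa>) (\<lambda>(r, U). (r, ctransp U))"
    by (rule pair_measure_distr) (auto simp: distr_ctransp sigma_finite_measure_axioms)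
  finally have eq: "h \<Otimes>\<^sub>M \<kappa> = distr (h \<Otimes>\<^sub>M \<kappa>) (h \<Otimes>\<^sub>M \<kappa>) (\<lambda>(r, U). (r, ctransp U))" .
  have "distr H borel (\<lambda>R. R) = distr (distr (h \<Otimes>\<^sub>M \<kappa>) (h \<Otimes>\<^sub>M \<kappa>) (\<lambda>(r, U). (r, ctransp U))) borel
      (\<lambda>(r, U). ctransp U ** diag_mat r ** U)"
    using H_law eq by simp
  also have "\<dots> = distr (h \<Otimes>\<^sub>M \<kappa>) borel ((\<lambda>(r, U). ctransp U ** diag_mat r ** U) \<circ> (\<lambda>(r, U). (r, ctransp U)))"
    by (rule distr_distr) measurable
  also have "(\<lambda>(r, U). ctransp U ** diag_mat r ** U) \<circ> (\<lambda>(r, U). (r, ctransp U))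
      = (\<lambda>z. snd z ** diag_mat (fst z) ** ctransp (snd z :: 'n cmat))"
    by (auto simp: fun_eq_iff)
  finally show ?thesis .
qed

lemma AE_H_iff:
  assumes [measurable]: "Measurable.pred borel P"
  shows "(AE R in H. P R) \<longleftrightarrow> (AE z in h \<Otimes>\<^sub>M \<kappa>. P (snd z ** diag_mat (fst z) ** ctransp (snd z)))"
proof -
  have "(AE R in H. P R) \<longleftrightarrow> (AE R in distr H borel (\<lambda>R. R). P R)"
    by (subst AE_distr_iff) auto
  also have "\<dots> \<longleftrightarrow> (AE z in h \<Otimes>\<^sub>M \<kappa>. P (snd z ** diag_mat (fst z) ** ctransp (snd z)))"
    unfolding H_law' by (rule AE_distr_iff) auto
  finally show ?thesis .
qed

lemma integral_H:
  fixes f :: "'n cmat \<Rightarrow> complex"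
  assumes [measurable]: "f \<in> borel_measurable borel"
  shows "(\<integral>R. f R \<partial>H) = (\<integral>z. f (snd z ** diag_mat (fst z) ** ctransp (snd z)) \<partial>(h \<Otimes>\<^sub>M \<kappa>))"
proof -
  have "(\<integral>R. f R \<partial>H) = (\<integral>R. f R \<partial>(distr H borel (\<lambda>R. R)))"
    by (subst integral_distr) auto
  also have "\<dots> = (\<integral>z. f (snd z ** diag_mat (fst z) ** ctransp (snd z)) \<partial>(h \<Otimes>\<^sub>M \<kappa>))"
    unfolding H_law' by (rule integral_distr) auto
  finally show ?thesis .
qed

text \<open>The hyperplane is closed and has full measure, so it contains the support of
  \<open>H\<close> and therefore its span \<open>W\<close>.\<close>

lemma AE_orthogonal_imp:
  assumes ae: "AE R in H. \<xi> \<bullet> coords R = 0" and "R \<in> W"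
  shows "\<xi> \<bullet> coords R = 0"
proof -
  let ?Z = "{R :: 'n cmat. \<xi> \<bullet> coords R = 0}"
  have "closed ?Z"
    by (intro closed_Collect_eq continuous_intros)
  then have "open (- ?Z)"
    by (rule open_Compl)
  moreover have "emeasure H (- ?Z \<inter> space H) = 0"
  proof -
    have "{R \<in> space H. \<not> \<xi> \<bullet> coords R = 0} \<in> sets H"
      by measurable
    then have "emeasure H {R \<in> space H. \<not> \<xi> \<bullet> coords R = 0} = 0"
      using ae by (simp only: AE_iff_measurable[OF _ refl])
    moreover have "- ?Z \<inter> space H = {R \<in> space H. \<not> \<xi> \<bullet> coords R = 0}"
      by auto
    ultimately show ?thesis
      by simp
  qed
  ultimately have "topological_support H \<subseteq> ?Z"
    unfolding topological_support_def by fastforce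
  moreover have "subspace ?Z"
    by (auto simp: subspace_def linear_0[OF linear_coords] linear_add[OF linear_coords]
        linear_cmul[OF linear_coords] inner_add_right)
  ultimately show ?thesis
    using span_minimal H_spans \<open>R \<in> W\<close> by blast
qed

lemma conj_spans:
  assumes ae: "AE z in h \<Otimes>\<^sub>M \<kappa>. fst z \<bullet> rot_diag (snd z) \<xi> = 0"
    and \<xi>: "W = Herm \<or> \<xi> \<bullet> coords (mat 1) = 0"
  shows "\<xi> = 0"
proof -
  have "AE R in H. \<xi> \<bullet> coords R = 0"
    by (subst AE_H_iff) (use ae in \<open>simp_all add: inner_coords_conj\<close>)
  \<comment> \<open>The test matrix is built with \<open>herm\<close> and not with
    \<open>dual\<close>, because pairing \<open>\<xi>\<close> with its coordinates then gives
    \<open>|\<xi>|^2\<close>.\<close>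
  then have "\<xi> \<bullet> coords (proj_on W (herm \<xi>)) = 0"
    by (rule AE_orthogonal_imp) (rule proj_on_in[OF W herm_Herm])
  moreover have "\<xi> \<bullet> coords (proj_on W (herm \<xi>)) = \<xi> \<bullet> \<xi>"
    using \<xi> by (auto simp: proj_on_def linear_diff[OF linear_coords] linear_cmul[OF linear_coords] inner_diff_right)
  ultimately show ?thesis
    by simp
qed

lemma AE_traceless:
  assumes "W \<noteq> Herm"
  shows "AE r in h. r \<bullet> (\<chi> i. 1) = 0"
proof -
  have "AE R in H. trace R = 0"
    by (rule AE_I2) (use assms W in \<open>auto simp: space_H unit_sphere_in_def Herm0_def\<close>)
  moreover have "Measurable.pred borel (\<lambda>R :: 'n cmat. trace R = 0)"
    unfolding trace_def by measurable
  ultimately have "AE z in h \<Otimes>\<^sub>M \<kappa>. trace (snd z ** diag_mat (fst z) ** ctransp (snd z)) = 0"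
    by (subst (asm) AE_H_iff)
  then have "AE r in h. AE U in \<kappa>. trace (U ** diag_mat r ** ctransp U) = 0"
    using h\<kappa>.AE_pair by fastforce
  then show ?thesis
  proof (rule AE_mp, intro AE_I2 impI)
    fix r :: "(real, 'n) vec" assume "AE U in \<kappa>. trace (U ** diag_mat r ** ctransp U) = 0"
    then have "AE U in \<kappa>. r \<bullet> (\<chi> i. 1) = 0"
      by (rule AE_mp, intro AE_I2 impI)
        (simp add: trace_conj trace_diag_mat inner_vec_def flip: of_real_sum)
    then show "r \<bullet> (\<chi> i. 1) = 0"
      by simp
  qed
qed

lemma AE_fst:
  assumes [measurable]: "Measurable.pred borel P" and "AE r in h. P r"
  shows "AE z in h \<Otimes>\<^sub>M \<kappa>. P (fst z)"
  by (rule h\<kappa>.AE_pair_measure) (use assms in \<open>auto elim: AE_mp\<close>)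

text \<open>If two coordinates of \<open>x\<close> differ, swapping them in \<open>r\<close> and
  subtracting shows that these two coordinates of \<open>r\<close> agree, and by invariance all of
  them do; \<open>H\<close> would live on multiples of the identity. If \<open>x\<close> is
  constant, \<open>H\<close> would be traceless although \<open>W = Herm\<close>. Both contradict
  the spanning support, by way of \<open>conj_spans\<close>.\<close>

lemma h_spans:
  assumes ae: "AE r in h. r \<bullet> x = 0" and x: "W = Herm \<or> (\<chi> i. 1) \<bullet> x = 0"
  shows "x = 0"
proof (rule ccontr)
  assume "x \<noteq> 0"
  show False
  proof (cases "\<exists>i j. x $ i \<noteq> x $ j")
    case True
    then obtain i j where ij: "x $ i \<noteq> x $ j"
      by blast
    then have "i \<noteq> j"
      by auto
    have "AE r in h. (\<chi> k. r $ Transposition.transpose i j k) \<bullet> x = 0"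
      by (rule permuted_AE[OF h h_perm _ ae]) simp
    with ae have eq: "AE r in h. r $ i = r $ j"
    proof eventually_elim
      case (elim r)
      have "r \<bullet> x - (\<chi> k. r $ Transposition.transpose i j k) \<bullet> x
          = (\<Sum>k\<in>UNIV. (r $ k - r $ Transposition.transpose i j k) * x $ k)"
        by (simp add: inner_vec_def sum_subtractf left_diff_distrib)
      also have "\<dots> = (\<Sum>k\<in>{i, j}. (r $ k - r $ Transposition.transpose i j k) * x $ k)"
        by (rule sum.mono_neutral_right) (auto simp: transpose_apply_other)
      also have "\<dots> = (r $ i - r $ j) * (x $ i - x $ j)"
        using ij by (subst sum.insert) (auto simp: algebra_simps)
      finally show ?case
        using elim ij by simp
    qed
    have "AE r in h. r $ l = r $ i" for l
    proof (cases "l = i \<or> l = j")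
      case False
      have "AE r in h. (\<chi> k. r $ Transposition.transpose j l k) $ i = (\<chi> k. r $ Transposition.transpose j l k) $ j"
        by (rule permuted_AE[OF h h_perm _ eq]) measurable
      then show ?thesis
        using False \<open>i \<noteq> j\<close> by (auto simp: transpose_apply_other elim: AE_mp)
    qed (use eq in \<open>auto elim: AE_mp\<close>)
    then have const: "AE r in h. r = (r $ i) *\<^sub>R (\<chi> l. 1)"
      by (simp add: vec_eq_iff AE_all_countable)
    obtain a b :: 'n where ab: "a \<noteq> b"
      using card by (metis (full_types) One_nat_def card_2_iff' numeral_le_one_iff semiring_norm(69) UNIV_I card_1_singleton_iff ex_card le_antisym not_less_eq_eq)
    \<comment> \<open>An off-diagonal direction, orthogonal to the identity; it exists because
      \<open>N \<ge> 2\<close>.\<close>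
    define \<xi> :: "real^('n \<times> 'n)" where "\<xi> = axis (a, b) 1"
    have \<xi>: "\<xi> \<bullet> coords (mat 1) = 0"
      using ab by (simp add: \<xi>_def inner_axis' coords_def mat_def)
    have "AE z in h \<Otimes>\<^sub>M \<kappa>. fst z = (fst z $ i) *\<^sub>R (\<chi> l. 1)"
      by (rule AE_fst[OF _ const]) measurable
    then have "AE z in h \<Otimes>\<^sub>M \<kappa>. fst z \<bullet> rot_diag (snd z) \<xi> = 0"
    proof (rule AE_mp, intro AE_I2 impI)
      fix z assume z: "z \<in> space (h \<Otimes>\<^sub>M \<kappa>)" and eq: "fst z = (fst z $ i) *\<^sub>R (\<chi> l. 1)"
      have "(\<chi> l. 1) \<bullet> rot_diag (snd z) \<xi> = \<xi> \<bullet> coords (mat 1)"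
        using inner_coords_conj[of \<xi> "snd z" "\<chi> l. 1"] z
        by (auto simp: diag_mat_const unitary_groupD space_pair_measure)
      then show "fst z \<bullet> rot_diag (snd z) \<xi> = 0"
        by (subst eq) (simp add: \<xi>)
    qed
    then have "\<xi> = 0"
      using \<xi> by (intro conj_spans) auto
    then show False
      by (simp add: \<xi>_def axis_eq_0_iff)
  next
    case False
    then obtain s where s: "x = s *\<^sub>R (\<chi> i. 1)"
      by (metis (mono_tags, lifting) mult.right_neutral real_scaleR_def vec_eq_iff vec_lambda_beta vector_scaleR_component)
    with \<open>x \<noteq> 0\<close> have "s \<noteq> 0"
      by auto
    have "W = Herm"
      using x s \<open>s \<noteq> 0\<close> by (auto simp: inner_vec_def)
    have "AE r in h. r \<bullet> (\<chi> i. 1) = 0"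
      using ae s \<open>s \<noteq> 0\<close> by simp
    then have "AE z in h \<Otimes>\<^sub>M \<kappa>. fst z \<bullet> (\<chi> i. 1) = 0"
      by (intro AE_fst) auto
    moreover obtain \<xi> :: "real^('n \<times> 'n)" where \<xi>: "dual \<xi> = mat 1"
      using dual_surj[OF mat_1_Herm] by blast
    ultimately have "AE z in h \<Otimes>\<^sub>M \<kappa>. fst z \<bullet> rot_diag (snd z) \<xi> = 0"
    proof (elim AE_mp, intro AE_I2 impI)
      fix z assume z: "z \<in> space (h \<Otimes>\<^sub>M \<kappa>)" and eq: "fst z \<bullet> (\<chi> i. 1) = 0"
      have "ctransp (snd z) ** mat 1 ** snd z = mat 1"
        using z by (auto simp: unitary_groupD space_pair_measure)
      then have "rot_diag (snd z) \<xi> = (\<chi> i. 1)"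
        unfolding rot_diag_def \<xi> by (simp add: mat_def)
      then show "fst z \<bullet> rot_diag (snd z) \<xi> = 0"
        using eq by simp
    qed
    then have "\<xi> = 0"
      using conj_spans \<open>W = Herm\<close> by blast
    then have "(mat 1 :: 'n cmat) = 0"
      using \<xi> by (metis dual_eq_0_iff)
    then have "(mat 1 :: 'n cmat) $ a $ a = 0" for a
      by simp
    then show False
      by (simp add: mat_def)
  qed
qed

text \<open>Otherwise permutation invariance would put \<open>h\<close> at the origin. This keeps
  the noise from degenerating.\<close>

lemma AE_nth_nonzero: "\<not> (AE r in h. r $ i = 0)"
proof
  assume ae: "AE r in h. r $ i = 0"
  have "AE r in h. r $ l = 0" for l
  proof -
    have "AE r in h. (\<chi> k. r $ Transposition.transpose i l k) $ i = 0"
      by (rule permuted_AE[OF h h_perm _ ae]) measurable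
    then show ?thesis
      by simp
  qed
  then have "AE r in h. r = 0"
    by (simp add: vec_eq_iff AE_all_countable)
  then have "AE r in h. False"
    by (rule AE_mp) (auto intro!: AE_I2)
  then show False
    by simp
qed

lemma noise:
  assumes "0 < \<alpha>" "\<alpha> \<le> 2" and \<psi>: "is_stable_dist \<alpha> 1 h 0 \<psi>"
  shows "\<exists>c0 \<rho>. 0 \<le> c0 \<and> borel_finite_measure \<rho> \<and>
    (\<forall>t. cf \<rho> t = of_real (exp (- c0 * \<bar>t\<bar> powr \<alpha>))) \<and> (c0 = 0 \<longleftrightarrow> W = Herm) \<and> (W = Herm \<longrightarrow> \<rho> = return borel 0)"
proof (cases "W = Herm")
  case True
  have "borel_finite_measure (return borel 0 :: real measure)"
    by (auto simp: borel_finite_measure_def borel_finite_measure_axioms_def prob_space_return intro: prob_space.finite_measure)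
  moreover have "cf (return borel 0) t = 1" for t :: real
    by (simp add: cf_def integral_return)
  ultimately show ?thesis
    using True by (intro exI[of _ 0] exI[of _ "return borel 0"]) auto
next
  case False
  define i :: 'n where "i = undefined"
  define c0 where "c0 = 2 * (\<integral>r. \<bar>r $ i\<bar> powr \<alpha> \<partial>h)"
  obtain \<rho> where \<rho>: "borel_finite_measure \<rho>" "\<And>t. cf \<rho> t = of_real (exp (- c0 * \<bar>t\<bar> powr \<alpha>))"
    using symmetric_noise[OF assms(1,2) h \<psi>, of i] unfolding c0_def by blast
  have "integrable h (\<lambda>r. \<bar>r $ i\<bar> powr \<alpha>)"
  proof (rule h.integrable_const_bound[where B=1])
    show "AE r in h. norm (\<bar>r $ i\<bar> powr \<alpha>) \<le> 1"
      using assms by (intro AE_I2) (auto intro!: powr_le1 order.trans[OF component_le_norm_cart])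
  qed measurable
  then have "(\<integral>r. \<bar>r $ i\<bar> powr \<alpha> \<partial>h) = 0 \<longleftrightarrow> (AE r in h. \<bar>r $ i\<bar> powr \<alpha> = 0)"
    by (intro integral_nonneg_eq_0_iff_AE) auto
  then have "c0 \<noteq> 0"
    using AE_nth_nonzero[of i] by (simp add: c0_def)
  moreover have "0 \<le> c0"
    by (auto simp: c0_def intro!: Bochner_Integration.integral_nonneg)
  ultimately show ?thesis
    using \<rho> False by blast
qed

end

section \<open>Densities on the space of the ensemble\<close>

lemma (in prob_space) density_exists:
  fixes X :: "'a \<Rightarrow> 'b"
  assumes N: "sigma_finite_measure N" and X: "X \<in> measurable M N"
    and ac: "absolutely_continuous N (distr M N X)"
  shows "\<exists>p. (\<forall>x. 0 \<le> p x) \<and> distributed M N X (\<lambda>x. ennreal (p x)) \<and>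
    (\<forall>A\<in>sets N. (LINT x:A|N. p x) = measure (distr M N X) A)"
proof -
  interpret N: sigma_finite_measure N by (rule N)
  have sets: "sets (distr M N X) = sets N"
    by simp
  interpret D: prob_space "distr M N X"
    by (rule prob_space_distr[OF X])
  obtain p where p: "p \<in> borel_measurable N" "AE x in N. RN_deriv N (distr M N X) x = ennreal (p x)"
    "\<And>x. 0 \<le> p x"
    using N.real_RN_deriv[OF D.finite_measure_axioms ac sets] by metis
  have "density N (\<lambda>x. ennreal (p x)) = density N (RN_deriv N (distr M N X))"
    using p by (intro density_cong) (auto elim: AE_mp)
  also have "\<dots> = distr M N X"
    by (rule N.density_RN_deriv[OF ac sets])
  finally have eq: "density N (\<lambda>x. ennreal (p x)) = distr M N X" .
  have "(LINT x:A|N. p x) = measure (distr M N X) A" if A: "A \<in> sets N" for A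
  proof -
    have "(LINT x:A|N. p x) = enn2real (\<integral>\<^sup>+x. ennreal (indicator A x * p x) \<partial>N)"
      unfolding set_lebesgue_integral_def using A p by (subst integral_eq_nn_integral) auto
    also have "(\<integral>\<^sup>+x. ennreal (indicator A x * p x) \<partial>N) = (\<integral>\<^sup>+x. ennreal (p x) * indicator A x \<partial>N)"
      by (intro nn_integral_cong) (auto simp: indicator_def)
    also have "\<dots> = emeasure (distr M N X) A"
      using A p by (simp add: emeasure_density flip: eq)
    finally show ?thesis
      by (simp add: measure_def)
  qed
  then show ?thesis
    using eq p X by (intro exI[of _ p]) (auto simp: distributed_def)
qed

text \<open>Projection removes the noise, so the law of \<open>Z\<close> is the image of
  \<open>Q\<close> under \<open>y \<mapsto> proj_on W (herm y)\<close>, and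
  \<open>emeasure_lborel_proj_null\<close> carries absolute continuity from the coordinate space
  over to \<open>W\<close>.\<close>

lemma (in prob_space) density_from_noisy_coords:
  fixes Z :: "'a \<Rightarrow> 'n::{finite,linorder} cmat" and \<rho> :: "real measure"
  assumes W: "W = Herm \<or> W = Herm0" and Z [measurable]: "Z \<in> borel_measurable M" and ZW: "AE \<omega> in M. Z \<omega> \<in> W"
    and \<rho>: "borel_finite_measure \<rho>" "measure \<rho> UNIV = 1" "W = Herm \<Longrightarrow> \<rho> = return borel 0"
    and Q: "Q = distr (distr M borel (\<lambda>\<omega>. coords (Z \<omega>)) \<Otimes>\<^sub>M distr \<rho> borel (\<lambda>s. s *\<^sub>R coords (mat 1))) borel (\<lambda>(x, y). x + y)"
    and ac: "absolutely_continuous lborel Q"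
  shows "\<exists>p. (\<forall>x. 0 \<le> p x) \<and> distributed M (lebesgue_in W) Z (\<lambda>x. ennreal (p x)) \<and>
    (\<forall>A\<in>sets borel. (LINT x:A|lebesgue_in W. p x) = measure Q {y. proj_on W (herm y) \<in> A})"
proof -
  have law: "emeasure (distr M (lebesgue_in W) Z) A = emeasure Q {y. proj_on W (herm y) \<in> A}"
    if A: "A \<in> sets borel" for A
  proof -
    note [measurable] = A
    have A' [measurable]: "{y :: real^('n \<times> 'n). proj_on W (herm y) \<in> A} \<in> sets borel"
      by measurable
    have D: "borel_finite_measure (distr M borel (\<lambda>\<omega>. coords (Z \<omega>)))"
      by (intro borel_finite_measure_distr finite_measure_axioms) measurable
    have "emeasure Q {y. proj_on W (herm y) \<in> A}
        = emeasure (distr M borel (\<lambda>\<omega>. coords (Z \<omega>))) {y. proj_on W (herm y) \<in> A}"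
      unfolding Q by (rule emeasure_add_noise[OF D \<rho> A])
    also have "\<dots> = emeasure M {\<omega> \<in> space M. proj_on W (herm (coords (Z \<omega>))) \<in> A}"
      by (subst emeasure_distr) (auto intro!: arg_cong[where f="emeasure M"])
    also have "\<dots> = emeasure M {\<omega> \<in> space M. Z \<omega> \<in> A}"
    proof (rule emeasure_eq_AE)
      show "AE \<omega> in M. \<omega> \<in> {\<omega> \<in> space M. proj_on W (herm (coords (Z \<omega>))) \<in> A} \<longleftrightarrow> \<omega> \<in> {\<omega> \<in> space M. Z \<omega> \<in> A}"
        using ZW
      proof eventually_elim
        case (elim \<omega>)
        then have "Z \<omega> \<in> Herm"
          using W Herm0_subset by blast
        then show ?case
          using proj_on_id[OF elim W] by (simp add: herm_coords)
      qed
    qed measurable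
    also have "\<dots> = emeasure (distr M (lebesgue_in W) Z) A"
      by (subst emeasure_distr) (auto intro!: arg_cong[where f="emeasure M"])
    finally show ?thesis ..
  qed
  have Z': "Z \<in> measurable M (lebesgue_in W)"
    by (simp add: measurable_cong_sets[OF refl sets_lebesgue_in])
  have "absolutely_continuous (lebesgue_in W) (distr M (lebesgue_in W) Z)"
    unfolding absolutely_continuous_def
  proof
    fix A assume "A \<in> null_sets (lebesgue_in W)"
    then have A: "A \<in> sets borel" "emeasure (lebesgue_in W) A = 0"
      by (auto simp: null_sets_def)
    note [measurable] = A(1)
    have "{y. proj_on W (herm y) \<in> A} \<in> null_sets lborel"
      using emeasure_lborel_proj_null[OF W A] by (auto simp: null_sets_def)
    then have "{y. proj_on W (herm y) \<in> A} \<in> null_sets Q"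
      using ac by (auto simp: absolutely_continuous_def)
    then show "A \<in> null_sets (distr M (lebesgue_in W) Z)"
      using law[OF A(1)] A(1) by (auto simp: null_sets_def)
  qed
  from density_exists[OF sigma_finite_lebesgue_in Z' this] show ?thesis
    using law by (auto simp: measure_def)
qed

lemma sup_set_integrals_bigo:
  assumes A: "\<And>A. A \<in> \<A> \<Longrightarrow> A \<in> \<B>" and ne: "{} \<in> \<A>"
    and bound: "\<And>m A. 1 \<le> m \<Longrightarrow> A \<in> \<B> \<Longrightarrow> \<bar>f m A - g A\<bar> \<le> K * real m powr e"
  shows "(\<lambda>m. SUP A\<in>\<A>. \<bar>f m A - g A\<bar> :: real) \<in> O(\<lambda>m. real m powr e)"
proof (rule bigoI)
  show "\<forall>\<^sub>F m in sequentially. norm (SUP A\<in>\<A>. \<bar>f m A - g A\<bar>) \<le> K * norm (real m powr e)"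
  proof (rule eventually_sequentiallyI)
    fix m :: nat assume m: "1 \<le> m"
    have le: "\<bar>f m A - g A\<bar> \<le> K * real m powr e" if "A \<in> \<A>" for A
      using bound[OF m A[OF that]] .
    then have "(SUP A\<in>\<A>. \<bar>f m A - g A\<bar>) \<le> K * real m powr e"
      using ne by (intro cSUP_least) auto
    moreover have "\<bar>f m {} - g {}\<bar> \<le> (SUP A\<in>\<A>. \<bar>f m A - g A\<bar>)"
      using ne le by (intro cSUP_upper bdd_aboveI2) auto
    ultimately show "norm (SUP A\<in>\<A>. \<bar>f m A - g A\<bar>) \<le> K * norm (real m powr e)"
      by simp
  qed
qed

lemma cis_sum: "cis (\<Sum>j\<in>A. f j) = (\<Prod>j\<in>A. cis (f j))"
  by (induction A rule: infinite_finite_induct) (simp_all flip: cis_mult)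

section \<open>Characteristic functions of the sum and of the ensemble\<close>

context rotated_stable
begin

lemma integrable_Nu: "integrable \<kappa> (\<lambda>U. Nu (rot_diag U \<xi>))"
proof (rule integrable_const_bound[where B="C1 * (1 + (norm \<xi>)\<^sup>2)"])
  show "AE U in \<kappa>. norm (Nu (rot_diag U \<xi>)) \<le> C1 * (1 + (norm \<xi>)\<^sup>2)"
  proof (rule AE_I2)
    fix U assume "U \<in> space \<kappa>"
    then have "(norm (rot_diag U \<xi>))\<^sup>2 \<le> (norm \<xi>)\<^sup>2"
      using norm_rot_diag_le[of U \<xi>] by (intro power_mono) auto
    then show "norm (Nu (rot_diag U \<xi>)) \<le> C1 * (1 + (norm \<xi>)\<^sup>2)"
      using C1(1) by (intro order.trans[OF norm_Nu_le] mult_left_mono) auto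
  qed
qed (auto intro: measurable_from)

lemma identity_noise:
  shows "borel_finite_measure (distr \<rho> borel (\<lambda>s. s *\<^sub>R coords (mat 1 :: 'n cmat)))"
    and "cf (distr \<rho> borel (\<lambda>s. s *\<^sub>R coords (mat 1))) \<xi> = of_real (exp (- c0 * \<bar>\<tau> \<xi>\<bar> powr \<alpha>))"
proof -
  show "borel_finite_measure (distr \<rho> borel (\<lambda>s. s *\<^sub>R coords (mat 1 :: 'n cmat)))"
    by (intro borel_finite_measure_distr \<rho>.finite_measure_axioms) auto
  have "cf (distr \<rho> borel (\<lambda>s. s *\<^sub>R coords (mat 1))) \<xi> = cf \<rho> (\<tau> \<xi>)"
    by (subst cf_distr) (auto simp: cf_def \<tau>_def mult.commute)
  then show "cf (distr \<rho> borel (\<lambda>s. s *\<^sub>R coords (mat 1))) \<xi> = of_real (exp (- c0 * \<bar>\<tau> \<xi>\<bar> powr \<alpha>))"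
    by (simp only: cf_\<rho>)
qed

text \<open>The noise is stable with the same exponent \<open>\<alpha>\<close>: in each rescaled
  summand its intensity is divided by \<open>m\<close>, so the noise of all \<open>m\<close>
  summands amounts to the noise added once to the sum.\<close>

lemma cf_noisy_sum:
  assumes D: "borel_finite_measure D" and m: "1 \<le> m"
    and cf: "cf D \<xi> = (\<integral>U. exp (- Nu (rot_diag U (real m powr (- 1 / \<alpha>) *\<^sub>R \<xi>))) \<partial>\<kappa>) ^ m * cis (shift m \<bullet> \<xi>) ^ m"
  shows "cf (distr (D \<Otimes>\<^sub>M distr \<rho> borel (\<lambda>s. s *\<^sub>R coords (mat 1))) borel (\<lambda>(x, y). x + y)) \<xi>
    = (cf \<mu> (real m powr (- 1 / \<alpha>) *\<^sub>R \<xi>) * cis (shift m \<bullet> \<xi>)) ^ m"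
proof -
  define t where "t = real m powr (- 1 / \<alpha>)"
  have "t powr \<alpha> = 1 / real m"
    unfolding t_def powr_powr using \<alpha> m by (simp add: powr_minus_divide)
  then have "\<bar>\<tau> (t *\<^sub>R \<xi>)\<bar> powr \<alpha> = \<bar>\<tau> \<xi>\<bar> powr \<alpha> / real m"
    by (simp add: linear_cmul[OF linear_\<tau>] abs_mult powr_mult t_def)
  then have noise: "exp (- c0 * \<bar>\<tau> (t *\<^sub>R \<xi>)\<bar> powr \<alpha>) ^ m = exp (- c0 * \<bar>\<tau> \<xi>\<bar> powr \<alpha>)"
    using m by (simp flip: exp_of_nat_mult)
  have "cf \<mu> (t *\<^sub>R \<xi>) = (\<integral>U. exp (- Nu (rot_diag U (t *\<^sub>R \<xi>))) * of_real (exp (- c0 * \<bar>\<tau> (t *\<^sub>R \<xi>)\<bar> powr \<alpha>)) \<partial>\<kappa>)"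
    unfolding \<mu>(3) g_def by (simp add: exp_add[symmetric] flip: exp_of_real)
  also have "\<dots> = (\<integral>U. exp (- Nu (rot_diag U (t *\<^sub>R \<xi>))) \<partial>\<kappa>) * of_real (exp (- c0 * \<bar>\<tau> (t *\<^sub>R \<xi>)\<bar> powr \<alpha>))"
    by simp
  finally have "(cf \<mu> (t *\<^sub>R \<xi>) * cis (shift m \<bullet> \<xi>)) ^ m
      = (\<integral>U. exp (- Nu (rot_diag U (t *\<^sub>R \<xi>))) \<partial>\<kappa>) ^ m
        * of_real (exp (- c0 * \<bar>\<tau> (t *\<^sub>R \<xi>)\<bar> powr \<alpha>) ^ m) * cis (shift m \<bullet> \<xi>) ^ m"
    by (simp only: power_mult_distrib of_real_power)
  then show ?thesis
    unfolding cf_convolution(2)[OF D identity_noise(1)] identity_noise(2) cf noise t_def[symmetric]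
    by (simp only: mult.commute mult.left_commute)
qed

lemma cf_noisy_limit:
  assumes D: "borel_finite_measure D" and cf: "cf D \<xi> = exp (- (\<integral>U. Nu (rot_diag U \<xi>) \<partial>\<kappa>))"
  shows "cf (distr (D \<Otimes>\<^sub>M distr \<rho> borel (\<lambda>s. s *\<^sub>R coords (mat 1))) borel (\<lambda>(x, y). x + y)) \<xi>
    = exp (- (\<integral>U. g U \<xi> \<partial>\<kappa>))"
proof -
  have "(\<integral>U. g U \<xi> \<partial>\<kappa>) = (\<integral>U. Nu (rot_diag U \<xi>) \<partial>\<kappa>) + of_real (c0 * \<bar>\<tau> \<xi>\<bar> powr \<alpha>)"
    unfolding g_def using prob_space
    by (subst Bochner_Integration.integral_add) (simp_all add: integrable_Nu)
  then show ?thesis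
    unfolding cf_convolution(2)[OF D identity_noise(1)] identity_noise(2) cf
    by (simp add: exp_diff exp_minus field_simps flip: exp_of_real)
qed

end

context eigenvalue_part
begin

lemma cf_ensemble:
  assumes \<alpha>: "0 < \<alpha>" "\<alpha> \<le> 2" and P: "is_stable_ensemble W \<alpha> H P"
  shows "cf (distr P borel coords) \<xi> = exp (- (\<integral>U. (\<integral>r. stable_nu \<alpha> (r \<bullet> rot_diag U \<xi>) \<partial>h) \<partial>\<kappa>))"
proof -
  interpret P: prob_space P
    using P by (simp add: is_stable_ensemble_def borel_prob_on_def)
  have sets_P: "sets P = sets (restrict_space borel W)"
    using P by (simp add: is_stable_ensemble_def borel_prob_on_def)
  have space_P: "space P = W"
    using sets_eq_imp_space_eq[OF sets_P] by (simp add: space_restrict_space)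
  have coords_P: "coords \<in> borel_measurable P"
    by (subst measurable_cong_sets[OF sets_P refl]) (rule measurable_restrict_space1, simp)
  \<comment> \<open>\<open>dual \<xi>\<close> need not lie in \<open>W\<close>, where the
    characteristic function of the ensemble is prescribed; its projection has the same trace pairing
    with \<open>W\<close>.\<close>
  define S where "S = proj_on W (dual \<xi>)"
  have S: "S \<in> W"
    unfolding S_def by (rule proj_on_in[OF W dual_Herm])
  have trace_S: "trace (S ** Y) = of_real (\<xi> \<bullet> coords Y)" if "Y \<in> W" for Y
    using that W_Herm trace_proj_on_mult[OF W that] trace_dual_mult[of Y \<xi>] by (auto simp: S_def)
  obtain C where C: "0 < C" "\<And>u. cmod (stable_nu \<alpha> u) \<le> C * (1 + u\<^sup>2)"
    using stable_nu_bounds[OF \<alpha>] by metis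
  have "cf (distr P borel coords) \<xi> = (\<integral>Y. cis (\<xi> \<bullet> coords Y) \<partial>P)"
    by (rule cf_distr[OF coords_P])
  also have "\<dots> = (\<integral>Y. exp (\<i> * trace (S ** Y)) \<partial>P)"
    by (intro Bochner_Integration.integral_cong refl) (simp add: space_P trace_S cis_conv_exp)
  also have "\<dots> = exp (- (\<integral>R. stable_nu \<alpha> (Re (trace (R ** S))) \<partial>H))"
    using P S by (simp add: is_stable_ensemble_def)
  also have "(\<integral>R. stable_nu \<alpha> (Re (trace (R ** S))) \<partial>H) = (\<integral>R. stable_nu \<alpha> (\<xi> \<bullet> coords R) \<partial>H)"
  proof (intro Bochner_Integration.integral_cong refl)
    fix R assume "R \<in> space H"
    then have "R \<in> W"
      by (simp add: space_H unit_sphere_in_def)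
    then show "stable_nu \<alpha> (Re (trace (R ** S))) = stable_nu \<alpha> (\<xi> \<bullet> coords R)"
      by (subst trace_mul_sym) (simp add: trace_S)
  qed
  also have "\<dots> = (\<integral>z. stable_nu \<alpha> (fst z \<bullet> rot_diag (snd z) \<xi>) \<partial>(h \<Otimes>\<^sub>M \<kappa>))"
    by (subst integral_H) (simp_all add: inner_coords_conj)
  also have "\<dots> = (\<integral>z. (case z of (r, U) \<Rightarrow> stable_nu \<alpha> (r \<bullet> rot_diag U \<xi>)) \<partial>(h \<Otimes>\<^sub>M \<kappa>))"
    by (simp add: split_beta')
  also have "\<dots> = (\<integral>U. (\<integral>r. stable_nu \<alpha> (r \<bullet> rot_diag U \<xi>) \<partial>h) \<partial>\<kappa>)"
  proof (rule h\<kappa>.integral_snd[symmetric])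
    show "integrable (h \<Otimes>\<^sub>M \<kappa>) (\<lambda>(r, U). stable_nu \<alpha> (r \<bullet> rot_diag U \<xi>))"
    proof (rule h\<kappa>.integrable_const_bound[where B="C * (1 + (norm \<xi>)\<^sup>2)"])
      show "AE z in h \<Otimes>\<^sub>M \<kappa>. norm (case z of (r, U) \<Rightarrow> stable_nu \<alpha> (r \<bullet> rot_diag U \<xi>)) \<le> C * (1 + (norm \<xi>)\<^sup>2)"
      proof (rule AE_I2)
        fix z assume "z \<in> space (h \<Otimes>\<^sub>M \<kappa>)"
        then obtain r U where z: "z = (r, U)" "norm r = 1" "U \<in> unitary_group"
          by (auto simp: space_pair_measure)
        have "\<bar>r \<bullet> rot_diag U \<xi>\<bar> \<le> norm \<xi>"
          using Cauchy_Schwarz_ineq2[of r "rot_diag U \<xi>"] norm_rot_diag_le[OF z(3), of \<xi>] z(2) by simp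
        then have "(r \<bullet> rot_diag U \<xi>)\<^sup>2 \<le> (norm \<xi>)\<^sup>2"
          by (simp add: abs_le_square_iff[symmetric])
        then show "norm (case z of (r, U) \<Rightarrow> stable_nu \<alpha> (r \<bullet> rot_diag U \<xi>)) \<le> C * (1 + (norm \<xi>)\<^sup>2)"
          using C(1) z(1) by (auto intro!: order.trans[OF C(2)] mult_left_mono)
      qed
    qed measurable
  qed
  finally show ?thesis .
qed

text \<open>Almost every \<open>r\<close> has coordinate sum 0, so the mean coordinate is 0 and the
  centring vanishes even at \<open>\<alpha> = 1\<close>.\<close>

lemma normalized_sum_traceless:
  assumes "W \<noteq> Herm" and U: "\<And>j. 1 \<le> j \<Longrightarrow> U j \<in> unitary_group" and x: "\<And>j. 1 \<le> j \<Longrightarrow> x j \<bullet> (\<chi> i. 1) = 0"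
  shows "normalized_sum \<alpha> h (\<lambda>j. diag_mat (x j)) U m \<in> W"
proof -
  have "(\<integral>t. (\<Sum>k\<in>UNIV. t $ k) \<partial>h) = 0"
    using AE_traceless[OF assms(1)] by (intro integral_eq_zero_AE) (simp add: inner_vec_def)
  then have mean: "mean_coordinate h = 0"
    by (simp add: mean_coordinate_def)
  have summand: "trace (U j ** diag_mat (x j) ** ctransp (U j)) = 0" if "1 \<le> j" for j
    using x[OF that] by (simp add: trace_conj U[OF that] trace_diag_mat inner_vec_def flip: of_real_sum)
  have add: "trace (A + B) = trace A + trace B" for A B :: "'n cmat"
    by (simp add: trace_def sum.distrib)
  have "trace (\<Sum>j = 1..m. U j ** diag_mat (x j) ** ctransp (U j)) = 0"
    by (induction m) (simp_all add: summand add, simp add: trace_def)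
  moreover have "trace (c *\<^sub>R A) = c *\<^sub>R trace A" for c and A :: "'n cmat"
    by (simp add: trace_def scaleR_sum_right)
  ultimately have "trace (normalized_sum \<alpha> h (\<lambda>j. diag_mat (x j)) U m) = 0"
    by (simp add: normalized_sum_def mean)
  then show ?thesis
    using assms(1) W normalized_sum_Herm[of "\<lambda>j. diag_mat (x j)" \<alpha> h U m] by (auto simp: Herm0_def)
qed

text \<open>The coordinate sum of \<open>Z\<close> has characteristic function constantly 1 and so
  is 0 by Levy's uniqueness theorem.\<close>

lemma AE_stable_traceless:
  assumes "W \<noteq> Herm" and M: "prob_space M" and Z [measurable]: "Z \<in> borel_measurable M"
    and stable: "is_stable_dist \<alpha> 1 h 0 (distr M borel Z)"
  shows "AE \<omega> in M. Z \<omega> \<bullet> (\<chi> i. 1) = 0"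
proof -
  interpret M: prob_space M by (rule M)
  define D where "D = distr M borel (\<lambda>\<omega>. Z \<omega> \<bullet> (\<chi> i. 1))"
  have D: "real_distribution D"
    unfolding D_def by (rule M.real_distribution_distr) measurable
  have stable_cf: "(\<integral>x. exp (\<i> * of_real (\<xi> \<bullet> x)) \<partial>(distr M borel Z))
      = exp (- (\<integral>r. stable_nu \<alpha> (r \<bullet> \<xi>) \<partial>h))" for \<xi>
    using stable by (simp add: is_stable_dist_def)
  have "char D t = 1" for t
  proof -
    have "char D t = (\<integral>\<omega>. exp (\<i> * of_real (t * (Z \<omega> \<bullet> (\<chi> i. 1)))) \<partial>M)"
      unfolding D_def char_def by (subst integral_distr) auto
    also have "\<dots> = (\<integral>x. exp (\<i> * of_real ((t *\<^sub>R (\<chi> i. 1)) \<bullet> x)) \<partial>(distr M borel Z))"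
      by (subst integral_distr) (auto simp: inner_commute)
    also have "\<dots> = exp (- (\<integral>r. stable_nu \<alpha> (r \<bullet> (t *\<^sub>R (\<chi> i. 1))) \<partial>h))"
      by (rule stable_cf)
    also have "(\<integral>r. stable_nu \<alpha> (r \<bullet> (t *\<^sub>R (\<chi> i. 1))) \<partial>h) = 0"
    proof (rule integral_eq_zero_AE)
      show "AE r in h. stable_nu \<alpha> (r \<bullet> (t *\<^sub>R (\<chi> i. 1))) = 0"
        using AE_traceless[OF assms(1)] by eventually_elim (simp add: stable_nu_def)
    qed
    finally show ?thesis
      by simp
  qed
  moreover have "char (return borel 0) t = 1" for t
    by (simp add: char_def integral_return)
  moreover have "real_distribution (return borel 0 :: real measure)"
    by (simp add: real_distribution_def real_distribution_axioms_def prob_space_return)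
  ultimately have eq: "D = return borel 0"
    using D by (intro Levy_uniqueness) auto
  have "AE x in D. x = 0"
    unfolding eq by (subst AE_return) measurable
  then show ?thesis
    unfolding D_def by (subst (asm) AE_distr_iff) auto
qed

end

section \<open>Total variation rate for the normalized sums\<close>

theorem corollary18:
  fixes \<alpha> :: real
    and W :: "'n::{finite,linorder} cmat set"
    and H P :: "'n cmat measure"
    and h :: "(real, 'n) vec measure"
    and M :: "'w measure"
    and Xt :: "nat \<Rightarrow> 'w \<Rightarrow> (real, 'n) vec"
    and X U :: "nat \<Rightarrow> 'w \<Rightarrow> 'n cmat"
    and Y :: "nat \<Rightarrow> 'w \<Rightarrow> 'n cmat"
  assumes "CARD('n) \<ge> 2"
    and "0 < \<alpha>" "\<alpha> \<le> 2"
    and "W = Herm \<or> W = Herm0"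
    and "borel_prob_on (unit_sphere_in W) H"
    and "unitarily_invariant H"
    and "span (topological_support H) = W"
    and "is_eigenvalue_part H h"
    and "is_stable_ensemble W \<alpha> H P"
    and "prob_space M"
    and "\<And>j. j \<ge> 1 \<Longrightarrow> Xt j \<in> borel_measurable M"
    and "\<And>j. j \<ge> 1 \<Longrightarrow> is_stable_dist \<alpha> 1 h 0 (distr M borel (Xt j))"
    and "\<And>j \<omega>. X j \<omega> = diag_mat (Xt j \<omega>)"
    and "\<And>j. j \<ge> 1 \<Longrightarrow> U j \<in> measurable M (restrict_space borel unitary_group)"
    and "\<And>j. j \<ge> 1 \<Longrightarrow> haar_unitary (distr M (restrict_space borel unitary_group) (U j))"
    and "prob_space.indep_vars M (\<lambda>_. borel) (case_sum X U) ({1..} <+> {1..})"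
    and "\<And>m \<omega>. Y m \<omega> = normalized_sum \<alpha> h (\<lambda>j. X j \<omega>) (\<lambda>j. U j \<omega>) m"
  shows "\<exists>(p :: nat \<Rightarrow> 'n cmat \<Rightarrow> real) (p_inf :: 'n cmat \<Rightarrow> real).
    (\<forall>m\<ge>1. (\<forall>x. 0 \<le> p m x) \<and> distributed M (lebesgue_in W) (Y m) (\<lambda>x. ennreal (p m x))) \<and>
    (\<forall>x. 0 \<le> p_inf x) \<and> distributed P (lebesgue_in W) (\<lambda>x. x) (\<lambda>x. ennreal (p_inf x)) \<and>
    (\<lambda>m. SUP A\<in>sets (restrict_space borel W).
        \<bar>(LINT x:A|lebesgue_in W. p m x) - (LINT x:A|lebesgue_in W. p_inf x)\<bar>)
      \<in> O(\<lambda>m. real m powr (- \<alpha> / (real CARD('n) ^ 2 + \<alpha>)))"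
proof -
  note W = assms(4) and Xt = assms(11) and stable = assms(12) and X = assms(13) and U = assms(14)
  interpret M: prob_space M by (rule assms(10))
  have h: "borel_prob_on (sphere 0 1) h" "permutation_invariant h"
    using assms(8) by (auto simp: is_eigenvalue_part_def)
  obtain \<kappa> where \<kappa>: "haar_unitary \<kappa>"
    and H_law: "distr H borel (\<lambda>R. R) = distr (h \<Otimes>\<^sub>M \<kappa>) borel (\<lambda>(r, U). ctransp U ** diag_mat r ** U)"
    using assms(8) by (auto simp: is_eigenvalue_part_def)
  interpret E: eigenvalue_part \<kappa> W H h
    by (intro eigenvalue_part.intro haar.intro eigenvalue_part_axioms.intro) (fact \<kappa> assms h H_law)+
  define \<psi> where "\<psi> = distr M borel (Xt 1)"
  have \<psi>: "is_stable_dist \<alpha> 1 h 0 \<psi>"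
    unfolding \<psi>_def by (rule stable) simp
  obtain c0 \<rho> where c0: "0 \<le> c0" "c0 = 0 \<longleftrightarrow> W = Herm" and \<rho>: "borel_finite_measure \<rho>"
    "\<And>t. cf \<rho> t = of_real (exp (- c0 * \<bar>t\<bar> powr \<alpha>))" "W = Herm \<Longrightarrow> \<rho> = return borel 0"
    using E.noise[OF assms(2,3) \<psi>] by blast
  interpret R: rotated_stable \<kappa> \<alpha> c0 h \<psi> \<rho>
  proof (intro rotated_stable.intro haar.intro rotated_stable_axioms.intro)
    show "x = 0" if "AE r in h. r \<bullet> x = 0" "c0 = 0 \<or> (\<chi> i. 1) \<bullet> x = 0" for x
      using E.h_spans that c0(2) by blast
    show "\<xi> = 0" if "AE z in h \<Otimes>\<^sub>M \<kappa>. fst z \<bullet> rot_diag (snd z) \<xi> = 0" "c0 = 0 \<or> \<xi> \<bullet> coords (mat 1) = 0" for \<xi>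
      using E.conj_spans that c0(2) by blast
  qed (fact \<kappa> assms h \<psi> c0 \<rho>)+
  interpret P: prob_space P
    using assms(9) by (simp add: is_stable_ensemble_def borel_prob_on_def)
  have sets_P: "sets P = sets (restrict_space borel W)"
    using assms(9) by (simp add: is_stable_ensemble_def borel_prob_on_def)
  have space_P: "space P = W"
    using sets_eq_imp_space_eq[OF sets_P] by (simp add: space_restrict_space)
  have P_id: "(\<lambda>x. x) \<in> borel_measurable P"
    by (subst measurable_cong_sets[OF sets_P refl]) (rule measurable_restrict_space1, simp)
  have U_borel: "U j \<in> borel_measurable M" if "1 \<le> j" for j
    using measurable_comp[OF U[OF that] measurable_restrict_space1[of "\<lambda>x. x" borel borel]] by (simp add: comp_def)
  have U_unitary: "U j \<omega> \<in> unitary_group" if "1 \<le> j" "\<omega> \<in> space M" for j \<omega>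
    using measurable_space[OF U[OF that(1)] that(2)] by (simp add: space_restrict_space)
  have Y: "Y m \<in> borel_measurable M" for m
  proof -
    have "(\<lambda>\<omega>. \<Sum>j = 1..m. U j \<omega> ** X j \<omega> ** ctransp (U j \<omega>)) \<in> borel_measurable M"
    proof (rule borel_measurable_sum)
      fix j assume j: "j \<in> {1..m}"
      then have [measurable]: "U j \<in> borel_measurable M" "Xt j \<in> borel_measurable M"
        using U_borel Xt by auto
      show "(\<lambda>\<omega>. U j \<omega> ** X j \<omega> ** ctransp (U j \<omega>)) \<in> borel_measurable M"
        unfolding X by measurable
    qed
    then show ?thesis
      unfolding assms(17)[abs_def] normalized_sum_def by measurable
  qed
  have YW: "AE \<omega> in M. Y m \<omega> \<in> W" for m
  proof (cases "W = Herm")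
    case True
    then show ?thesis
      by (auto simp: assms(17) X intro!: AE_I2 normalized_sum_Herm)
  next
    case False
    have "AE \<omega> in M. \<forall>j. 1 \<le> j \<longrightarrow> Xt j \<omega> \<bullet> (\<chi> i. 1) = 0"
      unfolding AE_all_countable
      using E.AE_stable_traceless[OF False assms(10) Xt stable] by (auto intro: AE_I2)
    then show ?thesis
    proof (rule AE_mp, intro AE_I2 impI)
      fix \<omega> assume "\<omega> \<in> space M" "\<forall>j. 1 \<le> j \<longrightarrow> Xt j \<omega> \<bullet> (\<chi> i. 1) = 0"
      then show "Y m \<omega> \<in> W"
        unfolding assms(17) X by (intro E.normalized_sum_traceless[OF False] U_unitary) auto
    qed
  qed
  \<comment> \<open>The noise enters through product measures, which makes it independent of
    \<open>Y m\<close> without enlarging \<open>M\<close>; the same \<open>N\<close> is used for the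
    sums and for the limit.\<close>
  define N where "N = distr \<rho> borel (\<lambda>s. s *\<^sub>R coords (mat 1 :: 'n cmat))"
  define L where "L m = distr (distr M borel (\<lambda>\<omega>. coords (Y m \<omega>)) \<Otimes>\<^sub>M N) borel (\<lambda>(x, y). x + y)" for m
  define \<nu> where "\<nu> = distr (distr P borel (\<lambda>x. coords x) \<Otimes>\<^sub>M N) borel (\<lambda>(x, y). x + y)"
  have D: "borel_finite_measure (distr M borel (\<lambda>\<omega>. coords (Y m \<omega>)))" for m
    by (intro borel_finite_measure_distr M.finite_measure_axioms measurable_compose[OF Y measurable_coords])
  have D\<nu>: "borel_finite_measure (distr P borel (\<lambda>x. coords x))"
    by (intro borel_finite_measure_distr P.finite_measure_axioms measurable_compose[OF P_id measurable_coords])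
  have N: "borel_finite_measure N"
    unfolding N_def by (rule R.identity_noise)
  have L: "borel_finite_measure (L m)" for m
    unfolding L_def by (rule cf_convolution(1)[OF D N])
  have \<nu>: "borel_finite_measure \<nu>"
    unfolding \<nu>_def by (rule cf_convolution(1)[OF D\<nu> N])
  have cf_D: "cf (distr M borel (\<lambda>\<omega>. coords (Y m \<omega>))) \<xi>
      = (\<integral>V. exp (- R.Nu (rot_diag V (real m powr (- 1 / \<alpha>) *\<^sub>R \<xi>))) \<partial>\<kappa>) ^ m * cis (R.shift m \<bullet> \<xi>) ^ m"
    if m: "1 \<le> m" for m \<xi>
  proof -
    let ?t = "real m powr (- 1 / \<alpha>)"
    have Y_coords: "coords (Y m \<omega>) = ?t *\<^sub>R (\<Sum>j = 1..m. coords (U j \<omega> ** X j \<omega> ** ctransp (U j \<omega>))) + real m *\<^sub>R R.shift m" for \<omega>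
      unfolding assms(17) R.shift_def by (rule coords_normalized_sum[OF m])
    have inner: "\<xi> \<bullet> coords (Y m \<omega>) = (\<Sum>j = 1..m. (?t *\<^sub>R \<xi>) \<bullet> coords (U j \<omega> ** X j \<omega> ** ctransp (U j \<omega>)))
        + real m * (R.shift m \<bullet> \<xi>)" for \<omega>
      unfolding Y_coords by (simp add: inner_add_right inner_sum_right sum_distrib_left inner_commute)
    have "cf (distr M borel (\<lambda>\<omega>. coords (Y m \<omega>))) \<xi> = (\<integral>\<omega>. cis (\<xi> \<bullet> coords (Y m \<omega>)) \<partial>M)"
      by (rule cf_distr[OF measurable_compose[OF Y measurable_coords]])
    also have "\<dots> = (\<integral>\<omega>. (\<Prod>j = 1..m. cis ((?t *\<^sub>R \<xi>) \<bullet> coords (U j \<omega> ** X j \<omega> ** ctransp (U j \<omega>)))) * cis (R.shift m \<bullet> \<xi>) ^ m \<partial>M)"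
      unfolding inner by (simp only: cis_mult[symmetric] cis_sum Complex.DeMoivre)
    also have "\<dots> = (\<integral>\<omega>. (\<Prod>j = 1..m. cis ((?t *\<^sub>R \<xi>) \<bullet> coords (U j \<omega> ** X j \<omega> ** ctransp (U j \<omega>)))) \<partial>M) * cis (R.shift m \<bullet> \<xi>) ^ m"
      by (rule integral_mult_left_zero)
    also have "(\<integral>\<omega>. (\<Prod>j = 1..m. cis ((?t *\<^sub>R \<xi>) \<bullet> coords (U j \<omega> ** X j \<omega> ** ctransp (U j \<omega>)))) \<partial>M)
        = (\<integral>V. exp (- R.Nu (rot_diag V (?t *\<^sub>R \<xi>))) \<partial>\<kappa>) ^ m"
    proof (rule M.expectation_cis_rotated_sum[OF assms(16) X Xt U])
      show "distr M (restrict_space borel unitary_group) (U j) = \<kappa>" if "1 \<le> j" for j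
        by (rule haar_unique[OF assms(15)[OF that] \<kappa>])
      show "cf (distr M borel (Xt j)) x = exp (- R.Nu x)" if "1 \<le> j" for j x
        using stable[OF that] by (simp add: is_stable_dist_def cf_def cis_conv_exp R.Nu_def)
      show "(\<lambda>x. exp (- R.Nu x)) \<in> borel_measurable borel"
        by measurable
    qed
    finally show ?thesis .
  qed
  have cf_L: "cf (L m) \<xi> = (cf R.\<mu> (real m powr (- 1 / \<alpha>) *\<^sub>R \<xi>) * cis (R.shift m \<bullet> \<xi>)) ^ m" if "1 \<le> m" for m \<xi>
    unfolding L_def N_def by (rule R.cf_noisy_sum[OF D that cf_D[OF that]])
  have cf_D\<nu>: "cf (distr P borel (\<lambda>x. coords x)) \<xi> = exp (- (\<integral>V. R.Nu (rot_diag V \<xi>) \<partial>\<kappa>))" for \<xi>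
    unfolding R.Nu_def by (rule E.cf_ensemble[OF assms(2,3,9)])
  have cf_\<nu>: "cf \<nu> \<xi> = exp (- (\<integral>V. R.g V \<xi> \<partial>\<kappa>))" for \<xi>
    unfolding \<nu>_def N_def by (rule R.cf_noisy_limit[OF D\<nu> cf_D\<nu>])
  have mass: "measure (distr (distr Q borel f \<Otimes>\<^sub>M N) borel (\<lambda>(x, y). x + y)) UNIV = 1"
    if Q: "prob_space Q" and f: "f \<in> borel_measurable Q" for Q :: "'z measure" and f :: "'z \<Rightarrow> real^('n \<times> 'n)"
  proof -
    interpret Q: prob_space Q by (rule Q)
    interpret Qf: prob_space "distr Q borel f" by (rule Q.prob_space_distr[OF f])
    have "borel_finite_measure (distr Q borel f)"
      by (intro borel_finite_measure_distr Q.finite_measure_axioms f)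
    note conv = cf_convolution[OF this N]
    have "cf (distr Q borel f) 0 = 1" "cf N 0 = 1"
      using Qf.prob_space R.identity_noise(2)[of 0] by (simp_all add: cf_def N_def R.\<tau>_def)
    then show ?thesis
      using conv(2)[of 0] borel_finite_measure.measure_UNIV_eq_cf[OF conv(1)] by simp
  qed
  have L_mass: "measure (L m) UNIV = 1" for m
    unfolding L_def by (rule mass[OF assms(10) measurable_compose[OF Y measurable_coords]])
  have \<nu>_mass: "measure \<nu> UNIV = 1"
    unfolding \<nu>_def by (rule mass[OF P.prob_space_axioms measurable_compose[OF P_id measurable_coords]])
  note rate = R.rotated_sum_rate[of L \<nu>, OF L L_mass cf_L \<nu> \<nu>_mass cf_\<nu>]
  have "\<exists>p. (\<forall>x. 0 \<le> p x) \<and> distributed M (lebesgue_in W) (Y m) (\<lambda>x. ennreal (p x)) \<and>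
      (\<forall>A\<in>sets borel. (LINT x:A|lebesgue_in W. p x) = measure (L m) {y. proj_on W (herm y) \<in> A})"
    if "1 \<le> m" for m
    using \<rho>(3) R.\<mu>_shift_absolutely_continuous[OF L that cf_L[OF that]]
    by (intro M.density_from_noisy_coords[OF W Y YW \<rho>(1) R.\<rho>_mass]) (simp_all add: L_def N_def)
  then obtain p where p: "\<And>m x. 1 \<le> m \<Longrightarrow> 0 \<le> p m x"
    "\<And>m. 1 \<le> m \<Longrightarrow> distributed M (lebesgue_in W) (Y m) (\<lambda>x. ennreal (p m x))"
    "\<And>m A. 1 \<le> m \<Longrightarrow> A \<in> sets borel \<Longrightarrow> (LINT x:A|lebesgue_in W. p m x) = measure (L m) {y. proj_on W (herm y) \<in> A}"
    by metis
  have "AE x in P. x \<in> W"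
    by (rule AE_I2) (simp add: space_P)
  then have "\<exists>p. (\<forall>x. 0 \<le> p x) \<and> distributed P (lebesgue_in W) (\<lambda>x. x) (\<lambda>x. ennreal (p x)) \<and>
      (\<forall>A\<in>sets borel. (LINT x:A|lebesgue_in W. p x) = measure \<nu> {y. proj_on W (herm y) \<in> A})"
    using \<rho>(3) rate(1) by (intro P.density_from_noisy_coords[OF W P_id _ \<rho>(1) R.\<rho>_mass]) (simp_all add: \<nu>_def N_def)
  then obtain p_inf where p_inf: "\<And>x. 0 \<le> p_inf x"
    "distributed P (lebesgue_in W) (\<lambda>x. x) (\<lambda>x. ennreal (p_inf x))"
    "\<And>A. A \<in> sets borel \<Longrightarrow> (LINT x:A|lebesgue_in W. p_inf x) = measure \<nu> {y. proj_on W (herm y) \<in> A}"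
    by blast
  obtain K where K: "\<And>m A. 1 \<le> m \<Longrightarrow> A \<in> sets borel \<Longrightarrow>
      \<bar>measure (L m) A - measure \<nu> A\<bar> \<le> K * real m powr (- \<alpha> / (real CARD('n) ^ 2 + \<alpha>))"
    using rate(2) by (auto simp: power2_eq_square)
  have "W \<in> sets borel"
    using W borel_closed[OF closed_Herm] borel_closed[OF closed_Herm0] by blast
  have "(\<lambda>m. SUP A\<in>sets (restrict_space borel W).
        \<bar>(LINT x:A|lebesgue_in W. p m x) - (LINT x:A|lebesgue_in W. p_inf x)\<bar>)
      \<in> O(\<lambda>m. real m powr (- \<alpha> / (real CARD('n) ^ 2 + \<alpha>)))"
  proof (rule sup_set_integrals_bigo[where \<B>="sets borel"])
    show "A \<in> sets borel" if "A \<in> sets (restrict_space borel W)" for A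
      using that \<open>W \<in> sets borel\<close> by (auto simp: sets_restrict_space)
    fix m :: nat and A :: "'n cmat set" assume m: "1 \<le> m" and A [measurable]: "A \<in> sets borel"
    show "\<bar>(LINT x:A|lebesgue_in W. p m x) - (LINT x:A|lebesgue_in W. p_inf x)\<bar>
        \<le> K * real m powr (- \<alpha> / (real CARD('n) ^ 2 + \<alpha>))"
      unfolding p(3)[OF m A] p_inf(3)[OF A] by (rule K[OF m]) measurable
  qed simp
  then show ?thesis
    using p p_inf by blast
qed

end
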